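(* For each $n\ge1$, let $\mathbf{G}_n$ be a uniform random labeled cograph with vertex set $\{1,\dots,n\}$, and let $\mathbf{X}_{n,k}$ be the number of independent sets of size $k$ in $\mathbf{G}_n$. Then there exist computable functions $\beta\mapsto B_\beta>0$ and $\beta\mapsto C_\beta>0$ defined for $0<\beta<1$ such that, for every fixed closed interval $[a,b]\subseteq(0,1)$, $$\mathbb{E}[\mathbf{X}_{n,k}]\sim B_{k/n}\, n^{-1/2}\,(C_{k/n})^n \qquad (n\to\infty)$$ uniformly for integers $k$ with $an\le k\le bn$. Furthermore: (i) as $\beta\to0$, $C_\beta=1+\beta|\log\beta|+o(\beta\log\beta)$; (ii) consequently, there exists $\beta_0>0$ such that $C_\beta>1$ for every $\beta\in(0,\beta_0)$.
   Context: All graphs are simple and undirected. The join of graphs with disjoint vertex sets is their disjoint union with all edges added between vertices coming from different graphs. A labeled cograph is a labeled graph that can be generated from single-vertex graphs by repeatedly applying join and disjoint union operations. An independent set of a graph is a set of pairwise non-adjacent vertices. *)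

theory Defs
  imports "HOL-Probability.Probability" "HOL-Library.Ramsey" "HOL-Library.Nat_Bijection"
    "HOL-Library.Landau_Symbols"
begin

section \<open>Labeled cographs\<close>

text \<open>A graph is given by its vertex set and its set of edges; an edge is an unordered pair
  \<open>{u, v}\<close> of distinct vertices (see \<open>cograph_edges\<close> below).\<close>

definition join_edges :: "'a set \<Rightarrow> 'a set \<Rightarrow> 'a set set" where
  "join_edges V W = {{v, w} | v w. v \<in> V \<and> w \<in> W}"

inductive cograph :: "'a set \<Rightarrow> 'a set set \<Rightarrow> bool" where
  single: "cograph {v} {}"
| disjoint_union: "cograph V E \<Longrightarrow> cograph W F \<Longrightarrow> V \<inter> W = {} \<Longrightarrow> cograph (V \<union> W) (E \<union> F)"
| join: "cograph V E \<Longrightarrow> cograph W F \<Longrightarrow> V \<inter> W = {} \<Longrightarrow>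
    cograph (V \<union> W) (E \<union> F \<union> join_edges V W)"

definition labeled_cographs :: "nat \<Rightarrow> nat set set set" where
  "labeled_cographs n = {E. cograph {1..n} E}"

definition uniform_cograph :: "nat \<Rightarrow> nat set set pmf" where
  "uniform_cograph n = pmf_of_set (labeled_cographs n)"

definition num_indep_sets :: "'a set \<Rightarrow> 'a set set \<Rightarrow> nat \<Rightarrow> nat" where
  "num_indep_sets V E k = card {I. I \<subseteq> V \<and> card I = k \<and> indep I E}"

definition expected_indep_sets :: "nat \<Rightarrow> nat \<Rightarrow> real" where
  "expected_indep_sets n k =
     measure_pmf.expectation (uniform_cograph n) (\<lambda>E. real (num_indep_sets {1..n} E k))"

lemma cograph_edges:
  assumes "cograph V E" shows "E \<subseteq> [V]\<^bsup>2\<^esup>"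
  using assms
proof induction
  case (join V E W F)
  have "join_edges V W \<subseteq> [V \<union> W]\<^bsup>2\<^esup>"
  proof
    fix e assume "e \<in> join_edges V W"
    then obtain v w where "e = {v, w}" "v \<in> V" "w \<in> W"
      by (auto simp: join_edges_def)
    moreover from this have "v \<noteq> w" using join.hyps by blast
    ultimately show "e \<in> [V \<union> W]\<^bsup>2\<^esup>" by (auto simp: nsets_def)
  qed
  with join.IH show ?case by (auto simp: nsets_def)
qed (auto simp: nsets_def)

text \<open>The next two facts are what makes \<^const>\<open>pmf_of_set\<close> the uniform distribution
  in \<^const>\<open>uniform_cograph\<close>.\<close>

lemma finite_labeled_cographs: "finite (labeled_cographs n)"
proof (rule finite_subset)
  show "labeled_cographs n \<subseteq> Pow (Pow {1..n})"
    using cograph_edges by (fastforce simp: labeled_cographs_def nsets_def)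
qed simp

lemma labeled_cographs_nonempty:
  assumes "n \<ge> 1" shows "labeled_cographs n \<noteq> {}"
proof -
  have "cograph {1..n} {}"
    using assms
  proof (induction n rule: nat_induct_at_least)
    case base
    show ?case using cograph.single[of "1::nat"] by simp
  next
    case (Suc n)
    have "cograph ({1..n} \<union> {Suc n}) ({} \<union> {})"
      by (rule cograph.disjoint_union[OF Suc.IH cograph.single]) simp
    moreover have "{1..n} \<union> {Suc n} = {1..Suc n}" by auto
    ultimately show ?case by simp
  qed
  then show ?thesis by (auto simp: labeled_cographs_def)
qed


section \<open>Computable real functions\<close>

text \<open>Computability is meant in the usual sense of computable analysis: some algorithm with
  oracle access to arbitrarily good dyadic approximations of the argument produces arbitrarily
  good dyadic approximations of the value. Algorithms are the partial recursive functionals,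
  i.e. the programs for partial recursive functions extended by an oracle call.\<close>

datatype recf =
    Zero
  | Succ
  | Proj nat
  | Oracle
  | Comp recf "recf list"
  | PrimRec recf recf
  | Minimize recf

text \<open>\<open>computes \<phi> P xs y\<close>: with oracle \<open>\<phi>\<close>, the program \<open>P\<close> halts on input \<open>xs\<close> with output \<open>y\<close>.\<close>

inductive computes :: "(nat \<Rightarrow> nat) \<Rightarrow> recf \<Rightarrow> nat list \<Rightarrow> nat \<Rightarrow> bool" for \<phi> where
  Zero: "computes \<phi> Zero xs 0"
| Succ: "computes \<phi> Succ [x] (Suc x)"
| Proj: "i < length xs \<Longrightarrow> computes \<phi> (Proj i) xs (xs ! i)"
| Oracle: "computes \<phi> Oracle [x] (\<phi> x)"
| Comp: "list_all2 (\<lambda>g y. computes \<phi> g xs y) gs ys \<Longrightarrow> computes \<phi> f ys z \<Longrightarrow>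
    computes \<phi> (Comp f gs) xs z"
| PrimRec_0: "computes \<phi> f xs y \<Longrightarrow> computes \<phi> (PrimRec f g) (0 # xs) y"
| PrimRec_Suc: "computes \<phi> (PrimRec f g) (m # xs) y \<Longrightarrow> computes \<phi> g (m # y # xs) z \<Longrightarrow>
    computes \<phi> (PrimRec f g) (Suc m # xs) z"
| Minimize: "computes \<phi> f (m # xs) 0 \<Longrightarrow> (\<forall>i<m. \<exists>y. computes \<phi> f (i # xs) (Suc y)) \<Longrightarrow>
    computes \<phi> (Minimize f) xs m"

text \<open>The number \<open>c\<close> encodes (through \<^const>\<open>int_decode\<close>) the numerator of a dyadic rational with
  denominator \<open>2 ^ m\<close> that approximates \<open>x\<close> up to an error of \<open>2 ^ -m\<close>.\<close>

definition dyadic_approx :: "real \<Rightarrow> nat \<Rightarrow> nat \<Rightarrow> bool" where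
  "dyadic_approx x m c \<longleftrightarrow> \<bar>real_of_int (int_decode c) / 2 ^ m - x\<bar> \<le> 1 / 2 ^ m"

text \<open>The same program has to work for all arguments, all names \<open>\<phi>\<close> of the argument and
  all precisions. Nothing is required outside of \<open>S\<close>.\<close>

definition computable_on :: "real set \<Rightarrow> (real \<Rightarrow> real) \<Rightarrow> bool" where
  "computable_on S f \<longleftrightarrow>
     (\<exists>P. \<forall>x\<in>S. \<forall>\<phi>. (\<forall>m. dyadic_approx x m (\<phi> m)) \<longrightarrow>
        (\<forall>m. \<exists>c. computes \<phi> P [m] c \<and> dyadic_approx (f x) m c))"

text \<open>Programs are deterministic, so \<open>c\<close> above is the output of \<open>P\<close>.\<close>

lemma computes_deterministic: "computes \<phi> P xs y \<Longrightarrow> computes \<phi> P xs z \<Longrightarrow> y = z"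
proof (induction arbitrary: z rule: computes.induct)
  case (Comp xs gs ys f y)
  from Comp.prems obtain ys' where
    ys': "list_all2 (\<lambda>g y. computes \<phi> g xs y) gs ys'" "computes \<phi> f ys' z"
    by (auto elim: computes.cases)
  have "ys = ys'"
  proof (rule nth_equalityI)
    show "length ys = length ys'"
      using Comp.IH(1) ys'(1) by (auto simp: list_all2_conv_all_nth)
    show "ys ! i = ys' ! i" if "i < length ys" for i
      using Comp.IH(1) ys'(1) that by (auto simp: list_all2_conv_all_nth)
  qed
  with Comp.IH(2) ys'(2) show ?case by blast
next
  case (PrimRec_0 f xs y g)
  from PrimRec_0.prems have "computes \<phi> f xs z" by (auto elim: computes.cases)
  then show ?case by (rule PrimRec_0.IH)
next
  case (PrimRec_Suc f g m xs y w)
  from PrimRec_Suc.prems obtain y' where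
    "computes \<phi> (PrimRec f g) (m # xs) y'" "computes \<phi> g (m # y' # xs) z"
    by (auto elim: computes.cases)
  with PrimRec_Suc.IH show ?case by blast
next
  case (Minimize f m xs)
  from Minimize.prems have z: "computes \<phi> f (z # xs) 0"
    "\<forall>i<z. \<exists>y. computes \<phi> f (i # xs) (Suc y)"
    by (auto elim: computes.cases)
  have "\<not> m < z" using z(2) Minimize.IH by fastforce
  moreover have "\<not> z < m" using z(1) Minimize.IH by fastforce
  ultimately show ?case by simp
qed (auto elim: computes.cases)

end

theory Submission
  imports Defs "HOL-Complex_Analysis.Complex_Analysis" "HOL-Real_Asymp.Real_Asymp"
begin

text \<open>
  A cograph on at least two vertices is either disconnected or has a disconnected complement. Hence
  the exponential generating functions \<open>W\<close> of all cographs and \<open>T\<close> of the connected ones satisfy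
  \<open>1 + W = exp T\<close> and \<open>2 T = W + x\<close>, that is, \<open>x = 2 T + 1 - exp T\<close>. The same decomposition with
  marked vertices, which have to form an independent set, yields an equation that can be solved for
  the marking variable. Lagrange inversion in both variables turns the number of cographs with \<open>p\<close>
  unmarked and \<open>q\<close> marked vertices into a torus integral of \<open>z(t)\<^bsup>-p\<^esup> s(t, x)\<^bsup>-q\<^esup>\<close> times a fixed
  weight, where \<open>z(t) = 2 t + 1 - exp t\<close> and \<open>s(t, x) = x - (exp t - 1) (exp x - 1)\<close>.

  For \<open>q = \<beta> n\<close> and \<open>p = (1 - \<beta>) n\<close> there is a real saddle point with \<open>exp t = 1 + w\<close> and
  \<open>exp x = 1 / w\<close>, where \<open>w\<close> is the unique root in \<open>(0, 1)\<close> of a monotone equation. Power series with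
  nonnegative coefficients make the integrand largest there, and Laplace's method applies along any
  sequence with \<open>q / n\<close> convergent in \<open>(0, 1)\<close>, which by compactness is as good as uniformity. The
  growth rate is \<open>\<rho> z(w) powr -(1 - \<beta>) s(w) powr -\<beta>\<close> with \<open>\<rho> = 2 ln 2 - 1\<close>. It is computable since
  \<open>w\<close>, being the root of a monotone equation, can be found by a search.\<close>

section \<open>Decomposing cographs\<close>

text \<open>The variable x is the marked part of the connected series. Let v mark vertices, W = exp
  t - 1 and Y the marked part of the co-connected series. An independent set lies inside one side of
  a join, so the marked part of all cographs is (1 + W) Y and that of the connected ones is x = v +
  W Y. Splitting off the component of a marked vertex gives Y' = (1 + Y) (1 + W Y') in v, whence 1 +
  Y = exp x; solving for v yields s. The radii depend on k / n itself and not on its limit. So the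
  linear term of the logarithm of the integrand vanishes exactly for every n, and only second
  derivatives need uniform control. The marked count is divided by the number of all cographs, an
  integral in one variable with saddle point ln 2, where z' = 0 and z = \<rho>. The Lagrange form
  with weight z' would lose its leading term there, so this count uses the form without it. The
  factorials of the marked count cancel against the binomial coefficient, and a two-dimensional
  integral of order 1 / n over a one-dimensional one of order n^(-1/2) leaves n^(-1/2).\<close>

definition disconn :: "'a set \<Rightarrow> 'a set set \<Rightarrow> bool" where
  "disconn V E \<longleftrightarrow> (\<exists>A B. V = A \<union> B \<and> A \<inter> B = {} \<and> A \<noteq> {} \<and> B \<noteq> {} \<and>
     (\<forall>a\<in>A. \<forall>b\<in>B. {a, b} \<notin> E))"

definition graph_compl :: "'a set \<Rightarrow> 'a set set \<Rightarrow> 'a set set" where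
  "graph_compl V E = [V]\<^bsup>2\<^esup> - E"

definition disconn_compl :: "'a set \<Rightarrow> 'a set set \<Rightarrow> bool" where
  "disconn_compl V E \<longleftrightarrow> disconn V (graph_compl V E)"

section \<open>Disconnected graphs and graphs with disconnected complement\<close>

lemma cograph_nonempty: "cograph V E \<Longrightarrow> V \<noteq> {}"
  by (induction rule: cograph.induct) auto

lemma doubleton_in_nsets: "{a, b} \<in> [V]\<^bsup>2\<^esup> \<longleftrightarrow> a \<in> V \<and> b \<in> V \<and> a \<noteq> b"
  by (auto simp: nsets_def card_insert_if)

lemma nsets_2E:
  assumes "e \<in> [V]\<^bsup>2\<^esup>"
  obtains a b where "e = {a, b}" "a \<in> V" "b \<in> V" "a \<noteq> b"
  using assms by (auto simp: nsets_def card_2_iff)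

lemma nsets_2_subset: "e \<in> [V]\<^bsup>2\<^esup> \<Longrightarrow> e \<subseteq> V \<and> e \<noteq> {}"
  by (auto simp: nsets_def)

lemma disconnI:
  assumes "V = A \<union> B" "A \<inter> B = {}" "A \<noteq> {}" "B \<noteq> {}"
    and "\<And>a b. a \<in> A \<Longrightarrow> b \<in> B \<Longrightarrow> {a, b} \<notin> E"
  shows "disconn V E"
  unfolding disconn_def using assms by blast

lemma disconnE:
  assumes "disconn V E"
  obtains A B where "V = A \<union> B" "A \<inter> B = {}" "A \<noteq> {}" "B \<noteq> {}"
    "\<And>a b. a \<in> A \<Longrightarrow> b \<in> B \<Longrightarrow> {a, b} \<notin> E"
  using assms unfolding disconn_def by blast

lemma disconnE_vertex:
  assumes "disconn V E" "v \<in> V"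
  obtains A where "v \<in> A" "A \<subset> V" "\<And>a b. a \<in> A \<Longrightarrow> b \<in> V - A \<Longrightarrow> {a, b} \<notin> E"
proof -
  from assms(1) obtain A B where AB: "V = A \<union> B" "A \<inter> B = {}" "A \<noteq> {}" "B \<noteq> {}"
      "\<And>a b. a \<in> A \<Longrightarrow> b \<in> B \<Longrightarrow> {a, b} \<notin> E" unfolding disconn_def by blast
  have diff: "V - A = B" "V - B = A" using AB(1,2) by auto
  show ?thesis
  proof (cases "v \<in> A")
    case True
    show ?thesis by (rule that[OF True]) (use AB diff in auto)
  next
    case False
    then have "v \<in> B" using assms(2) AB(1) by auto
    have *: "{b, a} \<notin> E" if "b \<in> B" "a \<in> A" for a b
      using AB(5)[OF that(2,1)] by (simp add: insert_commute)
    show ?thesis by (rule that[OF \<open>v \<in> B\<close>]) (use AB * diff in auto)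
  qed
qed

lemma disconn_complI:
  assumes "V = A \<union> B" "A \<inter> B = {}" "A \<noteq> {}" "B \<noteq> {}"
    and "\<And>a b. a \<in> A \<Longrightarrow> b \<in> B \<Longrightarrow> {a, b} \<in> E"
  shows "disconn_compl V E"
  unfolding disconn_compl_def disconn_def graph_compl_def using assms by blast

lemma disconn_complE:
  assumes "disconn_compl V E"
  obtains A B where "V = A \<union> B" "A \<inter> B = {}" "A \<noteq> {}" "B \<noteq> {}"
    "\<And>a b. a \<in> A \<Longrightarrow> b \<in> B \<Longrightarrow> {a, b} \<in> E"
proof -
  from assms obtain A B where AB: "V = A \<union> B" "A \<inter> B = {}" "A \<noteq> {}" "B \<noteq> {}"
    "\<forall>a\<in>A. \<forall>b\<in>B. {a, b} \<notin> [V]\<^bsup>2\<^esup> - E"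
    unfolding disconn_compl_def disconn_def graph_compl_def by blast
  have "{a, b} \<in> E" if "a \<in> A" "b \<in> B" for a b
  proof -
    have "{a, b} \<in> [V]\<^bsup>2\<^esup>" using that AB(1,2) by (auto simp: doubleton_in_nsets)
    with AB(5) that show ?thesis by blast
  qed
  with AB that show ?thesis by blast
qed

text \<open>Let A, B be the sides without edges between them and C, D those with all edges between
  them. A vertex of A and one of B cannot lie on different sides of C, D. Hence one vertex of A
  drags all of B to its side, and then all of A, so that the other side is empty.\<close>

lemma not_disconn_both: "disconn V E \<Longrightarrow> \<not> disconn_compl V E"
proof
  assume "disconn V E" "disconn_compl V E"
  from this(1) obtain A B where AB: "V = A \<union> B" "A \<inter> B = {}" "A \<noteq> {}" "B \<noteq> {}"
    "\<And>a b. a \<in> A \<Longrightarrow> b \<in> B \<Longrightarrow> {a, b} \<notin> E"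
    unfolding disconn_def by blast
  from \<open>disconn_compl V E\<close> obtain C D where CD: "V = C \<union> D" "C \<inter> D = {}" "C \<noteq> {}" "D \<noteq> {}"
    "\<And>a b. a \<in> C \<Longrightarrow> b \<in> D \<Longrightarrow> {a, b} \<in> E"
    by (rule disconn_complE) blast
  have AD: "\<not> (a \<in> A \<and> b \<in> B \<and> (a \<in> C \<and> b \<in> D \<or> a \<in> D \<and> b \<in> C))" for a b
    using AB(5)[of a b] CD(5)[of a b] CD(5)[of b a] by (auto simp: insert_commute)
  have side: "A \<union> B \<subseteq> X" if "a \<in> A" "b \<in> B" "a \<in> X" "X = C \<or> X = D" for a b X
  proof -
    have B: "y \<in> X" if "y \<in> B" for y
      using AD[of a y] \<open>a \<in> A\<close> \<open>a \<in> X\<close> \<open>X = C \<or> X = D\<close> that AB(1) CD(1) by auto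
    have "x \<in> X" if "x \<in> A" for x
      using AD[of x b] B[OF \<open>b \<in> B\<close>] \<open>b \<in> B\<close> \<open>X = C \<or> X = D\<close> that AB(1) CD(1) by auto
    with B show ?thesis by auto
  qed
  obtain a b where "a \<in> A" "b \<in> B" using AB(3,4) by auto
  then have "A \<union> B \<subseteq> C \<or> A \<union> B \<subseteq> D" using side[of a b C] side[of a b D] AB(1) CD(1) by auto
  then show False using AB(1) CD(1-4) by auto
qed

lemma not_disconn_singleton: "\<not> disconn {v} E"
proof
  assume "disconn {v} E"
  then obtain A B where AB: "{v} = A \<union> B" "A \<inter> B = {}" "A \<noteq> {}" "B \<noteq> {}"
    unfolding disconn_def by blast
  then have "A \<subseteq> {v}" "B \<subseteq> {v}" by auto
  then have "A = {v}" "B = {v}" using AB(3,4) by auto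
  with AB(2) show False by simp
qed

lemma cograph_disconn_cases:
  assumes "cograph V E" shows "(\<exists>v. V = {v}) \<or> disconn V E \<or> disconn_compl V E"
  using assms
proof cases
  case (disjoint_union V1 E1 V2 E2)
  have "{a, b} \<notin> E" if "a \<in> V1" "b \<in> V2" for a b
  proof
    assume "{a, b} \<in> E"
    then have "{a, b} \<subseteq> V1 \<or> {a, b} \<subseteq> V2"
      using disjoint_union cograph_edges[of V1 E1] cograph_edges[of V2 E2]
      by (auto simp: nsets_def)
    with that disjoint_union(5) show False by auto
  qed
  then have "disconn V E"
    unfolding disconn_def
    using disjoint_union(1,5) cograph_nonempty[OF disjoint_union(3)] cograph_nonempty[OF disjoint_union(4)]
    by blast
  then show ?thesis by blast
next
  case (join V1 E1 V2 E2)
  have "disconn_compl V E"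
    by (rule disconn_complI[of V V1 V2])
      (use join cograph_nonempty[OF join(3)] cograph_nonempty[OF join(4)] in
        \<open>auto simp: join_edges_def\<close>)
  then show ?thesis by blast
qed auto

text \<open>Needed to cut a disconnected cograph back into a cograph on a component and one on the
  rest. Since the empty graph is not a cograph, a set that meets only one operand is a separate case
  for both constructors.\<close>

lemma cograph_induced:
  assumes "cograph V E" "A \<subseteq> V" "A \<noteq> {}" shows "cograph A (E \<inter> Pow A)"
  using assms
proof (induction arbitrary: A rule: cograph.induct)
  case (single v)
  then have "A = {v}" by auto
  then show ?case using cograph.single by simp
next
  case (disjoint_union V E W F)
  note edges = cograph_edges[OF disjoint_union.hyps(1)] cograph_edges[OF disjoint_union.hyps(2)]
  have E: "E \<inter> Pow A = E \<inter> Pow (A \<inter> V)" "F \<inter> Pow A = F \<inter> Pow (A \<inter> W)"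
    using edges by (auto simp: nsets_def)
  have A: "A = (A \<inter> V) \<union> (A \<inter> W)" using disjoint_union.prems by auto
  have split: "(E \<union> F) \<inter> Pow A = (E \<inter> Pow (A \<inter> V)) \<union> (F \<inter> Pow (A \<inter> W))"
    using E by blast
  consider "A \<inter> V = {}" | "A \<inter> W = {}" | "A \<inter> V \<noteq> {}" "A \<inter> W \<noteq> {}" by blast
  then show ?case
  proof cases
    case 1
    moreover have "{} \<notin> E" using edges by (auto simp: nsets_def)
    then have "E \<inter> Pow {} = {}" by auto
    moreover have "A \<inter> W = A" using A 1 by auto
    ultimately show ?thesis using split disjoint_union.IH(2)[of A] disjoint_union.prems by auto
  next
    case 2
    moreover have "{} \<notin> F" using edges by (auto simp: nsets_def)
    then have "F \<inter> Pow {} = {}" by auto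
    moreover have "A \<inter> V = A" using A 2 by auto
    ultimately show ?thesis using split disjoint_union.IH(1)[of A] disjoint_union.prems by auto
  next
    case 3
    have "cograph ((A \<inter> V) \<union> (A \<inter> W)) ((E \<inter> Pow (A \<inter> V)) \<union> (F \<inter> Pow (A \<inter> W)))"
      by (rule cograph.disjoint_union[OF disjoint_union.IH])
        (use 3 disjoint_union.hyps(3) in auto)
    with A split show ?thesis by metis
  qed
next
  case (join V E W F)
  note edges = cograph_edges[OF join.hyps(1)] cograph_edges[OF join.hyps(2)]
  have E: "E \<inter> Pow A = E \<inter> Pow (A \<inter> V)" "F \<inter> Pow A = F \<inter> Pow (A \<inter> W)"
    using edges by (auto simp: nsets_def)
  have J: "join_edges V W \<inter> Pow A = join_edges (A \<inter> V) (A \<inter> W)"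
    by (auto simp: join_edges_def)
  have A: "A = (A \<inter> V) \<union> (A \<inter> W)" using join.prems by auto
  have split: "(E \<union> F \<union> join_edges V W) \<inter> Pow A =
      (E \<inter> Pow (A \<inter> V)) \<union> (F \<inter> Pow (A \<inter> W)) \<union> join_edges (A \<inter> V) (A \<inter> W)"
    using E J by blast
  consider "A \<inter> V = {}" | "A \<inter> W = {}" | "A \<inter> V \<noteq> {}" "A \<inter> W \<noteq> {}" by blast
  then show ?case
  proof cases
    case 1
    moreover have "{} \<notin> E" using edges by (auto simp: nsets_def)
    then have "E \<inter> Pow {} = {}" by auto
    moreover have "A \<inter> W = A" using A 1 by auto
    ultimately show ?thesis using split join.IH(2)[of A] join.prems
      by (auto simp: join_edges_def)
  next
    case 2
    moreover have "{} \<notin> F" using edges by (auto simp: nsets_def)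
    then have "F \<inter> Pow {} = {}" by auto
    moreover have "A \<inter> V = A" using A 2 by auto
    ultimately show ?thesis using split join.IH(1)[of A] join.prems
      by (auto simp: join_edges_def)
  next
    case 3
    have "cograph ((A \<inter> V) \<union> (A \<inter> W)) ((E \<inter> Pow (A \<inter> V)) \<union> (F \<inter> Pow (A \<inter> W)) \<union>
        join_edges (A \<inter> V) (A \<inter> W))"
      by (rule cograph.join[OF join.IH]) (use 3 join.hyps(3) in auto)
    with A split show ?thesis by metis
  qed
qed

section \<open>Complements of cographs\<close>

lemma graph_compl_compl: "E \<subseteq> [V]\<^bsup>2\<^esup> \<Longrightarrow> graph_compl V (graph_compl V E) = E"
  by (auto simp: graph_compl_def)

lemma nsets_2_Un:
  assumes "V \<inter> W = {}"
  shows "[V \<union> W]\<^bsup>2\<^esup> = [V]\<^bsup>2\<^esup> \<union> [W]\<^bsup>2\<^esup> \<union> join_edges V W"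
proof (intro equalityI subsetI)
  fix e assume "e \<in> [V \<union> W]\<^bsup>2\<^esup>"
  then obtain a b where "e = {a, b}" "a \<in> V \<union> W" "b \<in> V \<union> W" "a \<noteq> b" by (rule nsets_2E)
  moreover from this have "{a, b} \<in> join_edges V W" if "a \<in> V" "b \<in> W \<or> b \<in> V \<and> a \<in> W"
    using that by (auto simp: join_edges_def)
  moreover have "{a, b} \<in> join_edges V W" if "a \<in> W" "b \<in> V"
    using that by (auto simp: join_edges_def insert_commute)
  ultimately show "e \<in> [V]\<^bsup>2\<^esup> \<union> [W]\<^bsup>2\<^esup> \<union> join_edges V W"
    by (auto simp: doubleton_in_nsets)
next
  fix e assume "e \<in> [V]\<^bsup>2\<^esup> \<union> [W]\<^bsup>2\<^esup> \<union> join_edges V W"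
  moreover have "[V]\<^bsup>2\<^esup> \<subseteq> [V \<union> W]\<^bsup>2\<^esup>" "[W]\<^bsup>2\<^esup> \<subseteq> [V \<union> W]\<^bsup>2\<^esup>"
    by (auto simp: nsets_def)
  moreover have "join_edges V W \<subseteq> [V \<union> W]\<^bsup>2\<^esup>"
    using assms by (auto simp: join_edges_def doubleton_in_nsets)
  ultimately show "e \<in> [V \<union> W]\<^bsup>2\<^esup>" by blast
qed

lemma join_edges_nsets_disjoint:
  "V \<inter> W = {} \<Longrightarrow> join_edges V W \<inter> [V]\<^bsup>2\<^esup> = {}" "V \<inter> W = {} \<Longrightarrow> join_edges V W \<inter> [W]\<^bsup>2\<^esup> = {}"
  by (auto simp: join_edges_def doubleton_in_nsets)

lemma nsets_2_disjoint: "V \<inter> W = {} \<Longrightarrow> [V]\<^bsup>2\<^esup> \<inter> [W]\<^bsup>2\<^esup> = {}"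
proof -
  assume "V \<inter> W = {}"
  then have "e \<notin> [W]\<^bsup>2\<^esup>" if "e \<in> [V]\<^bsup>2\<^esup>" for e
    using nsets_2_subset[of e V] nsets_2_subset[of e W] that by blast
  then show ?thesis by blast
qed

lemma graph_compl_Un:
  assumes "V \<inter> W = {}" "E \<subseteq> [V]\<^bsup>2\<^esup>" "F \<subseteq> [W]\<^bsup>2\<^esup>"
  shows "graph_compl (V \<union> W) (E \<union> F) = graph_compl V E \<union> graph_compl W F \<union> join_edges V W"
    and "graph_compl (V \<union> W) (E \<union> F \<union> join_edges V W) = graph_compl V E \<union> graph_compl W F"
proof -
  let ?A = "[V]\<^bsup>2\<^esup>" and ?B = "[W]\<^bsup>2\<^esup>" and ?J = "join_edges V W"
  have "?J \<inter> ?A = {}" "?J \<inter> ?B = {}" "?A \<inter> ?B = {}"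
    using join_edges_nsets_disjoint[of V W] nsets_2_disjoint[of V W] assms(1) by simp_all
  then have *: "E \<inter> ?B = {}" "E \<inter> ?J = {}" "F \<inter> ?A = {}" "F \<inter> ?J = {}" "?J \<inter> ?A = {}" "?J \<inter> ?B = {}"
    using assms(2,3) by auto
  show "graph_compl (V \<union> W) (E \<union> F) = graph_compl V E \<union> graph_compl W F \<union> join_edges V W"
    "graph_compl (V \<union> W) (E \<union> F \<union> join_edges V W) = graph_compl V E \<union> graph_compl W F"
    unfolding graph_compl_def nsets_2_Un[OF assms(1)] Un_Diff using * by (auto simp: disjoint_iff)
qed

text \<open>Complementation swaps disjoint union and join. This transfers everything about
  components to co-components, the components of the complement.\<close>

lemma cograph_compl: "cograph V E \<Longrightarrow> cograph V (graph_compl V E)"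
proof (induction rule: cograph.induct)
  case (single v)
  have "[{v}]\<^bsup>2\<^esup> = {}" by (auto elim!: nsets_2E)
  then show ?case by (simp add: graph_compl_def cograph.single)
next
  case (disjoint_union V E W F)
  then show ?case
    using graph_compl_Un(1)[OF _ cograph_edges cograph_edges] cograph.join by metis
next
  case (join V E W F)
  then show ?case
    using graph_compl_Un(2)[OF _ cograph_edges cograph_edges] cograph.disjoint_union by metis
qed

subsection \<open>Splitting off the component of a vertex\<close>

lemma union_edges_restrict:
  assumes "S \<inter> W = {}" "E \<subseteq> [S]\<^bsup>2\<^esup>" "F \<subseteq> [W]\<^bsup>2\<^esup>"
  shows "(E \<union> F) \<inter> Pow S = E" "(E \<union> F) \<inter> Pow W = F"
proof -
  have "e \<subseteq> S \<and> \<not> e \<subseteq> W" if "e \<in> E" for e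
    using nsets_2_subset[of e S] assms(1,2) that by blast
  moreover have "e \<subseteq> W \<and> \<not> e \<subseteq> S" if "e \<in> F" for e
    using nsets_2_subset[of e W] assms(1,3) that by blast
  ultimately show "(E \<union> F) \<inter> Pow S = E" "(E \<union> F) \<inter> Pow W = F" by blast+
qed

text \<open>A connected S that is not inside S' has an edge between its parts inside and outside S',
  but no edge of E' \<union> F' leaves S'.\<close>

lemma union_component_unique:
  assumes "v \<in> S" "v \<in> S'" "S \<subseteq> V" "S' \<subseteq> V" "\<not> disconn S E"
    and "E \<union> F = E' \<union> F'" "E \<subseteq> [S]\<^bsup>2\<^esup>" "E' \<subseteq> [S']\<^bsup>2\<^esup>" "F' \<subseteq> [V - S']\<^bsup>2\<^esup>"
  shows "S \<subseteq> S'"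
proof (rule ccontr)
  assume "\<not> S \<subseteq> S'"
  then have "S - S' \<noteq> {}" "S \<inter> S' \<noteq> {}" using assms by auto
  moreover have "S = (S \<inter> S') \<union> (S - S')" "(S \<inter> S') \<inter> (S - S') = {}" by auto
  ultimately have "\<exists>a\<in>S \<inter> S'. \<exists>b\<in>S - S'. {a, b} \<in> E"
    using assms(5) disconnI[of S "S \<inter> S'" "S - S'" E] by blast
  then obtain a b where ab: "a \<in> S \<inter> S'" "b \<in> S - S'" "{a, b} \<in> E" by blast
  then have "{a, b} \<in> E' \<union> F'" using assms by blast
  then have "{a, b} \<subseteq> S' \<or> {a, b} \<subseteq> V - S'" using assms by (auto simp: nsets_def)
  with ab show False by auto
qed

text \<open>The component of v is a set of least cardinality among the proper subsets that contain v
  and have no edge to the outside; a disconnection of its induced graph would yield a smaller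
  one.\<close>

lemma exists_component:
  assumes "finite V" "v \<in> V" "disconn V E" "E \<subseteq> [V]\<^bsup>2\<^esup>"
  obtains S where "v \<in> S" "S \<subset> V" "\<not> disconn S (E \<inter> Pow S)"
    "E = (E \<inter> Pow S) \<union> (E \<inter> Pow (V - S))"
proof -
  define P where "P S \<longleftrightarrow> v \<in> S \<and> S \<subset> V \<and> (\<forall>a\<in>S. \<forall>b\<in>V - S. {a, b} \<notin> E)" for S
  obtain S0 where "P S0"
    using disconnE_vertex[OF assms(3,2)] unfolding P_def by metis
  then obtain S where S: "P S" and min: "\<And>S'. P S' \<Longrightarrow> card S \<le> card S'"
    using ex_has_least_nat[of P S0 card] by blast
  have fin: "finite S" using S assms(1) unfolding P_def by (meson finite_subset psubsetE)
  have "\<not> disconn S (E \<inter> Pow S)"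
  proof
    assume "disconn S (E \<inter> Pow S)"
    then obtain A' where A': "v \<in> A'" "A' \<subset> S"
      "\<And>a b. a \<in> A' \<Longrightarrow> b \<in> S - A' \<Longrightarrow> {a, b} \<notin> E \<inter> Pow S"
      using S disconnE_vertex[of S "E \<inter> Pow S" v] unfolding P_def by blast
    have "P A'" unfolding P_def
    proof (intro conjI ballI)
      fix a b assume "a \<in> A'" "b \<in> V - A'"
      then show "{a, b} \<notin> E" using A'(2) A'(3)[of a b] S unfolding P_def by (cases "b \<in> S") auto
    next
      show "v \<in> A'" by (rule A'(1))
      show "A' \<subset> V" using A'(2) S unfolding P_def by (meson psubset_trans)
    qed
    then show False using min[of A'] psubset_card_mono[OF fin A'(2)] by simp
  qed
  moreover have "E = (E \<inter> Pow S) \<union> (E \<inter> Pow (V - S))"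
  proof -
    have "e \<subseteq> S \<or> e \<subseteq> V - S" if "e \<in> E" for e
    proof -
      from that assms(4) obtain a b where e: "e = {a, b}" "a \<in> V" "b \<in> V" using nsets_2E[of e V] by blast
      have "\<not> (a \<in> S \<and> b \<notin> S)" "\<not> (b \<in> S \<and> a \<notin> S)"
        using S that e unfolding P_def by (metis DiffI insert_commute)+
      then show ?thesis using e by blast
    qed
    then show ?thesis by blast
  qed
  ultimately show ?thesis using S that unfolding P_def by blast
qed

text \<open>Encodes a disconnected cograph by the component of v and the graph on the other
  vertices, which may be connected or not. Rooting at v makes the encoding unique and avoids the
  symmetry factors of unordered components.\<close>

definition component_pairs :: "'a set \<Rightarrow> 'a \<Rightarrow> ('a set \<times> 'a set set \<times> 'a set set) set" where
  "component_pairs V v =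
     (SIGMA S:{S. v \<in> S \<and> S \<subset> V}. {E. cograph S E \<and> \<not> disconn S E} \<times> {F. cograph (V - S) F})"

lemma bij_betw_component_pairs:
  assumes "finite V" "v \<in> V"
  shows "bij_betw (\<lambda>(S, E, F). E \<union> F) (component_pairs V v) {E. cograph V E \<and> disconn V E}"
  unfolding bij_betw_def
proof
  show "inj_on (\<lambda>(S, E, F). E \<union> F) (component_pairs V v)"
  proof (rule inj_onI)
    fix p p' assume pp: "p \<in> component_pairs V v" "p' \<in> component_pairs V v"
      "(\<lambda>(S, E, F). E \<union> F) p = (\<lambda>(S, E, F). E \<union> F) p'"
    obtain S E F S' E' F' where eq: "p = (S, E, F)" "p' = (S', E', F')" by (metis prod_cases3)
    have *: "(S, E, F) \<in> component_pairs V v" "(S', E', F') \<in> component_pairs V v" "E \<union> F = E' \<union> F'"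
      using pp eq by auto
    then have p: "v \<in> S" "S \<subseteq> V" "\<not> disconn S E" "v \<in> S'" "S' \<subseteq> V" "\<not> disconn S' E'"
      and e: "E \<subseteq> [S]\<^bsup>2\<^esup>" "E' \<subseteq> [S']\<^bsup>2\<^esup>" "F \<subseteq> [V - S]\<^bsup>2\<^esup>" "F' \<subseteq> [V - S']\<^bsup>2\<^esup>"
      using cograph_edges[of S E] cograph_edges[of S' E'] cograph_edges[of "V - S" F]
        cograph_edges[of "V - S'" F'] by (auto simp: component_pairs_def)
    have "S \<subseteq> S'" by (rule union_component_unique[OF p(1,4,2,5,3) *(3) e(1,2,4)])
    moreover have "S' \<subseteq> S"
      by (rule union_component_unique[OF p(4,1,5,2,6) *(3)[symmetric] e(2,1,3)])
    ultimately have S: "S = S'" by blast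
    have "E = (E \<union> F) \<inter> Pow S" "F = (E \<union> F) \<inter> Pow (V - S)"
      using union_edges_restrict[of S "V - S" E F] e by blast+
    moreover have "E' = (E' \<union> F') \<inter> Pow S'" "F' = (E' \<union> F') \<inter> Pow (V - S')"
      using union_edges_restrict[of S' "V - S'" E' F'] e by blast+
    ultimately show "p = p'" using S *(3) eq by metis
  qed
  show "(\<lambda>(S, E, F). E \<union> F) ` component_pairs V v = {E. cograph V E \<and> disconn V E}"
  proof (intro equalityI subsetI)
    fix G assume "G \<in> (\<lambda>(S, E, F). E \<union> F) ` component_pairs V v"
    then obtain S E F where *: "(S, E, F) \<in> component_pairs V v" "G = E \<union> F" by auto
    then have c: "cograph S E" "cograph (V - S) F" "S \<subset> V" "v \<in> S" by (auto simp: component_pairs_def)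
    have V: "S \<union> (V - S) = V" using c by auto
    have "cograph V G" using cograph.disjoint_union[OF c(1,2)] * V by auto
    moreover have "disconn V G"
    proof (rule disconnI)
      fix a b assume "a \<in> S" "b \<in> V - S"
      then show "{a, b} \<notin> G" using cograph_edges[OF c(1)] cograph_edges[OF c(2)] *(2)
        by (auto simp: nsets_def)
    qed (use c in auto)
    ultimately show "G \<in> {E. cograph V E \<and> disconn V E}" by simp
  next
    fix G assume "G \<in> {E. cograph V E \<and> disconn V E}"
    then have G: "cograph V G" "disconn V G" by auto
    from exists_component[OF assms G(2) cograph_edges[OF G(1)]] obtain S where
      S: "v \<in> S" "S \<subset> V" "\<not> disconn S (G \<inter> Pow S)" "G = (G \<inter> Pow S) \<union> (G \<inter> Pow (V - S))" by blast
    have "cograph S (G \<inter> Pow S)" "cograph (V - S) (G \<inter> Pow (V - S))"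
      by (rule cograph_induced[OF G(1)]; use S in blast)+
    then have "(S, G \<inter> Pow S, G \<inter> Pow (V - S)) \<in> component_pairs V v"
      using S(1-3) by (simp add: component_pairs_def)
    with S(4) show "G \<in> (\<lambda>(S, E, F). E \<union> F) ` component_pairs V v"
      by (intro image_eqI[of _ _ "(S, G \<inter> Pow S, G \<inter> Pow (V - S))"]) simp_all
  qed
qed

subsection \<open>Counting cographs with a prescribed independent set\<close>

definition indep_cographs :: "'a set \<Rightarrow> 'a set \<Rightarrow> 'a set set set" where
  "indep_cographs V I = {E. cograph V E \<and> indep I E}"

definition conn_cographs :: "'a set \<Rightarrow> 'a set \<Rightarrow> 'a set set set" where
  "conn_cographs V I = {E \<in> indep_cographs V I. \<not> disconn V E}"

definition coconn_cographs :: "'a set \<Rightarrow> 'a set \<Rightarrow> 'a set set set" where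
  "coconn_cographs V I = {E \<in> indep_cographs V I. \<not> disconn_compl V E}"

lemma finite_indep_cographs:
  assumes "finite V"
  shows "finite (indep_cographs V I)" "finite (conn_cographs V I)" "finite (coconn_cographs V I)"
proof -
  have "indep_cographs V I \<subseteq> Pow (Pow V)"
    using cograph_edges by (fastforce simp: indep_cographs_def nsets_def)
  with assms show "finite (indep_cographs V I)" by (simp add: finite_subset)
  then show "finite (conn_cographs V I)" "finite (coconn_cographs V I)"
    by (simp_all add: conn_cographs_def coconn_cographs_def)
qed

lemma bij_betw_Collect_comp:
  "bij_betw f A B \<Longrightarrow> bij_betw f {x \<in> A. P (f x)} {y \<in> B. P y}"
  unfolding bij_betw_def by (auto simp: inj_on_def)

lemma indep_cographs_empty: "indep_cographs {} I = {}"
  using cograph_nonempty by (auto simp: indep_cographs_def)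

lemma indep_union_iff:
  assumes "E \<subseteq> [S]\<^bsup>2\<^esup>" "F \<subseteq> [V - S]\<^bsup>2\<^esup>"
  shows "indep I (E \<union> F) \<longleftrightarrow> indep (I \<inter> S) E \<and> indep (I - S) F"
proof -
  have E: "a \<in> S \<and> b \<in> S" if "{a, b} \<in> E" for a b using assms(1) that by (auto simp: nsets_def)
  have F: "a \<in> V - S \<and> b \<in> V - S" if "{a, b} \<in> F" for a b using assms(2) that by (auto simp: nsets_def)
  show ?thesis unfolding indep_def using E F by blast
qed

lemma card_disconn_indep_cographs:
  assumes "finite V" "v \<in> V"
  shows "card {E \<in> indep_cographs V I. disconn V E} =
    (\<Sum>S | v \<in> S \<and> S \<subseteq> V. card (conn_cographs S (I \<inter> S)) * card (indep_cographs (V - S) (I - S)))"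
proof -
  let ?f = "\<lambda>(S, E, F). E \<union> F"
  define Q where "Q = (SIGMA S:{S. v \<in> S \<and> S \<subset> V}.
     conn_cographs S (I \<inter> S) \<times> indep_cographs (V - S) (I - S))"
  have "Q = {p \<in> component_pairs V v. indep I (?f p)}"
  proof -
    have "indep I (E \<union> F) \<longleftrightarrow> indep (I \<inter> S) E \<and> indep (I - S) F"
      if "cograph S E" "cograph (V - S) F" for S E F
      by (rule indep_union_iff) (use cograph_edges that in blast)+
    then show ?thesis
      by (auto simp: Q_def component_pairs_def conn_cographs_def indep_cographs_def)
  qed
  moreover have "{E \<in> indep_cographs V I. disconn V E} = {E \<in> {E. cograph V E \<and> disconn V E}. indep I E}"
    by (auto simp: indep_cographs_def)
  ultimately have "bij_betw ?f Q {E \<in> indep_cographs V I. disconn V E}"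
    using bij_betw_Collect_comp[OF bij_betw_component_pairs[OF assms], of "indep I"] by simp
  then have "card {E \<in> indep_cographs V I. disconn V E} = card Q"
    by (simp add: bij_betw_same_card)
  also have "\<dots> = (\<Sum>S | v \<in> S \<and> S \<subset> V. card (conn_cographs S (I \<inter> S) \<times> indep_cographs (V - S) (I - S)))"
    unfolding Q_def
  proof (rule card_SigmaI)
    show "finite {S. v \<in> S \<and> S \<subset> V}" using assms(1) by (rule_tac finite_subset[of _ "Pow V"]) auto
    show "\<forall>S\<in>{S. v \<in> S \<and> S \<subset> V}. finite (conn_cographs S (I \<inter> S) \<times> indep_cographs (V - S) (I - S))"
      using assms(1) finite_indep_cographs by (metis (no_types, lifting) finite_Diff finite_SigmaI
          finite_subset mem_Collect_eq psubset_imp_subset)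
  qed
  \<comment> \<open>Adding S = V is harmless, because there is no cograph on the empty vertex set;
    the recurrences then need no exception for the full set.\<close>
  also have "\<dots> = (\<Sum>S | v \<in> S \<and> S \<subseteq> V. card (conn_cographs S (I \<inter> S) \<times> indep_cographs (V - S) (I - S)))"
  proof (rule sum.mono_neutral_left)
    show "finite {S. v \<in> S \<and> S \<subseteq> V}" using assms(1) by (rule_tac finite_subset[of _ "Pow V"]) auto
    have "S = V" if "S \<subseteq> V" "\<not> S \<subset> V" for S using that by blast
    then show "\<forall>S\<in>{S. v \<in> S \<and> S \<subseteq> V} - {S. v \<in> S \<and> S \<subset> V}.
        card (conn_cographs S (I \<inter> S) \<times> indep_cographs (V - S) (I - S)) = 0"
      by (auto simp: card_cartesian_product indep_cographs_empty)
  qed auto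
  finally show ?thesis by (simp add: card_cartesian_product)
qed

lemma disconn_compl_compl: "E \<subseteq> [V]\<^bsup>2\<^esup> \<Longrightarrow> disconn_compl V (graph_compl V E) \<longleftrightarrow> disconn V E"
  by (simp add: disconn_compl_def graph_compl_compl)

definition cocomponent_pairs :: "'a set \<Rightarrow> 'a \<Rightarrow> ('a set \<times> 'a set set \<times> 'a set set) set" where
  "cocomponent_pairs V v =
     (SIGMA S:{S. v \<in> S \<and> S \<subset> V}. {E. cograph S E \<and> \<not> disconn_compl S E} \<times> {F. cograph (V - S) F})"

lemma bij_betw_compl:
  "bij_betw (graph_compl V) {E. cograph V E \<and> disconn V E} {E. cograph V E \<and> disconn_compl V E}"
  "bij_betw (graph_compl V) {E. cograph V E \<and> \<not> disconn_compl V E} {E. cograph V E \<and> \<not> disconn V E}"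
  by (rule bij_betw_byWitness[where f' = "graph_compl V"];
      auto simp: cograph_compl graph_compl_compl disconn_compl_compl cograph_edges
        simp flip: disconn_compl_def)+

text \<open>Obtained from \<open>bij_betw_component_pairs\<close> by complementing the graph and
  both of its parts; the disjoint union then becomes a join.\<close>

lemma bij_betw_cocomponent_pairs:
  assumes "finite V" "v \<in> V"
  shows "bij_betw (\<lambda>(S, E, F). E \<union> F \<union> join_edges S (V - S)) (cocomponent_pairs V v)
    {E. cograph V E \<and> disconn_compl V E}"
proof -
  let ?g = "\<lambda>(S, E, F). (S, graph_compl S E, graph_compl (V - S) F)"
  have "bij_betw ?g (cocomponent_pairs V v) (component_pairs V v)"
    by (rule bij_betw_byWitness[where f' = ?g])
      (auto simp: component_pairs_def cocomponent_pairs_def graph_compl_compl cograph_edges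
        cograph_compl disconn_compl_compl simp flip: disconn_compl_def)
  from bij_betw_trans[OF bij_betw_trans[OF this bij_betw_component_pairs[OF assms]] bij_betw_compl(1)]
  have "bij_betw (graph_compl V \<circ> ((\<lambda>(S, E, F). E \<union> F) \<circ> ?g)) (cocomponent_pairs V v)
      {E. cograph V E \<and> disconn_compl V E}" .
  moreover have "(graph_compl V \<circ> ((\<lambda>(S, E, F). E \<union> F) \<circ> ?g)) p =
      (\<lambda>(S, E, F). E \<union> F \<union> join_edges S (V - S)) p" if "p \<in> cocomponent_pairs V v" for p
  proof -
    obtain S E F where p: "p = (S, E, F)" by (metis prod_cases3)
    have "S \<subseteq> V" and c: "cograph S E" "cograph (V - S) F" using that p by (auto simp: cocomponent_pairs_def)
    then have V: "S \<union> (V - S) = V" by auto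
    have "graph_compl (S \<union> (V - S)) (graph_compl S E \<union> graph_compl (V - S) F) =
        E \<union> F \<union> join_edges S (V - S)"
      using c by (subst graph_compl_Un(1)) (auto simp: graph_compl_compl cograph_edges cograph_compl)
    then show ?thesis using V p by simp
  qed
  ultimately show ?thesis by (simp cong: bij_betw_cong)
qed

text \<open>Vertices on different sides of a join are adjacent. So the independent set lies entirely
  in the co-component of any of its vertices v, and all vertices outside of this co-component are
  unmarked.\<close>

lemma card_disconn_compl_indep_cographs:
  assumes "finite V" "v \<in> I" "I \<subseteq> V"
  shows "card {E \<in> indep_cographs V I. disconn_compl V E} =
    (\<Sum>S | I \<subseteq> S \<and> S \<subseteq> V. card (coconn_cographs S I) * card (indep_cographs (V - S) {}))"
proof -
  let ?f = "\<lambda>(S, E, F). E \<union> F \<union> join_edges S (V - S)"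
  define Q where "Q = (SIGMA S:{S. I \<subseteq> S \<and> S \<subset> V}. coconn_cographs S I \<times> indep_cographs (V - S) {})"
  have "Q = {p \<in> cocomponent_pairs V v. indep I (?f p)}"
  proof -
    have "indep I (E \<union> F \<union> join_edges S (V - S)) \<longleftrightarrow> I \<subseteq> S \<and> indep I E"
      if "cograph S E" "cograph (V - S) F" "v \<in> S" "S \<subset> V" for S E F
    proof -
      have EF: "indep I (E \<union> F) \<longleftrightarrow> indep (I \<inter> S) E \<and> indep (I - S) F"
        by (rule indep_union_iff) (use cograph_edges that in blast)+
      show ?thesis
      proof (cases "I \<subseteq> S")
        case True
        have "indep I (join_edges S (V - S))"
          unfolding indep_def join_edges_def using True by (auto simp: doubleton_eq_iff)
        moreover have "I \<inter> S = I" "I - S = {}" using True by auto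
        ultimately show ?thesis using True EF by (auto simp: indep_def)
      next
        case False
        then obtain u where u: "u \<in> I" "u \<notin> S" by auto
        then have "{v, u} \<in> join_edges S (V - S)" "v \<noteq> u"
          using that assms(3) by (auto simp: join_edges_def)
        with u assms(2) have "\<not> indep I (E \<union> F \<union> join_edges S (V - S))" by (auto simp: indep_def)
        with False show ?thesis by simp
      qed
    qed
    then show ?thesis using assms(2)
      by (auto simp: Q_def cocomponent_pairs_def coconn_cographs_def indep_cographs_def)
  qed
  moreover have "{E \<in> indep_cographs V I. disconn_compl V E} =
      {E \<in> {E. cograph V E \<and> disconn_compl V E}. indep I E}"
    by (auto simp: indep_cographs_def)
  moreover have "v \<in> V" using assms by auto
  ultimately have "bij_betw ?f Q {E \<in> indep_cographs V I. disconn_compl V E}"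
    using bij_betw_Collect_comp[OF bij_betw_cocomponent_pairs[OF assms(1)], of v "indep I"] by simp
  then have "card {E \<in> indep_cographs V I. disconn_compl V E} = card Q"
    by (simp add: bij_betw_same_card)
  also have "\<dots> = (\<Sum>S | I \<subseteq> S \<and> S \<subset> V. card (coconn_cographs S I \<times> indep_cographs (V - S) {}))"
    unfolding Q_def
  proof (rule card_SigmaI)
    show "finite {S. I \<subseteq> S \<and> S \<subset> V}" using assms(1) by (rule_tac finite_subset[of _ "Pow V"]) auto
    show "\<forall>S\<in>{S. I \<subseteq> S \<and> S \<subset> V}. finite (coconn_cographs S I \<times> indep_cographs (V - S) {})"
      using assms(1) finite_indep_cographs by (metis (no_types, lifting) finite_Diff finite_SigmaI
          finite_subset mem_Collect_eq psubset_imp_subset)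
  qed
  also have "\<dots> = (\<Sum>S | I \<subseteq> S \<and> S \<subseteq> V. card (coconn_cographs S I \<times> indep_cographs (V - S) {}))"
  proof (rule sum.mono_neutral_left)
    show "finite {S. I \<subseteq> S \<and> S \<subseteq> V}" using assms(1) by (rule_tac finite_subset[of _ "Pow V"]) auto
    have "S = V" if "S \<subseteq> V" "\<not> S \<subset> V" for S using that by blast
    then show "\<forall>S\<in>{S. I \<subseteq> S \<and> S \<subseteq> V} - {S. I \<subseteq> S \<and> S \<subset> V}.
        card (coconn_cographs S I \<times> indep_cographs (V - S) {}) = 0"
      by (auto simp: card_cartesian_product indep_cographs_empty)
  qed auto
  finally show ?thesis by (simp add: card_cartesian_product)
qed

text \<open>Complementation exchanges the two kinds. It does not respect independent sets, hence the
  restriction to no marked vertices.\<close>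

lemma card_coconn_eq_conn: "card (coconn_cographs V {}) = card (conn_cographs V {})"
  using bij_betw_same_card[OF bij_betw_compl(2)[of V]]
  by (simp add: coconn_cographs_def conn_cographs_def indep_cographs_def indep_def)

lemma card_indep_cographs_conn:
  "finite V \<Longrightarrow> card (indep_cographs V I) =
     card (conn_cographs V I) + card {E \<in> indep_cographs V I. disconn V E}"
  unfolding conn_cographs_def
  by (subst card_Un_disjoint[symmetric]) (auto simp: finite_indep_cographs intro!: arg_cong[of _ _ card])

lemma card_indep_cographs_coconn:
  "finite V \<Longrightarrow> card (indep_cographs V I) =
     card (coconn_cographs V I) + card {E \<in> indep_cographs V I. disconn_compl V E}"
  unfolding coconn_cographs_def
  by (subst card_Un_disjoint[symmetric]) (auto simp: finite_indep_cographs intro!: arg_cong[of _ _ card])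

lemma cograph_singleton_iff: "cograph {v} E \<longleftrightarrow> E = {}"
proof
  assume "cograph {v} E"
  then show "E = {}" using cograph_edges[of "{v}" E] by (fastforce elim!: nsets_2E)
qed (auto intro: cograph.single)

text \<open>With at least two vertices, exactly one of the cograph and its complement is
  disconnected. The single vertex is connected and co-connected, so it is counted twice on the
  right.\<close>

lemma card_indep_cographs_sum:
  assumes "finite V"
  shows "card (indep_cographs V I) + (if card V = 1 then 1 else 0) =
    card (conn_cographs V I) + card (coconn_cographs V I)"
proof (cases "card V = 1")
  case True
  then obtain v where V: "V = {v}" by (auto simp: card_1_singleton_iff)
  have "indep_cographs V I = {{}}" "conn_cographs V I = {{}}" "coconn_cographs V I = {{}}"
    unfolding conn_cographs_def coconn_cographs_def
    by (auto simp: V indep_cographs_def cograph_singleton_iff indep_def not_disconn_singleton disconn_compl_def)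
  with True show ?thesis by simp
next
  case False
  then have "V \<noteq> {v}" for v by auto
  then have "coconn_cographs V I = {E \<in> indep_cographs V I. disconn V E}"
    using False cograph_disconn_cases[of V] not_disconn_both[of V]
    by (auto simp: coconn_cographs_def indep_cographs_def)
  with False card_indep_cographs_conn[OF assms, of I] show ?thesis by simp
qed

subsection \<open>Relabelling\<close>

lemma cograph_image:
  "cograph V E \<Longrightarrow> inj_on f V \<Longrightarrow> cograph (f ` V) ((`) f ` E)"
proof (induction rule: cograph.induct)
  case (single v)
  then show ?case by (simp add: cograph.single)
next
  case (disjoint_union V E W F)
  have "f ` V \<inter> f ` W = {}" using disjoint_union.prems disjoint_union.hyps(3)
    by (auto simp: inj_on_def)
  moreover have "inj_on f V" "inj_on f W" using disjoint_union.prems by (auto simp: inj_on_Un)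
  ultimately show ?case using cograph.disjoint_union[of "f ` V" _ "f ` W"] disjoint_union.IH
    by (simp add: image_Un)
next
  case (join V E W F)
  have "f ` V \<inter> f ` W = {}" using join.prems join.hyps(3)
    by (auto simp: inj_on_def)
  moreover have "inj_on f V" "inj_on f W" using join.prems by (auto simp: inj_on_Un)
  moreover have "(`) f ` join_edges V W = join_edges (f ` V) (f ` W)"
    by (auto simp: join_edges_def image_iff) (metis image_empty image_insert)
  ultimately show ?case using cograph.join[of "f ` V" _ "f ` W"] join.IH
    by (simp add: image_Un)
qed

lemma edge_image_iff:
  assumes "inj_on f V" "E \<subseteq> [V]\<^bsup>2\<^esup>" "a \<in> V" "b \<in> V"
  shows "{f a, f b} \<in> (`) f ` E \<longleftrightarrow> {a, b} \<in> E"
proof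
  assume "{f a, f b} \<in> (`) f ` E"
  then obtain e where e: "e \<in> E" "f ` e = f ` {a, b}" by auto
  then have "e = {a, b}"
    using inj_on_image_eq_iff[OF assms(1), of e "{a, b}"] assms nsets_2_subset[of e V] by auto
  with e show "{a, b} \<in> E" by simp
qed (auto intro: image_eqI[of _ _ "{a, b}"])

lemma disconn_image_iff:
  assumes "inj_on f V" "E \<subseteq> [V]\<^bsup>2\<^esup>"
  shows "disconn (f ` V) ((`) f ` E) \<longleftrightarrow> disconn V E"
proof
  assume "disconn V E"
  then obtain A B where AB: "V = A \<union> B" "A \<inter> B = {}" "A \<noteq> {}" "B \<noteq> {}"
    "\<And>a b. a \<in> A \<Longrightarrow> b \<in> B \<Longrightarrow> {a, b} \<notin> E" unfolding disconn_def by blast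
  show "disconn (f ` V) ((`) f ` E)"
  proof (rule disconnI)
    show "f ` V = f ` A \<union> f ` B" using AB by auto
    show "f ` A \<inter> f ` B = {}" using assms(1) AB(1,2) by (auto simp: inj_on_def)
    fix a b assume "a \<in> f ` A" "b \<in> f ` B"
    then obtain c d where "a = f c" "b = f d" "c \<in> A" "d \<in> B" by auto
    then show "{a, b} \<notin> (`) f ` E" using AB edge_image_iff[OF assms, of c d] by blast
  qed (use AB in auto)
next
  assume "disconn (f ` V) ((`) f ` E)"
  then obtain A B where AB: "f ` V = A \<union> B" "A \<inter> B = {}" "A \<noteq> {}" "B \<noteq> {}"
    "\<And>a b. a \<in> A \<Longrightarrow> b \<in> B \<Longrightarrow> {a, b} \<notin> (`) f ` E" by (rule disconnE) (rule that; simp)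
  show "disconn V E"
  proof (rule disconnI)
    have V: "f x \<in> A \<or> f x \<in> B" if "x \<in> V" for x using AB(1) that by blast
    show "V = {x \<in> V. f x \<in> A} \<union> {x \<in> V. f x \<in> B}" using V by blast
    show "{x \<in> V. f x \<in> A} \<inter> {x \<in> V. f x \<in> B} = {}" using AB(2) by blast
    obtain a b where "a \<in> A" "b \<in> B" using AB(3,4) by blast
    moreover from this have "a \<in> f ` V" "b \<in> f ` V" unfolding AB(1) by simp_all
    ultimately show "{x \<in> V. f x \<in> A} \<noteq> {}" "{x \<in> V. f x \<in> B} \<noteq> {}" by auto
    fix a b assume "a \<in> {x \<in> V. f x \<in> A}" "b \<in> {x \<in> V. f x \<in> B}"
    then show "{a, b} \<notin> E" using AB(5)[of "f a" "f b"] edge_image_iff[OF assms, of a b] by blast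
  qed
qed

lemma graph_compl_image:
  assumes "inj_on f V" "E \<subseteq> [V]\<^bsup>2\<^esup>"
  shows "graph_compl (f ` V) ((`) f ` E) = (`) f ` graph_compl V E"
proof (intro equalityI subsetI)
  fix e assume e: "e \<in> graph_compl (f ` V) ((`) f ` E)"
  then obtain x y where "e = {x, y}" "x \<in> f ` V" "y \<in> f ` V" "x \<noteq> y"
    using nsets_2E[of e "f ` V"] unfolding graph_compl_def by blast
  then obtain a b where ab: "e = {f a, f b}" "a \<in> V" "b \<in> V" "f a \<noteq> f b" by blast
  then have "{a, b} \<in> graph_compl V E"
    using e edge_image_iff[OF assms, of a b] by (auto simp: graph_compl_def doubleton_in_nsets)
  then show "e \<in> (`) f ` graph_compl V E" using ab by (intro image_eqI[of _ _ "{a, b}"]) auto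
next
  fix e assume "e \<in> (`) f ` graph_compl V E"
  then obtain d where d: "e = f ` d" "d \<in> [V]\<^bsup>2\<^esup>" "d \<notin> E" by (auto simp: graph_compl_def)
  then obtain a b where ab: "d = {a, b}" "a \<in> V" "b \<in> V" "a \<noteq> b" using nsets_2E by metis
  then have "f a \<noteq> f b" using assms(1) by (auto simp: inj_on_def)
  then show "e \<in> graph_compl (f ` V) ((`) f ` E)"
    using ab d edge_image_iff[OF assms, of a b] by (auto simp: graph_compl_def doubleton_in_nsets)
qed

lemma disconn_compl_image_iff:
  assumes "inj_on f V" "E \<subseteq> [V]\<^bsup>2\<^esup>"
  shows "disconn_compl (f ` V) ((`) f ` E) \<longleftrightarrow> disconn_compl V E"
  unfolding disconn_compl_def graph_compl_image[OF assms]
  by (rule disconn_image_iff[OF assms(1)]) (simp add: graph_compl_def)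

lemma indep_image:
  assumes "inj_on f V" "E \<subseteq> [V]\<^bsup>2\<^esup>" "I \<subseteq> V" "indep I E"
  shows "indep (f ` I) ((`) f ` E)"
  unfolding indep_def
proof (intro ballI impI)
  fix x y assume "x \<in> f ` I" "y \<in> f ` I" "x \<noteq> y"
  then obtain a b where ab: "x = f a" "y = f b" "a \<in> I" "b \<in> I" "a \<noteq> b" by auto
  then have "{a, b} \<notin> E" using assms(4) by (auto simp: indep_def)
  with ab edge_image_iff[OF assms(1,2), of a b] assms(3) show "{x, y} \<notin> (`) f ` E" by auto
qed

text \<open>Inequalities are enough: used for a relabelling in either direction, they give the
  equalities of \<open>card_cographs_relabel\<close>.\<close>

lemma card_cographs_image_le:
  assumes "finite V" "inj_on f V" "I \<subseteq> V"
  shows "card (indep_cographs V I) \<le> card (indep_cographs (f ` V) (f ` I))"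
    and "card (conn_cographs V I) \<le> card (conn_cographs (f ` V) (f ` I))"
    and "card (coconn_cographs V I) \<le> card (coconn_cographs (f ` V) (f ` I))"
proof -
  note e = cograph_edges[of V]
  have inj: "inj_on ((`) ((`) f)) X" if "X \<subseteq> {E. cograph V E}" for X
  proof -
    have 1: "inj_on ((`) f) (Pow V)" using assms(2) by (rule inj_on_image_Pow)
    have "inj_on ((`) ((`) f)) (Pow (Pow V))" using 1 by (rule inj_on_image_Pow)
    moreover have "X \<subseteq> Pow (Pow V)" using that e by (fastforce simp: nsets_def)
    ultimately show ?thesis by (rule inj_on_subset)
  qed
  have fin: "finite (f ` V)" using assms(1) by simp
  have 1: "(`) ((`) f) ` indep_cographs V I \<subseteq> indep_cographs (f ` V) (f ` I)"
    using cograph_image[of V _ f] indep_image[OF assms(2) e assms(3)] assms(2)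
    by (auto simp: indep_cographs_def)
  show "card (indep_cographs V I) \<le> card (indep_cographs (f ` V) (f ` I))"
    by (rule card_inj_on_le[OF inj 1 finite_indep_cographs(1)[OF fin]]) (auto simp: indep_cographs_def)
  have 2: "(`) ((`) f) ` conn_cographs V I \<subseteq> conn_cographs (f ` V) (f ` I)"
    using 1 disconn_image_iff[OF assms(2) e] by (auto simp: conn_cographs_def indep_cographs_def)
  show "card (conn_cographs V I) \<le> card (conn_cographs (f ` V) (f ` I))"
    by (rule card_inj_on_le[OF inj 2 finite_indep_cographs(2)[OF fin]])
      (auto simp: indep_cographs_def conn_cographs_def)
  have 3: "(`) ((`) f) ` coconn_cographs V I \<subseteq> coconn_cographs (f ` V) (f ` I)"
    using 1 disconn_compl_image_iff[OF assms(2) e] by (auto simp: coconn_cographs_def indep_cographs_def)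
  show "card (coconn_cographs V I) \<le> card (coconn_cographs (f ` V) (f ` I))"
    by (rule card_inj_on_le[OF inj 3 finite_indep_cographs(3)[OF fin]])
      (auto simp: indep_cographs_def coconn_cographs_def)
qed

subsection \<open>Recurrences\<close>

text \<open>The arguments are the numbers of unmarked and of marked vertices, the latter being independent.\<close>

definition num_all :: "nat \<Rightarrow> nat \<Rightarrow> nat" where
  "num_all p q = card (indep_cographs {..<p + q} {..<q})"
definition num_conn :: "nat \<Rightarrow> nat \<Rightarrow> nat" where
  "num_conn p q = card (conn_cographs {..<p + q} {..<q})"
definition num_coconn :: "nat \<Rightarrow> nat \<Rightarrow> nat" where
  "num_coconn p q = card (coconn_cographs {..<p + q} {..<q})"

lemma exists_relabelling:
  fixes V I :: "'a set" and V' I' :: "'b set"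
  assumes "finite V" "I \<subseteq> V" "finite V'" "I' \<subseteq> V'" "card I = card I'" "card (V - I) = card (V' - I')"
  obtains f where "inj_on f V" "f ` V = V'" "f ` I = I'"
proof -
  have "finite I" "finite I'" using assms finite_subset by auto
  then obtain g where g: "bij_betw g I I'" using assms(5) by (metis finite_same_card_bij)
  obtain h where h: "bij_betw h (V - I) (V' - I')"
    using assms by (metis finite_Diff finite_same_card_bij)
  let ?f = "\<lambda>x. if x \<in> I then g x else h x"
  have "bij_betw ?f (I \<union> (V - I)) (I' \<union> (V' - I'))"
    by (rule bij_betw_disjoint_Un[OF g h]) auto
  moreover have "I \<union> (V - I) = V" "I' \<union> (V' - I') = V'" using assms by auto
  moreover have "?f ` I = I'" using g by (auto simp: bij_betw_def)
  ultimately show ?thesis using that[of ?f] by (simp only: bij_betw_def)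
qed

lemma card_cographs_relabel:
  fixes V I :: "nat set"
  assumes "finite V" "I \<subseteq> V"
  shows "card (indep_cographs V I) = num_all (card (V - I)) (card I)"
    and "card (conn_cographs V I) = num_conn (card (V - I)) (card I)"
    and "card (coconn_cographs V I) = num_coconn (card (V - I)) (card I)"
proof -
  define V' I' where "V' = {..<card (V - I) + card I}" and "I' = {..<card I}"
  have c: "card I = card I'" "card (V - I) = card (V' - I')"
    by (auto simp: I'_def V'_def card_Diff_subset)
  have fin: "finite V'" "I' \<subseteq> V'" by (auto simp: V'_def I'_def)
  obtain f where f: "inj_on f V" "f ` V = V'" "f ` I = I'"
    using exists_relabelling[OF assms fin c] .
  obtain g where g: "inj_on g V'" "g ` V' = V" "g ` I' = I"
    using exists_relabelling[OF fin assms c[symmetric]] .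
  note le = card_cographs_image_le[OF assms(1) f(1) assms(2), unfolded f]
    card_cographs_image_le[OF fin(1) g(1) fin(2), unfolded g]
  show "card (indep_cographs V I) = num_all (card (V - I)) (card I)"
    "card (conn_cographs V I) = num_conn (card (V - I)) (card I)"
    "card (coconn_cographs V I) = num_coconn (card (V - I)) (card I)"
    using le by (auto simp: num_all_def num_conn_def num_coconn_def V'_def I'_def)
qed

lemma sum_Pow_card:
  fixes g :: "nat \<Rightarrow> nat"
  assumes "finite A"
  shows "(\<Sum>S\<in>Pow A. g (card S)) = (\<Sum>i\<le>card A. (card A choose i) * g i)"
proof -
  have "(\<Sum>S\<in>Pow A. g (card S)) = (\<Sum>i\<le>card A. \<Sum>S | S \<in> Pow A \<and> card S = i. g (card S))"
    by (rule sum.group[symmetric]) (use assms card_mono in auto)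
  also have "\<dots> = (\<Sum>i\<le>card A. (card A choose i) * g i)"
    using n_subsets[OF assms] by (intro sum.cong refl) (simp add: Pow_def)
  finally show ?thesis .
qed

lemma sum_Pow_card2:
  fixes g :: "nat \<Rightarrow> nat \<Rightarrow> nat"
  assumes "finite A" "finite B"
  shows "(\<Sum>S\<in>Pow A. \<Sum>T\<in>Pow B. g (card S) (card T)) =
    (\<Sum>i\<le>card A. \<Sum>j\<le>card B. (card A choose i) * (card B choose j) * g i j)"
  using sum_Pow_card[OF assms(1), of "\<lambda>i. \<Sum>T\<in>Pow B. g i (card T)"]
  by (simp add: sum_Pow_card[OF assms(2)] sum_distrib_left mult.assoc)

lemma num_all_split: "num_all p q + (if p + q = 1 then 1 else 0) = num_conn p q + num_coconn p q"
  using card_indep_cographs_sum[of "{..<p + q}" "{..<q}"]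
  by (simp add: num_all_def num_conn_def num_coconn_def)

lemma num_coconn_0: "num_coconn p 0 = num_conn p 0"
  by (simp add: num_coconn_def num_conn_def card_coconn_eq_conn)

lemma num_all_0_0: "num_all 0 0 = 0"
  by (simp add: num_all_def indep_cographs_empty)

text \<open>The last vertex p is the root, and i counts the other vertices of its component. The
  term i = p vanishes by \<open>num_all_0_0\<close>.\<close>

lemma num_all_unmarked:
  "num_all (Suc p) 0 = num_conn (Suc p) 0 +
     (\<Sum>i\<le>p. (p choose i) * (num_conn (Suc i) 0 * num_all (p - i) 0))"
proof -
  define V v where "V = {..<Suc p}" and "v = p"
  have V: "finite V" "v \<in> V" by (auto simp: V_def v_def)
  have "num_all (Suc p) 0 = card (indep_cographs V {})"
    by (simp add: num_all_def V_def)
  also have "\<dots> = num_conn (Suc p) 0 +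
      (\<Sum>S | v \<in> S \<and> S \<subseteq> V. card (conn_cographs S {}) * card (indep_cographs (V - S) {}))"
    using card_indep_cographs_conn[OF V(1), of "{}"] card_disconn_indep_cographs[OF V, of "{}"]
    by (simp add: num_conn_def V_def)
  also have "(\<Sum>S | v \<in> S \<and> S \<subseteq> V. card (conn_cographs S {}) * card (indep_cographs (V - S) {})) =
      (\<Sum>S\<in>Pow {..<p}. num_conn (Suc (card S)) 0 * num_all (p - card S) 0)"
  proof (rule sum.reindex_bij_witness[where i = "insert v" and j = "\<lambda>S. S - {v}"])
    fix S assume S: "S \<in> {S. v \<in> S \<and> S \<subseteq> V}"
    then have fin: "finite S" and pos: "card S > 0" using V(1) finite_subset card_gt_0_iff by blast+
    have "card (V - S) = Suc p - card S" using S fin by (simp add: card_Diff_subset V_def)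
    with S fin pos card_cographs_relabel(1)[of "V - S" "{}"] card_cographs_relabel(2)[of S "{}"] V(1)
    show "num_conn (Suc (card (S - {v}))) 0 * num_all (p - card (S - {v})) 0 =
        card (conn_cographs S {}) * card (indep_cographs (V - S) {})"
      by (simp add: card_Diff_singleton_if)
  qed (auto simp: V_def v_def)
  also have "\<dots> = (\<Sum>i\<le>p. (p choose i) * (num_conn (Suc i) 0 * num_all (p - i) 0))"
    using sum_Pow_card[of "{..<p}" "\<lambda>i. num_conn (Suc i) 0 * num_all (p - i) 0"] by simp
  finally show ?thesis .
qed

text \<open>The root is a marked vertex; i and j count the unmarked and the other marked vertices of
  its component. For generating functions this is a derivative in the marking variable.\<close>

lemma num_all_marked_conn:
  "num_all p (Suc q) = num_conn p (Suc q) +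
     (\<Sum>i\<le>p. \<Sum>j\<le>q. (p choose i) * (q choose j) * (num_conn i (Suc j) * num_all (p - i) (q - j)))"
proof -
  define V I v where "V = {..<p + Suc q}" and "I = {..<Suc q}" and "v = q"
  define A B where "A = V - I" and "B = I - {v}"
  have V: "finite V" "v \<in> V" by (auto simp: V_def v_def)
  have AB: "finite A" "finite B" "A \<inter> B = {}" "v \<notin> A" "v \<notin> B" "A \<union> insert v B = V" "I = insert v B"
    by (auto simp: A_def B_def V_def I_def v_def)
  have cA: "card A = p" unfolding A_def V_def I_def by (subst card_Diff_subset) auto
  have cB: "card B = q" unfolding B_def I_def v_def by (simp add: card_Diff_singleton_if)
  have "num_all p (Suc q) = card (indep_cographs V I)"
    by (simp add: num_all_def V_def I_def)
  also have "\<dots> = num_conn p (Suc q) +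
      (\<Sum>S | v \<in> S \<and> S \<subseteq> V. card (conn_cographs S (I \<inter> S)) * card (indep_cographs (V - S) (I - S)))"
    using card_indep_cographs_conn[OF V(1), of I] card_disconn_indep_cographs[OF V, of I]
    by (simp add: num_conn_def V_def I_def)
  also have "(\<Sum>S | v \<in> S \<and> S \<subseteq> V. card (conn_cographs S (I \<inter> S)) * card (indep_cographs (V - S) (I - S))) =
      (\<Sum>(S, T)\<in>Pow A \<times> Pow B. num_conn (card S) (Suc (card T)) * num_all (p - card S) (q - card T))"
  proof (rule sum.reindex_bij_witness[where i = "\<lambda>(S, T). insert v (S \<union> T)" and j = "\<lambda>S. (S \<inter> A, S \<inter> B)"])
    fix S assume S: "S \<in> {S. v \<in> S \<and> S \<subseteq> V}"
    have fin: "finite (S \<inter> A)" "finite (S \<inter> B)" using AB by auto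
    have e: "S - (I \<inter> S) = S \<inter> A" "I \<inter> S = insert v (S \<inter> B)" "(V - S) - (I - S) = A - S \<inter> A" "I - S = B - S \<inter> B"
      using S AB by auto
    have c: "card (A - S \<inter> A) = p - card (S \<inter> A)" "card (B - S \<inter> B) = q - card (S \<inter> B)"
      "card (insert v (S \<inter> B)) = Suc (card (S \<inter> B))"
      using fin cA cB AB(5) by (simp_all add: card_Diff_subset)
    have "card (conn_cographs S (I \<inter> S)) = num_conn (card (S \<inter> A)) (Suc (card (S \<inter> B)))"
      using card_cographs_relabel(2)[of S "I \<inter> S"] S e c finite_subset[OF _ V(1)] by simp
    moreover have "card (indep_cographs (V - S) (I - S)) = num_all (p - card (S \<inter> A)) (q - card (S \<inter> B))"
    proof -
      have "I - S \<subseteq> V - S" by (auto simp: V_def I_def)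
      then show ?thesis using card_cographs_relabel(1)[of "V - S" "I - S"] V(1) e c by simp
    qed
    ultimately show "(case (S \<inter> A, S \<inter> B) of (S, T) \<Rightarrow>
        num_conn (card S) (Suc (card T)) * num_all (p - card S) (q - card T)) =
        card (conn_cographs S (I \<inter> S)) * card (indep_cographs (V - S) (I - S))" by simp
    show "(case (S \<inter> A, S \<inter> B) of (S, T) \<Rightarrow> insert v (S \<union> T)) = S" using S AB(6) by auto
    show "(S \<inter> A, S \<inter> B) \<in> Pow A \<times> Pow B" by auto
  next
    fix p assume "p \<in> Pow A \<times> Pow B"
    then obtain S T where p: "p = (S, T)" "S \<subseteq> A" "T \<subseteq> B" by auto
    show "((case p of (S, T) \<Rightarrow> insert v (S \<union> T)) \<inter> A, (case p of (S, T) \<Rightarrow> insert v (S \<union> T)) \<inter> B) = p"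
      using p AB(3,4,5) by auto
    show "(case p of (S, T) \<Rightarrow> insert v (S \<union> T)) \<in> {S. v \<in> S \<and> S \<subseteq> V}"
      using p unfolding AB(6)[symmetric] by auto
  qed
  also have "\<dots> = (\<Sum>i\<le>p. \<Sum>j\<le>q. (p choose i) * (q choose j) * (num_conn i (Suc j) * num_all (p - i) (q - j)))"
    using sum_Pow_card2[OF AB(1,2), of "\<lambda>i j. num_conn i (Suc j) * num_all (p - i) (q - j)"] cA cB
    by (simp add: sum.cartesian_product)
  finally show ?thesis .
qed

text \<open>All marked vertices share one co-component, so only the number i of its unmarked
  vertices varies and the rest carries no mark.\<close>

lemma num_all_marked_coconn:
  "num_all p (Suc q) = num_coconn p (Suc q) +
     (\<Sum>i\<le>p. (p choose i) * (num_coconn i (Suc q) * num_all (p - i) 0))"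
proof -
  define V I v where "V = {..<p + Suc q}" and "I = {..<Suc q}" and "v = q"
  define A where "A = V - I"
  have V: "finite V" "v \<in> I" "I \<subseteq> V" by (auto simp: V_def v_def I_def)
  have A: "finite A" "A \<inter> I = {}" "A \<union> I = V"
    using V by (auto simp: A_def)
  have cA: "card A = p" unfolding A_def V_def I_def by (subst card_Diff_subset) auto
  have cI: "card I = Suc q" by (simp add: I_def)
  have "num_all p (Suc q) = card (indep_cographs V I)"
    by (simp add: num_all_def V_def I_def)
  also have "\<dots> = num_coconn p (Suc q) +
      (\<Sum>S | I \<subseteq> S \<and> S \<subseteq> V. card (coconn_cographs S I) * card (indep_cographs (V - S) {}))"
    using card_indep_cographs_coconn[OF V(1), of I] card_disconn_compl_indep_cographs[OF V]
    by (simp add: num_coconn_def V_def I_def)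
  also have "(\<Sum>S | I \<subseteq> S \<and> S \<subseteq> V. card (coconn_cographs S I) * card (indep_cographs (V - S) {})) =
      (\<Sum>S\<in>Pow A. num_coconn (card S) (Suc q) * num_all (p - card S) 0)"
  proof (rule sum.reindex_bij_witness[where i = "\<lambda>S. S \<union> I" and j = "\<lambda>S. S - I"])
    fix S assume S: "S \<in> {S. I \<subseteq> S \<and> S \<subseteq> V}"
    then have fin: "finite S" using V(1) finite_subset by blast
    have "V - S = A - (S - I)" using S by (auto simp: A_def)
    moreover have "S - I \<subseteq> A" using S by (auto simp: A_def)
    ultimately have "card (V - S) = p - card (S - I)" using fin cA by (simp add: card_Diff_subset)
    with S fin card_cographs_relabel(1)[of "V - S" "{}"] card_cographs_relabel(3)[of S I] V(1) cI
    show "num_coconn (card (S - I)) (Suc q) * num_all (p - card (S - I)) 0 =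
        card (coconn_cographs S I) * card (indep_cographs (V - S) {})"
      by simp
  qed (use A in auto)
  also have "\<dots> = (\<Sum>i\<le>p. (p choose i) * (num_coconn i (Suc q) * num_all (p - i) 0))"
    using sum_Pow_card[OF A(1), of "\<lambda>i. num_coconn i (Suc q) * num_all (p - i) 0"] cA by simp
  finally show ?thesis .
qed

lemma num_conn_0_0: "num_conn 0 0 = 0" "num_coconn 0 0 = 0"
  using num_all_split[of 0 0] by (simp_all add: num_all_0_0)

text \<open>The sums over cographs and over k-subsets are exchanged; by relabelling, every k-subset
  is independent in equally many cographs.\<close>

lemma expected_indep_sets_eq:
  assumes "k \<le> n" "n \<ge> 1"
  shows "expected_indep_sets n k = real (n choose k) * real (num_all (n - k) k) / real (num_all n 0)"
proof -
  let ?V = "{1..n}"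
  have L: "labeled_cographs n = indep_cographs ?V {}"
    by (simp add: labeled_cographs_def indep_cographs_def)
  have cL: "card (labeled_cographs n) = num_all n 0"
    unfolding L using card_cographs_relabel(1)[of "{1..n}" "{}"] by simp
  have "(\<Sum>E\<in>labeled_cographs n. num_indep_sets ?V E k) =
      (\<Sum>E\<in>labeled_cographs n. \<Sum>I | I \<subseteq> ?V \<and> card I = k. if indep I E then 1 else 0)"
  proof (rule sum.cong[OF refl])
    fix E
    have "finite {I. I \<subseteq> ?V \<and> card I = k}" by (rule finite_subset[of _ "Pow ?V"]) auto
    moreover have "{I. I \<subseteq> ?V \<and> card I = k} \<inter> {I. indep I E} = {I. I \<subseteq> ?V \<and> card I = k \<and> indep I E}"
      by auto
    ultimately show "num_indep_sets ?V E k = (\<Sum>I | I \<subseteq> ?V \<and> card I = k. if indep I E then 1 else 0)"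
      by (simp add: num_indep_sets_def sum.If_cases)
  qed
  also have "\<dots> = (\<Sum>I | I \<subseteq> ?V \<and> card I = k. \<Sum>E\<in>labeled_cographs n. if indep I E then 1 else 0)"
    by (rule sum.swap)
  also have "\<dots> = (\<Sum>I | I \<subseteq> ?V \<and> card I = k. num_all (n - k) k)"
  proof (rule sum.cong[OF refl])
    fix I assume "I \<in> {I. I \<subseteq> ?V \<and> card I = k}"
    then have I: "I \<subseteq> ?V" "card I = k" by auto
    have "labeled_cographs n \<inter> {E. indep I E} = indep_cographs ?V I"
      by (auto simp: labeled_cographs_def indep_cographs_def)
    then have "(\<Sum>E\<in>labeled_cographs n. if indep I E then 1 else 0) = card (indep_cographs ?V I)"
      by (simp add: sum.If_cases finite_labeled_cographs)
    also have "\<dots> = num_all (n - k) k"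
      using card_cographs_relabel(1)[of ?V I] I by (simp add: card_Diff_subset finite_subset)
    finally show "(\<Sum>E\<in>labeled_cographs n. if indep I E then 1 else 0) = num_all (n - k) k" .
  qed
  also have "\<dots> = (n choose k) * num_all (n - k) k"
    using n_subsets[of ?V k] by simp
  finally have sum: "(\<Sum>E\<in>labeled_cographs n. num_indep_sets ?V E k) = (n choose k) * num_all (n - k) k" .
  have "expected_indep_sets n k =
      (\<Sum>E\<in>labeled_cographs n. real (num_indep_sets ?V E k)) / real (card (labeled_cographs n))"
    unfolding expected_indep_sets_def uniform_cograph_def
    by (rule integral_pmf_of_set) (use assms finite_labeled_cographs labeled_cographs_nonempty in auto)
  also have "(\<Sum>E\<in>labeled_cographs n. real (num_indep_sets ?V E k)) = real ((n choose k) * num_all (n - k) k)"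
    unfolding sum[symmetric] by simp
  finally show ?thesis by (simp add: cL)
qed

section \<open>Lagrange inversion\<close>

text \<open>In terms of residues, this is the residue of G^(j-p-1) G', an exact derivative unless j
  = p. To stay within power series, the proof puts m = p - j and V = 1 / U, strips the factor G^j,
  and rewrites m G' V^(m+1) as m V^m - X (V^m)', whose coefficient at m is zero.\<close>

lemma lagrange_aux:
  fixes U :: "'a :: field_char_0 fps"
  assumes "U $ 0 \<noteq> 0" "j \<le> p"
  defines "G \<equiv> fps_X * U"
  shows "(G ^ j * fps_deriv G * inverse U ^ Suc p) $ p = (if j = p then 1 else 0)"
proof -
  define V where "V = inverse U"
  have UV: "U * V = 1" using assms(1) by (simp add: V_def inverse_mult_eq_1')
  define m where "m = p - j"
  have p: "p = j + m" using assms(2) by (simp add: m_def)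
  have pow: "U ^ j * V ^ j = 1" using UV by (metis power_mult_distrib power_one)
  have "G ^ j * fps_deriv G * V ^ Suc p = fps_X ^ j * (U ^ j * V ^ j) * (fps_deriv G * V ^ Suc m)"
    by (simp add: p G_def power_mult_distrib power_add mult_ac)
  also have "\<dots> = fps_X ^ j * (fps_deriv G * V ^ Suc m)"
    by (simp add: pow)
  finally have *: "(G ^ j * fps_deriv G * V ^ Suc p) $ p = (fps_deriv G * V ^ Suc m) $ m"
    by (simp only: p fps_X_power_mult_nth) simp
  have G': "fps_deriv G = U + fps_X * fps_deriv U"
    by (simp add: G_def)
  show ?thesis
  proof (cases m)
    case 0
    have "U $ 0 * V $ 0 = 1" using UV by (metis fps_mult_nth_0 fps_one_nth)
    with 0 p * show ?thesis by (simp add: G' V_def)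
  next
    case (Suc n)
    have V': "fps_deriv V = - fps_deriv U * V\<^sup>2"
      unfolding V_def by (rule fps_inverse_deriv) (use assms in auto)
    have "of_nat m * (fps_deriv G * V ^ Suc m) = of_nat m * (U * V) * V ^ m + of_nat m * fps_X * fps_deriv U * V ^ Suc m"
      by (simp add: G' algebra_simps)
    also have "\<dots> = of_nat m * V ^ m - fps_X * fps_deriv (V ^ m)"
    proof -
      have "fps_deriv (V ^ m) = of_nat m * fps_deriv V * V ^ n"
        using fps_deriv_power[of V m] Suc by (simp add: fps_of_nat del: of_nat_Suc fps_deriv_power)
      then show ?thesis by (simp add: UV V' Suc power2_eq_square mult_ac del: of_nat_Suc)
    qed
    finally have "(of_nat m * (fps_deriv G * V ^ Suc m)) $ m = (of_nat m * V ^ m - fps_X * fps_deriv (V ^ m)) $ m"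
      by simp
    moreover have "(of_nat m * F) $ m = of_nat m * F $ m" "(fps_X * fps_deriv F) $ m = of_nat m * F $ m"
      for F :: "'a fps"
      by (simp flip: fps_of_nat, cases m) simp_all
    ultimately have "of_nat m * (fps_deriv G * V ^ Suc m) $ m = 0"
      by (simp only: fps_sub_nth diff_self)
    then have "(fps_deriv G * V ^ Suc m) $ m = 0" using Suc by (simp del: of_nat_Suc power_Suc)
    with * Suc p show ?thesis by (simp add: V_def)
  qed
qed

text \<open>By linearity in h this reduces to powers of G = X U; exponents above p do not
  contribute, as G^j has no terms below degree j.\<close>

theorem lagrange_coeff:
  fixes U h :: "'a :: field_char_0 fps"
  assumes "U $ 0 \<noteq> 0"
  shows "((h oo (fps_X * U)) * fps_deriv (fps_X * U) * inverse U ^ Suc p) $ p = h $ p"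
proof -
  define G where "G = fps_X * U"
  define F where "F = fps_deriv G * inverse U ^ Suc p"
  have G0: "(G ^ j) $ i = 0" if "i < j" for i j
    using that by (simp add: G_def power_mult_distrib fps_X_power_mult_nth)
  have "((h oo G) * F) $ p = (\<Sum>i=0..p. \<Sum>j=0..i. h $ j * (G ^ j $ i) * F $ (p - i))"
    by (simp add: fps_mult_nth fps_compose_nth sum_distrib_right)
  also have "\<dots> = (\<Sum>i=0..p. \<Sum>j=0..p. h $ j * (G ^ j $ i) * F $ (p - i))"
    by (intro sum.cong refl sum.mono_neutral_left) (auto simp: G0)
  also have "\<dots> = (\<Sum>j=0..p. h $ j * (\<Sum>i=0..p. (G ^ j $ i) * F $ (p - i)))"
    by (subst sum.swap) (simp add: sum_distrib_left mult.assoc)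
  also have "\<dots> = (\<Sum>j=0..p. h $ j * (G ^ j * F) $ p)"
    by (simp add: fps_mult_nth)
  also have "\<dots> = (\<Sum>j=0..p. h $ j * (if j = p then 1 else 0))"
    using lagrange_aux[OF assms] by (intro sum.cong refl) (simp add: F_def G_def mult.assoc)
  also have "\<dots> = h $ p" by (simp add: sum.delta if_distrib[of "\<lambda>x. _ * x"] cong: if_cong)
  finally show ?thesis by (simp add: F_def G_def mult.assoc)
qed

lemma fps_inverse_compose_sym:
  fixes G N :: "'a :: field_char_0 fps"
  assumes "G $ 0 = 0" "G $ 1 \<noteq> 0" "N $ 0 = 0" "G oo N = fps_X"
  shows "N oo G = fps_X"
proof -
  have "N = (fps_inv G oo G) oo N"
    using assms by (simp add: fps_inv fps_X_fps_compose_startby0)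
  also have "\<dots> = fps_inv G oo (G oo N)"
    by (rule fps_compose_assoc[symmetric]) (use assms in auto)
  also have "\<dots> = fps_inv G" unfolding assms(4) by simp
  finally show ?thesis using assms fps_inv by simp
qed

text \<open>The coefficient form is applied to the derivative of \<open>f oo N\<close>; the chain
  rule then absorbs the factor G', which therefore is absent from the result.\<close>

theorem lagrange_inversion:
  fixes U N f :: "'a :: field_char_0 fps"
  assumes "U $ 0 \<noteq> 0" "N $ 0 = 0" "(fps_X * U) oo N = fps_X"
  shows "of_nat (Suc q) * (f oo N) $ Suc q = (fps_deriv f * inverse U ^ Suc q) $ q"
proof -
  define G where "G = fps_X * U"
  have G: "G $ 0 = 0" "G $ 1 \<noteq> 0" using assms(1) by (auto simp: G_def)
  have NG: "N oo G = fps_X"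
    by (rule fps_inverse_compose_sym) (use G assms in \<open>auto simp: G_def\<close>)
  define h where "h = f oo N"
  have hG: "h oo G = f"
    unfolding h_def using assms(2) G by (simp add: fps_compose_assoc[symmetric] NG)
  have "of_nat (Suc q) * h $ Suc q = fps_deriv h $ q" by simp
  also have "\<dots> = ((fps_deriv h oo G) * fps_deriv G * inverse U ^ Suc q) $ q"
    unfolding G_def by (rule lagrange_coeff[symmetric]) (rule assms)
  also have "(fps_deriv h oo G) * fps_deriv G = fps_deriv f"
    using fps_compose_deriv[OF G(1), of h] hG by simp
  finally show ?thesis by (simp add: h_def)
qed

section \<open>The generating functions\<close>

text \<open>\<open>(exp x - 1) / x\<close>\<close>

definition exp_quot_fps :: "complex fps" where
  "exp_quot_fps = Abs_fps (\<lambda>n. 1 / fact (Suc n))"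

lemma X_mult_exp_quot_fps: "fps_X * exp_quot_fps = fps_exp 1 - 1"
proof (rule fps_ext)
  fix n show "(fps_X * exp_quot_fps) $ n = (fps_exp 1 - 1) $ n"
    by (cases n) (simp_all add: exp_quot_fps_def field_simps)
qed

lemma exp_quot_fps_0: "exp_quot_fps $ 0 = 1"
  by (simp add: exp_quot_fps_def)

text \<open>By Lagrange inversion, \<open>mark_coeff q w\<close> is the coefficient of \<open>v\<^sup>q\<close> in \<open>exp x - 1\<close>, where
  \<open>v = x - w (exp x - 1)\<close>. This series satisfies \<open>y' = (1 + y) (1 + w y')\<close>, whose coefficientwise form
  is the recurrence \<open>mark_rec\<close>. The point of the recurrence is that it makes sense both for numbers \<open>w\<close>
  and for power series \<open>w\<close>, without any bivariate series.\<close>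

definition mark_coeff :: "nat \<Rightarrow> complex \<Rightarrow> complex" where
  "mark_coeff q w = (case q of 0 \<Rightarrow> 0 | Suc r \<Rightarrow>
     (fps_exp 1 * inverse (1 - fps_const w * exp_quot_fps) ^ q) $ r / of_nat q)"

definition mark_rec :: "'a :: comm_ring_1 \<Rightarrow> (nat \<Rightarrow> 'a) \<Rightarrow> bool" where
  "mark_rec w y \<longleftrightarrow> y 0 = 0 \<and> (\<forall>q. (1 - w) * of_nat (Suc q) * y (Suc q) = (if q = 0 then 1 else 0) +
     (\<Sum>i=1..q. y i * ((if i = q then 1 else 0) + w * of_nat (Suc (q - i)) * y (Suc (q - i)))))"

text \<open>The hypothesis is the coefficient form of Y' = (1 + Y) (1 + w Y'). Its summand i = 0
  contains \<open>y (Suc q)\<close> itself; moved to the left, it produces the factor 1 - w.\<close>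

lemma mark_recI:
  fixes w :: "'a :: comm_ring_1"
  assumes "y 0 = 0"
    and "\<And>q. of_nat (Suc q) * y (Suc q) = (\<Sum>i\<le>q. ((if i = 0 then 1 else 0) + y i) *
           ((if i = q then 1 else 0) + w * of_nat (Suc (q - i)) * y (Suc (q - i))))"
  shows "mark_rec w y"
  unfolding mark_rec_def
proof (intro conjI allI)
  fix q
  have "of_nat (Suc q) * y (Suc q) = ((if 0 = q then 1 else 0) + w * of_nat (Suc q) * y (Suc q)) +
      (\<Sum>i=1..q. ((if i = 0 then 1 else 0) + y i) *
         ((if i = q then 1 else 0) + w * of_nat (Suc (q - i)) * y (Suc (q - i))))"
    unfolding assms(2)
    by (subst atLeast0AtMost[symmetric], subst sum.atLeast_Suc_atMost) (simp_all add: assms(1))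
  also have "(\<Sum>i=1..q. ((if i = 0 then 1 else 0) + y i) *
         ((if i = q then 1 else 0) + w * of_nat (Suc (q - i)) * y (Suc (q - i)))) =
      (\<Sum>i=1..q. y i * ((if i = q then 1 else 0) + w * of_nat (Suc (q - i)) * y (Suc (q - i))))"
    by (intro sum.cong) auto
  finally have *: "of_nat (Suc q) * y (Suc q) = ((if q = 0 then 1 else 0) + w * of_nat (Suc q) * y (Suc q)) +
      (\<Sum>i=1..q. y i * ((if i = q then 1 else 0) + w * of_nat (Suc (q - i)) * y (Suc (q - i))))"
    by (simp only: eq_commute)
  have "a - b = d + S" if "a = (d + b) + S" for a b d S :: 'a using that by simp
  note this[OF *]
  moreover have "(1 - w) * of_nat (Suc q) * y (Suc q) = of_nat (Suc q) * y (Suc q) - w * of_nat (Suc q) * y (Suc q)"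
    by (simp only: left_diff_distrib mult_1_left)
  ultimately show "(1 - w) * of_nat (Suc q) * y (Suc q) = (if q = 0 then 1 else 0) +
     (\<Sum>i=1..q. y i * ((if i = q then 1 else 0) + w * of_nat (Suc (q - i)) * y (Suc (q - i))))"
    by simp
qed (rule assms(1))

text \<open>The inverse series N of x - w (exp x - 1) satisfies N = v + w Y and 1 + Y = exp N.
  Differentiating the latter gives the differential equation, and Lagrange inversion identifies the
  coefficients of Y.\<close>

lemma mark_rec_mark_coeff:
  assumes "w \<noteq> 1"
  shows "mark_rec w (\<lambda>q. mark_coeff q w)"
proof -
  define U where "U = 1 - fps_const w * exp_quot_fps"
  define G where "G = fps_X * U"
  have U0: "U $ 0 \<noteq> 0" using assms by (simp add: U_def exp_quot_fps_0)
  have G0: "G $ 0 = 0" "G $ 1 \<noteq> 0" using U0 by (auto simp: G_def)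
  define N where "N = fps_inv G"
  have N0: "N $ 0 = 0" by (simp add: N_def fps_inv_def)
  have GN: "G oo N = fps_X" unfolding N_def by (rule fps_inv_right) (use G0 in auto)
  define Y where "Y = (fps_exp 1 - 1) oo N"
  have Y0: "Y $ 0 = 0" by (simp add: Y_def)
  have "fps_X - fps_const w * (fps_exp 1 - 1) = G"
    by (simp add: G_def U_def X_mult_exp_quot_fps[symmetric] algebra_simps)
  then have "N - fps_const w * Y = fps_X"
    using GN by (simp add: Y_def fps_compose_sub_distrib fps_compose_mult_distrib[OF N0] N0
        flip: \<open>_ = G\<close>)
  then have N: "N = fps_X + fps_const w * Y" by (simp add: algebra_simps)
  have Y1: "1 + Y = fps_exp 1 oo N" by (simp add: Y_def fps_compose_sub_distrib)
  have dN: "fps_deriv N = 1 + fps_const w * fps_deriv Y" by (subst N) simp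
  have "fps_deriv (1 + Y) = (fps_exp 1 oo N) * fps_deriv N"
    unfolding Y1 by (subst fps_compose_deriv[OF N0]) simp
  then have ode: "fps_deriv Y = (1 + Y) * (1 + fps_const w * fps_deriv Y)"
    unfolding Y1[symmetric] dN by simp
  have coeff: "mark_coeff q w = Y $ q" for q
  proof (cases q)
    case (Suc r)
    have "of_nat (Suc r) * Y $ Suc r = (fps_deriv (fps_exp 1 - 1) * inverse U ^ Suc r) $ r"
      unfolding Y_def by (rule lagrange_inversion[OF U0 N0]) (use GN in \<open>simp add: G_def\<close>)
    then show ?thesis using Suc by (simp add: mark_coeff_def U_def field_simps del: of_nat_Suc power_Suc)
  qed (simp add: mark_coeff_def Y0)
  show ?thesis
    unfolding coeff
  proof (rule mark_recI)
    fix q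
    have "of_nat (Suc q) * Y $ Suc q = fps_deriv Y $ q" by simp
    also have "\<dots> = (\<Sum>i\<le>q. (1 + Y) $ i * (1 + fps_const w * fps_deriv Y) $ (q - i))"
      by (subst ode) (simp add: fps_mult_nth atLeast0AtMost)
    also have "\<dots> = (\<Sum>i\<le>q. ((if i = 0 then 1 else 0) + Y $ i) *
           ((if i = q then 1 else 0) + w * of_nat (Suc (q - i)) * Y $ Suc (q - i)))"
      by (intro sum.cong refl) (auto simp: mult.assoc)
    finally show "of_nat (Suc q) * Y $ Suc q = (\<Sum>i\<le>q. ((if i = 0 then 1 else 0) + Y $ i) *
           ((if i = q then 1 else 0) + w * of_nat (Suc (q - i)) * Y $ Suc (q - i)))" .
  qed (rule Y0)
qed

text \<open>Exhibits the coefficients recursively as rational functions of w whose only possible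
  pole is 1. Expansions and holomorphy are derived from this.\<close>

lemma mark_coeff_Suc_eq:
  assumes "w \<noteq> 1"
  shows "mark_coeff (Suc q) w = ((if q = 0 then 1 else 0) + (\<Sum>i=1..q. mark_coeff i w *
     ((if i = q then 1 else 0) + w * of_nat (Suc (q - i)) * mark_coeff (Suc (q - i)) w))) /
     ((1 - w) * of_nat (Suc q))"
  using mark_rec_mark_coeff[OF assms] assms
  unfolding mark_rec_def by (simp add: field_simps del: of_nat_Suc)

text \<open>Once 1 - W is a unit, the recurrence determines y: each term arises from earlier ones by
  ring operations and division by 1 - W. Expansions respect these operations, so strong induction
  transfers the recurrence from numbers to series.\<close>

lemma mark_coeff_has_fps_expansion:
  fixes W :: "complex fps"
  assumes "mark_rec W y" "f has_fps_expansion W" "W $ 0 \<noteq> 1"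
  shows "(\<lambda>t. mark_coeff q (f t)) has_fps_expansion y q"
proof (induction q rule: less_induct)
  case (less q)
  show ?case
  proof (cases q)
    case 0
    then show ?thesis using assms(1) by (simp add: mark_rec_def mark_coeff_def)
  next
    case (Suc r)
    have "f 0 = W $ 0" using has_fps_expansion_imp_0_eq_fps_nth_0[OF assms(2)] .
    with assms(3) have "f 0 \<noteq> 1" by simp
    moreover have "isCont f 0" using has_fps_expansion_imp_continuous[OF assms(2)] by (simp add: continuous_at_imp_continuous_at_within)
    ultimately have ev: "\<forall>\<^sub>F t in nhds 0. f t \<noteq> 1"
      by (metis isCont_def tendsto_imp_eventually_ne tendsto_at_iff_tendsto_nhds)
    define F where "F = (if r = 0 then 1 else 0) + (\<Sum>i=1..r. y i *
       ((if i = r then 1 else 0) + W * of_nat (Suc (r - i)) * y (Suc (r - i))))"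
    have rec: "(1 - W) * of_nat (Suc r) * y q = F"
      using assms(1) unfolding mark_rec_def F_def Suc by blast
    have unit: "((1 - W) * of_nat (Suc r)) $ 0 \<noteq> 0"
      using assms(3) by (simp add: fps_of_nat[symmetric] del: of_nat_Suc)
    have "y q = F * inverse ((1 - W) * of_nat (Suc r))"
      unfolding rec[symmetric] using inverse_mult_eq_1'[OF unit]
      by (metis (no_types, lifting) mult.assoc mult.commute mult.right_neutral)
    moreover have "(\<lambda>t. ((if r = 0 then 1 else 0) + (\<Sum>i=1..r. mark_coeff i (f t) *
       ((if i = r then 1 else 0) + f t * of_nat (Suc (r - i)) * mark_coeff (Suc (r - i)) (f t)))) *
       inverse ((1 - f t) * of_nat (Suc r))) has_fps_expansion F * inverse ((1 - W) * of_nat (Suc r))"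
    proof -
      have c: "(\<lambda>_. of_nat n) has_fps_expansion (of_nat n :: complex fps)" for n
        by (simp add: fps_of_nat[symmetric])
      have i: "(\<lambda>_. if P then 1 else 0) has_fps_expansion (if P then 1 else 0 :: complex fps)" for P
        by simp
      show ?thesis unfolding F_def
        by (intro has_fps_expansion_mult has_fps_expansion_add has_fps_expansion_sum has_fps_expansion_inverse
            has_fps_expansion_diff has_fps_expansion_1 assms(2) c i less.IH unit) (use Suc in auto)
    qed
    ultimately have "(\<lambda>t. ((if r = 0 then 1 else 0) + (\<Sum>i=1..r. mark_coeff i (f t) *
       ((if i = r then 1 else 0) + f t * of_nat (Suc (r - i)) * mark_coeff (Suc (r - i)) (f t)))) *
       inverse ((1 - f t) * of_nat (Suc r))) has_fps_expansion y q" by simp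
    moreover have "\<forall>\<^sub>F t in nhds 0. ((if r = 0 then 1 else 0) + (\<Sum>i=1..r. mark_coeff i (f t) *
       ((if i = r then 1 else 0) + f t * of_nat (Suc (r - i)) * mark_coeff (Suc (r - i)) (f t)))) *
       inverse ((1 - f t) * of_nat (Suc r)) = mark_coeff q (f t)"
      unfolding Suc using ev by eventually_elim (subst mark_coeff_Suc_eq; simp only: divide_inverse not_False_eq_True)
    ultimately show ?thesis using has_fps_expansion_cong by fast
  qed
qed

lemma mark_coeff_holomorphic:
  assumes "f holomorphic_on S" "\<And>t. t \<in> S \<Longrightarrow> f t \<noteq> 1"
  shows "(\<lambda>t. mark_coeff q (f t)) holomorphic_on S"
proof (induction q rule: less_induct)
  case (less q)
  show ?case
  proof (cases q)
    case 0
    then show ?thesis by (simp add: mark_coeff_def)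
  next
    case (Suc r)
    have "(\<lambda>t. ((if r = 0 then 1 else 0) + (\<Sum>i=1..r. mark_coeff i (f t) *
       ((if i = r then 1 else 0) + f t * of_nat (Suc (r - i)) * mark_coeff (Suc (r - i)) (f t)))) /
       ((1 - f t) * of_nat (Suc r))) holomorphic_on S"
      by (intro holomorphic_intros less.IH assms(1))
        (use Suc assms(2) in \<open>auto simp del: of_nat_Suc\<close>)
    then show ?thesis
      unfolding Suc
      by (rule holomorphic_transform) (subst mark_coeff_Suc_eq[OF assms(2)]; simp)
  qed
qed

section \<open>Exponential generating functions in the unmarked variable, one for each number of
  marks\<close>

definition egf_all :: "nat \<Rightarrow> complex fps" where
  "egf_all q = Abs_fps (\<lambda>p. of_nat (num_all p q) / (fact p * fact q))"
definition egf_conn :: "nat \<Rightarrow> complex fps" where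
  "egf_conn q = Abs_fps (\<lambda>p. of_nat (num_conn p q) / (fact p * fact q))"
definition egf_coconn :: "nat \<Rightarrow> complex fps" where
  "egf_coconn q = Abs_fps (\<lambda>p. of_nat (num_coconn p q) / (fact p * fact q))"

text \<open>The correction is the single vertex, which is both connected and co-connected: the
  series x if it is unmarked, the constant 1 at q = 1 if it is marked.\<close>

lemma egf_split:
  "egf_all q + (if q = 0 then fps_X else if q = 1 then 1 else 0) = egf_conn q + egf_coconn q"
proof (rule fps_ext)
  fix p
  have "(of_nat (num_all p q) + (if p + q = 1 then 1 else 0 :: complex)) = of_nat (num_conn p q) + of_nat (num_coconn p q)"
    using arg_cong[OF num_all_split[of p q], of "of_nat :: nat \<Rightarrow> complex"] by (auto split: if_splits)
  then have "(of_nat (num_all p q) + (if p + q = 1 then 1 else 0 :: complex)) / (fact p * fact q) =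
      of_nat (num_conn p q) / (fact p * fact q) + of_nat (num_coconn p q) / (fact p * fact q)"
    by (simp add: add_divide_distrib)
  then show "(egf_all q + (if q = 0 then fps_X else if q = 1 then 1 else 0)) $ p = (egf_conn q + egf_coconn q) $ p"
    by (cases "p = 0"; cases "q = 0"; cases "p = 1"; cases "q = 1")
      (simp_all add: egf_all_def egf_conn_def egf_coconn_def)
qed

lemma egf_coconn_0: "egf_coconn 0 = egf_conn 0"
  by (simp add: egf_coconn_def egf_conn_def num_coconn_0)

text \<open>The derivative distinguishes a root vertex: its component is a rooted connected cograph,
  and the rest is arbitrary or, for the summand 1, empty.\<close>

lemma deriv_egf_all_0: "fps_deriv (egf_all 0) = fps_deriv (egf_conn 0) * (1 + egf_all 0)"
proof (rule fps_ext)
  fix p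
  have A: "fps_deriv (egf_all 0) $ p = of_nat (num_all (Suc p) 0) / fact p"
    by (simp add: egf_all_def field_simps del: of_nat_Suc)
  have C: "fps_deriv (egf_conn 0) $ i = of_nat (num_conn (Suc i) 0) / fact i" for i
    by (simp add: egf_conn_def field_simps del: of_nat_Suc)
  have "of_nat (num_all (Suc p) 0) / (fact p :: complex) = of_nat (num_conn (Suc p) 0) / fact p +
      (\<Sum>i\<le>p. of_nat (p choose i) * of_nat (num_conn (Suc i) 0) * of_nat (num_all (p - i) 0) / fact p)"
    unfolding num_all_unmarked by (simp add: add_divide_distrib sum_divide_distrib mult.assoc)
  also have "(\<Sum>i\<le>p. of_nat (p choose i) * of_nat (num_conn (Suc i) 0) * of_nat (num_all (p - i) 0) / (fact p :: complex)) =
      (\<Sum>i\<le>p. fps_deriv (egf_conn 0) $ i * egf_all 0 $ (p - i))"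
    unfolding C by (intro sum.cong refl) (simp add: egf_all_def binomial_fact field_simps)
  finally show "fps_deriv (egf_all 0) $ p = (fps_deriv (egf_conn 0) * (1 + egf_all 0)) $ p"
    by (simp only: A distrib_left mult_1_right fps_add_nth C fps_mult_nth atLeast0AtMost)
qed

lemma egf_all_Suc_conn:
  "of_nat (Suc q) * egf_all (Suc q) = of_nat (Suc q) * egf_conn (Suc q) +
     (\<Sum>j\<le>q. of_nat (Suc j) * egf_conn (Suc j) * egf_all (q - j))"
proof (rule fps_ext)
  fix p
  have n: "(of_nat n * F) $ i = of_nat n * F $ i" for n i and F :: "complex fps"
    by (simp flip: fps_of_nat)
  have f: "of_nat (Suc j) * (of_nat a / (fact i * fact (Suc j))) = (of_nat a / (fact i * fact j) :: complex)" for i j a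
    by (simp add: field_simps del: of_nat_Suc)
  have "(of_nat (Suc q) * egf_all (Suc q)) $ p = of_nat (num_all p (Suc q)) / (fact p * fact q)"
    unfolding n egf_all_def fps_nth_Abs_fps f ..
  also have "\<dots> = of_nat (num_conn p (Suc q)) / (fact p * fact q) +
     (\<Sum>i\<le>p. \<Sum>j\<le>q. of_nat (p choose i) * of_nat (q choose j) *
        (of_nat (num_conn i (Suc j)) * of_nat (num_all (p - i) (q - j))) / (fact p * fact q))"
    unfolding num_all_marked_conn by (simp add: add_divide_distrib sum_divide_distrib)
  also have "of_nat (num_conn p (Suc q)) / (fact p * fact q) = (of_nat (Suc q) * egf_conn (Suc q)) $ p"
    unfolding n egf_conn_def fps_nth_Abs_fps f ..
  also have "(\<Sum>i\<le>p. \<Sum>j\<le>q. of_nat (p choose i) * of_nat (q choose j) *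
        (of_nat (num_conn i (Suc j)) * of_nat (num_all (p - i) (q - j))) / (fact p * fact q)) =
      (\<Sum>i\<le>p. \<Sum>j\<le>q. (of_nat (Suc j) * egf_conn (Suc j)) $ i * egf_all (q - j) $ (p - i))"
    unfolding n egf_conn_def egf_all_def fps_nth_Abs_fps f
    by (intro sum.cong refl) (simp add: binomial_fact field_simps)
  also have "\<dots> = (\<Sum>j\<le>q. of_nat (Suc j) * egf_conn (Suc j) * egf_all (q - j)) $ p"
    by (subst sum.swap) (simp add: fps_sum_nth fps_mult_nth[of "of_nat _ * _"] atLeast0AtMost del: of_nat_Suc)
  finally show "(of_nat (Suc q) * egf_all (Suc q)) $ p = (of_nat (Suc q) * egf_conn (Suc q) +
     (\<Sum>j\<le>q. of_nat (Suc j) * egf_conn (Suc j) * egf_all (q - j))) $ p"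
    by (simp only: fps_add_nth)
qed

lemma egf_all_Suc_coconn: "egf_all (Suc q) = (1 + egf_all 0) * egf_coconn (Suc q)"
proof (rule fps_ext)
  fix p
  have "egf_all (Suc q) $ p = egf_coconn (Suc q) $ p +
     (\<Sum>i\<le>p. of_nat (p choose i) * (of_nat (num_coconn i (Suc q)) * of_nat (num_all (p - i) 0)) / (fact p * fact (Suc q)))"
    unfolding egf_all_def egf_coconn_def fps_nth_Abs_fps num_all_marked_coconn
    by (simp add: add_divide_distrib sum_divide_distrib del: fact_Suc)
  also have "(\<Sum>i\<le>p. of_nat (p choose i) * (of_nat (num_coconn i (Suc q)) * of_nat (num_all (p - i) 0)) / (fact p * fact (Suc q))) =
      (\<Sum>i\<le>p. egf_coconn (Suc q) $ i * egf_all 0 $ (p - i))"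
    by (intro sum.cong refl) (simp add: egf_coconn_def egf_all_def binomial_fact field_simps del: fact_Suc)
  finally show "egf_all (Suc q) $ p = ((1 + egf_all 0) * egf_coconn (Suc q)) $ p"
    by (simp add: distrib_right mult.commute[of "egf_all 0"] fps_mult_nth atLeast0AtMost)
qed

text \<open>The series of z, which turns out to be the compositional inverse of the connected series
  \<open>egf_conn 0\<close>. The product form is the one that Lagrange inversion expects.\<close>

definition cotree_fps :: "complex fps" where
  "cotree_fps = fps_X * (2 - exp_quot_fps)"

lemma cotree_fps_eq: "cotree_fps = 2 * fps_X + 1 - fps_exp 1"
  using X_mult_exp_quot_fps by (simp add: cotree_fps_def algebra_simps)

lemma cotree_fps_0: "cotree_fps $ 0 = 0" "(2 - exp_quot_fps) $ 0 \<noteq> 0"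
  by (simp_all add: cotree_fps_def exp_quot_fps_0)

lemma egf_conn_0_nth_0: "egf_conn 0 $ 0 = 0" "egf_all 0 $ 0 = 0"
  by (simp_all add: egf_conn_def egf_all_def num_conn_0_0 num_all_0_0)

text \<open>With W for all and T for connected cographs, (1 + W) exp (-T) has derivative zero and
  constant term 1.\<close>

lemma egf_all_0_eq: "1 + egf_all 0 = fps_exp 1 oo egf_conn 0"
proof -
  define T W where "T = egf_conn 0" and "W = egf_all 0"
  have T0: "T $ 0 = 0" by (simp add: T_def egf_conn_0_nth_0)
  define E where "E = fps_exp (-1) oo T"
  have dE: "fps_deriv E = - E * fps_deriv T"
    unfolding E_def by (subst fps_compose_deriv[OF T0]) (simp add: fps_compose_uminus flip: fps_const_neg)
  have "fps_deriv ((1 + W) * E) = fps_deriv W * E + (1 + W) * fps_deriv E" by (simp add: algebra_simps)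
  also have "\<dots> = 0" unfolding dE using deriv_egf_all_0 by (simp add: W_def T_def algebra_simps)
  finally have "(1 + W) * E = fps_const (((1 + W) * E) $ 0)" using fps_deriv_eq_0_iff by blast
  also have "((1 + W) * E) $ 0 = 1" by (simp add: W_def E_def egf_conn_0_nth_0)
  finally have "(1 + W) * E = 1" by simp
  moreover have "(fps_exp 1 oo T) * E = 1"
    unfolding E_def by (simp add: fps_compose_mult_distrib[OF T0, symmetric] fps_exp_add_mult[symmetric])
  ultimately show ?thesis unfolding W_def[symmetric] T_def[symmetric]
    by (metis mult.commute mult.left_commute mult.right_neutral)
qed

lemma egf_conn_eq: "2 * egf_conn 0 = egf_all 0 + fps_X"
  using egf_split[of 0] by (simp add: egf_coconn_0)

lemma cotree_fps_egf_conn: "cotree_fps oo egf_conn 0 = fps_X"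
proof -
  have "cotree_fps oo egf_conn 0 = 2 * egf_conn 0 + 1 - (1 + egf_all 0)"
    unfolding egf_all_0_eq cotree_fps_eq
    by (simp add: fps_compose_add_distrib fps_compose_sub_distrib fps_compose_mult_distrib
        fps_X_fps_compose_startby0 egf_conn_0_nth_0)
  then show ?thesis by (simp add: egf_conn_eq)
qed

lemma egf_conn_cotree_fps: "egf_conn 0 oo cotree_fps = fps_X"
proof (rule fps_inverse_compose_sym[OF cotree_fps_0(1) _ _ cotree_fps_egf_conn])
  show "cotree_fps $ 1 \<noteq> 0" by (simp add: cotree_fps_def exp_quot_fps_0)
qed (simp add: egf_conn_0_nth_0)

lemma egf_all_0_cotree_fps: "egf_all 0 oo cotree_fps = fps_exp 1 - 1"
proof -
  have "(1 + egf_all 0) oo cotree_fps = fps_exp 1 oo (egf_conn 0 oo cotree_fps)"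
    unfolding egf_all_0_eq by (rule fps_compose_assoc[symmetric]) (simp_all add: cotree_fps_0 egf_conn_0_nth_0)
  then show ?thesis by (simp add: egf_conn_cotree_fps fps_compose_add_distrib algebra_simps)
qed

text \<open>For n \<ge> 2 this is twice the connected count, since 2 T = W + x. Inverting T itself
  leaves the weight 1, whereas the weight 2 - exp t of \<open>num_all_marked_eq\<close> would vanish
  at the saddle point ln 2.\<close>

theorem num_all_unmarked_eq:
  assumes "n \<ge> 2"
  shows "complex_of_nat (num_all n 0) = 2 * fact n / of_nat n * (inverse (2 - exp_quot_fps) ^ n) $ (n - 1)"
proof -
  have "of_nat (Suc (n - 1)) * (fps_X oo egf_conn 0) $ Suc (n - 1) =
      (fps_deriv fps_X * inverse (2 - exp_quot_fps) ^ Suc (n - 1)) $ (n - 1)"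
    by (rule lagrange_inversion)
      (use cotree_fps_egf_conn in \<open>simp_all add: exp_quot_fps_0 egf_conn_0_nth_0 cotree_fps_def\<close>)
  moreover have "Suc (n - 1) = n" using assms by simp
  ultimately have T: "of_nat n * egf_conn 0 $ n = (inverse (2 - exp_quot_fps) ^ n) $ (n - 1)"
    by (simp add: fps_X_fps_compose_startby0 egf_conn_0_nth_0)
  have "2 * egf_conn 0 $ n = (2 * egf_conn 0) $ n" by (simp add: fps_mult_numeral_left)
  also have "\<dots> = egf_all 0 $ n" using assms by (simp add: egf_conn_eq)
  finally have "of_nat (num_all n 0) = 2 * fact n * egf_conn 0 $ n"
    by (simp add: egf_all_def field_simps)
  with T assms show ?thesis by (simp add: field_simps)
qed

text \<open>Substituting z for the unmarked variable turns the series of all cographs into exp t -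
  1, so that this becomes the expansion of \<open>mark_coeff q (exp t - 1)\<close>.\<close>

definition marked_fps :: "nat \<Rightarrow> complex fps" where
  "marked_fps q = (if q = 0 then 0 else egf_coconn q) oo cotree_fps"

text \<open>Everything is expressed by the co-connected series Y: the connected one is W Y plus the
  single marked vertex (\<open>N\<close>), the total one is 1 + W times 1 + Y (\<open>R\<close>).
  Inserted into \<open>egf_all_Suc_conn\<close>, a factor 1 + W cancels.\<close>

lemma mark_rec_egf_coconn: "mark_rec (egf_all 0) (\<lambda>q. if q = 0 then 0 else egf_coconn q)"
proof (rule mark_recI)
  fix q
  let ?y = "\<lambda>q. if q = 0 then 0 else egf_coconn q"
  define W where "W = egf_all 0"
  have N: "egf_conn (Suc j) = W * egf_coconn (Suc j) + (if j = 0 then 1 else 0)" for j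
    using egf_split[of "Suc j"] egf_all_Suc_coconn[of j] by (simp add: W_def algebra_simps)
  have R: "egf_all i + (if i = 0 then 1 else 0) = (1 + W) * ((if i = 0 then 1 else 0) + ?y i)" for i
    using egf_all_Suc_coconn[of "i - 1"] by (cases i) (simp_all add: W_def)
  have "(1 + W) * (of_nat (Suc q) * egf_coconn (Suc q)) = of_nat (Suc q) * egf_all (Suc q)"
    by (simp add: egf_all_Suc_coconn W_def algebra_simps)
  also have "\<dots> = (\<Sum>j\<le>q. of_nat (Suc j) * egf_conn (Suc j) * (egf_all (q - j) + (if q - j = 0 then 1 else 0)))"
  proof -
    have "(\<Sum>j\<le>q. of_nat (Suc j) * egf_conn (Suc j) * (if q - j = 0 then 1 else 0)) =
        (\<Sum>j\<le>q. if j = q then of_nat (Suc j) * egf_conn (Suc j) else 0)"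
      by (intro sum.cong) auto
    also have "\<dots> = of_nat (Suc q) * egf_conn (Suc q)" by (simp add: sum.delta)
    finally show ?thesis unfolding egf_all_Suc_conn distrib_left sum.distrib by (simp only: add.commute)
  qed
  also have "\<dots> = (1 + W) * (\<Sum>j\<le>q. of_nat (Suc j) * egf_conn (Suc j) * ((if q - j = 0 then 1 else 0) + ?y (q - j)))"
    unfolding R sum_distrib_left by (intro sum.cong refl) (simp only: mult_ac)
  finally have "(1 + W) * (of_nat (Suc q) * egf_coconn (Suc q)) =
      (1 + W) * (\<Sum>j\<le>q. of_nat (Suc j) * egf_conn (Suc j) * ((if q - j = 0 then 1 else 0) + ?y (q - j)))" .
  moreover have "(1 + W) $ 0 \<noteq> 0" by (simp add: W_def egf_conn_0_nth_0)
  then have "1 + W \<noteq> 0" by force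
  ultimately have "of_nat (Suc q) * egf_coconn (Suc q) =
      (\<Sum>j\<le>q. of_nat (Suc j) * egf_conn (Suc j) * ((if q - j = 0 then 1 else 0) + ?y (q - j)))"
    by (simp only: mult_cancel_left) simp
  also have "\<dots> = (\<Sum>i\<le>q. of_nat (Suc (q - i)) * egf_conn (Suc (q - i)) * ((if i = 0 then 1 else 0) + ?y i))"
    by (rule sum.reindex_bij_witness[of _ "\<lambda>i. q - i" "\<lambda>i. q - i"]) auto
  also have "\<dots> = (\<Sum>i\<le>q. ((if i = 0 then 1 else 0) + ?y i) *
           ((if i = q then 1 else 0) + W * of_nat (Suc (q - i)) * egf_coconn (Suc (q - i))))"
  proof (intro sum.cong refl)
    fix i assume "i \<in> {..q}"
    then have "(of_nat (Suc (q - i)) * egf_conn (Suc (q - i))) =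
        ((if i = q then 1 else 0) + W * of_nat (Suc (q - i)) * egf_coconn (Suc (q - i)))"
      unfolding N by (auto simp: algebra_simps)
    then show "of_nat (Suc (q - i)) * egf_conn (Suc (q - i)) * ((if i = 0 then 1 else 0) + ?y i) =
      ((if i = 0 then 1 else 0) + ?y i) *
           ((if i = q then 1 else 0) + W * of_nat (Suc (q - i)) * egf_coconn (Suc (q - i)))"
      by (simp only: mult.commute)
  qed
  finally show "of_nat (Suc q) * ?y (Suc q) = (\<Sum>i\<le>q. ((if i = 0 then 1 else 0) + ?y i) *
           ((if i = q then 1 else 0) + egf_all 0 * of_nat (Suc (q - i)) * ?y (Suc (q - i))))"
    by (simp only: W_def nat.simps if_False)
qed simp

lemma mark_rec_compose:
  fixes W G :: "complex fps"
  assumes "mark_rec W y" "G $ 0 = 0"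
  shows "mark_rec (W oo G) (\<lambda>q. y q oo G)"
  unfolding mark_rec_def
proof (intro conjI allI)
  show "y 0 oo G = 0" using assms(1) by (simp add: mark_rec_def)
  fix q
  have c: "of_nat n oo G = of_nat n" "(if P then 1 else 0) oo G = (if P then 1 else 0)" for n P
    by (simp_all flip: fps_of_nat)
  have "((1 - W) * of_nat (Suc q) * y (Suc q)) oo G = ((if q = 0 then 1 else 0) +
     (\<Sum>i=1..q. y i * ((if i = q then 1 else 0) + W * of_nat (Suc (q - i)) * y (Suc (q - i))))) oo G"
    using assms(1) unfolding mark_rec_def by metis
  then show "(1 - (W oo G)) * of_nat (Suc q) * (y (Suc q) oo G) = (if q = 0 then 1 else 0) +
     (\<Sum>i=1..q. (y i oo G) * ((if i = q then 1 else 0) + (W oo G) * of_nat (Suc (q - i)) * (y (Suc (q - i)) oo G)))"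
    by (simp only: fps_compose_mult_distrib[OF assms(2)] fps_compose_add_distrib fps_compose_sub_distrib
        fps_compose_sum_distrib c fps_compose_1)
qed

lemma marked_fps_expansion: "(\<lambda>t. mark_coeff q (exp t - 1)) has_fps_expansion marked_fps q"
  unfolding marked_fps_def
proof (rule mark_coeff_has_fps_expansion)
  show "mark_rec (fps_exp 1 - 1) (\<lambda>q. (if q = 0 then 0 else egf_coconn q) oo cotree_fps)"
    using mark_rec_compose[OF mark_rec_egf_coconn cotree_fps_0(1)] by (simp only: egf_all_0_cotree_fps)
  show "(\<lambda>t::complex. exp t - 1) has_fps_expansion (fps_exp 1 - 1)"
    by (intro has_fps_expansion_diff has_fps_expansion_exp1 has_fps_expansion_1)
qed simp

theorem num_all_marked_eq:
  assumes "q \<ge> 1"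
  shows "complex_of_nat (num_all p q) = fact p * fact q *
    (fps_exp 1 * marked_fps q * (2 - fps_exp 1) * inverse (2 - exp_quot_fps) ^ Suc p) $ p"
proof -
  obtain r where q: "q = Suc r" using assms by (cases q) auto
  have "egf_all q oo cotree_fps = (1 + (egf_all 0 oo cotree_fps)) * (egf_coconn q oo cotree_fps)"
    unfolding q egf_all_Suc_coconn
    by (simp add: fps_compose_mult_distrib[OF cotree_fps_0(1)] fps_compose_add_distrib)
  also have "\<dots> = fps_exp 1 * marked_fps q"
    using q by (simp add: egf_all_0_cotree_fps marked_fps_def)
  finally have 1: "egf_all q oo cotree_fps = fps_exp 1 * marked_fps q" .
  have 2: "fps_deriv cotree_fps = 2 - fps_exp 1" unfolding cotree_fps_eq by simp
  have "egf_all q $ p = (fps_exp 1 * marked_fps q * (2 - fps_exp 1) * inverse (2 - exp_quot_fps) ^ Suc p) $ p"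
    using lagrange_coeff[OF cotree_fps_0(2), of "egf_all q" p]
    unfolding cotree_fps_def[symmetric] 1 2 by simp
  then show ?thesis by (simp add: egf_all_def field_simps)
qed

section \<open>The saddle point\<close>

text \<open>The values of \<open>z(t)\<close> and \<open>s(t, x)\<close> for \<open>exp t = 1 + w\<close> and \<open>exp x = 1 / w\<close>. With these, the
  derivative of \<open>s\<close> in \<open>x\<close> vanishes, and that of \<open>(1 - \<beta>) ln z + \<beta> ln s\<close> in \<open>t\<close> vanishes if and only if
  \<open>sp_h w = \<beta> / (1 - \<beta>)\<close>. Up to a positive factor, \<open>sp_det w\<close> is the Hessian determinant.\<close>

definition sp_z :: "real \<Rightarrow> real" where "sp_z w = 2 * ln (1 + w) - w"
definition sp_s :: "real \<Rightarrow> real" where "sp_s w = w - 1 - ln w"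
definition sp_h :: "real \<Rightarrow> real" where "sp_h w = w * sp_s w / ((1 + w) * sp_z w)"
definition sp_det :: "real \<Rightarrow> real" where
  "sp_det w = (1 - w) * w / sp_z w + (1 - w\<^sup>2) / sp_s w - 1"

section \<open>Elementary bounds for \<open>sp_z\<close>, \<open>sp_s\<close> and
  \<open>sp_det\<close>\<close>

lemma ln_one_plus_lower:
  fixes w :: real assumes "0 \<le> w" shows "w - w\<^sup>2 / 2 \<le> ln (1 + w)"
proof -
  have "(\<lambda>w. ln (1 + w) - (w - w\<^sup>2 / 2)) 0 \<le> (\<lambda>w. ln (1 + w) - (w - w\<^sup>2 / 2)) w"
  proof (rule DERIV_nonneg_imp_nondecreasing[OF assms])
    fix x :: real assume x: "0 \<le> x" "x \<le> w"
    have "((\<lambda>w. ln (1 + w) - (w - w\<^sup>2 / 2)) has_real_derivative x\<^sup>2 / (1 + x)) (at x)"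
      using x by (auto intro!: derivative_eq_intros simp: field_simps power2_eq_square)
    then show "\<exists>y. ((\<lambda>w. ln (1 + w) - (w - w\<^sup>2 / 2)) has_real_derivative y) (at x) \<and> 0 \<le> y"
      using x by (intro exI[of _ "x\<^sup>2 / (1 + x)"]) auto
  qed
  then show ?thesis by simp
qed

lemma ln_one_plus_upper:
  fixes w :: real assumes "0 \<le> w" shows "ln (1 + w) \<le> w - w\<^sup>2 / 2 + w ^ 3 / 3"
proof -
  have "(\<lambda>w. w - w\<^sup>2 / 2 + w ^ 3 / 3 - ln (1 + w)) 0 \<le> (\<lambda>w. w - w\<^sup>2 / 2 + w ^ 3 / 3 - ln (1 + w)) w"
  proof (rule DERIV_nonneg_imp_nondecreasing[OF assms])
    fix x :: real assume x: "0 \<le> x" "x \<le> w"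
    have "((\<lambda>w. w - w\<^sup>2 / 2 + w ^ 3 / 3 - ln (1 + w)) has_real_derivative x ^ 3 / (1 + x)) (at x)"
      using x by (auto intro!: derivative_eq_intros simp: field_simps power2_eq_square power3_eq_cube)
    then show "\<exists>y. ((\<lambda>w. w - w\<^sup>2 / 2 + w ^ 3 / 3 - ln (1 + w)) has_real_derivative y) (at x) \<and> 0 \<le> y"
      using x by (intro exI[of _ "x ^ 3 / (1 + x)"]) auto
  qed
  then show ?thesis by simp
qed

lemma neg_ln_lower:
  fixes w :: real assumes "0 < w" "w \<le> 1" shows "(1 - w) + (1 - w)\<^sup>2 / 2 \<le> - ln w"
proof -
  have "(\<lambda>w. - ln w - ((1 - w) + (1 - w)\<^sup>2 / 2)) w \<ge> (\<lambda>w. - ln w - ((1 - w) + (1 - w)\<^sup>2 / 2)) 1"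
  proof (rule DERIV_nonpos_imp_nonincreasing[OF assms(2)])
    fix x :: real assume x: "w \<le> x" "x \<le> 1"
    have "((\<lambda>w. - ln w - ((1 - w) + (1 - w)\<^sup>2 / 2)) has_real_derivative - ((1 - x)\<^sup>2 / x)) (at x)"
      using x assms by (auto intro!: derivative_eq_intros simp: field_simps power2_eq_square)
    then show "\<exists>y. ((\<lambda>w. - ln w - ((1 - w) + (1 - w)\<^sup>2 / 2)) has_real_derivative y) (at x) \<and> y \<le> 0"
      using x assms by (intro exI[of _ "- ((1 - x)\<^sup>2 / x)"]) auto
  qed
  then show ?thesis by simp
qed

lemma sp_bounds:
  assumes "0 < w" "w < 1"
  shows "w * (1 - w) \<le> sp_z w" "0 < sp_z w" "sp_z w \<le> w" "sp_z w \<le> w - w\<^sup>2 + 2 / 3 * w ^ 3"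
    "(1 - w)\<^sup>2 / 2 \<le> sp_s w" "0 < sp_s w" "sp_s w \<le> (1 - w)\<^sup>2 / w"
proof -
  show 1: "w * (1 - w) \<le> sp_z w"
    using ln_one_plus_lower[of w] assms by (simp add: sp_z_def algebra_simps power2_eq_square)
  have "0 < w * (1 - w)" using assms by simp
  with 1 show "0 < sp_z w" by linarith
  show "sp_z w \<le> w" using ln_add_one_self_le_self[of w] assms by (simp add: sp_z_def)
  show "sp_z w \<le> w - w\<^sup>2 + 2 / 3 * w ^ 3"
    using ln_one_plus_upper[of w] assms by (simp add: sp_z_def)
  show 2: "(1 - w)\<^sup>2 / 2 \<le> sp_s w" using neg_ln_lower[of w] assms by (simp add: sp_s_def)
  have "0 < (1 - w)\<^sup>2 / 2" using assms by simp
  with 2 show "0 < sp_s w" by linarith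
  have "- ln w \<le> 1 / w - 1" using ln_le_minus_one[of "1 / w"] assms by (simp add: ln_div)
  then have "sp_s w \<le> w - 2 + 1 / w" by (simp add: sp_s_def)
  also have "\<dots> = (1 - w)\<^sup>2 / w" using assms by (simp add: field_simps power2_eq_square)
  finally show "sp_s w \<le> (1 - w)\<^sup>2 / w" .
qed

text \<open>The term with z falls short of 1 by at most 2/3 w^2 / (1 - w), by the cubic Taylor bound
  for ln (1 + w). The term with s is at least w (1 + w) / (1 - w), which is more.\<close>

lemma sp_det_pos:
  assumes "0 < w" "w < 1" shows "0 < sp_det w"
proof -
  note b = sp_bounds[OF assms]
  have "1 - (1 - w) * w / sp_z w = (sp_z w - w + w\<^sup>2) / sp_z w"
    using b by (simp add: field_simps power2_eq_square)
  also have "\<dots> \<le> (2 / 3 * w ^ 3) / sp_z w"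
    by (rule divide_right_mono) (use b in auto)
  also have "\<dots> \<le> (2 / 3 * w ^ 3) / (w * (1 - w))"
    by (rule divide_left_mono) (use b assms in auto)
  also have "\<dots> = 2 / 3 * w\<^sup>2 / (1 - w)"
    using assms by (simp add: field_simps power2_eq_square power3_eq_cube)
  also have "\<dots> < w * (1 + w) / (1 - w)"
  proof (rule divide_strict_right_mono)
    show "2 / 3 * w\<^sup>2 < w * (1 + w)" using assms by (simp add: field_simps power2_eq_square) (smt (verit) mult_pos_pos)
  qed (use assms in auto)
  also have "\<dots> = (1 - w\<^sup>2) / ((1 - w)\<^sup>2 / w)"
  proof -
    have "1 - w\<^sup>2 = (1 - w) * (1 + w)" by (simp add: algebra_simps power2_eq_square)
    then show ?thesis using assms by (simp add: power2_eq_square)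
  qed
  also have "\<dots> \<le> (1 - w\<^sup>2) / sp_s w"
    by (rule divide_left_mono) (use b assms in \<open>auto simp: power2_eq_square mult_le_one\<close>)
  finally show ?thesis by (simp add: sp_det_def)
qed

lemma sp_z_deriv: "0 < w \<Longrightarrow> (sp_z has_real_derivative (1 - w) / (1 + w)) (at w)"
  unfolding sp_z_def by (auto intro!: derivative_eq_intros simp: field_simps)

lemma sp_s_deriv: "0 < w \<Longrightarrow> (sp_s has_real_derivative - ((1 - w) / w)) (at w)"
  unfolding sp_s_def by (auto intro!: derivative_eq_intros simp: field_simps)

lemma sp_h_pos: "0 < w \<Longrightarrow> w < 1 \<Longrightarrow> 0 < sp_h w"
  unfolding sp_h_def using sp_bounds[of w] by (intro divide_pos_pos mult_pos_pos) auto

text \<open>The logarithmic derivative of \<open>sp_h\<close> is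
  \<open>- sp_det w / (w * (1 + w))\<close>. So uniqueness of the saddle point and nondegeneracy of
  its Hessian rest on the same inequality.\<close>

lemma sp_h_strict_antimono:
  assumes "0 < v" "v < w" "w < 1" shows "sp_h w < sp_h v"
proof -
  define L where "L x = ln x + ln (sp_s x) - ln (1 + x) - ln (sp_z x)" for x
  have L: "ln (sp_h x) = L x" if "0 < x" "x < 1" for x
    using sp_bounds[OF that] that unfolding sp_h_def L_def by (simp add: ln_div ln_mult)
  have "L w < L v"
  proof (rule DERIV_neg_imp_decreasing[OF assms(2)])
    fix x assume x: "v \<le> x" "x \<le> w"
    then have x1: "0 < x" "x < 1" using assms by auto
    note b = sp_bounds[OF x1]
    have "(L has_real_derivative inverse x + inverse (sp_s x) * (- ((1 - x) / x)) - inverse (1 + x) * (0 + 1)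
        - inverse (sp_z x) * ((1 - x) / (1 + x))) (at x)"
      unfolding L_def using x1
      by (intro DERIV_diff DERIV_add DERIV_ln DERIV_chain2[OF DERIV_ln[OF b(6)] sp_s_deriv]
          DERIV_chain2[OF DERIV_ln[OF b(2)] sp_z_deriv] DERIV_chain2[OF DERIV_ln] DERIV_const DERIV_ident) auto
    also have "inverse x + inverse (sp_s x) * (- ((1 - x) / x)) - inverse (1 + x) * (0 + 1)
        - inverse (sp_z x) * ((1 - x) / (1 + x)) = - sp_det x / (x * (1 + x))"
    proof -
      have m1: "((1 - x) * x / sp_z x) / (x * (1 + x)) = inverse (sp_z x) * ((1 - x) / (1 + x))"
        using x1 by (simp add: divide_inverse)
      have "1 - x\<^sup>2 = (1 - x) * (1 + x)" by (simp add: algebra_simps power2_eq_square)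
      then have m2: "((1 - x\<^sup>2) / sp_s x) / (x * (1 + x)) = inverse (sp_s x) * ((1 - x) / x)"
        using x1 by (simp add: divide_inverse)
      have m3: "1 / (x * (1 + x)) = inverse x - inverse (1 + x)"
        using x1 by (simp add: field_simps)
      have "- (a + b - 1) / d = 1 / d - a / d - b / d" for a b d :: real
        by (simp add: diff_divide_distrib add_divide_distrib)
      from this[of "(1 - x) * x / sp_z x" "(1 - x\<^sup>2) / sp_s x" "x * (1 + x)"]
      show ?thesis unfolding sp_det_def m1 m2 m3 by (simp only: mult_minus_right add_0 mult_1_right)
    qed
    finally show "\<exists>y. (L has_real_derivative y) (at x) \<and> y < 0"
      using sp_det_pos[OF x1] x1 by (intro exI[of _ "- sp_det x / (x * (1 + x))"]) (auto simp: divide_neg_pos)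
  qed
  then have "ln (sp_h w) < ln (sp_h v)" using L[of v] L[of w] assms by simp
  moreover have "0 < sp_h v" "0 < sp_h w" using sp_h_pos assms by auto
  ultimately show ?thesis by simp
qed

lemma continuous_on_sp: "continuous_on {0<..<1} sp_z" "continuous_on {0<..<1} sp_s" "continuous_on {0<..<1} sp_h"
  "continuous_on {0<..<1} sp_det"
proof -
  show z: "continuous_on {0<..<1} sp_z" unfolding sp_z_def by (intro continuous_intros) auto
  show s: "continuous_on {0<..<1} sp_s" unfolding sp_s_def by (intro continuous_intros) auto
  have nz: "sp_z w \<noteq> 0" "sp_s w \<noteq> 0" if "w \<in> {0<..<1}" for w using sp_bounds[of w] that by auto
  show "continuous_on {0<..<1} sp_h" unfolding sp_h_def
    by (intro continuous_intros z s) (use nz in auto)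
  show "continuous_on {0<..<1} sp_det" unfolding sp_det_def
    by (intro continuous_intros z s) (use nz in auto)
qed

lemma sp_h_surj:
  assumes "0 < y" shows "\<exists>w. 0 < w \<and> w < 1 \<and> sp_h w = y"
proof -
  \<comment> \<open>Here s(u) > 2 y because - ln u = 2 y + 2, and \<open>sp_h u\<close> is at least
    s(u) / 2.\<close>
  define u where "u = exp (- 2 * y - 2)"
  \<comment> \<open>Chosen so that (1 - v) / v = y; the bounds on z and s then give
    \<open>sp_h v\<close> \<le> y / (1 + v).\<close>
  define v where "v = 1 / (1 + y)"
  have u: "0 < u" "u < 1" and v: "0 < v" "v < 1" using assms by (auto simp: u_def v_def)
  have hu: "y < sp_h u"
  proof -
    note b = sp_bounds[OF u]
    have "ln u = - 2 * y - 2" by (simp add: u_def)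
    then have "2 * y < sp_s u" using u by (simp add: sp_s_def)
    moreover have "sp_s u * (1 / 2) \<le> sp_s u * (u / ((1 + u) * sp_z u))"
    proof (rule mult_left_mono)
      have "(1 + u) * sp_z u \<le> 2 * u" by (rule mult_mono) (use b u in auto)
      then show "1 / 2 \<le> u / ((1 + u) * sp_z u)" using b u by (simp add: pos_le_divide_eq)
    qed (use b in auto)
    ultimately show ?thesis by (simp add: sp_h_def mult.commute)
  qed
  have hv: "sp_h v < y"
  proof -
    note b = sp_bounds[OF v]
    have "sp_h v \<le> v * ((1 - v)\<^sup>2 / v) / ((1 + v) * (v * (1 - v)))"
      unfolding sp_h_def
    proof (rule frac_le)
      show "v * sp_s v \<le> v * ((1 - v)\<^sup>2 / v)" by (rule mult_left_mono) (use b v in auto)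
      show "(1 + v) * (v * (1 - v)) \<le> (1 + v) * sp_z v" by (rule mult_left_mono) (use b v in auto)
    qed (use v in auto)
    also have "\<dots> = (1 - v) / v / (1 + v)"     proof -
      have "v * ((1 - v)\<^sup>2 / v) / ((1 + v) * (v * (1 - v))) = ((1 - v) * (1 - v)) / ((v * (1 + v)) * (1 - v))"
        using v by (simp add: power2_eq_square mult_ac)
      also have "\<dots> = (1 - v) / (v * (1 + v))" using v by simp
      finally show ?thesis by simp
    qed
    also have "(1 - v) / v = y" using assms by (simp add: v_def field_simps)
    also have "y / (1 + v) < y" using assms v by (simp add: field_simps)
    finally show ?thesis .
  qed
  have uv: "u < v"
  proof (rule ccontr)
    assume "\<not> u < v"
    then have "v < u \<or> v = u" by auto
    then have "sp_h u \<le> sp_h v" using sp_h_strict_antimono[of v u] u v by auto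
    with hu hv show False by simp
  qed
  have "continuous_on {u..v} sp_h"
    by (rule continuous_on_subset[OF continuous_on_sp(3)]) (use u v in auto)
  then have "\<exists>x\<ge>u. x \<le> v \<and> sp_h x = y"
    by (intro IVT2') (use hu hv uv in auto)
  then obtain x where "u \<le> x" "x \<le> v" "sp_h x = y" by blast
  then show ?thesis using u v by (intro exI[of _ x]) auto
qed

section \<open>The saddle point as a function of \<beta>\<close>

definition saddle :: "real \<Rightarrow> real" where
  "saddle \<beta> = (THE w. 0 < w \<and> w < 1 \<and> sp_h w = \<beta> / (1 - \<beta>))"

lemma saddle:
  assumes "0 < \<beta>" "\<beta> < 1"
  shows "0 < saddle \<beta>" "saddle \<beta> < 1" "sp_h (saddle \<beta>) = \<beta> / (1 - \<beta>)"
proof -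
  have "\<exists>!w. 0 < w \<and> w < 1 \<and> sp_h w = \<beta> / (1 - \<beta>)"
  proof (rule ex_ex1I)
    show "\<exists>w. 0 < w \<and> w < 1 \<and> sp_h w = \<beta> / (1 - \<beta>)" by (rule sp_h_surj) (use assms in auto)
    show "v = w" if "0 < v \<and> v < 1 \<and> sp_h v = \<beta> / (1 - \<beta>)" "0 < w \<and> w < 1 \<and> sp_h w = \<beta> / (1 - \<beta>)" for v w
      using that sp_h_strict_antimono[of v w] sp_h_strict_antimono[of w v] by (cases v w rule: linorder_cases) auto
  qed
  from theI'[OF this, folded saddle_def]
  show "0 < saddle \<beta>" "saddle \<beta> < 1" "sp_h (saddle \<beta>) = \<beta> / (1 - \<beta>)" by auto
qed

lemma saddle_less_iff:
  assumes "0 < \<beta>" "\<beta> < 1" "0 < w" "w < 1"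
  shows "saddle \<beta> < w \<longleftrightarrow> sp_h w < \<beta> / (1 - \<beta>)" "w < saddle \<beta> \<longleftrightarrow> \<beta> / (1 - \<beta>) < sp_h w"
proof -
  note s = saddle[OF assms(1,2)]
  show "saddle \<beta> < w \<longleftrightarrow> sp_h w < \<beta> / (1 - \<beta>)" "w < saddle \<beta> \<longleftrightarrow> \<beta> / (1 - \<beta>) < sp_h w"
    using sp_h_strict_antimono[of "saddle \<beta>" w] sp_h_strict_antimono[of w "saddle \<beta>"] s assms(3,4)
    by (cases w "saddle \<beta>" rule: linorder_cases; force)+
qed

text \<open>By monotonicity of \<open>sp_h\<close>, comparing \<open>saddle\<close> with a point w
  amounts to comparing \<beta> / (1 - \<beta>) with \<open>sp_h w\<close>, and the former is
  continuous. It suffices to test one point w between the saddle point and the given bound.\<close>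

lemma isCont_saddle:
  assumes "0 < \<beta>" "\<beta> < 1" shows "isCont saddle \<beta>"
  unfolding isCont_def
proof (rule order_tendstoI)
  note s = saddle[OF assms]
  have lim: "((\<lambda>x. x / (1 - x)) \<longlongrightarrow> \<beta> / (1 - \<beta>)) (at \<beta>)"
    by (intro tendsto_intros) (use assms in auto)
  have ev: "\<forall>\<^sub>F x in at \<beta>. 0 < x \<and> x < 1"
    using order_tendstoD[OF tendsto_ident_at[of \<beta> UNIV]] assms by (auto intro: eventually_conj)
  fix a assume a: "a < saddle \<beta>"
  define w where "w = (max a 0 + saddle \<beta>) / 2"
  have w: "0 < w" "w < 1" "a < w" "w < saddle \<beta>" using s a by (auto simp: w_def max_def field_simps)
  then have "\<beta> / (1 - \<beta>) < sp_h w" using saddle_less_iff[OF assms w(1,2)] by auto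
  from order_tendstoD(2)[OF lim this] ev show "\<forall>\<^sub>F x in at \<beta>. a < saddle x"
    by eventually_elim (use saddle_less_iff w in force)
next
  note s = saddle[OF assms]
  have lim: "((\<lambda>x. x / (1 - x)) \<longlongrightarrow> \<beta> / (1 - \<beta>)) (at \<beta>)"
    by (intro tendsto_intros) (use assms in auto)
  have ev: "\<forall>\<^sub>F x in at \<beta>. 0 < x \<and> x < 1"
    using order_tendstoD[OF tendsto_ident_at[of \<beta> UNIV]] assms by (auto intro: eventually_conj)
  fix a assume a: "saddle \<beta> < a"
  define w where "w = (min a 1 + saddle \<beta>) / 2"
  have w: "0 < w" "w < 1" "w < a" "saddle \<beta> < w" using s a by (auto simp: w_def min_def field_simps)
  then have "sp_h w < \<beta> / (1 - \<beta>)" using saddle_less_iff[OF assms w(1,2)] by auto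
  from order_tendstoD(1)[OF lim this] ev show "\<forall>\<^sub>F x in at \<beta>. saddle x < a"
    by eventually_elim (use saddle_less_iff w in force)
qed

text \<open>The value of z at its critical point ln 2, which is the formula for \<open>sp_z\<close>
  at w = 1.\<close>

definition rho :: real where "rho = 2 * ln 2 - 1"

definition growth_rate :: "real \<Rightarrow> real" where
  "growth_rate \<beta> = rho * sp_z (saddle \<beta>) powr (- (1 - \<beta>)) * sp_s (saddle \<beta>) powr (- \<beta>)"

text \<open>The quotient of the limits of the two rescaled integrals with their constants,
  simplified by \<open>growth_factor_identity\<close>. The product \<open>pi * rho\<close> under the
  root stems from the number of all cographs.\<close>

definition growth_factor :: "real \<Rightarrow> real" where
  "growth_factor \<beta> = sp_s (saddle \<beta>) * sqrt (1 - (saddle \<beta>)\<^sup>2) /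
     (2 * \<beta>\<^sup>2 * sp_z (saddle \<beta>) * sqrt (pi * rho * sp_det (saddle \<beta>)))"

lemma rho_bounds: "0 < rho" "rho < 1"
proof -
  have "1 - 1\<^sup>2 / 2 < ln (1 + 1 :: real)"
  proof -
    have "ln (2::real) > 1 / 2" using ln2_ge_two_thirds by simp
    then show ?thesis by simp
  qed
  then show "0 < rho" by (simp add: rho_def)
  show "rho < 1" using ln_2_less_1 by (simp add: rho_def)
qed

lemma growth_rate_pos: "0 < \<beta> \<Longrightarrow> \<beta> < 1 \<Longrightarrow> 0 < growth_rate \<beta>"
  unfolding growth_rate_def using sp_bounds[of "saddle \<beta>"] saddle[of \<beta>] rho_bounds by simp

lemma growth_factor_pos: "0 < \<beta> \<Longrightarrow> \<beta> < 1 \<Longrightarrow> 0 < growth_factor \<beta>"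
  unfolding growth_factor_def
  using sp_bounds[of "saddle \<beta>"] saddle[of \<beta>] rho_bounds sp_det_pos[of "saddle \<beta>"]
  by (intro divide_pos_pos mult_pos_pos) (auto simp: power_less_one_iff abs_square_less_1)

section \<open>The growth rate for small \<beta>\<close>

lemma sp_z_mono:
  assumes "0 < v" "v \<le> w" "w \<le> 1" shows "sp_z v \<le> sp_z w"
proof (rule DERIV_nonneg_imp_nondecreasing[OF assms(2)])
  fix x assume "v \<le> x" "x \<le> w"
  with assms show "\<exists>y. (sp_z has_real_derivative y) (at x) \<and> 0 \<le> y"
    by (intro exI[of _ "(1 - x) / (1 + x)"]) (auto intro: sp_z_deriv)
qed

text \<open>The derivative of \<open>sp_z\<close> vanishes at w = 1, so z misses its maximum only by
  a term quadratic in 1 - w. For small \<beta> this term is of order \<beta>.\<close>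

lemma sp_z_near_1:
  assumes "0 < w" "w \<le> 1" shows "rho - (1 - w)\<^sup>2 \<le> sp_z w" "sp_z w \<le> rho"
proof -
  have "(\<lambda>w. sp_z w + (1 - w)\<^sup>2) w \<ge> (\<lambda>w. sp_z w + (1 - w)\<^sup>2) 1"
  proof (rule DERIV_nonpos_imp_nonincreasing[OF assms(2)])
    fix x assume x: "w \<le> x" "x \<le> 1"
    have "((\<lambda>w. sp_z w + (1 - w)\<^sup>2) has_real_derivative (1 - x) / (1 + x) - 2 * (1 - x)) (at x)"
      using x assms by (auto intro!: derivative_eq_intros sp_z_deriv)
    moreover have "(1 - x) / (1 + x) \<le> (1 - x) / 1"
      by (rule divide_left_mono) (use x assms in auto)
    ultimately show "\<exists>y. ((\<lambda>w. sp_z w + (1 - w)\<^sup>2) has_real_derivative y) (at x) \<and> y \<le> 0"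
      using x by (intro exI[of _ "(1 - x) / (1 + x) - 2 * (1 - x)"]) auto
  qed
  then show "rho - (1 - w)\<^sup>2 \<le> sp_z w" by (simp add: sp_z_def rho_def)
  show "sp_z w \<le> rho" using sp_z_mono[of w 1] assms by (simp add: sp_z_def rho_def)
qed

lemma exp_minus_linear_le:
  fixes u :: real assumes "\<bar>u\<bar> \<le> 1" shows "\<bar>exp u - 1 - u\<bar> \<le> u\<^sup>2"
proof -
  have "exp u \<le> 1 + u + u\<^sup>2"
  proof (cases "0 \<le> u")
    case True
    then show ?thesis using exp_bound[of u] assms by simp
  next
    case False
    define v where "v = - u"
    have v: "0 < v" "v \<le> 1" using False assms by (auto simp: v_def)
    have "1 \<le> (1 - v + v\<^sup>2) * (1 + v + v\<^sup>2 / 2)"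
    proof -
      have "(1 - v + v\<^sup>2) * (1 + v + v\<^sup>2 / 2) = 1 + v\<^sup>2 * (1 + v + v\<^sup>2) / 2"
        by (simp add: field_simps power2_eq_square)
      then show ?thesis using v by simp
    qed
    also have "\<dots> \<le> (1 - v + v\<^sup>2) * exp v"
      using exp_lower_Taylor_quadratic[of v] v by (intro mult_left_mono) auto
    finally have "1 / exp v \<le> 1 - v + v\<^sup>2" by (simp add: divide_le_eq)
    moreover have "exp u = 1 / exp v" by (simp add: v_def exp_minus divide_inverse)
    ultimately show ?thesis by (simp add: v_def)
  qed
  moreover have "0 \<le> exp u - 1 - u" using exp_ge_add_one_self[of u] by linarith
  ultimately show ?thesis by simp
qed

text \<open>For small \<beta> the saddle point is near 1: \<open>sp_h w\<close> is at least (1 -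
  w)^2 / 4, hence (1 - w)^2 \<le> 8 \<beta>, and \<beta> < 1 / 64 gives w \<ge> 1 / 2. Then ln rho -
  ln z is at most 32 \<beta>, z is at least 1 / 4, and s agrees with \<beta> up to a factor 16. The
  main term - \<beta> ln \<beta> comes from s alone.\<close>

lemma ln_growth_rate_bound:
  "\<exists>K\<ge>0. \<forall>\<beta>. 0 < \<beta> \<and> \<beta> < 1 / 64 \<longrightarrow> \<bar>ln (growth_rate \<beta>) + \<beta> * ln \<beta>\<bar> \<le> K * \<beta>"
proof (intro exI[of _ "32 + ln 4 + ln 16"] conjI allI impI)
  show "0 \<le> 32 + ln 4 + ln (16 :: real)" by simp
  fix \<beta> :: real assume "0 < \<beta> \<and> \<beta> < 1 / 64"
  then have \<beta>: "0 < \<beta>" "\<beta> < 1 / 64" "\<beta> < 1" by auto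
  define w where "w = saddle \<beta>"
  note w = saddle[OF \<beta>(1,3), folded w_def]
  note b = sp_bounds[OF w(1,2)]
  have "(1 - w)\<^sup>2 / 4 \<le> sp_h w"
  proof -
    have "(1 - w)\<^sup>2 / 4 = w * ((1 - w)\<^sup>2 / 2) / (2 * w)" using w by simp
    also have "\<dots> \<le> sp_h w" unfolding sp_h_def
      by (rule frac_le) (use b w in \<open>auto intro!: mult_left_mono mult_mono\<close>)
    finally show ?thesis .
  qed
  also have "sp_h w \<le> 2 * \<beta>" unfolding w(3) using \<beta> by (simp add: field_simps)
  finally have d: "(1 - w)\<^sup>2 \<le> 8 * \<beta>" by simp
  have "(1 - w)\<^sup>2 \<le> (1 / 2)\<^sup>2" using d \<beta> by (simp add: power2_eq_square)
  then have "1 - w \<le> 1 / 2" by (rule power2_le_imp_le) simp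
  then have w2: "1 / 2 \<le> w" by simp
  have "sp_z (1 / 2) \<ge> 1 / 4" using sp_bounds(1)[of "1 / 2"] by simp
  with sp_z_mono[of "1 / 2" w] w2 w have z4: "1 / 4 \<le> sp_z w" by linarith
  have lz: "\<bar>ln (sp_z w)\<bar> \<le> ln 4"
  proof -
    have "ln (1 / 4) \<le> ln (sp_z w)" using z4 by (subst ln_le_cancel_iff) auto
    moreover have "ln (sp_z w) \<le> 0" using b w by simp
    ultimately show ?thesis by (simp add: ln_div)
  qed
  have lr: "0 \<le> ln rho - ln (sp_z w)" "ln rho - ln (sp_z w) \<le> 32 * \<beta>"
  proof -
    note z1 = sp_z_near_1[of w]
    show "0 \<le> ln rho - ln (sp_z w)" using z1 w b by simp
    have "ln rho - ln (sp_z w) = ln (rho / sp_z w)" using rho_bounds b by (simp add: ln_div)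
    also have "\<dots> \<le> rho / sp_z w - 1" using rho_bounds b by (intro ln_le_minus_one) auto
    also have "\<dots> = (rho - sp_z w) / sp_z w" using b by (simp add: field_simps)
    also have "\<dots> \<le> (8 * \<beta>) / (1 / 4)" by (rule frac_le) (use z1 w d z4 \<beta> in auto)
    finally show "ln rho - ln (sp_z w) \<le> 32 * \<beta>" by simp
  qed
  have ls: "\<bar>ln (sp_s w) - ln \<beta>\<bar> \<le> ln 16"
  proof -
    have "sp_s w \<le> (1 - w)\<^sup>2 / w" by (rule b)
    also have "\<dots> \<le> (8 * \<beta>) / (1 / 2)" by (rule frac_le) (use d w2 \<beta> in auto)
    finally have "sp_s w \<le> 16 * \<beta>" by simp
    then have "ln (sp_s w) \<le> ln (16 * \<beta>)" using b \<beta> by simp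
    then have 1: "ln (sp_s w) \<le> ln 16 + ln \<beta>" using \<beta> by (simp add: ln_mult)
    have "\<beta> \<le> \<beta> / (1 - \<beta>)" using \<beta> by (simp add: field_simps)
    also have "\<dots> = sp_h w" using w by simp
    also have "\<dots> \<le> (1 * sp_s w) / (1 * (1 / 4))" unfolding sp_h_def
    proof (rule frac_le)
      show "1 * (1 / 4) \<le> (1 + w) * sp_z w" by (rule mult_mono) (use w z4 in auto)
    qed (use b w in \<open>auto intro!: mult_right_mono\<close>)
    finally have "\<beta> \<le> 16 * sp_s w" using b by simp
    then have "ln \<beta> \<le> ln (16 * sp_s w)" using b \<beta> by simp
    then have "ln \<beta> \<le> ln 16 + ln (sp_s w)" using b by (simp add: ln_mult)
    with 1 show ?thesis by simp
  qed
  have "ln (growth_rate \<beta>) = ln rho - (1 - \<beta>) * ln (sp_z w) - \<beta> * ln (sp_s w)"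
    unfolding growth_rate_def w_def[symmetric] using rho_bounds b by (simp add: ln_mult ln_powr algebra_simps)
  then have "ln (growth_rate \<beta>) + \<beta> * ln \<beta> = (ln rho - ln (sp_z w)) + \<beta> * ln (sp_z w) - \<beta> * (ln (sp_s w) - ln \<beta>)"
    by (simp add: algebra_simps)
  also have "\<bar>\<dots>\<bar> \<le> \<bar>ln rho - ln (sp_z w)\<bar> + \<bar>\<beta> * ln (sp_z w)\<bar> + \<bar>\<beta> * (ln (sp_s w) - ln \<beta>)\<bar>" by linarith
  also have "\<dots> \<le> 32 * \<beta> + \<beta> * ln 4 + \<beta> * ln 16"
    using lr lz ls \<beta> by (intro add_mono) (auto simp: abs_mult intro!: mult_left_mono)
  finally show "\<bar>ln (growth_rate \<beta>) + \<beta> * ln \<beta>\<bar> \<le> (32 + ln 4 + ln 16) * \<beta>" by (simp add: algebra_simps)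
qed

text \<open>Exponentiating costs at most the square of the exponent, and both \<beta> and (\<beta>
  ln \<beta>)^2 are negligible against \<beta> ln \<beta>.\<close>

theorem growth_rate_asymp:
  "(\<lambda>\<beta>. growth_rate \<beta> - (1 + \<beta> * \<bar>ln \<beta>\<bar>)) \<in> o[at_right 0](\<lambda>\<beta>. \<beta> * ln \<beta>)"
proof -
  obtain K where K: "K \<ge> 0"
    "\<And>\<beta>. 0 < \<beta> \<Longrightarrow> \<beta> < 1 / 64 \<Longrightarrow> \<bar>ln (growth_rate \<beta>) + \<beta> * ln \<beta>\<bar> \<le> K * \<beta>"
    using ln_growth_rate_bound by blast
  have lim: "((\<lambda>\<beta>::real. - \<beta> * ln \<beta> + K * \<beta>) \<longlongrightarrow> 0) (at_right 0)" by real_asymp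
  have e1: "\<forall>\<^sub>F \<beta>::real in at_right 0. \<beta> < 1 / 64" "\<forall>\<^sub>F \<beta>::real in at_right 0. 0 < \<beta>"
    by real_asymp+
  have e3: "\<forall>\<^sub>F \<beta>::real in at_right 0. - \<beta> * ln \<beta> + K * \<beta> < 1" using order_tendstoD(2)[OF lim] by simp
  have "\<forall>\<^sub>F \<beta> in at_right 0. norm (growth_rate \<beta> - (1 + \<beta> * \<bar>ln \<beta>\<bar>)) \<le>
      1 * norm (K * \<beta> + (- \<beta> * ln \<beta> + K * \<beta>)\<^sup>2)"
    using e1 e3
  proof eventually_elim
    case (elim \<beta>)
    define u where "u = ln (growth_rate \<beta>)"
    have g: "growth_rate \<beta> = exp u" using growth_rate_pos[of \<beta>] elim by (simp add: u_def)
    have l: "\<bar>ln \<beta>\<bar> = - ln \<beta>" using elim by (simp add: abs_if)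
    have k: "\<bar>u + \<beta> * ln \<beta>\<bar> \<le> K * \<beta>" using K(2)[of \<beta>] elim by (simp add: u_def)
    have lneg: "\<beta> * ln \<beta> \<le> 0" using elim by (simp add: mult_nonneg_nonpos)
    have u: "\<bar>u\<bar> \<le> - \<beta> * ln \<beta> + K * \<beta>" using k lneg by (simp add: abs_le_iff)
    have "\<bar>exp u - 1 - u\<bar> \<le> u\<^sup>2"
      by (rule exp_minus_linear_le) (use u elim in linarith)
    moreover have "u\<^sup>2 \<le> (- \<beta> * ln \<beta> + K * \<beta>)\<^sup>2"
      using power_mono[OF u, of 2] by simp
    ultimately have "\<bar>exp u - (1 - \<beta> * ln \<beta>)\<bar> \<le> K * \<beta> + (- \<beta> * ln \<beta> + K * \<beta>)\<^sup>2" using k by linarith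
    then show ?case unfolding g l using K(1) elim by simp
  qed
  then have "(\<lambda>\<beta>. growth_rate \<beta> - (1 + \<beta> * \<bar>ln \<beta>\<bar>)) \<in> O[at_right 0](\<lambda>\<beta>. K * \<beta> + (- \<beta> * ln \<beta> + K * \<beta>)\<^sup>2)"
    by (rule bigoI)
  also have "(\<lambda>\<beta>. K * \<beta> + (- \<beta> * ln \<beta> + K * \<beta>)\<^sup>2) \<in> o[at_right 0](\<lambda>\<beta>. \<beta> * ln \<beta>)" by real_asymp
  finally show ?thesis .
qed

theorem growth_rate_gt_1: "\<exists>\<beta>0>0. \<beta>0 \<le> 1 \<and> (\<forall>\<beta>\<in>{0<..<\<beta>0}. growth_rate \<beta> > 1)"
proof -
  have "\<forall>\<^sub>F \<beta> in at_right 0. norm (growth_rate \<beta> - (1 + \<beta> * \<bar>ln \<beta>\<bar>)) \<le> 1 / 2 * norm (\<beta> * ln \<beta>)"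
    using landau_o.smallD[OF growth_rate_asymp, of "1 / 2"] by simp
  then obtain b where b: "b > 0" "\<And>\<beta>. 0 < \<beta> \<Longrightarrow> \<beta> < b \<Longrightarrow>
      norm (growth_rate \<beta> - (1 + \<beta> * \<bar>ln \<beta>\<bar>)) \<le> 1 / 2 * norm (\<beta> * ln \<beta>)"
    by (auto simp: eventually_at_right_field)
  have "growth_rate \<beta> > 1" if "\<beta> \<in> {0<..<min b 1}" for \<beta>
  proof -
    have "0 < \<beta> * \<bar>ln \<beta>\<bar>" using that by (intro mult_pos_pos) auto
    moreover have "\<bar>growth_rate \<beta> - (1 + \<beta> * \<bar>ln \<beta>\<bar>)\<bar> \<le> 1 / 2 * (\<beta> * \<bar>ln \<beta>\<bar>)"
      using b(2)[of \<beta>] that by (simp add: abs_mult)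
    ultimately show ?thesis by linarith
  qed
  with b(1) show ?thesis by (intro exI[of _ "min b 1"]) auto
qed

section \<open>Coefficient integrals and Laplace's method\<close>

lemma integral_cis:
  "(LBINT \<theta>. indicator {-pi..pi} \<theta> *\<^sub>R cis (of_int k * \<theta>)) = (if k = 0 then complex_of_real (2 * pi) else 0)"
proof (cases "k = 0")
  case True
  then show ?thesis by (simp add: scaleR_conv_of_real)
next
  case False
  have "(LBINT \<theta>. indicator {-pi..pi} \<theta> *\<^sub>R cis (of_int k * \<theta>)) =
      cis (of_int k * pi) / (\<i> * of_int k) - cis (of_int k * (- pi)) / (\<i> * of_int k)"
  proof (rule integral_FTC_atLeastAtMost)
    fix x :: real
    have "((\<lambda>\<theta>. exp (\<i> * (of_int k * of_real \<theta>)) / (\<i> * of_int k)) has_vector_derivative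
        exp (\<i> * (of_int k * of_real x))) (at x within {-pi..pi})"
      using False by (auto intro!: derivative_eq_intros has_vector_derivative_real_field simp: algebra_simps)
    then show "((\<lambda>\<theta>. cis (of_int k * \<theta>) / (\<i> * of_int k)) has_vector_derivative cis (of_int k * x))
        (at x within {-pi..pi})" by (simp add: cis_conv_exp)
  qed (auto intro!: continuous_intros)
  also have "cis (of_int k * (- pi)) = cis (of_int k * pi)"
  proof -
    have "cis (of_int k * pi) = cis (of_int k * (- pi)) * cis (2 * pi * of_int k)"
      unfolding cis_mult by (rule arg_cong[of _ _ cis]) (simp add: algebra_simps)
    also have "cis (2 * pi * of_int k) = 1" by (simp add: cis_multiple_2pi)
    finally show ?thesis by simp
  qed
  finally show ?thesis using False by simp
qed

text \<open>Integrates the power series term by term over the circle of radius r. As a Lebesgue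
  integral over the angle, the result is open to Fubini and to dominated convergence.\<close>

theorem fps_nth_integral:
  assumes "f has_fps_expansion F" "f holomorphic_on ball 0 R" "0 < r" "r < R"
  shows "F $ n = (LBINT \<theta>. indicator {-pi..pi} \<theta> *\<^sub>R (f (of_real r * cis \<theta>) * cis (- real n * \<theta>))) /
    of_real (2 * pi * r ^ n)"
proof -
  define h where "h m \<theta> = indicator {-pi..pi} \<theta> *\<^sub>R (F $ m * (of_real r * cis \<theta>) ^ m * cis (- real n * \<theta>))" for m \<theta>
  have sums: "(\<lambda>m. F $ m * z ^ m) sums f z" if "norm z < R" for z
    using has_fps_expansion_imp_sums_complex[OF assms(1), of "ereal R" z] assms(2) that by simp
  have abs: "summable (\<lambda>m. norm (F $ m) * r ^ m)"
  proof -
    have "ereal R \<le> fps_conv_radius F"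
      using assms(1,2) by (intro holomorphic_on_imp_fps_conv_radius_ge) simp_all
    then have "ereal (norm (of_real r :: complex)) < fps_conv_radius F" using assms(3,4)
      by (simp add: less_le_trans[of "ereal r" "ereal R"])
    from norm_summable_fps[OF this] show ?thesis using assms(3) by (simp add: norm_mult norm_power)
  qed
  have nh: "norm (h m \<theta>) = indicator {-pi..pi} \<theta> *\<^sub>R (norm (F $ m) * r ^ m)" for m \<theta>
    using assms(3) by (simp add: h_def norm_mult norm_power indicator_def)
  have int: "integrable lborel (h m)" for m
    unfolding h_def by (intro borel_integrable_compact continuous_intros) auto
  have hI: "(LBINT \<theta>. h m \<theta>) = (if m = n then of_real (2 * pi * r ^ n) * F $ n else 0)" for m
  proof -
    have "cis \<theta> ^ m * cis (- real n * \<theta>) = cis (of_int (int m - int n) * \<theta>)" for \<theta>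
      by (simp only: Complex.DeMoivre cis_mult) (simp add: algebra_simps)
    then have hm: "h m \<theta> = (F $ m * of_real r ^ m) * (indicator {-pi..pi} \<theta> *\<^sub>R cis (of_int (int m - int n) * \<theta>))" for \<theta>
      by (simp add: h_def power_mult_distrib scaleR_conv_of_real)
    have "(LBINT \<theta>. h m \<theta>) = (F $ m * of_real r ^ m) * (if int m - int n = 0 then of_real (2 * pi) else 0)"
      unfolding hm integral_mult_right_zero integral_cis ..
    then show ?thesis by simp
  qed
  have suminf: "(\<Sum>m. h m \<theta>) = indicator {-pi..pi} \<theta> *\<^sub>R (f (of_real r * cis \<theta>) * cis (- real n * \<theta>))" for \<theta>
  proof -
    have "(\<lambda>m. F $ m * (of_real r * cis \<theta>) ^ m) sums f (of_real r * cis \<theta>)"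
      by (rule sums) (use assms(3,4) in \<open>simp add: norm_mult\<close>)
    from sums_scaleR_right[OF sums_mult2[OF this, of "cis (- real n * \<theta>)"], of "indicator {-pi..pi} \<theta>"]
    show ?thesis by (simp add: h_def sums_iff)
  qed
  have "(\<lambda>m. LBINT \<theta>. h m \<theta>) sums (LBINT \<theta>. (\<Sum>m. h m \<theta>))"
  proof (rule sums_integral[OF int])
    show "AE \<theta> in lborel. summable (\<lambda>m. norm (h m \<theta>))"
      unfolding nh by (intro AE_I2 summable_scaleR_right abs)
    have "(LBINT \<theta>. norm (h m \<theta>)) = 2 * pi * (norm (F $ m) * r ^ m)" for m
      unfolding nh by simp
    then show "summable (\<lambda>m. LBINT \<theta>. norm (h m \<theta>))" using abs by (simp add: summable_mult)
  qed
  moreover have "(\<lambda>m. LBINT \<theta>. h m \<theta>) sums (of_real (2 * pi * r ^ n) * F $ n)"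
    unfolding hI by (rule sums_single)
  ultimately have "(LBINT \<theta>. (\<Sum>m. h m \<theta>)) = of_real (2 * pi * r ^ n) * F $ n" by (rule sums_unique2)
  then show ?thesis using assms(3) unfolding suminf by simp
qed

section \<open>Laplace's method\<close>

lemma lborel_integral_scale:
  fixes h :: "'a :: euclidean_space \<Rightarrow> complex"
  assumes "0 < c" "h \<in> borel_measurable borel"
  shows "integral\<^sup>L lborel h = of_real (c ^ DIM('a)) * (LBINT x. h (c *\<^sub>R x))"
proof -
  have "integral\<^sup>L lborel h = integral\<^sup>L (density (distr lborel borel (\<lambda>x. 0 + c *\<^sub>R x)) (\<lambda>_. \<bar>c\<bar> ^ DIM('a))) h"
    by (subst lborel_affine[of c 0]) (use assms in auto)
  also have "\<dots> = integral\<^sup>L (distr lborel borel (\<lambda>x. 0 + c *\<^sub>R x)) (\<lambda>x. \<bar>c\<bar> ^ DIM('a) *\<^sub>R h x)"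
    by (rule integral_density) (use assms in auto)
  also have "\<dots> = (LBINT x. \<bar>c\<bar> ^ DIM('a) *\<^sub>R h (0 + c *\<^sub>R x))"
    by (rule integral_distr) (use assms in auto)
  also have "\<dots> = of_real (c ^ DIM('a)) * (LBINT x. h (c *\<^sub>R x))"
    using assms(1) by (simp add: scaleR_conv_of_real)
  finally show ?thesis .
qed

text \<open>Substituting v / sqrt N turns the bound into a fixed Gaussian, which dominates. It is
  enough that Q contains a ball about 0, since v / sqrt N enters this ball eventually for each fixed
  v.\<close>

theorem laplace_integral:
  fixes F :: "nat \<Rightarrow> 'a :: euclidean_space \<Rightarrow> complex" and N :: "nat \<Rightarrow> real"
  assumes N: "filterlim N at_top sequentially"
    and meas: "\<And>j. (\<lambda>v. indicator Q v *\<^sub>R F j v) \<in> borel_measurable borel"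
    and G: "G \<in> borel_measurable borel"
    and bound: "\<forall>\<^sub>F j in sequentially. \<forall>v\<in>Q. norm (F j v) \<le> K * exp (- (c * N j * (norm v)\<^sup>2))"
    and int: "integrable lborel (\<lambda>v :: 'a. exp (- (c * (norm v)\<^sup>2)))"
    and lim: "\<And>v. (\<lambda>j. F j (v /\<^sub>R sqrt (N j))) \<longlonglongrightarrow> G v"
    and Q: "e > 0" "ball 0 e \<subseteq> Q"
  shows "(\<lambda>j. of_real (sqrt (N j) ^ DIM('a)) * (LBINT v. indicator Q v *\<^sub>R F j v)) \<longlonglongrightarrow> integral\<^sup>L lborel G"
proof -
  have "\<forall>\<^sub>F j in sequentially. N j > 0" using N by (simp add: filterlim_at_top_dense)
  with bound have "\<forall>\<^sub>F j in sequentially. N j > 0 \<and>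
      (\<forall>v\<in>Q. norm (F j v) \<le> K * exp (- (c * N j * (norm v)\<^sup>2)))" by eventually_elim simp
  \<comment> \<open>Shifting the sequence by J makes the bound and the positivity of N hold for all
    indices, as dominated convergence demands.\<close>
  then obtain J where J: "\<And>j. j \<ge> J \<Longrightarrow> N j > 0"
    "\<And>j v. j \<ge> J \<Longrightarrow> v \<in> Q \<Longrightarrow> norm (F j v) \<le> K * exp (- (c * N j * (norm v)\<^sup>2))"
    unfolding eventually_sequentially by blast
  define h where "h j v = indicator Q v *\<^sub>R F j v" for j v
  define s where "s j v = h (j + J) (v /\<^sub>R sqrt (N (j + J)))" for j v
  have m: "h j \<in> borel_measurable borel" for j unfolding h_def by (rule meas)
  have "norm (F J 0) \<le> K * exp (- (c * N J * (norm (0::'a))\<^sup>2))" using J(2)[of J 0] Q(1) subsetD[OF Q(2), of 0] by simp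
  then have "0 \<le> K" using norm_ge_zero[of "F J 0"] by (simp del: norm_ge_zero)
  have "(\<lambda>j. LBINT v. s j v) \<longlonglongrightarrow> integral\<^sup>L lborel G"
  proof (rule integral_dominated_convergence[where w = "\<lambda>v. K * exp (- (c * (norm v)\<^sup>2))"])
    show "G \<in> borel_measurable lborel" using G by simp
    show "s j \<in> borel_measurable lborel" for j
      unfolding s_def using measurable_compose[OF _ m[of "j + J"], of "\<lambda>v. v /\<^sub>R sqrt (N (j + J))" borel] by simp
    show "integrable lborel (\<lambda>v. K * exp (- (c * (norm (v::'a))\<^sup>2)))" using int by simp
    show "AE v in lborel. (\<lambda>j. s j v) \<longlonglongrightarrow> G v"
    proof (rule AE_I2)
      fix v :: 'a
      have "(\<lambda>j. v /\<^sub>R sqrt (N j)) \<longlonglongrightarrow> 0"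
      proof -
        have "filterlim (\<lambda>j. sqrt (N j)) at_top sequentially"
          by (rule filterlim_compose[OF sqrt_at_top N])
        then have "(\<lambda>j. inverse (sqrt (N j))) \<longlonglongrightarrow> 0" by (rule tendsto_inverse_0_at_top)
        from tendsto_scaleR[OF this tendsto_const[of v]] show ?thesis by simp
      qed
      then have "\<forall>\<^sub>F j in sequentially. v /\<^sub>R sqrt (N j) \<in> ball 0 e"
        using Q(1) by (auto simp: tendsto_iff dist_commute)
      then have "\<forall>\<^sub>F j in sequentially. F j (v /\<^sub>R sqrt (N j)) = h j (v /\<^sub>R sqrt (N j))"
        unfolding h_def by eventually_elim (simp only: subsetD[OF Q(2)] indicator_simps scaleR_one)
      from Lim_transform_eventually[OF lim this] have "(\<lambda>j. h j (v /\<^sub>R sqrt (N j))) \<longlonglongrightarrow> G v" .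
      then show "(\<lambda>j. s j v) \<longlonglongrightarrow> G v" unfolding s_def by (rule LIMSEQ_ignore_initial_segment)
    qed
    show "AE v in lborel. norm (s j v) \<le> K * exp (- (c * (norm v)\<^sup>2))" for j
    proof (rule AE_I2)
      fix v :: 'a
      let ?u = "v /\<^sub>R sqrt (N (j + J))"
      have n: "N (j + J) > 0" using J(1) by simp
      show "norm (s j v) \<le> K * exp (- (c * (norm v)\<^sup>2))"
      proof (cases "?u \<in> Q")
        case True
        have "norm (s j v) \<le> K * exp (- (c * N (j + J) * (norm ?u)\<^sup>2))"
          using J(2)[of "j + J" ?u] True by (simp add: s_def h_def)
        also have "c * N (j + J) * (norm ?u)\<^sup>2 = c * (norm v)\<^sup>2"
          using n by (simp add: power_mult_distrib power_divide divide_inverse power_inverse)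
        finally show ?thesis .
      qed (use \<open>0 \<le> K\<close> in \<open>simp add: s_def h_def\<close>)
    qed
  qed
  moreover have "(LBINT v. s j v) = of_real (sqrt (N (j + J)) ^ DIM('a)) * (LBINT v. h (j + J) v)" for j
  proof -
    let ?c = "inverse (sqrt (N (j + J)))"
    have c: "0 < ?c" using J(1)[of "j + J"] by simp
    have "(LBINT v. h (j + J) v) = of_real (?c ^ DIM('a)) * (LBINT v. s j v)"
      unfolding s_def by (rule lborel_integral_scale[OF c m])
    moreover have "sqrt (N (j + J)) ^ DIM('a) * ?c ^ DIM('a) = 1"
      using c by (simp flip: power_mult_distrib)
    then have "complex_of_real (sqrt (N (j + J)) ^ DIM('a)) * of_real (?c ^ DIM('a)) = 1"
      by (simp only: of_real_mult[symmetric] of_real_1)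
    ultimately show ?thesis by (simp only: mult.assoc[symmetric] mult_1_left)
  qed
  ultimately have "(\<lambda>j. of_real (sqrt (N (j + J)) ^ DIM('a)) * (LBINT v. h (j + J) v)) \<longlonglongrightarrow> integral\<^sup>L lborel G"
    by simp
  from LIMSEQ_offset[OF this] show ?thesis by (simp add: h_def)
qed

section \<open>Gaussian integrals in dimensions one and two\<close>

lemma has_bochner_integral_gaussian:
  fixes c m :: real assumes "0 < c"
  shows "has_bochner_integral lborel (\<lambda>x. exp (- (c * (x - m)\<^sup>2 / 2))) (sqrt (2 * pi / c))"
proof -
  define \<sigma> where "\<sigma> = 1 / sqrt c"
  have \<sigma>: "0 < \<sigma>" "\<sigma>\<^sup>2 = 1 / c" using assms by (auto simp: \<sigma>_def power_divide)
  have "has_bochner_integral lborel (normal_density m \<sigma>) 1"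
    using integrable_normal_density[OF \<sigma>(1)] integral_normal_density[OF \<sigma>(1)]
    by (simp add: has_bochner_integral_iff)
  then have "has_bochner_integral lborel (\<lambda>x. sqrt (2 * pi / c) * normal_density m \<sigma> x) (sqrt (2 * pi / c) * 1)"
    by (rule has_bochner_integral_mult_right)
  moreover have "sqrt (2 * pi / c) * normal_density m \<sigma> x = exp (- (c * (x - m)\<^sup>2 / 2))" for x
    using assms unfolding normal_density_def \<sigma>(2) by simp
  ultimately show ?thesis by simp
qed

text \<open>Completing the square in the second variable leaves e = (a d - b^2) / d as coefficient
  of the first. The integrand is positive, so Tonelli gives integrability and value at once.\<close>

lemma has_bochner_integral_gaussian2:
  fixes a b d :: real assumes "0 < d" "0 < a * d - b\<^sup>2"
  shows "has_bochner_integral lborel (\<lambda>v :: real \<times> real. exp (- ((a * (fst v)\<^sup>2 + 2 * b * fst v * snd v + d * (snd v)\<^sup>2) / 2)))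
    (2 * pi / sqrt (a * d - b\<^sup>2))"
proof (rule has_bochner_integral_nn_integral)
  let ?g = "\<lambda>v :: real \<times> real. exp (- ((a * (fst v)\<^sup>2 + 2 * b * fst v * snd v + d * (snd v)\<^sup>2) / 2))"
  define e where "e = (a * d - b\<^sup>2) / d"
  have e: "0 < e" using assms by (simp add: e_def)
  have "?g \<in> borel_measurable borel"
    by (intro borel_measurable_continuous_onI continuous_intros) auto
  then show meas: "?g \<in> borel_measurable lborel" by simp
  have split: "?g (x, y) = exp (- (e * (x - 0)\<^sup>2 / 2)) * exp (- (d * (y - (- (b * x / d)))\<^sup>2 / 2))" for x y
  proof -
    have "a * x\<^sup>2 + 2 * b * x * y + d * y\<^sup>2 = e * x\<^sup>2 + d * (y + b * x / d)\<^sup>2"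
      using assms by (simp add: e_def field_simps power2_eq_square)
    then show ?thesis by (simp add: exp_add[symmetric] add_divide_distrib)
  qed
  have g1: "(\<integral>\<^sup>+y. ennreal (exp (- (c * (y - m)\<^sup>2 / 2))) \<partial>lborel) = ennreal (sqrt (2 * pi / c))"
    if "0 < c" for c m :: real
    using has_bochner_integral_gaussian[OF that, of m]
    by (subst nn_integral_eq_integral) (auto simp: has_bochner_integral_iff)
  have "(\<integral>\<^sup>+v. ?g v \<partial>lborel) = (\<integral>\<^sup>+v. ?g v \<partial>(lborel \<Otimes>\<^sub>M lborel))"
    by (simp add: lborel_prod)
  also have "\<dots> = (\<integral>\<^sup>+x. \<integral>\<^sup>+y. ?g (x, y) \<partial>lborel \<partial>lborel)"
    by (rule lborel.nn_integral_fst[symmetric]) (use meas in \<open>simp add: lborel_prod\<close>)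
  also have "\<dots> = (\<integral>\<^sup>+x. ennreal (exp (- (e * (x - 0)\<^sup>2 / 2))) * ennreal (sqrt (2 * pi / d)) \<partial>lborel)"
  proof (intro nn_integral_cong)
    fix x :: real
    have "(\<integral>\<^sup>+y. ?g (x, y) \<partial>lborel) = (\<integral>\<^sup>+y. ennreal (exp (- (e * (x - 0)\<^sup>2 / 2))) *
        ennreal (exp (- (d * (y - (- (b * x / d)))\<^sup>2 / 2))) \<partial>lborel)"
      unfolding split by (simp only: ennreal_mult exp_ge_zero)
    also have "\<dots> = ennreal (exp (- (e * (x - 0)\<^sup>2 / 2))) *
        (\<integral>\<^sup>+y. ennreal (exp (- (d * (y - (- (b * x / d)))\<^sup>2 / 2))) \<partial>lborel)"
      by (rule nn_integral_cmult) measurable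
    finally show "(\<integral>\<^sup>+y. ?g (x, y) \<partial>lborel) =
        ennreal (exp (- (e * (x - 0)\<^sup>2 / 2))) * ennreal (sqrt (2 * pi / d))"
      unfolding g1[OF assms(1)] .
  qed
  also have "\<dots> = ennreal (sqrt (2 * pi / e)) * ennreal (sqrt (2 * pi / d))"
    by (subst nn_integral_multc) (simp_all add: g1[OF e, of 0, simplified])
  also have "\<dots> = ennreal (sqrt (2 * pi / e) * sqrt (2 * pi / d))" using e assms by (simp add: ennreal_mult)
  also have "sqrt (2 * pi / e) * sqrt (2 * pi / d) = sqrt ((2 * pi)\<^sup>2 / (a * d - b\<^sup>2))"
    using assms by (simp add: e_def real_sqrt_mult[symmetric] power2_eq_square)
  also have "\<dots> = 2 * pi / sqrt (a * d - b\<^sup>2)" by (simp only: real_sqrt_divide real_sqrt_abs) simp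
  finally show "(\<integral>\<^sup>+v. ?g v \<partial>lborel) = ennreal (2 * pi / sqrt (a * d - b\<^sup>2))" .
qed (use assms in auto)

section \<open>Integral representation of the counts\<close>

definition cot_z :: "complex \<Rightarrow> complex" where "cot_z t = 2 * t + 1 - exp t"
definition mark_s :: "complex \<Rightarrow> complex \<Rightarrow> complex" where
  "mark_s t x = x - (exp t - 1) * (exp x - 1)"
text \<open>Defined by its power series, which makes it entire and gives the value 1 at 0 without a
  case distinction.\<close>

definition exp_quot :: "complex \<Rightarrow> complex" where "exp_quot = eval_fps exp_quot_fps"

lemma exp_quot_conv_radius: "fps_conv_radius exp_quot_fps = \<infinity>"
proof -
  have eq: "exp_quot_fps = fps_shift 1 (fps_exp 1 - 1)"
    unfolding X_mult_exp_quot_fps[symmetric] by (rule fps_ext) simp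
  have "fps_conv_radius (fps_exp 1 - 1 :: complex fps) \<ge> \<infinity>"
    using fps_conv_radius_diff[of "fps_exp (1::complex)" 1] by simp
  then have r: "fps_conv_radius (fps_exp 1 - 1 :: complex fps) = \<infinity>" by simp
  show ?thesis unfolding eq fps_conv_radius_shift r ..
qed

lemma exp_quot_sums: "(\<lambda>n. x ^ n / fact (Suc n)) sums exp_quot x"
proof -
  have "exp_quot_fps $ n * x ^ n = x ^ n / fact (Suc n)" for n by (simp add: exp_quot_fps_def)
  with sums_eval_fps[of x exp_quot_fps] show ?thesis
    by (simp add: exp_quot_conv_radius exp_quot_def del: fact_Suc)
qed

lemma exp_quot_holomorphic: "exp_quot holomorphic_on S"
  unfolding exp_quot_def by (intro holomorphic_intros) (simp add: exp_quot_conv_radius)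

lemma exp_quot_has_fps_expansion: "exp_quot has_fps_expansion exp_quot_fps"
  unfolding exp_quot_def by (intro eval_fps_has_fps_expansion) (simp add: exp_quot_conv_radius)

lemma mult_exp_quot: "x * exp_quot x = exp x - 1"
proof -
  have "eval_fps (fps_X * exp_quot_fps) x = eval_fps (fps_exp 1 - 1) x"
    by (simp only: X_mult_exp_quot_fps)
  then show ?thesis
    by (subst (asm) eval_fps_mult) (simp_all add: exp_quot_conv_radius eval_fps_diff exp_quot_def)
qed

lemma exp_quot_of_real: "exp_quot (of_real r) = of_real ((exp r - 1) / r)" if "r \<noteq> 0"
  using mult_exp_quot[of "of_real r"] that by (simp add: exp_of_real[symmetric] field_simps)

lemma exp_quot_real_sums: "r \<noteq> 0 \<Longrightarrow> (\<lambda>n. r ^ n / fact (Suc n)) sums ((exp r - 1) / r)" for r :: real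
proof -
  assume "r \<noteq> 0"
  have "(\<lambda>n. complex_of_real (r ^ n / fact (Suc n))) sums complex_of_real ((exp r - 1) / r)"
    using exp_quot_sums[of "of_real r"] unfolding exp_quot_of_real[OF \<open>r \<noteq> 0\<close>]
    by (simp only: of_real_power of_real_divide of_real_fact)
  then show ?thesis by (simp only: sums_of_real_iff)
qed

section \<open>Bounds for z and s on circles about the origin\<close>

lemma norm_exp_quot_le:
  assumes "norm x \<le> r" "0 < r" shows "norm (exp_quot x) \<le> (exp r - 1) / r"
proof (rule norm_sums_le[OF exp_quot_sums exp_quot_real_sums])
  show "norm (x ^ n / fact (Suc n)) \<le> r ^ n / fact (Suc n)" for n
    unfolding norm_divide norm_power norm_fact using assms by (intro divide_right_mono power_mono) auto
qed (use assms in auto)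

text \<open>Nonnegative coefficients give the value at r as a bound; the gain comes from the two
  lowest terms. With y = r / (2 + r) (1 - cos \<theta>), the squared modulus of 1 + t / 2 is (1 + r
  / 2)^2 - (2 + r) y, which is at most (1 + r / 2 - y)^2.\<close>

lemma norm_exp_quot_cis_le:
  assumes "0 < r"
  shows "norm (exp_quot (of_real r * cis \<theta>)) \<le> (exp r - 1) / r - r / (2 + r) * (1 - cos \<theta>)"
proof -
  define t where "t = of_real r * cis \<theta>"
  have nt: "norm t = r" using assms by (simp add: t_def norm_mult)
  have "(\<lambda>n. t ^ (n + 2) / fact (Suc (n + 2))) sums (exp_quot t - (\<Sum>n<2. t ^ n / fact (Suc n)))"
    using exp_quot_sums[of t] by (subst sums_iff_shift) simp
  moreover have "(\<lambda>n. r ^ (n + 2) / fact (Suc (n + 2))) sums ((exp r - 1) / r - (\<Sum>n<2. r ^ n / fact (Suc n)))"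
    using exp_quot_real_sums[of r] assms by (subst sums_iff_shift) simp
  ultimately have "norm (exp_quot t - (\<Sum>n<2. t ^ n / fact (Suc n))) \<le>
      (exp r - 1) / r - (\<Sum>n<2. r ^ n / fact (Suc n))"
    by (rule norm_sums_le) (simp add: norm_divide norm_power norm_fact nt norm_mult del: fact_Suc power_Suc)
  then have 1: "norm (exp_quot t - (1 + t / 2)) \<le> (exp r - 1) / r - (1 + r / 2)"
    by (simp add: numeral_2_eq_2 lessThan_Suc fact_numeral add.commute)
  define y where "y = r / (2 + r) * (1 - cos \<theta>)"
  have "y \<le> r / (2 + r) * 2" unfolding y_def using assms cos_ge_minus_one[of \<theta>]
    by (intro mult_left_mono) auto
  also have "\<dots> \<le> 1 + r / 2"
  proof -
    have "(1 + r / 2) * (2 + r) = 2 + 2 * r + r * r / 2" by (simp add: field_simps)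
    then have "r * 2 \<le> (1 + r / 2) * (2 + r)" by simp
    then show ?thesis using assms by (simp add: pos_divide_le_eq)
  qed
  finally have y: "y \<le> 1 + r / 2" .
  have "(norm (1 + t / 2))\<^sup>2 = (1 + r / 2 * cos \<theta>)\<^sup>2 + (r / 2 * sin \<theta>)\<^sup>2"
    unfolding cmod_power2 by (simp add: t_def)
  also have "\<dots> = 1 + r * cos \<theta> + (r / 2)\<^sup>2 * ((sin \<theta>)\<^sup>2 + (cos \<theta>)\<^sup>2)"
  proof -
    have "(1 + r / 2 * c)\<^sup>2 + (r / 2 * s)\<^sup>2 = 1 + r * c + (r / 2)\<^sup>2 * (s\<^sup>2 + c\<^sup>2)" for c s :: real
      by (simp add: field_simps power2_eq_square)
    then show ?thesis .
  qed
  also have "\<dots> = (1 + r / 2)\<^sup>2 - (2 + r) * y"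
    using assms by (simp add: y_def field_simps power2_eq_square)
  also have "\<dots> \<le> (1 + r / 2 - y)\<^sup>2"
    by (simp add: power2_eq_square algebra_simps)
  finally have "norm (1 + t / 2) \<le> 1 + r / 2 - y" by (rule power2_le_imp_le) (use y in simp)
  with 1 have "norm (exp_quot t) \<le> (exp r - 1) / r - y"
    using norm_triangle_ineq[of "exp_quot t - (1 + t / 2)" "1 + t / 2"] by simp
  then show ?thesis by (simp add: y_def t_def)
qed

text \<open>1 - cos \<theta> = 2 (sin y)^2 for y = |\<theta>| / 2, and y^2 \<le> 3 turns sin y \<ge>
  y - y^3 / 6 into sin y \<ge> y / 2.\<close>

lemma one_minus_cos_ge:
  assumes "\<bar>\<theta>\<bar> \<le> pi" shows "\<theta>\<^sup>2 / 8 \<le> 1 - cos \<theta>"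
proof -
  define y where "y = \<bar>\<theta>\<bar> / 2"
  have y: "0 \<le> y" "y \<le> pi / 2" using assms by (auto simp: y_def)
  have "y\<^sup>2 \<le> (8 / 5)\<^sup>2" by (rule power_mono) (use y pi_less_4 pi_approx in auto)
  then have y2: "y\<^sup>2 \<le> 3" by (simp add: power2_eq_square)
  have "\<bar>sin y - (\<Sum>m<3. sin_coeff m * y ^ m)\<bar> \<le> inverse (fact 3) * \<bar>y\<bar> ^ 3"
    by (rule Maclaurin_sin_bound)
  then have "\<bar>sin y - y\<bar> \<le> y ^ 3 / 6"
    using y by (simp add: sin_coeff_def numeral_3_eq_3 lessThan_Suc fact_numeral)
  moreover have "y ^ 3 / 6 = y * (y\<^sup>2 / 6)" by (simp add: power2_eq_square power3_eq_cube)
  moreover have "y * (y\<^sup>2 / 6) \<le> y * (1 / 2)" using y2 y by (intro mult_left_mono) auto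
  ultimately have "y / 2 \<le> sin y" by linarith
  then have "(y / 2)\<^sup>2 \<le> (sin y)\<^sup>2" using y by (intro power_mono) auto
  moreover have "1 - cos \<theta> = 2 * (sin y)\<^sup>2"
  proof -
    have "cos \<theta> = cos (2 * y)" by (simp add: y_def)
    then show ?thesis by (simp add: cos_double_sin)
  qed
  ultimately show ?thesis by (simp add: y_def power_divide)
qed

text \<open>Converts the decay 1 / (1 + y) into an exponential one, which survives high powers. The
  range y \<le> 2 is what (1 + y) (1 - y / 3) \<ge> 1 amounts to.\<close>

lemma inverse_le_exp:
  fixes y :: real assumes "0 \<le> y" "y \<le> 2" shows "1 / (1 + y) \<le> exp (- (y / 3))"
proof -
  have "exp (y / 3) \<le> 1 / (1 - y / 3)"
  proof -
    have "1 - y / 3 \<le> exp (- (y / 3))" using exp_ge_add_one_self[of "- (y / 3)"] by simp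
    then show ?thesis using assms by (simp add: exp_minus field_simps)
  qed
  also have "\<dots> \<le> 1 + y" using assms
  proof -
    have "(1 + y) * (1 - y / 3) = 1 + y * (2 - y) / 3" by (simp add: field_simps)
    moreover have "0 \<le> y * (2 - y)" using assms by simp
    ultimately show ?thesis using assms by (simp add: divide_le_eq)
  qed
  finally show ?thesis using assms by (simp add: exp_minus field_simps)
qed

definition sp_t :: "real \<Rightarrow> real" where "sp_t w = ln (1 + w)"
definition sp_x :: "real \<Rightarrow> real" where "sp_x w = - ln w"

lemma sp_tx:
  assumes "0 < w" "w < 1"
  shows "0 < sp_t w" "sp_t w < ln 2" "sp_t w < 1" "0 < sp_x w" "exp (sp_t w) = 1 + w" "exp (sp_x w) = 1 / w"
proof -
  show "0 < sp_t w" "0 < sp_x w" "exp (sp_t w) = 1 + w" "exp (sp_x w) = 1 / w"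
    using assms by (auto simp: sp_t_def sp_x_def exp_minus divide_inverse)
  show "sp_t w < ln 2" using assms by (simp add: sp_t_def)
  then show "sp_t w < 1" using ln_2_less_1 by linarith
qed

lemma cot_z_eq: "cot_z t = t * (2 - exp_quot t)"
  using mult_exp_quot[of t] by (simp add: cot_z_def algebra_simps)

lemma mark_s_eq: "mark_s t x = x * (1 - (exp t - 1) * exp_quot x)"
proof -
  have "exp x = 1 + x * exp_quot x" by (simp add: mult_exp_quot)
  then show ?thesis unfolding mark_s_def by (simp add: algebra_simps)
qed

lemma norm_exp_minus_one_le: "norm (exp t - 1) \<le> exp (norm t) - 1" for t :: complex
proof (cases "t = 0")
  case False
  have "norm (exp t - 1) = norm t * norm (exp_quot t)" by (simp add: mult_exp_quot[symmetric] norm_mult)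
  also have "\<dots> \<le> norm t * ((exp (norm t) - 1) / norm t)"
    by (rule mult_left_mono) (use norm_exp_quot_le[of t "norm t"] False in auto)
  finally show ?thesis using False by simp
qed simp

text \<open>As z(t) = t (2 - \<open>exp_quot t\<close>), a loss in \<open>exp_quot\<close> is a gain
  in z. The inequality z(r) \<le> r turns the additive gain into a factor.\<close>

lemma norm_cot_z_ge:
  assumes r: "0 < r"
  shows "(2 * r + 1 - exp r) * (1 + r / (2 + r) * (1 - cos \<theta>)) \<le> norm (cot_z (of_real r * cis \<theta>))"
proof -
  define t where "t = of_real r * cis \<theta>"
  define y where "y = r / (2 + r) * (1 - cos \<theta>)"
  have y: "0 \<le> y" using r by (simp add: y_def)
  have "2 * r + 1 - exp r \<le> r" using exp_ge_add_one_self[of r] by linarith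
  then have "(2 * r + 1 - exp r) * y \<le> r * y" using y by (rule mult_right_mono)
  then have "(2 * r + 1 - exp r) * (1 + y) \<le> (2 * r + 1 - exp r) + r * y"
    by (simp only: distrib_left mult_1_right)
  also have "\<dots> = r * (2 - ((exp r - 1) / r - y))"
  proof -
    have "r * (2 - (A / r - y)) = 2 * r - A + r * y" for A using r by (simp add: field_simps)
    then show ?thesis by simp
  qed
  also have "\<dots> \<le> r * (2 - norm (exp_quot t))"
    using norm_exp_quot_cis_le[OF r, of \<theta>] r by (intro mult_left_mono) (auto simp: y_def t_def)
  also have "\<dots> \<le> r * norm (2 - exp_quot t)"
    using norm_triangle_ineq2[of 2 "exp_quot t"] r by (intro mult_left_mono) auto
  also have "\<dots> = norm (cot_z t)" using r by (simp add: cot_z_eq norm_mult t_def)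
  finally show ?thesis by (simp add: y_def t_def)
qed

lemma cot_z_nonzero_gen:
  assumes "0 < r" "0 < 2 * r + 1 - exp r" shows "cot_z (of_real r * cis \<theta>) \<noteq> 0"
proof -
  have "0 < (2 * r + 1 - exp r) * (1 + r / (2 + r) * (1 - cos \<theta>))"
    using assms by (intro mult_pos_pos add_pos_nonneg) auto
  with norm_cot_z_ge[OF assms(1), of \<theta>] show ?thesis by auto
qed

text \<open>The radius is kept general to serve both \<open>sp_t w\<close> and ln 2. The constant 24
  is 8 from \<open>one_minus_cos_ge\<close> times 3 from \<open>inverse_le_exp\<close>.\<close>

lemma norm_cot_z_quot_le_gen:
  assumes r: "0 < r" "r \<le> 1" and z: "0 < 2 * r + 1 - exp r"
  shows "norm (of_real (2 * r + 1 - exp r) / cot_z (of_real r * cis \<theta>)) \<le> 1"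
  "\<bar>\<theta>\<bar> \<le> pi \<Longrightarrow> norm (of_real (2 * r + 1 - exp r) / cot_z (of_real r * cis \<theta>)) \<le>
     exp (- (r / (24 * (2 + r)) * \<theta>\<^sup>2))"
proof -
  define z where "z = 2 * r + 1 - exp r"
  have z0: "0 < z" using assms by (simp add: z_def)
  define y where "y = r / (2 + r) * (1 - cos \<theta>)"
  have "r / (2 + r) * (1 - cos \<theta>) \<le> 1 * 2"
    by (rule mult_mono) (use r in auto)
  then have y: "0 \<le> y" "y \<le> 2" using r by (auto simp: y_def)
  have ge: "z * (1 + y) \<le> norm (cot_z (of_real r * cis \<theta>))"
    using norm_cot_z_ge[OF r(1), of \<theta>] by (simp only: y_def z_def)
  have "norm (of_real z / cot_z (of_real r * cis \<theta>)) \<le> z / (z * (1 + y))"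
    unfolding norm_divide using ge z0 y by (intro frac_le) auto
  also have "\<dots> = 1 / (1 + y)" using z0 by simp
  finally have *: "norm (of_real z / cot_z (of_real r * cis \<theta>)) \<le> 1 / (1 + y)" .
  also have "\<dots> \<le> 1" using y by simp
  finally show "norm (of_real (2 * r + 1 - exp r) / cot_z (of_real r * cis \<theta>)) \<le> 1" unfolding z_def .
  assume "\<bar>\<theta>\<bar> \<le> pi"
  have 1: "r / (2 + r) * (\<theta>\<^sup>2 / 8) \<le> y"
    unfolding y_def using one_minus_cos_ge[OF \<open>\<bar>\<theta>\<bar> \<le> pi\<close>] r by (intro mult_left_mono) auto
  have 2: "r / (24 * (2 + r)) * \<theta>\<^sup>2 = r / (2 + r) * (\<theta>\<^sup>2 / 8) / 3"
    using r by (simp add: field_simps)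
  have "r / (24 * (2 + r)) * \<theta>\<^sup>2 \<le> y / 3"
    unfolding 2 by (rule divide_right_mono[OF 1]) simp
  then have "exp (- (y / 3)) \<le> exp (- (r / (24 * (2 + r)) * \<theta>\<^sup>2))"
    by (simp only: exp_le_cancel_iff neg_le_iff_le)
  with inverse_le_exp[OF y] * show "norm (of_real (2 * r + 1 - exp r) / cot_z (of_real r * cis \<theta>)) \<le>
     exp (- (r / (24 * (2 + r)) * \<theta>\<^sup>2))"
    unfolding z_def by linarith
qed

context
  fixes w :: real assumes w: "0 < w" "w < 1"
begin

lemma sp_z_alt: "2 * sp_t w + 1 - exp (sp_t w) = sp_z w"
  using sp_tx(5)[OF w] by (simp add: sp_z_def sp_t_def)

lemma sp_s_alt: "sp_s w = sp_x w * (1 - w * ((exp (sp_x w) - 1) / sp_x w))" "sp_s w \<le> sp_x w"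
proof -
  note tx = sp_tx[OF w]
  show 1: "sp_s w = sp_x w * (1 - w * ((exp (sp_x w) - 1) / sp_x w))"
  proof -
    have a: "sp_x w * (1 - w * (A / sp_x w)) = sp_x w - w * A" for A using tx by (simp add: field_simps)
    have b: "w * (exp (sp_x w) - 1) = 1 - w" using tx w by (simp add: field_simps)
    show ?thesis unfolding a b by (simp add: sp_s_def sp_x_def)
  qed
  show "sp_s w \<le> sp_x w" using w by (simp add: sp_s_def sp_x_def)
qed

text \<open>On the circle of radius \<open>sp_t w\<close> the modulus of exp t - 1 is at most w, so
  \<theta> drops out and the gain is in \<psi> alone. The gain in \<theta> is provided by z.\<close>

lemma norm_mark_s_ge:
  "sp_s w * (1 + w * (sp_x w / (2 + sp_x w) * (1 - cos \<psi>))) \<le>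
     norm (mark_s (of_real (sp_t w) * cis \<theta>) (of_real (sp_x w) * cis \<psi>))"
proof -
  define r x t where "r = sp_x w" and "x = of_real r * cis \<psi>" and "t = of_real (sp_t w) * cis \<theta>"
  have r: "0 < r" using sp_tx[OF w] by (simp add: r_def)
  define y where "y = r / (2 + r) * (1 - cos \<psi>)"
  have y: "0 \<le> y" using r by (simp add: y_def)
  have nt: "norm t = sp_t w" using sp_tx[OF w] by (simp add: t_def norm_mult)
  then have ne: "norm (exp t - 1) \<le> w" using norm_exp_minus_one_le[of t] sp_tx[OF w] by simp
  have "sp_s w * (w * y) \<le> r * (w * y)"
    using sp_s_alt(2) y w unfolding r_def by (intro mult_right_mono) auto
  then have "sp_s w * (1 + w * y) \<le> sp_s w + r * (w * y)"
    by (simp add: distrib_left)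
  also have "\<dots> = r * (1 - w * ((exp r - 1) / r - y))"
    unfolding sp_s_alt(1) r_def[symmetric] by (simp add: algebra_simps)
  also have "\<dots> \<le> r * (1 - norm (exp t - 1) * norm (exp_quot x))"
  proof (intro mult_left_mono diff_left_mono)
    show "norm (exp t - 1) * norm (exp_quot x) \<le> w * ((exp r - 1) / r - y)"
      using norm_exp_quot_cis_le[OF r, of \<psi>] ne w by (intro mult_mono) (auto simp: y_def x_def)
  qed (use r in simp)
  also have "\<dots> \<le> r * norm (1 - (exp t - 1) * exp_quot x)"
    using norm_triangle_ineq2[of 1 "(exp t - 1) * exp_quot x"] r
    by (intro mult_left_mono) (auto simp: norm_mult)
  also have "\<dots> = norm (mark_s t x)" using r by (simp add: mark_s_eq norm_mult x_def)
  finally show ?thesis by (simp add: y_def r_def t_def x_def)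
qed

lemma cot_z_nonzero: "cot_z (of_real (sp_t w) * cis \<theta>) \<noteq> 0"
  using cot_z_nonzero_gen[of "sp_t w" \<theta>, unfolded sp_z_alt] sp_tx(1)[OF w] sp_bounds(2)[OF w] by simp

lemma mark_s_nonzero: "mark_s (of_real (sp_t w) * cis \<theta>) (of_real (sp_x w) * cis \<psi>) \<noteq> 0"
proof -
  have "0 < sp_s w * (1 + w * (sp_x w / (2 + sp_x w) * (1 - cos \<psi>)))"
    using sp_tx[OF w] sp_bounds[OF w] w by (intro mult_pos_pos add_pos_nonneg mult_nonneg_nonneg) auto
  with norm_mark_s_ge[of \<psi> \<theta>] show ?thesis by auto
qed

lemma norm_cot_z_quot_le:
  "norm (of_real (sp_z w) / cot_z (of_real (sp_t w) * cis \<theta>)) \<le> 1"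
  "\<bar>\<theta>\<bar> \<le> pi \<Longrightarrow> norm (of_real (sp_z w) / cot_z (of_real (sp_t w) * cis \<theta>)) \<le>
     exp (- (sp_t w / (24 * (2 + sp_t w)) * \<theta>\<^sup>2))"
  using norm_cot_z_quot_le_gen[of "sp_t w" \<theta>, unfolded sp_z_alt] sp_tx(1,3)[OF w] sp_bounds(2)[OF w] by simp_all

lemma norm_mark_s_quot_le:
  "norm (of_real (sp_s w) / mark_s (of_real (sp_t w) * cis \<theta>) (of_real (sp_x w) * cis \<psi>)) \<le> 1"
  "\<bar>\<psi>\<bar> \<le> pi \<Longrightarrow> norm (of_real (sp_s w) / mark_s (of_real (sp_t w) * cis \<theta>) (of_real (sp_x w) * cis \<psi>)) \<le>
     exp (- (w * sp_x w / (24 * (2 + sp_x w)) * \<psi>\<^sup>2))"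
proof -
  note tx = sp_tx[OF w]
  let ?S = "mark_s (of_real (sp_t w) * cis \<theta>) (of_real (sp_x w) * cis \<psi>)"
  define y where "y = w * (sp_x w / (2 + sp_x w) * (1 - cos \<psi>))"
  have "w * (sp_x w / (2 + sp_x w) * (1 - cos \<psi>)) \<le> 1 * (1 * 2)"
    by (intro mult_mono) (use tx w in auto)
  then have y: "0 \<le> y" "y \<le> 2" using tx w by (auto simp: y_def)
  note b = sp_bounds[OF w]
  have ge: "sp_s w * (1 + y) \<le> norm ?S" using norm_mark_s_ge[of \<psi> \<theta>] by (simp add: y_def)
  have "norm (of_real (sp_s w) / ?S) \<le> sp_s w / (sp_s w * (1 + y))"
    unfolding norm_divide using ge b y by (intro frac_le) auto
  also have "\<dots> = 1 / (1 + y)" using b by simp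
  finally have *: "norm (of_real (sp_s w) / ?S) \<le> 1 / (1 + y)" .
  also have "\<dots> \<le> 1" using y by simp
  finally show "norm (of_real (sp_s w) / ?S) \<le> 1" .
  assume "\<bar>\<psi>\<bar> \<le> pi"
  have 1: "w * (sp_x w / (2 + sp_x w) * (\<psi>\<^sup>2 / 8)) \<le> y"
    unfolding y_def using one_minus_cos_ge[OF \<open>\<bar>\<psi>\<bar> \<le> pi\<close>] tx w by (intro mult_left_mono) auto
  have 2: "w * sp_x w / (24 * (2 + sp_x w)) * \<psi>\<^sup>2 = w * (sp_x w / (2 + sp_x w) * (\<psi>\<^sup>2 / 8)) / 3"
    using tx by (simp add: field_simps)
  have "w * sp_x w / (24 * (2 + sp_x w)) * \<psi>\<^sup>2 \<le> y / 3"
    unfolding 2 by (rule divide_right_mono[OF 1]) simp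
  then have "exp (- (y / 3)) \<le> exp (- (w * sp_x w / (24 * (2 + sp_x w)) * \<psi>\<^sup>2))"
    by (simp only: exp_le_cancel_iff neg_le_iff_le)
  with inverse_le_exp[OF y] * show "norm (of_real (sp_s w) / ?S) \<le>
     exp (- (w * sp_x w / (24 * (2 + sp_x w)) * \<psi>\<^sup>2))"
    by linarith
qed

end


text \<open>What the two inversions leave besides the powers: exp t from passing to all cographs, z'
  = 2 - exp t, one factor t / z since the exponent there is p + 1, and exp x times the phase of x.
  The modulus of x goes into the constant of \<open>num_all_integral\<close>.\<close>

definition saddle_weight :: "real \<Rightarrow> real \<times> real \<Rightarrow> complex" where
  "saddle_weight w v = (let t = of_real (sp_t w) * cis (fst v); x = of_real (sp_x w) * cis (snd v) in
     exp t * (2 - exp t) * (t / cot_z t) * exp x * cis (snd v))"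

text \<open>Normalised by the values at the saddle point, so that it is 1 there and at most 1 in
  modulus on the whole torus.\<close>

definition saddle_pow :: "real \<Rightarrow> nat \<Rightarrow> nat \<Rightarrow> real \<times> real \<Rightarrow> complex" where
  "saddle_pow w p q v = (of_real (sp_z w) / cot_z (of_real (sp_t w) * cis (fst v))) ^ p *
     (of_real (sp_s w) / mark_s (of_real (sp_t w) * cis (fst v)) (of_real (sp_x w) * cis (snd v))) ^ q"

abbreviation torus :: "(real \<times> real) set" where "torus \<equiv> {-pi..pi} \<times> {-pi..pi}"

context
  fixes w :: real assumes w: "0 < w" "w < 1"
begin

lemma continuous_on_saddle: "continuous_on A (saddle_weight w)" "continuous_on A (saddle_pow w p q)"
  unfolding saddle_weight_def saddle_pow_def Let_def
  by (intro continuous_intros; use cot_z_nonzero[OF w] mark_s_nonzero[OF w] in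
      \<open>auto simp: cot_z_def mark_s_def intro!: continuous_intros\<close>)+

text \<open>The circle of radius \<open>sp_x w\<close> has to lie strictly inside a disc of
  holomorphy. At this radius 1 - w (exp x - 1) / x = s / x is still positive, hence also at some
  larger R, and the bound for \<open>exp_quot\<close> excludes zeros of the denominator in the disc
  of radius R.\<close>

lemma marked_coeff_integral:
  assumes "q \<ge> 1" "norm u \<le> w"
  shows "mark_coeff q u = (LBINT \<psi>. indicator {-pi..pi} \<psi> *\<^sub>R (exp (of_real (sp_x w) * cis \<psi>) *
      inverse (1 - u * exp_quot (of_real (sp_x w) * cis \<psi>)) ^ q * cis (- real (q - 1) * \<psi>))) /
      (of_real (2 * pi * sp_x w ^ (q - 1)) * of_nat q)"
proof -
  note tx = sp_tx[OF w]
  have "((\<lambda>R. 1 - w * ((exp R - 1) / R)) \<longlongrightarrow> 1 - w * ((exp (sp_x w) - 1) / sp_x w)) (at (sp_x w))"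
    using tx by (intro tendsto_intros) auto
  moreover have "0 < 1 - w * ((exp (sp_x w) - 1) / sp_x w)"
    using sp_bounds(6)[OF w] sp_s_alt(1)[OF w] tx(4) by (simp only: zero_less_mult_iff) auto
  ultimately have "\<forall>\<^sub>F R in at (sp_x w). 0 < 1 - w * ((exp R - 1) / R)" by (rule order_tendstoD(1))
  then obtain e where e: "e > 0" "\<And>R. R \<noteq> sp_x w \<Longrightarrow> dist R (sp_x w) < e \<Longrightarrow> 0 < 1 - w * ((exp R - 1) / R)"
    unfolding eventually_at by blast
  define R where "R = sp_x w + e / 2"
  have "0 < 1 - w * ((exp R - 1) / R)" by (rule e(2)) (use e(1) in \<open>auto simp: R_def dist_real_def\<close>)
  then have R: "sp_x w < R" "0 < R" "0 < 1 - w * ((exp R - 1) / R)"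
    using e(1) tx(4) by (auto simp: R_def)
  have nz: "1 - u * exp_quot x \<noteq> 0" if "norm x < R" for x
  proof -
    have "norm (u * exp_quot x) \<le> w * ((exp R - 1) / R)"
      unfolding norm_mult by (intro mult_mono norm_exp_quot_le) (use assms that R w in auto)
    also have "\<dots> < 1" using R(3) by linarith
    finally have "norm (u * exp_quot x) < 1" .
    then show ?thesis by auto
  qed
  have "(\<lambda>x. exp x * inverse (1 - u * exp_quot x) ^ q) has_fps_expansion
      (fps_exp 1 * inverse (1 - fps_const u * exp_quot_fps) ^ q)"
    using nz[of 0] R
    by (intro fps_expansion_intros exp_quot_has_fps_expansion)
      (use nz[of 0] exp_quot_sums[of 0] in \<open>auto simp: exp_quot_fps_0 exp_quot_def eval_fps_at_0\<close>)
  moreover have "(\<lambda>x. exp x * inverse (1 - u * exp_quot x) ^ q) holomorphic_on ball 0 R"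
    using nz by (intro holomorphic_intros exp_quot_holomorphic) auto
  ultimately have "(fps_exp 1 * inverse (1 - fps_const u * exp_quot_fps) ^ q) $ (q - 1) =
    (LBINT \<psi>. indicator {-pi..pi} \<psi> *\<^sub>R (exp (of_real (sp_x w) * cis \<psi>) *
      inverse (1 - u * exp_quot (of_real (sp_x w) * cis \<psi>)) ^ q * cis (- real (q - 1) * \<psi>))) /
      of_real (2 * pi * sp_x w ^ (q - 1))"
    by (rule fps_nth_integral) (use tx R in auto)
  moreover have "mark_coeff q u = (fps_exp 1 * inverse (1 - fps_const u * exp_quot_fps) ^ q) $ (q - 1) / of_nat q"
    using assms(1) by (cases q) (simp_all add: mark_coeff_def)
  ultimately show ?thesis by simp
qed

text \<open>Both denominators are safe in the disc of radius ln 2: exp t - 1 has modulus below 1, so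
  it avoids the pole 1 of \<open>mark_coeff\<close>, and \<open>exp_quot t\<close> has modulus at
  most 1 / ln 2 < 2.\<close>

lemma num_all_coeff_integral:
  assumes "q \<ge> 1"
  shows "complex_of_nat (num_all p q) = fact p * fact q *
    ((LBINT \<theta>. indicator {-pi..pi} \<theta> *\<^sub>R (exp (of_real (sp_t w) * cis \<theta>) * mark_coeff q (exp (of_real (sp_t w) * cis \<theta>) - 1) *
       (2 - exp (of_real (sp_t w) * cis \<theta>)) * inverse (2 - exp_quot (of_real (sp_t w) * cis \<theta>)) ^ Suc p * cis (- real p * \<theta>))) /
     of_real (2 * pi * sp_t w ^ p))"
proof -
  note tx = sp_tx[OF w]
  have lt: "norm (exp t - 1) < 1" "2 - exp_quot t \<noteq> 0" if "t \<in> ball 0 (ln 2)" for t :: complex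
  proof -
    have nt: "norm t < ln 2" using that by simp
    have "exp (norm t) < exp (ln 2)" using nt by (subst exp_less_cancel_iff)
    then have e: "exp (norm t) < 2" by simp
    then show "norm (exp t - 1) < 1" using norm_exp_minus_one_le[of t] by simp
    show "2 - exp_quot t \<noteq> 0"
    proof -
      have "norm (exp_quot t) \<le> (exp (ln 2) - 1) / ln 2"
        by (rule norm_exp_quot_le) (use nt in auto)
      also have "\<dots> = 1 / ln 2" by simp
      also have "\<dots> < 2" using ln2_ge_two_thirds by (simp add: divide_less_eq)
      finally show ?thesis by auto
    qed
  qed
  have "(\<lambda>t. exp t * mark_coeff q (exp t - 1) * (2 - exp t) * inverse (2 - exp_quot t) ^ Suc p) has_fps_expansion
      (fps_exp 1 * marked_fps q * (2 - fps_exp 1) * inverse (2 - exp_quot_fps) ^ Suc p)"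
    using exp_quot_fps_0
    by (intro fps_expansion_intros exp_quot_has_fps_expansion marked_fps_expansion) simp
  moreover have "(\<lambda>t. exp t * mark_coeff q (exp t - 1) * (2 - exp t) * inverse (2 - exp_quot t) ^ Suc p)
      holomorphic_on ball 0 (ln 2)"
  proof (intro holomorphic_intros exp_quot_holomorphic mark_coeff_holomorphic)
    show "exp t - 1 \<noteq> 1" if "t \<in> ball 0 (ln 2)" for t :: complex using lt(1)[OF that] by auto
  qed (use lt(2) in auto)
  ultimately have "(fps_exp 1 * marked_fps q * (2 - fps_exp 1) * inverse (2 - exp_quot_fps) ^ Suc p) $ p =
     (LBINT \<theta>. indicator {-pi..pi} \<theta> *\<^sub>R (exp (of_real (sp_t w) * cis \<theta>) * mark_coeff q (exp (of_real (sp_t w) * cis \<theta>) - 1) *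
       (2 - exp (of_real (sp_t w) * cis \<theta>)) * inverse (2 - exp_quot (of_real (sp_t w) * cis \<theta>)) ^ Suc p * cis (- real p * \<theta>))) /
     of_real (2 * pi * sp_t w ^ p)"
    by (rule fps_nth_integral) (use tx in auto)
  then show ?thesis unfolding num_all_marked_eq[OF assms] by simp
qed

text \<open>The inner integral replaces \<open>mark_coeff\<close> under the outer one, and Fubini
  joins them. The phases of the coefficient formula turn t^p and x^(q - 1) into constants, which
  cancel the powers of the radii in the denominators.\<close>

theorem num_all_integral:
  assumes "q \<ge> 1"
  shows "complex_of_nat (num_all p q) = fact p * fact q *
    of_real (sp_x w / (4 * pi\<^sup>2 * real q * sp_z w ^ p * sp_s w ^ q)) *
    (LBINT v. indicator torus v *\<^sub>R (saddle_weight w v * saddle_pow w p q v))"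
proof -
  note tx = sp_tx[OF w]
  note b = sp_bounds[OF w]
  define T X where "T \<theta> = of_real (sp_t w) * cis \<theta>" and "X \<psi> = of_real (sp_x w) * cis \<psi>" for \<theta> \<psi>
  define H where "H v = saddle_weight w v * saddle_pow w p q v" for v
  define c where "c = of_real (sp_x w / (sp_z w ^ p * sp_s w ^ q)) * (of_real (sp_t w ^ p) :: complex)"
  have nz: "T \<theta> \<noteq> 0" "X \<psi> \<noteq> 0" "cot_z (T \<theta>) \<noteq> 0" "mark_s (T \<theta>) (X \<psi>) \<noteq> 0" for \<theta> \<psi>
    using tx cot_z_nonzero[OF w] mark_s_nonzero[OF w] by (auto simp: T_def X_def)
  have mc: "mark_coeff q (exp (T \<theta>) - 1) = (LBINT \<psi>. indicator {-pi..pi} \<psi> *\<^sub>R (exp (X \<psi>) *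
      X \<psi> / mark_s (T \<theta>) (X \<psi>) ^ q)) / of_real (2 * pi * real q)" for \<theta>
  proof -
    have nt: "norm (T \<theta>) = sp_t w" using tx by (simp add: T_def norm_mult)
    have "exp (X \<psi>) * inverse (1 - (exp (T \<theta>) - 1) * exp_quot (X \<psi>)) ^ q * cis (- real (q - 1) * \<psi>) =
        exp (X \<psi>) * X \<psi> / mark_s (T \<theta>) (X \<psi>) ^ q * of_real (sp_x w ^ (q - 1))" for \<psi>
    proof -
      have "X \<psi> ^ q * cis (- real (q - 1) * \<psi>) = X \<psi> * of_real (sp_x w ^ (q - 1))"
      proof -
        have "X \<psi> ^ q = X \<psi> * X \<psi> ^ (q - 1)" using assms by (cases q) auto
        moreover have "X \<psi> ^ (q - 1) * cis (- real (q - 1) * \<psi>) = of_real (sp_x w ^ (q - 1))"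
          by (simp add: X_def power_mult_distrib Complex.DeMoivre cis_mult)
        ultimately show ?thesis by (simp only: mult.assoc)
      qed
      then have "cis (- real (q - 1) * \<psi>) = X \<psi> * of_real (sp_x w ^ (q - 1)) / X \<psi> ^ q"
        using nz by (simp add: eq_divide_eq mult.commute)
      moreover have "inverse (1 - (exp (T \<theta>) - 1) * exp_quot (X \<psi>)) ^ q = X \<psi> ^ q / mark_s (T \<theta>) (X \<psi>) ^ q"
        unfolding mark_s_eq using nz by (simp add: power_mult_distrib power_inverse divide_inverse)
      ultimately show ?thesis using nz by simp
    qed
    then have eq: "(LBINT \<psi>. indicator {-pi..pi} \<psi> *\<^sub>R (exp (X \<psi>) *
        inverse (1 - (exp (T \<theta>) - 1) * exp_quot (X \<psi>)) ^ q * cis (- real (q - 1) * \<psi>))) =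
        (LBINT \<psi>. indicator {-pi..pi} \<psi> *\<^sub>R (exp (X \<psi>) * X \<psi> / mark_s (T \<theta>) (X \<psi>) ^ q)) * of_real (sp_x w ^ (q - 1))"
      by (simp only: mult_scaleR_left[symmetric] integral_mult_left_zero)
    have "norm (exp (T \<theta>) - 1) \<le> w" using norm_exp_minus_one_le[of "T \<theta>"] nt tx by simp
    from marked_coeff_integral[OF assms this] show ?thesis
      unfolding X_def[symmetric] eq using tx by (simp add: field_simps)
  qed
  have "complex_of_nat (num_all p q) = fact p * fact q *
    ((LBINT \<theta>. indicator {-pi..pi} \<theta> *\<^sub>R (exp (T \<theta>) * mark_coeff q (exp (T \<theta>) - 1) *
       (2 - exp (T \<theta>)) * inverse (2 - exp_quot (T \<theta>)) ^ Suc p * cis (- real p * \<theta>))) /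
     of_real (2 * pi * sp_t w ^ p))"
    unfolding T_def by (rule num_all_coeff_integral[OF assms])
  also have "(LBINT \<theta>. indicator {-pi..pi} \<theta> *\<^sub>R (exp (T \<theta>) * mark_coeff q (exp (T \<theta>) - 1) *
       (2 - exp (T \<theta>)) * inverse (2 - exp_quot (T \<theta>)) ^ Suc p * cis (- real p * \<theta>))) =
     (LBINT \<theta>. (LBINT \<psi>. indicator torus (\<theta>, \<psi>) *\<^sub>R H (\<theta>, \<psi>)) * (c / of_real (2 * pi * real q)))"
  proof (rule Bochner_Integration.integral_cong[OF refl])
    fix \<theta>
    have V: "inverse (2 - exp_quot (T \<theta>)) = T \<theta> / cot_z (T \<theta>)"
      unfolding cot_z_eq using nz by (simp add: divide_inverse)
    have cp: "T \<theta> ^ p * cis (- real p * \<theta>) = of_real (sp_t w ^ p)"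
      by (simp add: T_def power_mult_distrib Complex.DeMoivre cis_mult)
    have "inverse (2 - exp_quot (T \<theta>)) ^ Suc p * cis (- real p * \<theta>) =
        T \<theta> / cot_z (T \<theta>) * ((T \<theta> ^ p * cis (- real p * \<theta>)) / cot_z (T \<theta>) ^ p)"
      unfolding V by (simp add: power_divide)
    then have p1: "inverse (2 - exp_quot (T \<theta>)) ^ Suc p * cis (- real p * \<theta>) =
        T \<theta> / cot_z (T \<theta>) * (of_real (sp_t w ^ p) / cot_z (T \<theta>) ^ p)"
      unfolding cp .
    have "(exp (T \<theta>) * (2 - exp (T \<theta>)) * (T \<theta> / cot_z (T \<theta>) * (of_real (sp_t w ^ p) / cot_z (T \<theta>) ^ p))) *
        (exp (X \<psi>) * X \<psi> / mark_s (T \<theta>) (X \<psi>) ^ q) = H (\<theta>, \<psi>) * c" for \<psi>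
      using b tx unfolding H_def saddle_weight_def saddle_pow_def Let_def fst_conv snd_conv T_def[symmetric] X_def[symmetric] c_def
      by (simp add: power_divide X_def[of \<psi>] mult_ac)
    then have in_eq: "indicator {-pi..pi} \<theta> *\<^sub>R ((exp (T \<theta>) * (2 - exp (T \<theta>)) * (T \<theta> / cot_z (T \<theta>) * (of_real (sp_t w ^ p) / cot_z (T \<theta>) ^ p))) *
        (indicator {-pi..pi} \<psi> *\<^sub>R (exp (X \<psi>) * X \<psi> / mark_s (T \<theta>) (X \<psi>) ^ q))) =
        (indicator torus (\<theta>, \<psi>) *\<^sub>R H (\<theta>, \<psi>)) * c" for \<psi>
      by (auto simp: indicator_def)
    have K: "(LBINT \<psi>. indicator torus (\<theta>, \<psi>) *\<^sub>R H (\<theta>, \<psi>)) * c =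
        indicator {-pi..pi} \<theta> *\<^sub>R ((exp (T \<theta>) * (2 - exp (T \<theta>)) * (T \<theta> / cot_z (T \<theta>) * (of_real (sp_t w ^ p) / cot_z (T \<theta>) ^ p))) *
        (LBINT \<psi>. indicator {-pi..pi} \<psi> *\<^sub>R (exp (X \<psi>) * X \<psi> / mark_s (T \<theta>) (X \<psi>) ^ q)))"
      by (simp only: integral_mult_left_zero[symmetric] integral_mult_right_zero[symmetric] integral_scaleR_right[symmetric] in_eq)
    have gen: "i *\<^sub>R (a * (J / d) * b * iv * cs) = (i *\<^sub>R ((a * b * (iv * cs)) * J)) / d"
      for i :: real and a b iv cs J d :: complex by (simp add: scaleR_conv_of_real mult_ac)
    show "indicator {-pi..pi} \<theta> *\<^sub>R (exp (T \<theta>) * mark_coeff q (exp (T \<theta>) - 1) *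
       (2 - exp (T \<theta>)) * inverse (2 - exp_quot (T \<theta>)) ^ Suc p * cis (- real p * \<theta>)) =
       (LBINT \<psi>. indicator torus (\<theta>, \<psi>) *\<^sub>R H (\<theta>, \<psi>)) * (c / of_real (2 * pi * real q))"
      unfolding mc gen p1 K[symmetric] by (simp only: times_divide_eq_right)
  qed
  also have "\<dots> = (LBINT \<theta>. (LBINT \<psi>. indicator torus (\<theta>, \<psi>) *\<^sub>R H (\<theta>, \<psi>))) * (c / of_real (2 * pi * real q))"
    by simp
  also have "(LBINT \<theta>. (LBINT \<psi>. indicator torus (\<theta>, \<psi>) *\<^sub>R H (\<theta>, \<psi>))) = (LBINT v. indicator torus v *\<^sub>R H v)"
  proof -
    have "integrable lborel (\<lambda>v. indicator torus v *\<^sub>R H v)"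
      unfolding H_def by (intro borel_integrable_compact compact_Times continuous_intros continuous_on_saddle) auto
    then have "integrable (lborel \<Otimes>\<^sub>M lborel) (\<lambda>(\<theta>, \<psi>). indicator torus (\<theta>, \<psi>) *\<^sub>R H (\<theta>, \<psi>))"
      by (simp add: lborel_prod case_prod_beta')
    from lborel_pair.integral_fst[OF this] show ?thesis by (simp add: lborel_prod case_prod_beta')
  qed
  finally show ?thesis using tx b assms unfolding H_def[symmetric] c_def
    by (simp add: field_simps power2_eq_square)
qed

end

section \<open>Local behaviour of the integrand\<close>

text \<open>P solves P' = N l P with l close to - c u near 0. Therefore D = P exp (N c u^2 / 2)
  satisfies D' = N (l + c u) D and stays close to D(0) = 1 up to u = 1 / sqrt N, where the bound on
  P controls D. This avoids branches of the logarithm and third derivatives.\<close>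

theorem gaussian_limit_along_line:
  fixes P l l' :: "nat \<Rightarrow> real \<Rightarrow> complex" and N :: "nat \<Rightarrow> real" and c :: real
  assumes N: "filterlim N at_top sequentially"
    and P: "\<And>j. P j 0 = 1" "\<And>j u. (P j has_vector_derivative of_real (N j) * l j u * P j u) (at u)"
      "\<And>j u. norm (P j u) \<le> 1"
    and l: "\<And>j. l j 0 = 0" "\<And>j u. (l j has_vector_derivative l' j u) (at u)"
    and lim: "\<And>\<eta>. \<eta> > 0 \<Longrightarrow> \<exists>\<delta>>0. \<forall>\<^sub>F j in sequentially. \<forall>u. 0 \<le> u \<and> u \<le> \<delta> \<longrightarrow> norm (l' j u + of_real c) \<le> \<eta>"
  shows "(\<lambda>j. P j (1 / sqrt (N j))) \<longlonglongrightarrow> of_real (exp (- c / 2))"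
proof -
  \<comment> \<open>Bounds the integrating factor as long as N u^2 \<le> 1.\<close>
  define K where "K = exp (\<bar>c\<bar> / 2)"
  have K: "K > 0" by (simp add: K_def)
  have bound: "norm (P j e * of_real (exp (c / 2)) - 1) \<le> \<eta> * K / 2"
    if \<eta>: "\<eta> > 0" and e: "e = 1 / sqrt (N j)" "N j > 0" "\<And>u. 0 \<le> u \<Longrightarrow> u \<le> e \<Longrightarrow> norm (l' j u + of_real c) \<le> \<eta>" for j e \<eta>
  proof -
    have e0: "0 < e" and Ne: "N j * e\<^sup>2 = 1" using e(1,2) by (auto simp: power_divide)
    have lb: "norm (l j u + of_real (c * u)) \<le> \<eta> * u" if u: "0 \<le> u" "u \<le> e" for u
    proof (cases "u = 0")
      case False
      have "norm ((l j u + of_real (c * u)) - (l j 0 + of_real (c * 0))) \<le> \<eta> * u - \<eta> * 0"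
      proof (rule differentiable_bound_general[where f' = "\<lambda>x. l' j x + of_real c" and \<phi>' = "\<lambda>_. \<eta>"])
        show "((\<lambda>x. l j x + of_real (c * x)) has_vector_derivative l' j x + of_real c) (at x)" for x
          by (auto intro!: derivative_eq_intros l(2) has_vector_derivative_of_real)
        show "((\<lambda>x. \<eta> * x) has_vector_derivative \<eta>) (at x)" for x
          by (auto intro!: derivative_eq_intros)
        have "isCont (l j) x" for x using l(2) has_vector_derivative_continuous by blast
        then show "continuous_on {0..u} (\<lambda>x. l j x + of_real (c * x))"
          by (intro continuous_intros continuous_at_imp_continuous_on) auto
        show "norm (l' j x + of_real c) \<le> \<eta>" if "0 < x" "x < u" for x using e(3)[of x] that u by auto
      qed (use u False in \<open>auto intro!: continuous_intros\<close>)
      then show ?thesis by (simp add: l(1))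
    qed (simp add: l(1))
    define D where "D u = P j u * of_real (exp (N j * c * u\<^sup>2 / 2))" for u
    define D' where "D' u = of_real (N j) * (l j u + of_real (c * u)) * D u" for u
    have dD: "(D has_vector_derivative D' u) (at u)" for u
    proof -
      have "((\<lambda>u. exp (N j * c * u\<^sup>2 / 2)) has_real_derivative exp (N j * c * u\<^sup>2 / 2) * (N j * c * u)) (at u)"
        by (auto intro!: derivative_eq_intros simp: power2_eq_square)
      then have "((\<lambda>u. of_real (exp (N j * c * u\<^sup>2 / 2)) :: complex) has_vector_derivative
          of_real (exp (N j * c * u\<^sup>2 / 2) * (N j * c * u))) (at u)"
        by (intro has_vector_derivative_of_real) (simp add: has_real_derivative_iff_has_vector_derivative)
      from has_vector_derivative_mult[OF P(2)[of j u] this] show ?thesis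
        unfolding D_def D'_def by (simp add: algebra_simps)
    qed
    have "norm (D e - D 0) \<le> N j * \<eta> * K * e\<^sup>2 / 2 - N j * \<eta> * K * 0\<^sup>2 / 2"
    proof (rule differentiable_bound_general[where f' = D' and \<phi>' = "\<lambda>u. N j * \<eta> * K * u"])
      show "((\<lambda>u. N j * \<eta> * K * u\<^sup>2 / 2) has_vector_derivative N j * \<eta> * K * x) (at x)" for x
        unfolding has_real_derivative_iff_has_vector_derivative[symmetric]
        by (auto intro!: derivative_eq_intros simp: power2_eq_square)
      have "isCont D x" for x using dD has_vector_derivative_continuous by blast
      then show "continuous_on {0..e} D" by (intro continuous_at_imp_continuous_on) auto
      show "norm (D' x) \<le> N j * \<eta> * K * x" if x: "0 < x" "x < e" for x
      proof -
        have "x\<^sup>2 \<le> e\<^sup>2" using x by (intro power_mono) auto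
        then have "N j * x\<^sup>2 \<le> 1" using e(2) Ne mult_left_mono[of "x\<^sup>2" "e\<^sup>2" "N j"] by simp
        then have "\<bar>c\<bar> * (N j * x\<^sup>2) \<le> \<bar>c\<bar> * 1" by (intro mult_left_mono) auto
        moreover have "c * (N j * x\<^sup>2) \<le> \<bar>c\<bar> * (N j * x\<^sup>2)"
          using e(2) by (intro mult_right_mono) auto
        then have "N j * c * x\<^sup>2 \<le> \<bar>c\<bar> * (N j * x\<^sup>2)" by (simp only: mult_ac)
        ultimately have "norm (D x) \<le> 1 * K"
          unfolding D_def norm_mult using P(3)[of j x] by (intro mult_mono) (auto simp: K_def)
        moreover have "norm (l j x + of_real (c * x)) \<le> \<eta> * x" using lb x by simp
        ultimately have "norm (D' x) \<le> N j * (\<eta> * x) * (1 * K)"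
          unfolding D'_def norm_mult using e(2) \<eta> x by (intro mult_mono) auto
        then show ?thesis by (simp add: mult_ac)
      qed
    qed (use e0 in \<open>auto intro!: continuous_intros dD\<close>)
    moreover have "N j * \<eta> * K * e\<^sup>2 / 2 = \<eta> * K / 2" "N j * c * e\<^sup>2 / 2 = c / 2"
      using Ne by (simp_all add: mult.commute mult.left_commute)
    ultimately show ?thesis by (simp add: D_def P(1))
  qed
  have "(\<lambda>j. P j (1 / sqrt (N j)) * of_real (exp (c / 2))) \<longlonglongrightarrow> 1"
  proof (rule tendstoI)
    fix \<epsilon> :: real assume \<epsilon>: "\<epsilon> > 0"
    define \<eta> where "\<eta> = \<epsilon> / K"
    have \<eta>: "\<eta> > 0" using \<epsilon> K by (simp add: \<eta>_def)
    from lim[OF \<eta>] obtain \<delta> where \<delta>: "\<delta> > 0"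
      "\<forall>\<^sub>F j in sequentially. \<forall>u. 0 \<le> u \<and> u \<le> \<delta> \<longrightarrow> norm (l' j u + of_real c) \<le> \<eta>" by blast
    have "filterlim (\<lambda>j. sqrt (N j)) at_top sequentially" by (rule filterlim_compose[OF sqrt_at_top N])
    then have "(\<lambda>j. 1 / sqrt (N j)) \<longlonglongrightarrow> 0"
      using tendsto_inverse_0_at_top by (simp add: divide_inverse)
    then have "\<forall>\<^sub>F j in sequentially. 1 / sqrt (N j) < \<delta>" using \<delta>(1) by (rule order_tendstoD(2))
    moreover have "\<forall>\<^sub>F j in sequentially. N j > 0" using N by (simp add: filterlim_at_top_dense)
    ultimately show "\<forall>\<^sub>F j in sequentially. dist (P j (1 / sqrt (N j)) * of_real (exp (c / 2))) 1 < \<epsilon>"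
      using \<delta>(2)
    proof eventually_elim
      case (elim j)
      have "norm (P j (1 / sqrt (N j)) * of_real (exp (c / 2)) - 1) \<le> \<eta> * K / 2"
        by (rule bound[OF \<eta> refl]) (use elim in auto)
      also have "\<dots> < \<epsilon>" using \<epsilon> K by (simp add: \<eta>_def)
      finally show ?case by (simp add: dist_norm)
    qed
  qed
  from tendsto_mult[OF this tendsto_const[of "of_real (exp (- c / 2)) :: complex"]]
  show ?thesis by (simp add: mult.assoc exp_add[symmetric] flip: of_real_mult)
qed

text \<open>The integrand on the line through the saddle point in direction \<open>(p, q)\<close>. \<open>line_z1\<close>, \<open>line_z2\<close>,
  \<open>line_s1\<close>, \<open>line_s2\<close> are the first two derivatives of \<open>z\<close> and \<open>s\<close> along this line, and \<open>line_l\<close>,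
  \<open>line_l'\<close> those of the logarithm of the integrand. They are spelled out because they are needed as
  functions that are jointly continuous in \<open>w\<close>, \<open>\<beta>\<close> and the position on the line.\<close>

definition line_t :: "real \<Rightarrow> real \<Rightarrow> complex \<Rightarrow> complex" where
  "line_t w p u = of_real (ln (1 + w)) * exp (\<i> * of_real p * u)"
definition line_x :: "real \<Rightarrow> real \<Rightarrow> complex \<Rightarrow> complex" where
  "line_x w q u = of_real (- ln w) * exp (\<i> * of_real q * u)"

definition line_z1 :: "real \<Rightarrow> real \<Rightarrow> complex \<Rightarrow> complex" where
  "line_z1 w p u = (let t = line_t w p u in (2 - exp t) * (\<i> * of_real p * t))"
definition line_z2 :: "real \<Rightarrow> real \<Rightarrow> complex \<Rightarrow> complex" where
  "line_z2 w p u = (let t = line_t w p u; t1 = \<i> * of_real p * t in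
     - (exp t * t1 * t1) + (2 - exp t) * (\<i> * of_real p * t1))"
definition line_s1 :: "real \<Rightarrow> real \<Rightarrow> real \<Rightarrow> complex \<Rightarrow> complex" where
  "line_s1 w p q u = (let t = line_t w p u; t1 = \<i> * of_real p * t; x = line_x w q u; x1 = \<i> * of_real q * x in
     x1 - (exp t * t1 * (exp x - 1) + (exp t - 1) * (exp x * x1)))"
definition line_s2 :: "real \<Rightarrow> real \<Rightarrow> real \<Rightarrow> complex \<Rightarrow> complex" where
  "line_s2 w p q u = (let t = line_t w p u; t1 = \<i> * of_real p * t; x = line_x w q u; x1 = \<i> * of_real q * x in
     \<i> * of_real q * x1 - ((exp t * t1 * t1 + exp t * (\<i> * of_real p * t1)) * (exp x - 1)
       + 2 * (exp t * t1 * (exp x * x1)) + (exp t - 1) * (exp x * x1 * x1 + exp x * (\<i> * of_real q * x1))))"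

definition line_l :: "real \<Rightarrow> real \<Rightarrow> real \<Rightarrow> real \<Rightarrow> complex \<Rightarrow> complex" where
  "line_l w \<beta> p q u = - (of_real (1 - \<beta>) * (line_z1 w p u / cot_z (line_t w p u))
     + of_real \<beta> * (line_s1 w p q u / mark_s (line_t w p u) (line_x w q u)))"
definition line_l' :: "real \<Rightarrow> real \<Rightarrow> real \<Rightarrow> real \<Rightarrow> complex \<Rightarrow> complex" where
  "line_l' w \<beta> p q u = (let z = cot_z (line_t w p u); s = mark_s (line_t w p u) (line_x w q u) in
     - (of_real (1 - \<beta>) * ((line_z2 w p u * z - line_z1 w p u * line_z1 w p u) / (z * z))
     + of_real \<beta> * ((line_s2 w p q u * s - line_s1 w p q u * line_s1 w p q u) / (s * s))))"

section \<open>Logarithmic derivatives along a line\<close>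

lemma line_t_deriv: "(line_t w p has_field_derivative \<i> * of_real p * line_t w p u) (at u)"
  unfolding line_t_def by (auto intro!: derivative_eq_intros)
lemma line_x_deriv: "(line_x w q has_field_derivative \<i> * of_real q * line_x w q u) (at u)"
  unfolding line_x_def by (auto intro!: derivative_eq_intros)

lemma line_z_deriv: "((\<lambda>u. cot_z (line_t w p u)) has_field_derivative line_z1 w p u) (at u)"
  unfolding cot_z_def line_z1_def Let_def
  by (auto intro!: derivative_eq_intros line_t_deriv simp: algebra_simps)
lemma line_z1_deriv: "(line_z1 w p has_field_derivative line_z2 w p u) (at u)"
  unfolding line_z1_def line_z2_def Let_def
  by (auto intro!: derivative_eq_intros line_t_deriv simp: algebra_simps)
lemma line_s_deriv: "((\<lambda>u. mark_s (line_t w p u) (line_x w q u)) has_field_derivative line_s1 w p q u) (at u)"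
  unfolding mark_s_def line_s1_def Let_def
  by (auto intro!: derivative_eq_intros line_t_deriv line_x_deriv simp: algebra_simps)
lemma line_s1_deriv: "(line_s1 w p q has_field_derivative line_s2 w p q u) (at u)"
  unfolding line_s1_def line_s2_def Let_def
  by (auto intro!: derivative_eq_intros line_t_deriv line_x_deriv simp: algebra_simps)

lemma line_l_deriv:
  assumes "cot_z (line_t w p u) \<noteq> 0" "mark_s (line_t w p u) (line_x w q u) \<noteq> 0"
  shows "(line_l w \<beta> p q has_field_derivative line_l' w \<beta> p q u) (at u)"
  unfolding line_l_def line_l'_def Let_def
  by (rule DERIV_minus DERIV_add DERIV_cmult DERIV_divide line_z1_deriv line_s1_deriv line_z_deriv
      line_s_deriv assms)+

lemma power_log_deriv:
  fixes f :: "complex \<Rightarrow> complex"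
  assumes "(f has_field_derivative f u * g) (at u)"
  shows "((\<lambda>u. f u ^ m) has_field_derivative f u ^ m * (of_nat m * g)) (at u)"
proof (cases m)
  case (Suc r)
  from DERIV_power[OF assms, of m] show ?thesis
    by (simp add: Suc algebra_simps)
qed simp

definition line_P :: "real \<Rightarrow> nat \<Rightarrow> nat \<Rightarrow> real \<Rightarrow> real \<Rightarrow> complex \<Rightarrow> complex" where
  "line_P w m k p q u = (of_real (sp_z w) / cot_z (line_t w p u)) ^ m *
     (of_real (sp_s w) / mark_s (line_t w p u) (line_x w q u)) ^ k"

lemma line_P_deriv:
  assumes "cot_z (line_t w p u) \<noteq> 0" "mark_s (line_t w p u) (line_x w q u) \<noteq> 0" "n > 0" "k \<le> n"
  shows "(line_P w (n - k) k p q has_field_derivative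
     of_real (real n) * line_l w (real k / real n) p q u * line_P w (n - k) k p q u) (at u)"
proof -
  have quot: "((\<lambda>u. c / f u) has_field_derivative c / f u * - (f' / f u)) (at u)"
    if "(f has_field_derivative f') (at u)" "f u \<noteq> 0" for f :: "complex \<Rightarrow> complex" and f' c
    using that by (auto intro!: derivative_eq_intros simp: field_simps)
  have "(line_P w (n - k) k p q has_field_derivative
      (of_real (sp_z w) / cot_z (line_t w p u)) ^ (n - k) * (of_nat (n - k) * - (line_z1 w p u / cot_z (line_t w p u))) *
      (of_real (sp_s w) / mark_s (line_t w p u) (line_x w q u)) ^ k +
      (of_real (sp_s w) / mark_s (line_t w p u) (line_x w q u)) ^ k *
        (of_nat k * - (line_s1 w p q u / mark_s (line_t w p u) (line_x w q u))) *
      (of_real (sp_z w) / cot_z (line_t w p u)) ^ (n - k)) (at u)"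
    unfolding line_P_def
    by (intro DERIV_mult power_log_deriv quot line_z_deriv line_s_deriv assms)
  moreover have "of_real (real n) * line_l w (real k / real n) p q u =
      of_nat (n - k) * - (line_z1 w p u / cot_z (line_t w p u)) +
      of_nat k * - (line_s1 w p q u / mark_s (line_t w p u) (line_x w q u))"
  proof -
    have "complex_of_real (real n) * of_real (1 - real k / real n) = of_nat (n - k)"
      using assms(3,4) by (simp add: of_nat_diff right_diff_distrib)
    moreover have "complex_of_real (real n) * of_real (real k / real n) = of_nat k"
      using assms(3) by simp
    ultimately show ?thesis unfolding line_l_def
      by (metis (no_types, lifting) distrib_left minus_add_distrib mult.assoc mult_minus_right)
  qed
  ultimately show ?thesis unfolding line_P_def by (simp only:) (simp add: algebra_simps)
qed

lemma line_cis:
  "line_t w p (of_real u) = of_real (sp_t w) * cis (u * p)"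
  "line_x w q (of_real u) = of_real (sp_x w) * cis (u * q)"
  by (simp_all add: line_t_def line_x_def sp_t_def sp_x_def cis_conv_exp mult_ac)

lemma line_P_saddle_pow: "line_P w m k p q (of_real u) = saddle_pow w m k (u *\<^sub>R (p, q))"
  unfolding line_P_def saddle_pow_def line_cis by simp

lemma line_nonzero:
  assumes "0 < w" "w < 1"
  shows "cot_z (line_t w p (of_real u)) \<noteq> 0"
    "mark_s (line_t w p (of_real u)) (line_x w q (of_real u)) \<noteq> 0"
  unfolding line_cis using cot_z_nonzero[OF assms] mark_s_nonzero[OF assms] by auto

text \<open>Coefficients of the quadratic form a p^2 + 2 b p q + d q^2, minus the second derivative
  at the saddle point of the logarithm of the integrand divided by n. The saddle equation is built
  in: it makes \<beta> / (w s) a common factor of the weights \<beta> and 1 - \<beta>.\<close>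

definition quad_a :: "real \<Rightarrow> real \<Rightarrow> real" where
  "quad_a w \<beta> = \<beta> / (w * sp_s w) * (sp_t w)\<^sup>2 * ((1 + w) * (2 + (1 - w)\<^sup>2 / sp_z w + (1 + w) * (1 - w)\<^sup>2 / (w * sp_s w)))"
definition quad_b :: "real \<Rightarrow> real \<Rightarrow> real" where
  "quad_b w \<beta> = \<beta> / (w * sp_s w) * (sp_t w * sp_x w * (1 + w))"
definition quad_d :: "real \<Rightarrow> real \<Rightarrow> real" where
  "quad_d w \<beta> = \<beta> / (w * sp_s w) * ((sp_x w)\<^sup>2 * w)"

context
  fixes w :: real assumes w: "0 < w" "w < 1"
begin

text \<open>Everything follows from exp t = 1 + w and exp x = 1 / w. The direction q is absent from
  the first derivative of s, because the partial derivative in x vanishes.\<close>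

lemma line_0:
  "line_t w p 0 = of_real (sp_t w)" "line_x w q 0 = of_real (sp_x w)"
  "cot_z (of_real (sp_t w)) = of_real (sp_z w)" "mark_s (of_real (sp_t w)) (of_real (sp_x w)) = of_real (sp_s w)"
  "line_z1 w p 0 = \<i> * of_real (p * sp_t w * (1 - w))"
  "line_s1 w p q 0 = - (\<i> * of_real (p * sp_t w * ((1 + w) * (1 - w) / w)))"
  "line_z2 w p 0 = of_real (p\<^sup>2 * sp_t w * ((1 + w) * sp_t w - (1 - w)))"
  "line_s2 w p q 0 = of_real (q\<^sup>2 * (sp_x w)\<^sup>2 + p\<^sup>2 * (1 + w) * sp_t w * (sp_t w + 1) * (1 - w) / w
     + 2 * p * q * (1 + w) * sp_t w * sp_x w / w)"
proof -
  note tx = sp_tx[OF w]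
  show t: "line_t w p 0 = of_real (sp_t w)" and x: "line_x w q 0 = of_real (sp_x w)"
    using line_cis[of w p 0] line_cis[of w q 0] by simp_all
  have e: "exp (line_t w p 0) = 1 + of_real w" "exp (line_x w q 0) = 1 / of_real w"
    unfolding t x exp_of_real tx by simp_all
  have "cot_z (line_t w p 0) = of_real (2 * sp_t w + 1 - (1 + w))"
    unfolding cot_z_def e unfolding t by simp
  also have "2 * sp_t w + 1 - (1 + w) = sp_z w" by (simp add: sp_z_def sp_t_def)
  finally show "cot_z (of_real (sp_t w)) = of_real (sp_z w)" unfolding t .
  have "mark_s (line_t w p 0) (line_x w q 0) = of_real (sp_x w - w * (1 / w - 1))"
    unfolding mark_s_def e unfolding x by simp
  also have "sp_x w - w * (1 / w - 1) = sp_s w" using w by (simp add: sp_s_def sp_x_def algebra_simps)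
  finally show "mark_s (of_real (sp_t w)) (of_real (sp_x w)) = of_real (sp_s w)" unfolding t x .
  show "line_z1 w p 0 = \<i> * of_real (p * sp_t w * (1 - w))"
    unfolding line_z1_def Let_def e unfolding t by (simp add: algebra_simps)
  have w0: "complex_of_real w \<noteq> 0" using w by simp
  show "line_s1 w p q 0 = - (\<i> * of_real (p * sp_t w * ((1 + w) * (1 - w) / w)))"
    unfolding line_s1_def Let_def e unfolding t x using w0 by (simp add: field_simps)
  show "line_z2 w p 0 = of_real (p\<^sup>2 * sp_t w * ((1 + w) * sp_t w - (1 - w)))"
    unfolding line_z2_def Let_def e unfolding t by (simp add: algebra_simps power2_eq_square)
  show "line_s2 w p q 0 = of_real (q\<^sup>2 * (sp_x w)\<^sup>2 + p\<^sup>2 * (1 + w) * sp_t w * (sp_t w + 1) * (1 - w) / w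
     + 2 * p * q * (1 + w) * sp_t w * sp_x w / w)"
    unfolding line_s2_def Let_def e unfolding t x using w0 by (simp add: field_simps power2_eq_square)
qed

text \<open>Joint continuity in w, \<beta> and the position on the line provides one \<delta> for
  all late members of a sequence of saddle points.\<close>

lemma line_l'_tendsto:
  "((\<lambda>v. line_l' (fst v) (fst (snd v)) p q (of_real (snd (snd v)))) \<longlongrightarrow> line_l' w \<beta> p q 0) (nhds (w, \<beta>, 0))"
proof -
  let ?F = "nhds (w, \<beta>, 0 :: real)"
  have id: "((\<lambda>v. v) \<longlongrightarrow> (w, \<beta>, 0)) ?F" by (rule filterlim_ident)
  have fw: "(fst \<longlongrightarrow> w) ?F" using tendsto_fst[OF id] by simp
  have fb: "((\<lambda>v. fst (snd v)) \<longlongrightarrow> \<beta>) ?F" using tendsto_fst[OF tendsto_snd[OF id]] by simp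
  have fu: "((\<lambda>v. complex_of_real (snd (snd v))) \<longlongrightarrow> 0) ?F"
    using tendsto_of_real[OF tendsto_snd[OF tendsto_snd[OF id]]] by simp
  have t: "((\<lambda>v. line_t (fst v) p (of_real (snd (snd v)))) \<longlongrightarrow> line_t w p 0) ?F"
    unfolding line_t_def by (intro tendsto_intros fw fu) (use w in auto)
  have x: "((\<lambda>v. line_x (fst v) q (of_real (snd (snd v)))) \<longlongrightarrow> line_x w q 0) ?F"
    unfolding line_x_def by (intro tendsto_intros fw fu) (use w in auto)
  have nz: "cot_z (line_t w p 0) \<noteq> 0" "mark_s (line_t w p 0) (line_x w q 0) \<noteq> 0"
    using line_nonzero(1)[OF w, of p 0] line_nonzero(2)[OF w, of p 0 q] by auto
  show ?thesis
    unfolding line_l'_def line_z1_def line_z2_def line_s1_def line_s2_def Let_def cot_z_def mark_s_def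
    by (intro tendsto_intros t x fb) (use nz in \<open>auto simp: cot_z_def mark_s_def\<close>)
qed

end

context
  fixes w \<beta> :: real assumes w: "0 < w" "w < 1" and \<beta>: "0 < \<beta>" "\<beta> < 1" "sp_h w = \<beta> / (1 - \<beta>)"
begin

lemma saddle_kappa: "1 - \<beta> = \<beta> / (w * sp_s w) * ((1 + w) * sp_z w)"
proof -
  have "w * sp_s w * (1 - \<beta>) = \<beta> * ((1 + w) * sp_z w)"
    using \<beta> w sp_bounds[OF w] by (simp add: sp_h_def frac_eq_eq)
  then show ?thesis using w sp_bounds[OF w] by (simp add: field_simps)
qed

text \<open>Up to a square the determinant is (1 - w^2) \<open>sp_det w\<close>; with d > 0, the
  positivity of \<open>sp_det\<close> makes the form positive definite.\<close>

lemma quad_det: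
  "quad_a w \<beta> * quad_d w \<beta> - (quad_b w \<beta>)\<^sup>2 = (\<beta> / (w * sp_s w) * sp_t w * sp_x w)\<^sup>2 * ((1 - w\<^sup>2) * sp_det w)"
proof -
  define M where "M = (1 + w) * (2 + (1 - w)\<^sup>2 / sp_z w + (1 + w) * (1 - w)\<^sup>2 / (w * sp_s w))"
  define \<kappa> where "\<kappa> = \<beta> / (w * sp_s w)"
  have "w * ((1 + w) * (1 - w)\<^sup>2 / (w * sp_s w)) = (1 - w) * ((1 - w\<^sup>2) / sp_s w)"
  proof -
    have "1 - w\<^sup>2 = (1 + w) * (1 - w)" by (simp add: power2_eq_square algebra_simps)
    then show ?thesis using w by (simp add: power2_eq_square mult_ac)
  qed
  moreover have "w * ((1 - w)\<^sup>2 / sp_z w) = (1 - w) * ((1 - w) * w / sp_z w)"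
    by (simp add: power2_eq_square mult_ac)
  moreover have "w * M - (1 + w)\<^sup>2 = (1 + w) * (w - 1 + w * ((1 - w)\<^sup>2 / sp_z w) + w * ((1 + w) * (1 - w)\<^sup>2 / (w * sp_s w)))"
    unfolding M_def by (simp only: power2_eq_square[of "1 + w"]) (simp only: algebra_simps)
  ultimately have "w * M - (1 + w)\<^sup>2 = (1 + w) * (w - 1 + (1 - w) * ((1 - w) * w / sp_z w) + (1 - w) * ((1 - w\<^sup>2) / sp_s w))"
    by (simp only:)
  also have "\<dots> = (1 + w) * (1 - w) * sp_det w"
    unfolding sp_det_def by (simp only: algebra_simps)
  also have "(1 + w) * (1 - w) = 1 - w\<^sup>2" by (simp add: power2_eq_square algebra_simps)
  finally have *: "w * M - (1 + w)\<^sup>2 = (1 - w\<^sup>2) * sp_det w" .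
  have "quad_a w \<beta> * quad_d w \<beta> - (quad_b w \<beta>)\<^sup>2 = (\<kappa> * sp_t w * sp_x w)\<^sup>2 * (w * M - (1 + w)\<^sup>2)"
    unfolding quad_a_def quad_b_def quad_d_def M_def[symmetric] \<kappa>_def[symmetric]
    by (simp add: power2_eq_square algebra_simps)
  then show ?thesis unfolding * \<kappa>_def .
qed

text \<open>The contributions of z and s cancel by the saddle equation, once
  \<open>saddle_kappa\<close> has written both weights as multiples of \<beta> / (w s).\<close>

lemma line_l_0: "line_l w \<beta> p q 0 = 0"
proof -
  note b = sp_bounds[OF w]
  define \<kappa> where "\<kappa> = \<beta> / (w * sp_s w)"
  have k: "\<beta> = \<kappa> * (w * sp_s w)" "1 - \<beta> = \<kappa> * ((1 + w) * sp_z w)"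
    using saddle_kappa w b by (auto simp: \<kappa>_def)
  have "(1 - \<beta>) * (p * sp_t w * (1 - w) / sp_z w) = \<kappa> * (1 + w) * (p * sp_t w * (1 - w))"
    unfolding k(2) using b by simp
  moreover have "\<beta> * (p * sp_t w * ((1 + w) * (1 - w) / w) / sp_s w) = \<kappa> * (1 + w) * (p * sp_t w * (1 - w))"
    unfolding k(1) using b w by simp
  moreover have "line_l w \<beta> p q 0 = - (\<i> * of_real ((1 - \<beta>) * (p * sp_t w * (1 - w) / sp_z w)
      - \<beta> * (p * sp_t w * ((1 + w) * (1 - w) / w) / sp_s w)))"
    unfolding line_l_def line_0[OF w] by (simp add: algebra_simps)
  ultimately show ?thesis by simp
qed

lemma line_l'_0:
  "line_l' w \<beta> p q 0 = - of_real (quad_a w \<beta> * p\<^sup>2 + 2 * quad_b w \<beta> * p * q + quad_d w \<beta> * q\<^sup>2)"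
proof -
  note b = sp_bounds[OF w]
  define \<kappa> where "\<kappa> = \<beta> / (w * sp_s w)"
  have k: "\<beta> = \<kappa> * (w * sp_s w)" "1 - \<beta> = \<kappa> * ((1 + w) * sp_z w)"
    using saddle_kappa w b by (auto simp: \<kappa>_def)
  define t x z s where "t = sp_t w" and "x = sp_x w" and "z = sp_z w" and "s = sp_s w"
  have zs: "z \<noteq> 0" "s \<noteq> 0" "w \<noteq> 0" using b w by (auto simp: z_def s_def)
  define z2 where "z2 = p\<^sup>2 * t * ((1 + w) * t - (1 - w))"
  define s2 where "s2 = q\<^sup>2 * x\<^sup>2 + p\<^sup>2 * (1 + w) * t * (t + 1) * (1 - w) / w + 2 * p * q * (1 + w) * t * x / w"
  define z1 s1 where "z1 = p * t * (1 - w)" and "s1 = p * t * ((1 + w) * (1 - w) / w)"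
  have ii: "\<i> * a * (\<i> * a) = - (a * a)" for a by (simp add: algebra_simps)
  have "line_l' w \<beta> p q 0 = - of_real ((1 - \<beta>) * ((z2 * z + z1 * z1) / (z * z)) + \<beta> * ((s2 * s + s1 * s1) / (s * s)))"
    unfolding line_l'_def Let_def line_0[OF w] z1_def s1_def z2_def s2_def t_def x_def z_def s_def
    by (simp add: ii)
  also have "(1 - \<beta>) * ((z2 * z + z1 * z1) / (z * z)) = \<kappa> * ((1 + w) * (z2 + z1\<^sup>2 / z))"
    unfolding k(2) z_def[symmetric] using zs by (simp add: field_simps power2_eq_square)
  also have "z1\<^sup>2 / z = p\<^sup>2 * t\<^sup>2 * ((1 - w)\<^sup>2 / z)" by (simp add: z1_def power_mult_distrib)
  also have "\<beta> * ((s2 * s + s1 * s1) / (s * s)) = \<kappa> * (w * s2 + w * (s1\<^sup>2 / s))"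
    unfolding k(1) s_def[symmetric] using zs by (simp add: field_simps power2_eq_square)
  also have "w * (s1\<^sup>2 / s) = p\<^sup>2 * t\<^sup>2 * ((1 + w) * ((1 + w) * (1 - w)\<^sup>2 / (w * s)))"
    using zs by (simp add: s1_def power2_eq_square)
  also have "w * s2 = w * (q\<^sup>2 * x\<^sup>2) + p\<^sup>2 * (1 + w) * t * (t + 1) * (1 - w) + 2 * p * q * (1 + w) * t * x"
    using zs by (simp add: s2_def distrib_left)
  also have "\<kappa> * ((1 + w) * (z2 + p\<^sup>2 * t\<^sup>2 * A)) +
      \<kappa> * (w * (q\<^sup>2 * x\<^sup>2) + p\<^sup>2 * (1 + w) * t * (t + 1) * (1 - w) + 2 * p * q * (1 + w) * t * x + p\<^sup>2 * t\<^sup>2 * ((1 + w) * B)) =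
      (\<kappa> * t\<^sup>2 * ((1 + w) * (2 + A + B))) * p\<^sup>2 + 2 * (\<kappa> * (t * x * (1 + w))) * p * q + (\<kappa> * (x\<^sup>2 * w)) * q\<^sup>2" for A B
    unfolding z2_def by (simp add: algebra_simps power2_eq_square)
  finally show ?thesis
    unfolding quad_a_def quad_b_def quad_d_def \<kappa>_def t_def x_def z_def s_def .
qed

end

lemma dist_Pair_le: "dist (a, b) (c, d) \<le> dist a c + dist b d"
  unfolding dist_Pair_Pair by (rule sqrt_sum_squares_le_sum; simp)

text \<open>\<open>W j\<close> is the saddle point of k j / n j itself, so \<open>line_l\<close>
  vanishes exactly at 0 for every j; what remains to be controlled is the second derivative near
  0.\<close>

theorem saddle_pow_tendsto:
  fixes n k :: "nat \<Rightarrow> nat" and W :: "nat \<Rightarrow> real"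
  assumes w: "0 < w" "w < 1" and \<beta>: "0 < \<beta>" "\<beta> < 1" "sp_h w = \<beta> / (1 - \<beta>)"
    and W: "\<And>j. 0 < W j" "\<And>j. W j < 1" "W \<longlonglongrightarrow> w"
    and k: "\<And>j. 0 < k j" "\<And>j. k j < n j" "(\<lambda>j. real (k j) / real (n j)) \<longlonglongrightarrow> \<beta>"
    and s: "\<And>j. sp_h (W j) = (real (k j) / real (n j)) / (1 - real (k j) / real (n j))"
    and n: "filterlim (\<lambda>j. real (n j)) at_top sequentially"
  shows "(\<lambda>j. saddle_pow (W j) (n j - k j) (k j) ((p, q) /\<^sub>R sqrt (real (n j)))) \<longlonglongrightarrow>
    of_real (exp (- (quad_a w \<beta> * p\<^sup>2 + 2 * quad_b w \<beta> * p * q + quad_d w \<beta> * q\<^sup>2) / 2))"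
proof -
  let ?c = "quad_a w \<beta> * p\<^sup>2 + 2 * quad_b w \<beta> * p * q + quad_d w \<beta> * q\<^sup>2"
  define b where "b j = real (k j) / real (n j)" for j
  have b: "0 < b j" "b j < 1" for j using k(1,2)[of j] by (auto simp: b_def)
  have "(\<lambda>j. line_P (W j) (n j - k j) (k j) p q (of_real (1 / sqrt (real (n j))))) \<longlonglongrightarrow> of_real (exp (- ?c / 2))"
  proof (rule gaussian_limit_along_line[where P = "\<lambda>j u. line_P (W j) (n j - k j) (k j) p q (of_real u)"
        and l = "\<lambda>j u. line_l (W j) (b j) p q (of_real u)" and l' = "\<lambda>j u. line_l' (W j) (b j) p q (of_real u)", OF n])
    fix j u
    note nz = line_nonzero[OF W(1,2)[of j]]
    note W01 = W(1,2)[of j]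
    show "line_P (W j) (n j - k j) (k j) p q (of_real 0) = 1"
      using sp_bounds[OF W01] by (simp add: line_P_def line_0[OF W01])
    show "((\<lambda>u. line_P (W j) (n j - k j) (k j) p q (of_real u)) has_vector_derivative
        of_real (real (n j)) * line_l (W j) (b j) p q (of_real u) * line_P (W j) (n j - k j) (k j) p q (of_real u)) (at u)"
      unfolding b_def by (rule has_vector_derivative_real_field line_P_deriv nz)+ (use k(1,2)[of j] in auto)
    show "norm (line_P (W j) (n j - k j) (k j) p q (of_real u)) \<le> 1"
      unfolding line_P_def line_cis norm_mult norm_power
      using norm_cot_z_quot_le(1)[OF W01] norm_mark_s_quot_le(1)[OF W01]
      by (intro mult_le_one power_le_one) auto
    show "line_l (W j) (b j) p q (of_real 0) = 0"
      using line_l_0[OF W01 b[of j] s[of j, folded b_def]] by simp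
    show "((\<lambda>u. line_l (W j) (b j) p q (of_real u)) has_vector_derivative line_l' (W j) (b j) p q (of_real u)) (at u)"
      by (rule has_vector_derivative_real_field line_l_deriv nz)+
  next
    fix \<eta> :: real assume \<eta>: "\<eta> > 0"
    have "\<forall>\<^sub>F v in nhds (w, \<beta>, 0). dist (line_l' (fst v) (fst (snd v)) p q (of_real (snd (snd v)))) (line_l' w \<beta> p q 0) < \<eta>"
      using line_l'_tendsto[OF w, of p q \<beta>] \<eta> by (rule tendstoD)
    then obtain d where d: "d > 0" "\<And>v. dist v (w, \<beta>, 0) < d \<Longrightarrow>
        dist (line_l' (fst v) (fst (snd v)) p q (of_real (snd (snd v)))) (line_l' w \<beta> p q 0) < \<eta>"
      unfolding eventually_nhds_metric by blast
    have "\<forall>\<^sub>F j in sequentially. dist (W j) w < d / 4" using W(3) d(1) by (intro tendstoD) auto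
    moreover have "\<forall>\<^sub>F j in sequentially. dist (b j) \<beta> < d / 4" using k(3) d(1) unfolding b_def by (intro tendstoD) auto
    ultimately have "\<forall>\<^sub>F j in sequentially. \<forall>u. 0 \<le> u \<and> u \<le> d / 4 \<longrightarrow> norm (line_l' (W j) (b j) p q (of_real u) + of_real ?c) \<le> \<eta>"
    proof eventually_elim
      case (elim j)
      show ?case
      proof (intro allI impI)
        fix u :: real assume u: "0 \<le> u \<and> u \<le> d / 4"
        have "dist (W j, b j, u) (w, \<beta>, 0) \<le> dist (W j) w + (dist (b j) \<beta> + dist u 0)"
          using dist_Pair_le[of "W j" "(b j, u)" w "(\<beta>, 0)"] dist_Pair_le[of "b j" u \<beta> 0] by linarith
        also have "\<dots> < d" using elim u d(1) by (simp add: dist_real_def)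
        finally have "dist (line_l' (W j) (b j) p q (of_real u)) (line_l' w \<beta> p q 0) < \<eta>"
          using d(2)[of "(W j, b j, u)"] by simp
        then show "norm (line_l' (W j) (b j) p q (of_real u) + of_real ?c) \<le> \<eta>"
          unfolding line_l'_0[OF w \<beta>] dist_norm by (simp only: diff_minus_eq_add)
      qed
    qed
    then show "\<exists>\<delta>>0. \<forall>\<^sub>F j in sequentially. \<forall>u. 0 \<le> u \<and> u \<le> \<delta> \<longrightarrow>
        norm (line_l' (W j) (b j) p q (of_real u) + of_real ?c) \<le> \<eta>"
      using d(1) by (intro exI[of _ "d / 4"]) simp
  qed
  then show ?thesis unfolding line_P_saddle_pow inverse_eq_divide .
qed

section \<open>The asymptotic formula\<close>

lemma saddle_weight_0:
  assumes "0 < w" "w < 1"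
  shows "saddle_weight w 0 = of_real ((1 - w\<^sup>2) * sp_t w / (w * sp_z w))"
proof -
  note tx = sp_tx[OF assms]
  have e: "exp (complex_of_real (sp_t w)) = of_real (1 + w)" "exp (complex_of_real (sp_x w)) = of_real (1 / w)"
    unfolding exp_of_real tx by simp_all
  have "saddle_weight w 0 = of_real ((1 + w) * (2 - (1 + w)) * (sp_t w / sp_z w) * (1 / w))"
    unfolding saddle_weight_def Let_def fst_zero snd_zero using line_0(3)[OF assms] by (simp add: e)
  also have "(1 + w) * (2 - (1 + w)) * (sp_t w / sp_z w) * (1 / w) = (1 - w\<^sup>2) * sp_t w / (w * sp_z w)"
  proof -
    have "(1 + w) * (2 - (1 + w)) = 1 - w\<^sup>2" by (simp add: power2_eq_square algebra_simps)
    then show ?thesis by (simp only: times_divide_times_eq mult_1_right times_divide_eq_right mult.commute[of w])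
      (simp add: mult.commute)
  qed
  finally show ?thesis .
qed

lemma norm_saddle_weight_le:
  assumes "0 < w" "w < 1"
  shows "norm (saddle_weight w v) \<le> (1 + w) * (3 + w) * (1 / sp_z w) * (1 / w)"
proof -
  note tx = sp_tx[OF assms]
  note b = sp_bounds[OF assms]
  define t x where "t = of_real (sp_t w) * cis (fst v)" and "x = of_real (sp_x w) * cis (snd v)"
  have nt: "norm t = sp_t w" "norm x = sp_x w" using tx by (auto simp: t_def x_def norm_mult)
  have et: "norm (exp t) \<le> 1 + w" "norm (exp x) \<le> 1 / w"
    using norm_exp[of t] norm_exp[of x] tx nt by simp_all
  have "norm (2 - exp t) \<le> 2 + norm (exp t)" using norm_triangle_ineq4[of 2 "exp t"] by simp
  then have e2: "norm (2 - exp t) \<le> 3 + w" using et by simp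
  have "norm (of_real (sp_z w) / cot_z t) \<le> 1"
    unfolding t_def by (rule norm_cot_z_quot_le(1)[OF assms])
  moreover have "norm (t / cot_z t) = sp_t w * norm (of_real (sp_z w) / cot_z t) / sp_z w"
    using b nt by (simp add: norm_divide)
  moreover have "sp_t w * norm (of_real (sp_z w) / cot_z t) \<le> 1 * 1"
    using calculation(1) tx by (intro mult_mono) auto
  ultimately have tz: "norm (t / cot_z t) \<le> 1 / sp_z w"
    using b by (simp add: divide_right_mono)
  have "norm (saddle_weight w v) = norm (exp t) * norm (2 - exp t) * norm (t / cot_z t) * norm (exp x)"
    unfolding saddle_weight_def Let_def t_def[symmetric] x_def[symmetric] by (simp only: norm_mult norm_cis mult_1_right)
  also have "\<dots> \<le> (1 + w) * (3 + w) * (1 / sp_z w) * (1 / w)"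
    by (intro mult_mono et e2 tz) (use b assms in auto)
  finally show ?thesis .
qed

lemma saddle_weight_tendsto:
  assumes w: "0 < w" "w < 1" and W: "W \<longlonglongrightarrow> w" and v: "v \<longlonglongrightarrow> 0"
  shows "(\<lambda>j. saddle_weight (W j) (v j)) \<longlonglongrightarrow> saddle_weight w 0"
proof -
  have v': "(\<lambda>j. fst (v j)) \<longlonglongrightarrow> 0" "(\<lambda>j. snd (v j)) \<longlonglongrightarrow> 0"
    using tendsto_fst[OF v] tendsto_snd[OF v] by simp_all
  have cis: "(\<lambda>j. cis (fst (v j))) \<longlonglongrightarrow> cis 0" "(\<lambda>j. cis (snd (v j))) \<longlonglongrightarrow> cis 0"
    unfolding cis_conv_exp by (intro tendsto_intros v')+
  have z: "2 * (of_real (sp_t w) * cis 0) + 1 - exp (of_real (sp_t w) * cis 0) \<noteq> 0"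
    using cot_z_nonzero[OF w, of 0] by (simp add: cot_z_def)
  have T: "(\<lambda>j. sp_t (W j)) \<longlonglongrightarrow> sp_t w" "(\<lambda>j. sp_x (W j)) \<longlonglongrightarrow> sp_x w"
    unfolding sp_t_def sp_x_def using w by (auto intro!: tendsto_intros W)
  show ?thesis
    unfolding saddle_weight_def Let_def cot_z_def fst_zero snd_zero
    by (intro tendsto_intros cis T) (rule z)
qed

theorem saddle_integral_tendsto:
  fixes n k :: "nat \<Rightarrow> nat" and W :: "nat \<Rightarrow> real"
  assumes w: "0 < w" "w < 1" and \<beta>: "0 < \<beta>" "\<beta> < 1" "sp_h w = \<beta> / (1 - \<beta>)"
    and W: "\<And>j. 0 < W j" "\<And>j. W j < 1" "W \<longlonglongrightarrow> w"
    and k: "\<And>j. 0 < k j" "\<And>j. k j < n j" "(\<lambda>j. real (k j) / real (n j)) \<longlonglongrightarrow> \<beta>"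
    and s: "\<And>j. sp_h (W j) = (real (k j) / real (n j)) / (1 - real (k j) / real (n j))"
    and n: "filterlim (\<lambda>j. real (n j)) at_top sequentially"
  shows "(\<lambda>j. of_real (real (n j)) * (LBINT v. indicator torus v *\<^sub>R
      (saddle_weight (W j) v * saddle_pow (W j) (n j - k j) (k j) v))) \<longlonglongrightarrow>
    of_real ((1 - w\<^sup>2) * sp_t w / (w * sp_z w) *
      (2 * pi / (\<beta> / (w * sp_s w) * sp_t w * sp_x w * sqrt ((1 - w\<^sup>2) * sp_det w))))"
proof -
  note tx = sp_tx[OF w]
  note b = sp_bounds[OF w]
  define \<alpha> \<gamma> where "\<alpha> u = sp_t u / (24 * (2 + sp_t u))" and "\<gamma> u = u * sp_x u / (24 * (2 + sp_x u))" for u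
  define Q where "Q v = quad_a w \<beta> * (fst v)\<^sup>2 + 2 * quad_b w \<beta> * fst v * snd v + quad_d w \<beta> * (snd v)\<^sup>2"
    for v :: "real \<times> real"
  define G where "G v = saddle_weight w 0 * of_real (exp (- (Q v / 2)))" for v
  have T: "(\<lambda>j. sp_t (W j)) \<longlonglongrightarrow> sp_t w" "(\<lambda>j. sp_x (W j)) \<longlonglongrightarrow> sp_x w"
    unfolding sp_t_def sp_x_def using w by (auto intro!: tendsto_intros W)
  have l1: "(\<lambda>j. (1 - real (k j) / real (n j)) * \<alpha> (W j)) \<longlonglongrightarrow> (1 - \<beta>) * \<alpha> w"
    unfolding \<alpha>_def using tx by (intro tendsto_intros k T) auto
  have l2: "(\<lambda>j. real (k j) / real (n j) * \<gamma> (W j)) \<longlonglongrightarrow> \<beta> * \<gamma> w"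
    unfolding \<gamma>_def using tx by (intro tendsto_intros k T W) auto
  have ag: "0 < (1 - \<beta>) * \<alpha> w" "0 < \<beta> * \<gamma> w" using \<beta> tx w by (auto simp: \<alpha>_def \<gamma>_def)
  \<comment> \<open>Half the smaller of the two limiting decay rates, in \<theta> and in \<psi>, so
    that the actual rates exceed it from some index on.\<close>
  define c where "c = min ((1 - \<beta>) * \<alpha> w) (\<beta> * \<gamma> w) / 2"
  have c: "0 < c" "c < (1 - \<beta>) * \<alpha> w" "c < \<beta> * \<gamma> w"
  proof -
    have "0 < min ((1 - \<beta>) * \<alpha> w) (\<beta> * \<gamma> w)" using ag by simp
    moreover have "min ((1 - \<beta>) * \<alpha> w) (\<beta> * \<gamma> w) \<le> (1 - \<beta>) * \<alpha> w" by (rule min.cobounded1)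
    moreover have "min ((1 - \<beta>) * \<alpha> w) (\<beta> * \<gamma> w) \<le> \<beta> * \<gamma> w" by (rule min.cobounded2)
    ultimately show "0 < c" "c < (1 - \<beta>) * \<alpha> w" "c < \<beta> * \<gamma> w" unfolding c_def by linarith+
  qed
  have lz: "(\<lambda>j. sp_z (W j)) \<longlonglongrightarrow> sp_z w" unfolding sp_z_def using w by (auto intro!: tendsto_intros W)
  have lK: "(\<lambda>j. (1 + W j) * (3 + W j) * (1 / sp_z (W j)) * (1 / W j)) \<longlonglongrightarrow>
      (1 + w) * (3 + w) * (1 / sp_z w) * (1 / w)"
    using w b by (intro tendsto_intros W lz) auto
  \<comment> \<open>The bounds of \<open>norm_saddle_weight_le\<close> converge, so one more than
    their limit is an eventual bound.\<close>
  define K where "K = (1 + w) * (3 + w) * (1 / sp_z w) * (1 / w) + 1"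
  have "(\<lambda>j. of_real (sqrt (real (n j)) ^ DIM(real \<times> real)) * (LBINT v. indicator torus v *\<^sub>R
      (saddle_weight (W j) v * saddle_pow (W j) (n j - k j) (k j) v))) \<longlonglongrightarrow> integral\<^sup>L lborel G"
  proof (rule laplace_integral[where K = K and c = c and e = pi, OF n])
    fix j
    have "continuous_on torus (\<lambda>v. saddle_weight (W j) v * saddle_pow (W j) (n j - k j) (k j) v)"
      by (intro continuous_on_mult continuous_on_saddle W)
    then have "(\<lambda>v. indicator torus v *\<^sub>R (saddle_weight (W j) v * saddle_pow (W j) (n j - k j) (k j) v))
        \<in> borel_measurable lborel"
      by (intro borel_measurable_integrable borel_integrable_compact compact_Times) auto
    then show "(\<lambda>v. indicator torus v *\<^sub>R (saddle_weight (W j) v * saddle_pow (W j) (n j - k j) (k j) v))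
        \<in> borel_measurable borel" by simp
  next
    show "G \<in> borel_measurable borel" unfolding G_def Q_def
      by (intro borel_measurable_continuous_onI continuous_intros) auto
  next
    have "\<forall>\<^sub>F j in sequentially. c < (1 - real (k j) / real (n j)) * \<alpha> (W j)"
      using l1 c(2) by (rule order_tendstoD(1))
    moreover have "\<forall>\<^sub>F j in sequentially. c < real (k j) / real (n j) * \<gamma> (W j)"
      using l2 c(3) by (rule order_tendstoD(1))
    moreover have "\<forall>\<^sub>F j in sequentially. (1 + W j) * (3 + W j) * (1 / sp_z (W j)) * (1 / W j) < K"
      using lK by (rule order_tendstoD(2)) (simp add: K_def)
    ultimately show "\<forall>\<^sub>F j in sequentially. \<forall>v\<in>torus.
        norm (saddle_weight (W j) v * saddle_pow (W j) (n j - k j) (k j) v) \<le> K * exp (- (c * real (n j) * (norm v)\<^sup>2))"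
    proof eventually_elim
      case (elim j)
      show ?case
      proof
        fix v :: "real \<times> real" assume v: "v \<in> torus"
        then have v1: "\<bar>fst v\<bar> \<le> pi" "\<bar>snd v\<bar> \<le> pi" by (auto simp: mem_Times_iff abs_le_iff)
        have nj: "real (n j) > 0" using k(2)[of j] by simp
        have qz: "norm (of_real (sp_z (W j)) / cot_z (of_real (sp_t (W j)) * cis (fst v))) \<le> exp (- (\<alpha> (W j) * (fst v)\<^sup>2))"
          unfolding \<alpha>_def by (rule norm_cot_z_quot_le(2)[OF W(1,2) v1(1)])
        have qs: "norm (of_real (sp_s (W j)) / mark_s (of_real (sp_t (W j)) * cis (fst v)) (of_real (sp_x (W j)) * cis (snd v)))
            \<le> exp (- (\<gamma> (W j) * (snd v)\<^sup>2))"
          unfolding \<gamma>_def by (rule norm_mark_s_quot_le(2)[OF W(1,2) v1(2)])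
        have "norm (saddle_pow (W j) (n j - k j) (k j) v) \<le>
            exp (- (\<alpha> (W j) * (fst v)\<^sup>2)) ^ (n j - k j) * exp (- (\<gamma> (W j) * (snd v)\<^sup>2)) ^ k j"
          unfolding saddle_pow_def norm_mult norm_power
          by (intro mult_mono power_mono qz qs zero_le_power norm_ge_zero exp_ge_zero)
        also have "\<dots> = exp (- (real (n j - k j) * \<alpha> (W j) * (fst v)\<^sup>2 + real (k j) * \<gamma> (W j) * (snd v)\<^sup>2))"
          by (simp add: exp_of_nat_mult[symmetric] exp_add[symmetric] mult.assoc)
        also have "\<dots> \<le> exp (- (c * real (n j) * (norm v)\<^sup>2))"
        proof -
          have "c * real (n j) \<le> real (n j - k j) * \<alpha> (W j)" "c * real (n j) \<le> real (k j) * \<gamma> (W j)"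
          proof -
            have "real (n j - k j) = real (n j) * (1 - real (k j) / real (n j))"
              using nj k(2)[of j] by (simp add: of_nat_diff right_diff_distrib)
            moreover have "real (n j) * c \<le> real (n j) * ((1 - real (k j) / real (n j)) * \<alpha> (W j))"
              using elim(1) nj by (intro mult_left_mono) auto
            ultimately show "c * real (n j) \<le> real (n j - k j) * \<alpha> (W j)" by (simp only: mult_ac)
            have "real (n j) * c \<le> real (n j) * (real (k j) / real (n j) * \<gamma> (W j))"
              using elim(2) nj by (intro mult_left_mono) auto
            then show "c * real (n j) \<le> real (k j) * \<gamma> (W j)" using nj by (simp add: mult.commute)
          qed
          then have "c * real (n j) * (fst v)\<^sup>2 \<le> real (n j - k j) * \<alpha> (W j) * (fst v)\<^sup>2"
            "c * real (n j) * (snd v)\<^sup>2 \<le> real (k j) * \<gamma> (W j) * (snd v)\<^sup>2"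
            by (intro mult_right_mono; simp)+
          moreover have "(norm v)\<^sup>2 = (fst v)\<^sup>2 + (snd v)\<^sup>2"
            by (cases v) (simp add: norm_Pair)
          ultimately show ?thesis by (simp add: distrib_left)
        qed
        finally have "norm (saddle_pow (W j) (n j - k j) (k j) v) \<le> exp (- (c * real (n j) * (norm v)\<^sup>2))" .
        moreover have "norm (saddle_weight (W j) v) \<le> K"
          using norm_saddle_weight_le[OF W(1,2)[of j], of v] elim(3) by linarith
        ultimately show "norm (saddle_weight (W j) v * saddle_pow (W j) (n j - k j) (k j) v) \<le>
            K * exp (- (c * real (n j) * (norm v)\<^sup>2))"
          unfolding norm_mult by (intro mult_mono) (auto intro: order_trans[OF norm_ge_zero])
      qed
    qed
  next
    \<comment> \<open>The diagonal form a = d = 2 c supplies the integrability of the dominating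
      Gaussian.\<close>
    have "has_bochner_integral lborel (\<lambda>v :: real \<times> real. exp (- ((2 * c * (fst v)\<^sup>2 + 2 * 0 * fst v * snd v + 2 * c * (snd v)\<^sup>2) / 2)))
      (2 * pi / sqrt (2 * c * (2 * c) - 0\<^sup>2))"
      by (rule has_bochner_integral_gaussian2) (use c in auto)
    moreover have "(2 * c * (fst v)\<^sup>2 + 2 * 0 * fst v * snd v + 2 * c * (snd v)\<^sup>2) / 2 = c * (norm v)\<^sup>2"
      for v :: "real \<times> real" by (cases v) (simp add: norm_Pair distrib_left)
    ultimately show "integrable lborel (\<lambda>v :: real \<times> real. exp (- (c * (norm v)\<^sup>2)))"
      by (simp only: has_bochner_integral_iff)
  next
    fix v :: "real \<times> real"
    have "(\<lambda>j. v /\<^sub>R sqrt (real (n j))) \<longlonglongrightarrow> 0"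
    proof -
      have "filterlim (\<lambda>j. sqrt (real (n j))) at_top sequentially" by (rule filterlim_compose[OF sqrt_at_top n])
      then have "(\<lambda>j. inverse (sqrt (real (n j)))) \<longlonglongrightarrow> 0" by (rule tendsto_inverse_0_at_top)
      from tendsto_scaleR[OF this tendsto_const[of v]] show ?thesis by simp
    qed
    from saddle_weight_tendsto[OF w W(3) this]
    have "(\<lambda>j. saddle_weight (W j) (v /\<^sub>R sqrt (real (n j)))) \<longlonglongrightarrow> saddle_weight w 0" .
    moreover have "(\<lambda>j. saddle_pow (W j) (n j - k j) (k j) (v /\<^sub>R sqrt (real (n j)))) \<longlonglongrightarrow> of_real (exp (- (Q v / 2)))"
      using saddle_pow_tendsto[OF w \<beta> W k s n, of "fst v" "snd v"]
      by (simp only: Q_def minus_divide_left prod.collapse)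
    ultimately show "(\<lambda>j. saddle_weight (W j) (v /\<^sub>R sqrt (real (n j))) *
        saddle_pow (W j) (n j - k j) (k j) (v /\<^sub>R sqrt (real (n j)))) \<longlonglongrightarrow> G v"
      unfolding G_def by (rule tendsto_mult)
  next
    show "ball 0 pi \<subseteq> torus"
    proof
      fix v :: "real \<times> real" assume "v \<in> ball 0 pi"
      then have "norm v < pi" by simp
      then have "norm (fst v) < pi" "norm (snd v) < pi"
        using norm_fst_le[of "fst v" "snd v"] norm_snd_le[of "snd v" "fst v"] unfolding prod.collapse by linarith+
      then show "v \<in> torus" by (auto simp: mem_Times_iff abs_less_iff)
    qed
  qed auto
  also have "integral\<^sup>L lborel G = of_real ((1 - w\<^sup>2) * sp_t w / (w * sp_z w) *
      (2 * pi / (\<beta> / (w * sp_s w) * sp_t w * sp_x w * sqrt ((1 - w\<^sup>2) * sp_det w))))"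
  proof -
    define E where "E = \<beta> / (w * sp_s w) * sp_t w * sp_x w"
    have E: "0 < E" unfolding E_def by (intro mult_pos_pos divide_pos_pos \<beta>(1) w(1) b(6) tx(1,4))
    have w2: "0 < 1 - w\<^sup>2" using w power_strict_mono[of w 1 2] by simp
    have det: "quad_a w \<beta> * quad_d w \<beta> - (quad_b w \<beta>)\<^sup>2 = E\<^sup>2 * ((1 - w\<^sup>2) * sp_det w)"
      using quad_det[OF w \<beta>] by (simp add: E_def)
    have "has_bochner_integral lborel (\<lambda>v. exp (- (Q v / 2))) (2 * pi / sqrt (quad_a w \<beta> * quad_d w \<beta> - (quad_b w \<beta>)\<^sup>2))"
      unfolding Q_def
    proof (rule has_bochner_integral_gaussian2)
      show "0 < quad_d w \<beta>" unfolding quad_d_def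
        by (intro mult_pos_pos divide_pos_pos zero_less_power \<beta>(1) w(1) b(6) tx(4))
      show "0 < quad_a w \<beta> * quad_d w \<beta> - (quad_b w \<beta>)\<^sup>2"
        unfolding det using E w2 sp_det_pos[OF w] by simp
    qed
    then have "(LBINT v. exp (- (Q v / 2))) = 2 * pi / (E * sqrt ((1 - w\<^sup>2) * sp_det w))"
      unfolding det using E by (simp add: has_bochner_integral_iff real_sqrt_mult)
    then show ?thesis unfolding G_def saddle_weight_0[OF w] E_def by simp
  qed
  finally show ?thesis by simp
qed

section \<open>The number of all cographs\<close>

definition tree_integral :: "nat \<Rightarrow> complex" where
  "tree_integral n = (LBINT \<theta>. indicator {-pi..pi} \<theta> *\<^sub>R
     (of_real (ln 2) * cis \<theta> * (of_real rho / cot_z (of_real (ln 2) * cis \<theta>)) ^ n))"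

lemma rho_alt: "2 * ln 2 + 1 - exp (ln 2) = rho"
  by (simp add: rho_def)

lemma cot_z_ln2: "cot_z (of_real (ln 2) * cis \<theta>) \<noteq> 0"
  "norm (of_real rho / cot_z (of_real (ln 2) * cis \<theta>)) \<le> 1"
  "\<bar>\<theta>\<bar> \<le> pi \<Longrightarrow> norm (of_real rho / cot_z (of_real (ln 2) * cis \<theta>)) \<le>
     exp (- (ln 2 / (24 * (2 + ln 2)) * \<theta>\<^sup>2))"
proof -
  have l: "0 < ln (2::real)" "ln 2 \<le> (1::real)" using ln_2_less_1 by auto
  show "cot_z (of_real (ln 2) * cis \<theta>) \<noteq> 0"
    by (rule cot_z_nonzero_gen[OF l(1), unfolded rho_alt, OF rho_bounds(1)])
  show "norm (of_real rho / cot_z (of_real (ln 2) * cis \<theta>)) \<le> 1"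
    by (rule norm_cot_z_quot_le_gen(1)[OF l, unfolded rho_alt, OF rho_bounds(1)])
  show "norm (of_real rho / cot_z (of_real (ln 2) * cis \<theta>)) \<le>
     exp (- (ln 2 / (24 * (2 + ln 2)) * \<theta>\<^sup>2))" if "\<bar>\<theta>\<bar> \<le> pi"
    by (rule norm_cot_z_quot_le_gen(2)[OF l, unfolded rho_alt, OF rho_bounds(1) that])
qed

text \<open>The disc of radius 3 / 4 contains the circle of radius ln 2 and has no pole: e^3 \<le>
  27 < (5 / 2)^4 gives exp (3 / 4) < 5 / 2, hence (exp (3 / 4) - 1) / (3 / 4) < 2. The factor t in
  \<open>tree_integral\<close> arises because the power has exponent n and the coefficient index n -
  1.\<close>

lemma num_all_unmarked_integral:
  assumes "n \<ge> 2"
  shows "complex_of_nat (num_all n 0) = fact n / (of_nat n * of_real (pi * rho ^ n)) * tree_integral n"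
proof -
  define T where "T \<theta> = of_real (ln 2) * cis \<theta>" for \<theta>
  have nz: "2 - exp_quot t \<noteq> 0" if "t \<in> ball 0 (3 / 4)" for t
  proof -
    have "norm (exp_quot t) \<le> (exp (3 / 4) - 1) / (3 / 4)" by (rule norm_exp_quot_le) (use that in auto)
    also have "\<dots> < 2"
    proof -
      have "exp (3 / 4) ^ 4 = exp (1::real) ^ 3" by (simp flip: exp_of_nat_mult)
      also have "\<dots> \<le> 3 ^ 3" by (rule power_mono) (use exp_le in auto)
      also have "\<dots> < (5 / 2) ^ 4" by (simp add: power_divide)
      finally have "exp (3 / 4) < (5 / 2 :: real)" by (rule power_less_imp_less_base) simp
      then show ?thesis by simp
    qed
    finally show ?thesis by auto
  qed
  have ln2: "0 < ln (2::real)" "ln 2 < (3 / 4 :: real)" using ln2_le_25_over_36 by auto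
  have "(\<lambda>t. inverse (2 - exp_quot t) ^ n) has_fps_expansion inverse (2 - exp_quot_fps) ^ n"
    using exp_quot_fps_0 by (intro fps_expansion_intros exp_quot_has_fps_expansion) simp
  moreover have "(\<lambda>t. inverse (2 - exp_quot t) ^ n) holomorphic_on ball 0 (3 / 4)"
    using nz by (intro holomorphic_intros exp_quot_holomorphic) auto
  ultimately have c: "(inverse (2 - exp_quot_fps) ^ n) $ (n - 1) =
      (LBINT \<theta>. indicator {-pi..pi} \<theta> *\<^sub>R (inverse (2 - exp_quot (T \<theta>)) ^ n * cis (- real (n - 1) * \<theta>))) /
      of_real (2 * pi * ln 2 ^ (n - 1))"
    unfolding T_def by (rule fps_nth_integral) (use ln2 in auto)
  have "inverse (2 - exp_quot (T \<theta>)) ^ n * cis (- real (n - 1) * \<theta>) =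
      (T \<theta> * (of_real rho / cot_z (T \<theta>)) ^ n) * of_real (ln 2 ^ (n - 1) / rho ^ n)" for \<theta>
  proof -
    have T0: "T \<theta> \<noteq> 0" by (simp add: T_def)
    have V: "inverse (2 - exp_quot (T \<theta>)) = T \<theta> / cot_z (T \<theta>)"
      unfolding cot_z_eq using T0 by (simp add: divide_inverse)
    have cp: "T \<theta> ^ (n - 1) * cis (- real (n - 1) * \<theta>) = of_real (ln 2 ^ (n - 1))"
      by (simp add: T_def power_mult_distrib Complex.DeMoivre cis_mult)
    have Tn: "T \<theta> ^ n = T \<theta> * T \<theta> ^ (n - 1)" using assms by (cases n) auto
    have "inverse (2 - exp_quot (T \<theta>)) ^ n * cis (- real (n - 1) * \<theta>) =
        T \<theta> * (T \<theta> ^ (n - 1) * cis (- real (n - 1) * \<theta>)) / cot_z (T \<theta>) ^ n"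
      unfolding V power_divide Tn by simp
    then show ?thesis unfolding cp using rho_bounds by (simp add: power_divide)
  qed
  then have eq: "(LBINT \<theta>. indicator {-pi..pi} \<theta> *\<^sub>R (inverse (2 - exp_quot (T \<theta>)) ^ n * cis (- real (n - 1) * \<theta>))) =
      tree_integral n * of_real (ln 2 ^ (n - 1) / rho ^ n)"
    unfolding tree_integral_def T_def[symmetric] by (simp only: mult_scaleR_left[symmetric] integral_mult_left_zero)
  then show ?thesis unfolding num_all_unmarked_eq[OF assms] c eq using ln2 rho_bounds by (simp add: field_simps)
qed

text \<open>The line functions at w = 1, where exp t = 2. There z' vanishes, so the logarithmic
  derivative is zero at the centre and the Gaussian is determined by z'' alone.\<close>

lemma tree_pow_tendsto:
  assumes n: "filterlim (\<lambda>j. real (n j)) at_top sequentially"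
  shows "(\<lambda>j. (of_real rho / cot_z (of_real (ln 2) * cis (p / sqrt (real (n j))))) ^ n j) \<longlonglongrightarrow>
    of_real (exp (- (2 * (ln 2)\<^sup>2 / rho * p\<^sup>2) / 2))"
proof -
  have cis: "line_t 1 p (of_real u) = of_real (ln 2) * cis (u * p)" for u
    by (simp add: line_t_def cis_conv_exp mult_ac)
  have nz: "cot_z (line_t 1 p (of_real u)) \<noteq> 0" for u unfolding cis by (rule cot_z_ln2)
  have t0: "line_t 1 p 0 = of_real (ln 2)" using cis[of 0] by simp
  have e0: "exp (line_t 1 p 0) = 2" unfolding t0 exp_of_real by simp
  have c0: "cot_z (line_t 1 p 0) = of_real rho" unfolding cot_z_def e0 unfolding t0 by (simp add: rho_def)
  have z10: "line_z1 1 p 0 = 0" unfolding line_z1_def Let_def e0 by simp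
  have z20: "line_z2 1 p 0 = of_real (2 * (ln 2)\<^sup>2 * p\<^sup>2)"
    unfolding line_z2_def Let_def e0 unfolding t0 by (simp add: power2_eq_square algebra_simps)
  define l l' where "l u = - (line_z1 1 p u / cot_z (line_t 1 p u))"
    and "l' u = - ((line_z2 1 p u * cot_z (line_t 1 p u) - line_z1 1 p u * line_z1 1 p u) / (cot_z (line_t 1 p u) * cot_z (line_t 1 p u)))" for u
  have l'0: "l' 0 = - of_real (2 * (ln 2)\<^sup>2 / rho * p\<^sup>2)"
    unfolding l'_def z10 z20 c0 using rho_bounds by (simp add: field_simps)
  have dl: "(l has_field_derivative l' (of_real u)) (at (of_real u))" for u
    unfolding l_def l'_def by (rule DERIV_minus DERIV_divide line_z1_deriv line_z_deriv nz)+
  have "(\<lambda>j. (of_real rho / cot_z (line_t 1 p (of_real (1 / sqrt (real (n j)))))) ^ n j) \<longlonglongrightarrow>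
      of_real (exp (- (2 * (ln 2)\<^sup>2 / rho * p\<^sup>2) / 2))"
  proof (rule gaussian_limit_along_line[where P = "\<lambda>j u. (of_real rho / cot_z (line_t 1 p (of_real u))) ^ n j"
        and l = "\<lambda>j u. l (of_real u)" and l' = "\<lambda>j u. l' (of_real u)", OF n])
    fix j u
    show "(of_real rho / cot_z (line_t 1 p (of_real 0))) ^ n j = 1" using c0 rho_bounds by simp
    have "((\<lambda>u. of_real rho / cot_z (line_t 1 p u)) has_field_derivative
        of_real rho / cot_z (line_t 1 p (of_real u)) * l (of_real u)) (at (of_real u))"
      using line_z_deriv[of 1 p "of_real u"] nz[of u] unfolding l_def
      by (auto intro!: derivative_eq_intros simp: field_simps)
    from power_log_deriv[OF this, of "n j"]
    show "((\<lambda>u. (of_real rho / cot_z (line_t 1 p (of_real u))) ^ n j) has_vector_derivative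
        of_real (real (n j)) * l (of_real u) * (of_real rho / cot_z (line_t 1 p (of_real u))) ^ n j) (at u)"
      by (intro has_vector_derivative_real_field) (simp add: mult_ac)
    show "norm ((of_real rho / cot_z (line_t 1 p (of_real u))) ^ n j) \<le> 1"
      unfolding norm_power cis using cot_z_ln2(2) by (intro power_le_one) auto
    show "l (of_real 0) = 0" by (simp add: l_def z10)
    show "((\<lambda>u. l (of_real u)) has_vector_derivative l' (of_real u)) (at u)"
      by (rule has_vector_derivative_real_field dl)+
  next
    fix \<eta> :: real assume \<eta>: "\<eta> > 0"
    have t: "((\<lambda>u. line_t 1 p (of_real u)) \<longlongrightarrow> line_t 1 p (of_real 0)) (nhds 0)"
      unfolding line_t_def by (intro tendsto_intros filterlim_ident)
    have "((\<lambda>u. l' (of_real u)) \<longlongrightarrow> l' (of_real 0)) (nhds 0)"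
      unfolding l'_def line_z1_def line_z2_def Let_def cot_z_def
      by (intro tendsto_intros t) (use nz[of 0] in \<open>auto simp: cot_z_def\<close>)
    then have "\<forall>\<^sub>F u in nhds 0. dist (l' (of_real u)) (l' (of_real 0)) < \<eta>" using \<eta> by (rule tendstoD)
    then obtain d where d: "d > 0" "\<And>u :: real. dist u 0 < d \<Longrightarrow> dist (l' (of_real u)) (l' (of_real 0)) < \<eta>"
      unfolding eventually_nhds_metric by blast
    have "norm (l' (of_real u) + of_real (2 * (ln 2)\<^sup>2 / rho * p\<^sup>2)) \<le> \<eta>" if "0 \<le> u" "u \<le> d / 2" for u
      using d(2)[of u] that d(1) by (simp add: l'0 dist_norm)
    then show "\<exists>\<delta>>0. \<forall>\<^sub>F j in sequentially. \<forall>u. 0 \<le> u \<and> u \<le> \<delta> \<longrightarrow>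
        norm (l' (of_real u) + of_real (2 * (ln 2)\<^sup>2 / rho * p\<^sup>2)) \<le> \<eta>"
      using d(1) by (intro exI[of _ "d / 2"]) auto
  qed
  moreover have "1 / sqrt (real (n j)) * p = p / sqrt (real (n j))" for j by simp
  ultimately show ?thesis unfolding cis by (simp only:)
qed

text \<open>Laplace's method on a fixed circle, so the constants do not depend on j. The Gaussian
  integral ln 2 sqrt (2 pi / e) simplifies to sqrt (pi rho).\<close>

theorem tree_integral_tendsto:
  assumes n: "filterlim (\<lambda>j. real (n j)) at_top sequentially"
  shows "(\<lambda>j. of_real (sqrt (real (n j))) * tree_integral (n j)) \<longlonglongrightarrow> of_real (sqrt (pi * rho))"
proof -
  define e where "e = 2 * (ln 2)\<^sup>2 / rho"
  have e: "0 < e" using rho_bounds by (simp add: e_def)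
  define c where "c = ln 2 / (24 * (2 + ln (2::real)))"
  have c: "0 < c" unfolding c_def by (intro divide_pos_pos mult_pos_pos add_pos_pos) auto
  define F where "F j \<theta> = of_real (ln 2) * cis \<theta> * (of_real rho / cot_z (of_real (ln 2) * cis \<theta>)) ^ n j" for j \<theta>
  have "(\<lambda>j. of_real (sqrt (real (n j)) ^ DIM(real)) * (LBINT \<theta>. indicator {-pi..pi} \<theta> *\<^sub>R F j \<theta>)) \<longlonglongrightarrow>
      (LBINT p. of_real (ln 2) * of_real (exp (- (e * p\<^sup>2) / 2)))"
  proof (rule laplace_integral[where K = "ln 2" and c = c and e = pi, OF n])
    fix j
    have "continuous_on {-pi..pi} (F j)"
      unfolding F_def cot_z_def
      by (intro continuous_intros) (use cot_z_ln2(1) in \<open>auto simp: cot_z_def\<close>)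
    then have "(\<lambda>\<theta>. indicator {-pi..pi} \<theta> *\<^sub>R F j \<theta>) \<in> borel_measurable lborel"
      by (intro borel_measurable_integrable borel_integrable_compact) auto
    then show "(\<lambda>\<theta>. indicator {-pi..pi} \<theta> *\<^sub>R F j \<theta>) \<in> borel_measurable borel" by simp
  next
    show "\<forall>\<^sub>F j in sequentially. \<forall>\<theta>\<in>{-pi..pi}. norm (F j \<theta>) \<le> ln 2 * exp (- (c * real (n j) * (norm \<theta>)\<^sup>2))"
    proof (intro always_eventually allI ballI)
      fix j \<theta> assume "\<theta> \<in> {-pi..pi}"
      then have "\<bar>\<theta>\<bar> \<le> pi" by auto
      then have "norm ((of_real rho / cot_z (of_real (ln 2) * cis \<theta>)) ^ n j) \<le> exp (- (c * \<theta>\<^sup>2)) ^ n j"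
        unfolding norm_power c_def by (intro power_mono cot_z_ln2) auto
      also have "\<dots> = exp (- (c * real (n j) * (norm \<theta>)\<^sup>2))"
        by (simp add: exp_of_nat_mult[symmetric] mult_ac)
      finally show "norm (F j \<theta>) \<le> ln 2 * exp (- (c * real (n j) * (norm \<theta>)\<^sup>2))"
        unfolding F_def norm_mult by simp
    qed
  next
    have "integrable lborel (\<lambda>x. exp (- (2 * c * (x - 0)\<^sup>2 / 2)))"
      using has_bochner_integral_gaussian[of "2 * c" 0] c by (simp only: has_bochner_integral_iff)
    then show "integrable lborel (\<lambda>\<theta>::real. exp (- (c * (norm \<theta>)\<^sup>2)))" by simp
  next
    fix p :: real
    have pe: "p /\<^sub>R x = p / x" for x by (simp add: divide_inverse mult.commute)
    have l0: "(\<lambda>j. p / sqrt (real (n j))) \<longlonglongrightarrow> 0"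
    proof -
      have "filterlim (\<lambda>j. sqrt (real (n j))) at_top sequentially" by (rule filterlim_compose[OF sqrt_at_top n])
      then have "(\<lambda>j. inverse (sqrt (real (n j)))) \<longlonglongrightarrow> 0" by (rule tendsto_inverse_0_at_top)
      from tendsto_mult[OF tendsto_const[of p] this] show ?thesis by (simp add: divide_inverse)
    qed
    have "(\<lambda>j. of_real (ln 2) * cis (p / sqrt (real (n j)))) \<longlonglongrightarrow> complex_of_real (ln 2) * 1"
    proof -
      have "(\<lambda>j. cis (p / sqrt (real (n j)))) \<longlonglongrightarrow> exp (\<i> * of_real 0)"
        unfolding cis_conv_exp by (intro tendsto_intros l0)
      then show ?thesis by (intro tendsto_intros; simp)
    qed
    from tendsto_mult[OF this tree_pow_tendsto[OF n, of p]]
    show "(\<lambda>j. F j (p /\<^sub>R sqrt (real (n j)))) \<longlonglongrightarrow> of_real (ln 2) * of_real (exp (- (e * p\<^sup>2) / 2))"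
      unfolding F_def e_def pe mult_1_right .
  next
    show "ball 0 pi \<subseteq> {-pi..pi}" by (auto simp: dist_real_def)
    show "(\<lambda>p. of_real (ln 2) * complex_of_real (exp (- (e * p\<^sup>2) / 2))) \<in> borel_measurable borel" by measurable
  qed auto
  also have "(LBINT p. of_real (ln 2) * complex_of_real (exp (- (e * p\<^sup>2) / 2))) = of_real (ln 2 * sqrt (2 * pi / e))"
    using has_bochner_integral_gaussian[OF e, of 0] by (simp add: has_bochner_integral_iff)
  also have "ln 2 * sqrt (2 * pi / e) = sqrt ((ln 2)\<^sup>2 * (2 * pi / e))"
    unfolding real_sqrt_mult[of "(ln 2)\<^sup>2"] by simp
  also have "(ln 2)\<^sup>2 * (2 * pi / e) = pi * rho" using rho_bounds by (simp add: e_def)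
  finally show ?thesis by (simp add: tree_integral_def F_def)
qed

section \<open>Quotient of the two integrals\<close>

lemma isCont_growth_factor:
  assumes "0 < \<beta>" "\<beta> < 1" shows "isCont growth_factor \<beta>"
proof -
  note s = saddle[OF assms]
  note b = sp_bounds[OF s(1,2)]
  have sp: "isCont sp_z (saddle \<beta>)" "isCont sp_s (saddle \<beta>)" "isCont sp_det (saddle \<beta>)"
    using continuous_on_sp s(1,2) by (auto simp: continuous_on_eq_continuous_at)
  note c = isCont_o2[OF isCont_saddle[OF assms]]
  show ?thesis unfolding growth_factor_def
    by (intro continuous_intros c[OF sp(1)] c[OF sp(2)] c[OF sp(3)] isCont_saddle[OF assms])
      (use assms b rho_bounds sp_det_pos[OF s(1,2)] in auto)
qed

text \<open>For \<beta> = k / n the real exponents multiplied by n become the integers n - k and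
  k.\<close>

lemma growth_rate_power:
  assumes "0 < k" "k < n"
  defines "w \<equiv> saddle (real k / real n)"
  shows "growth_rate (real k / real n) ^ n = rho ^ n / (sp_z w ^ (n - k) * sp_s w ^ k)"
proof -
  have \<beta>: "0 < real k / real n" "real k / real n < 1" using assms by auto
  note b = sp_bounds[OF saddle(1,2)[OF \<beta>], folded w_def]
  have pow: "(y powr (- c)) ^ n = 1 / y ^ m" if "0 < y" "real n * c = real m" for y c m
  proof -
    have "(y powr (- c)) ^ n = y powr (- (real n * c))"
      using that(1) by (simp add: powr_powr[symmetric] powr_realpow[symmetric] powr_powr mult.commute)
    also have "\<dots> = 1 / y ^ m" unfolding that(2) using that(1) by (simp add: powr_minus powr_realpow divide_inverse)
    finally show ?thesis .
  qed
  have "real n * (1 - real k / real n) = real (n - k)" "real n * (real k / real n) = real k"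
    using assms(1,2) by (auto simp: right_diff_distrib of_nat_diff)
  then have "(sp_z w powr (- (1 - real k / real n))) ^ n = 1 / sp_z w ^ (n - k)"
    "(sp_s w powr (- (real k / real n))) ^ n = 1 / sp_s w ^ k"
    using pow b by blast+
  then show ?thesis unfolding growth_rate_def w_def[symmetric] power_mult_distrib by simp
qed

text \<open>An exact identity. The binomial coefficient times the factorials of the marked count is
  n!, which cancels against the total count; the divisor k / n combines the factors 1 / k and 1 / n
  left by the two inversions.\<close>

lemma expected_indep_sets_integral:
  assumes "0 < k" "k < n"
  defines "w \<equiv> saddle (real k / real n)"
  shows "complex_of_real (expected_indep_sets n k) * tree_integral n =
    of_real (growth_rate (real k / real n) ^ n * (sp_x w / (4 * pi * (real k / real n)))) *
    (LBINT v. indicator torus v *\<^sub>R (saddle_weight w v * saddle_pow w (n - k) k v))"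
proof -
  have \<beta>: "0 < real k / real n" "real k / real n < 1" using assms by auto
  note s = saddle(1,2)[OF \<beta>, folded w_def]
  note b = sp_bounds[OF s]
  define I where "I = (LBINT v. indicator torus v *\<^sub>R (saddle_weight w v * saddle_pow w (n - k) k v))"
  have n2: "n \<ge> 2" "k \<ge> 1" using assms by auto
  have nz: "num_all n 0 \<noteq> 0"
  proof -
    have "indep_cographs {..<n} {} \<noteq> {}"
    proof -
      have "labeled_cographs n \<noteq> {}" by (rule labeled_cographs_nonempty) (use n2 in simp)
      then have "card (labeled_cographs n) \<noteq> 0" using finite_labeled_cographs by simp
      moreover have "labeled_cographs n = indep_cographs {1..n} {}"
        by (simp add: labeled_cographs_def indep_cographs_def)
      ultimately have "num_all n 0 \<noteq> 0" using card_cographs_relabel(1)[of "{1..n}" "{}"] by simp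
      then show ?thesis by (auto simp: num_all_def)
    qed
    then show ?thesis by (simp add: num_all_def finite_indep_cographs)
  qed
  have "complex_of_real (expected_indep_sets n k) * of_nat (num_all n 0) = of_nat (n choose k) * of_nat (num_all (n - k) k)"
    using expected_indep_sets_eq[of k n] assms nz by simp
  also have "\<dots> = of_nat (n choose k) * (fact (n - k) * fact k *
      of_real (sp_x w / (4 * pi\<^sup>2 * real k * sp_z w ^ (n - k) * sp_s w ^ k)) * I)"
    unfolding num_all_integral[OF s n2(2)] I_def ..
  also have "\<dots> = fact n * (of_real (sp_x w / (4 * pi\<^sup>2 * real k * sp_z w ^ (n - k) * sp_s w ^ k)) * I)"
  proof -
    have "of_nat (n choose k) * (fact (n - k) * fact k) = (fact n :: complex)"
      using assms by (simp add: binomial_fact)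
    then show ?thesis by (simp only: mult.assoc[symmetric])
  qed
  finally have "complex_of_real (expected_indep_sets n k) * (fact n / (of_nat n * of_real (pi * rho ^ n)) * tree_integral n) =
      fact n * (of_real (sp_x w / (4 * pi\<^sup>2 * real k * sp_z w ^ (n - k) * sp_s w ^ k)) * I)"
    unfolding num_all_unmarked_integral[OF n2(1)] .
  moreover have "E * (fact n / d * T) = fact n * (E * (1 / d * T))" for E d T :: complex by simp
  ultimately have "complex_of_real (expected_indep_sets n k) * (1 / (of_nat n * of_real (pi * rho ^ n)) * tree_integral n) =
      of_real (sp_x w / (4 * pi\<^sup>2 * real k * sp_z w ^ (n - k) * sp_s w ^ k)) * I"
    by (simp only: mult_cancel_left fact_nonzero simp_thms)
  then have "complex_of_real (expected_indep_sets n k) * tree_integral n =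
      of_nat n * of_real (pi * rho ^ n) * (of_real (sp_x w / (4 * pi\<^sup>2 * real k * sp_z w ^ (n - k) * sp_s w ^ k)) * I)"
    using n2 rho_bounds by (simp add: field_simps)
  also have "\<dots> = of_real (real n * (pi * rho ^ n) * (sp_x w / (4 * pi\<^sup>2 * real k * sp_z w ^ (n - k) * sp_s w ^ k))) * I"
    by simp
  also have "real n * (pi * rho ^ n) * (sp_x w / (4 * pi\<^sup>2 * real k * sp_z w ^ (n - k) * sp_s w ^ k)) =
      growth_rate (real k / real n) ^ n * (sp_x w / (4 * pi * (real k / real n)))"
    unfolding growth_rate_power[OF assms(1,2)] w_def[symmetric] using assms(1,2) b
    by (simp add: power2_eq_square field_simps)
  finally show ?thesis unfolding I_def .
qed

text \<open>q, d and r stand for the square roots of 1 - w^2, \<open>sp_det w\<close> and pi rho.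
  With these as positive variables, only an identity of rational functions remains.\<close>

lemma growth_factor_identity:
  fixes x s z t q d r \<beta> w :: real
  assumes "0 < x" "0 < s" "0 < z" "0 < t" "0 < q" "0 < d" "0 < r" "0 < \<beta>" "0 < w"
  shows "x / (4 * pi * \<beta>) / (s * q / (2 * \<beta>\<^sup>2 * z * (r * d))) *
        (q\<^sup>2 * t / (w * z) * (2 * pi / (\<beta> / (w * s) * t * x * (q * d)))) / r = 1"
proof -
  have "q\<^sup>2 * t / (w * z) * (2 * pi / (\<beta> / (w * s) * t * x * (q * d))) = 2 * pi * q * s / (\<beta> * x * d * z)"
    using assms by (simp add: power2_eq_square mult_ac)
  moreover have "x / (4 * pi * \<beta>) / (s * q / (2 * \<beta>\<^sup>2 * z * (r * d))) = x * \<beta> * z * r * d / (2 * pi * s * q)"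
    using assms by (simp add: power2_eq_square mult_ac)
  moreover have "x * \<beta> * z * r * d / (2 * pi * s * q) * (2 * pi * q * s / (\<beta> * x * d * z)) = r"
    using assms by simp
  ultimately show ?thesis using assms by simp
qed

text \<open>The torus integral converges after multiplication by n, the other one after
  multiplication by sqrt n. In the quotient this leaves the factor sqrt n, which is the compensation
  of n^(-1/2).\<close>

theorem expected_indep_sets_seq:
  fixes n k :: "nat \<Rightarrow> nat"
  assumes \<beta>: "0 < \<beta>" "\<beta> < 1"
    and k: "\<And>j. 0 < k j" "\<And>j. k j < n j" "(\<lambda>j. real (k j) / real (n j)) \<longlonglongrightarrow> \<beta>"
    and n: "filterlim (\<lambda>j. real (n j)) at_top sequentially"
  shows "(\<lambda>j. expected_indep_sets (n j) (k j) / (growth_factor (real (k j) / real (n j)) *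
    real (n j) powr (- 1 / 2) * growth_rate (real (k j) / real (n j)) ^ n j)) \<longlonglongrightarrow> 1"
proof -
  define b where "b j = real (k j) / real (n j)" for j
  have b: "0 < b j" "b j < 1" for j using k(1,2)[of j] by (auto simp: b_def)
  have lb: "(\<lambda>j. b j) \<longlonglongrightarrow> \<beta>" using k(3) by (simp add: b_def)
  define W where "W j = saddle (b j)" for j
  define w where "w = saddle \<beta>"
  note w = saddle[OF \<beta>, folded w_def]
  note bd = sp_bounds[OF w(1,2)]
  note tx = sp_tx[OF w(1,2)]
  have W: "0 < W j" "W j < 1" "sp_h (W j) = b j / (1 - b j)" for j using saddle[OF b] by (auto simp: W_def)
  have lW: "W \<longlonglongrightarrow> w" unfolding W_def w_def by (rule isCont_tendsto_compose[OF isCont_saddle[OF \<beta>] lb])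
  define I where "I j = (LBINT v. indicator torus v *\<^sub>R (saddle_weight (W j) v * saddle_pow (W j) (n j - k j) (k j) v))" for j
  define A where "A = (1 - w\<^sup>2) * sp_t w / (w * sp_z w) *
      (2 * pi / (\<beta> / (w * sp_s w) * sp_t w * sp_x w * sqrt ((1 - w\<^sup>2) * sp_det w)))"
  have lI: "(\<lambda>j. of_real (real (n j)) * I j) \<longlonglongrightarrow> of_real A"
    unfolding I_def A_def
    by (rule saddle_integral_tendsto[OF w(1,2) \<beta> w(3) W(1,2) lW k W(3)[unfolded b_def] n])
  have lT: "(\<lambda>j. of_real (sqrt (real (n j))) * tree_integral (n j)) \<longlonglongrightarrow> of_real (sqrt (pi * rho))"
    by (rule tree_integral_tendsto[OF n])
  have lx: "(\<lambda>j. sp_x (W j)) \<longlonglongrightarrow> sp_x w" unfolding sp_x_def using w(1) by (intro tendsto_intros lW) auto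
  have lB: "(\<lambda>j. growth_factor (b j)) \<longlonglongrightarrow> growth_factor \<beta>"
    by (rule isCont_tendsto_compose[OF isCont_growth_factor[OF \<beta>] lb])
  have B: "0 < growth_factor \<beta>" by (rule growth_factor_pos[OF \<beta>])
  define R where "R j = complex_of_real (sp_x (W j) / (4 * pi * b j) / growth_factor (b j)) * (of_real (real (n j)) * I j) /
      (of_real (sqrt (real (n j))) * tree_integral (n j))" for j
  have "R \<longlonglongrightarrow> complex_of_real (sp_x w / (4 * pi * \<beta>) / growth_factor \<beta>) * of_real A / of_real (sqrt (pi * rho))"
    unfolding R_def using B \<beta> rho_bounds by (intro tendsto_intros lI lT lx lb lB) auto
  also have "complex_of_real (sp_x w / (4 * pi * \<beta>) / growth_factor \<beta>) * of_real A / of_real (sqrt (pi * rho)) =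
      of_real (sp_x w / (4 * pi * \<beta>) / growth_factor \<beta> * A / sqrt (pi * rho))" by simp
  also have "sp_x w / (4 * pi * \<beta>) / growth_factor \<beta> * A / sqrt (pi * rho) = 1"
  proof -
    define q where "q = sqrt (1 - w\<^sup>2)"
    define d where "d = sqrt (sp_det w)"
    define r where "r = sqrt (pi * rho)"
    have "0 < 1 - w\<^sup>2" using w power_strict_mono[of w 1 2] by simp
    then have q: "0 < q" "1 - w\<^sup>2 = q\<^sup>2" by (auto simp: q_def)
    have d: "0 < d" using sp_det_pos[OF w(1,2)] by (simp add: d_def)
    have r: "0 < r" using rho_bounds by (simp add: r_def)
    have "growth_factor \<beta> = sp_s w * q / (2 * \<beta>\<^sup>2 * sp_z w * (r * d))"
      unfolding growth_factor_def w_def[symmetric] q_def d_def r_def real_sqrt_mult ..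
    moreover have "A = (1 - w\<^sup>2) * sp_t w / (w * sp_z w) * (2 * pi / (\<beta> / (w * sp_s w) * sp_t w * sp_x w * (q * d)))"
      unfolding A_def q_def d_def real_sqrt_mult ..
    then have "A = q\<^sup>2 * sp_t w / (w * sp_z w) * (2 * pi / (\<beta> / (w * sp_s w) * sp_t w * sp_x w * (q * d)))"
      unfolding q(2) .
    ultimately show ?thesis unfolding r_def[symmetric]
      by (simp only: growth_factor_identity[OF tx(4) bd(6,2) tx(1) q(1) d r \<beta>(1) w(1)])
  qed
  finally have lR: "R \<longlonglongrightarrow> 1" by simp
  have "\<forall>\<^sub>F j in sequentially. R j = of_real (expected_indep_sets (n j) (k j) / (growth_factor (b j) *
    real (n j) powr (- 1 / 2) * growth_rate (b j) ^ n j))"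
  proof -
    have "\<forall>\<^sub>F j in sequentially. of_real (sqrt (real (n j))) * tree_integral (n j) \<noteq> 0"
      using tendsto_imp_eventually_ne[OF lT, of 0] rho_bounds by simp
    then show ?thesis
    proof eventually_elim
      case (elim j)
      define E where "E = complex_of_real (expected_indep_sets (n j) (k j))"
      define C where "C = complex_of_real (growth_rate (b j) ^ n j)"
      have C: "C \<noteq> 0" using growth_rate_pos[OF b[of j]] by (simp add: C_def)
      have nj: "0 < n j" using k(2)[of j] by simp
      have Bj: "growth_factor (b j) \<noteq> 0" using growth_factor_pos[OF b[of j]] by simp
      define X where "X = complex_of_real (sp_x (W j) / (4 * pi * b j))"
      have "E * tree_integral (n j) = C * X * I j"
        using expected_indep_sets_integral[OF k(1,2)[of j]] unfolding E_def C_def X_def I_def W_def b_def by simp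
      then have EI: "X * I j = E * tree_integral (n j) / C" using C by (simp add: field_simps)
      have "R j = complex_of_real (1 / growth_factor (b j)) * of_real (real (n j)) * (X * I j) /
          (of_real (sqrt (real (n j))) * tree_integral (n j))"
        unfolding R_def X_def by (simp add: mult_ac)
      also have "\<dots> = complex_of_real (1 / growth_factor (b j)) * (of_real (real (n j)) / of_real (sqrt (real (n j)))) * (E / C)"
      proof -
        have "g * N * (E * T / C) / (S * T) = g * (N / S) * (E / C)" if "T \<noteq> 0" for g N T S :: complex
          using that by (simp add: mult_ac)
        moreover have "tree_integral (n j) \<noteq> 0" using elim by auto
        ultimately show ?thesis unfolding EI by blast
      qed
      also have "complex_of_real (real (n j)) / of_real (sqrt (real (n j))) = of_real (sqrt (real (n j)))"
        by (simp only: of_real_divide[symmetric] real_div_sqrt of_nat_0_le_iff)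
      finally have Rj: "R j = complex_of_real (1 / growth_factor (b j)) * of_real (sqrt (real (n j))) * (E / C)" .
      have "real (n j) powr (- 1 / 2) = inverse (real (n j) powr (1 / 2))"
        using powr_minus[of "real (n j)" "1 / 2"] by (simp only: minus_divide_left)
      then have pw: "real (n j) powr (- 1 / 2) = 1 / sqrt (real (n j))"
        using nj by (simp only: powr_half_sqrt of_nat_0_le_iff inverse_eq_divide)
      show ?case unfolding Rj pw E_def C_def by (simp add: mult_ac)
    qed
  qed
  from Lim_transform_eventually[OF lR this]
  have "(\<lambda>j. complex_of_real (expected_indep_sets (n j) (k j) / (growth_factor (b j) *
    real (n j) powr (- 1 / 2) * growth_rate (b j) ^ n j))) \<longlonglongrightarrow> of_real 1" by simp
  then show ?thesis unfolding tendsto_of_real_iff b_def .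
qed

theorem expected_indep_sets_uniform:
  assumes ab: "0 < a" "a \<le> b" "b < 1" and "\<epsilon> > 0"
  shows "\<forall>\<^sub>F n :: nat in sequentially. \<forall>k :: nat. a * real n \<le> real k \<and> real k \<le> b * real n \<longrightarrow>
    \<bar>expected_indep_sets n k / (growth_factor (real k / real n) * real n powr (- 1 / 2) *
      growth_rate (real k / real n) ^ n) - 1\<bar> < \<epsilon>"
proof (rule ccontr)
  let ?Q = "\<lambda>n k. expected_indep_sets n k / (growth_factor (real k / real n) * real n powr (- 1 / 2) *
      growth_rate (real k / real n) ^ n)"
  assume "\<not> ?thesis"
  then have "\<forall>N. \<exists>n\<ge>N. \<exists>k. a * real n \<le> real k \<and> real k \<le> b * real n \<and> \<not> \<bar>?Q n k - 1\<bar> < \<epsilon>"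
    unfolding eventually_sequentially by blast
  \<comment> \<open>\<open>Suc j\<close> instead of j keeps n positive for every j; the same
    inequality forces n to infinity.\<close>
  then have "\<forall>j. \<exists>p. Suc j \<le> fst p \<and> a * real (fst p) \<le> real (snd p) \<and> real (snd p) \<le> b * real (fst p) \<and>
      \<not> \<bar>?Q (fst p) (snd p) - 1\<bar> < \<epsilon>"
    by (metis fst_conv snd_conv)
  then obtain p where p: "\<And>j. Suc j \<le> fst (p j)" "\<And>j. a * real (fst (p j)) \<le> real (snd (p j))"
      "\<And>j. real (snd (p j)) \<le> b * real (fst (p j))" "\<And>j. \<not> \<bar>?Q (fst (p j)) (snd (p j)) - 1\<bar> < \<epsilon>"
    by metis
  define n k where "n j = fst (p j)" and "k j = snd (p j)" for j
  have n0: "0 < real (n j)" for j using p(1)[of j] by (simp add: n_def)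
  have "\<forall>j. real (k j) / real (n j) \<in> {a..b}"
  proof
    fix j show "real (k j) / real (n j) \<in> {a..b}"
    using p(2,3)[of j] n0[of j] by (auto simp: n_def k_def field_simps)
  qed
  then obtain \<beta> r where r: "\<beta> \<in> {a..b}" "strict_mono r" "((\<lambda>j. real (k j) / real (n j)) \<circ> r) \<longlonglongrightarrow> \<beta>"
    by (rule seq_compactE[OF compact_imp_seq_compact[OF compact_Icc[of a b]]])
  have kn: "0 < k j" "k j < n j" for j
  proof -
    have "0 < a * real (n j)" using ab n0[of j] by simp
    then show "0 < k j" using p(2)[of j] by (simp add: n_def k_def)
    have "b * real (n j) < 1 * real (n j)" using ab n0[of j] by (intro mult_strict_right_mono) auto
    then show "k j < n j" using p(3)[of j] by (simp add: n_def k_def)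
  qed
  have "filterlim (\<lambda>j. real (n (r j))) at_top sequentially"
  proof (rule filterlim_at_top_mono[OF filterlim_real_sequentially], rule always_eventually, rule allI)
    fix j
    have "j \<le> r j" using r(2) by (rule seq_suble)
    also have "r j \<le> n (r j)" using p(1)[of "r j"] by (simp add: n_def)
    finally show "real j \<le> real (n (r j))" by simp
  qed
  then have "(\<lambda>j. ?Q (n (r j)) (k (r j))) \<longlonglongrightarrow> 1"
    using expected_indep_sets_seq[of \<beta> "\<lambda>j. k (r j)" "\<lambda>j. n (r j)"] r ab kn by (auto simp: o_def)
  then have "\<forall>\<^sub>F j in sequentially. dist (?Q (n (r j)) (k (r j))) 1 < \<epsilon>" using assms(4) by (rule tendstoD)
  then obtain j where "dist (?Q (n (r j)) (k (r j))) 1 < \<epsilon>" unfolding eventually_sequentially by blast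
  with p(4)[of "r j"] show False by (simp add: dist_real_def n_def k_def)
qed

section \<open>Computable functionals\<close>

text \<open>The oracles range over a fixed set \<open>V\<close>; outside of it a program need not halt.\<close>

definition prog :: "(nat \<Rightarrow> nat) set \<Rightarrow> nat \<Rightarrow> ((nat \<Rightarrow> nat) \<Rightarrow> nat list \<Rightarrow> nat) \<Rightarrow> bool" where
  "prog V k F \<longleftrightarrow> (\<exists>P. \<forall>\<phi>\<in>V. \<forall>xs. length xs = k \<longrightarrow> computes \<phi> P xs (F \<phi> xs))"

lemma prog_cong:
  assumes "prog V k F" "\<And>\<phi> xs. \<phi> \<in> V \<Longrightarrow> length xs = k \<Longrightarrow> F \<phi> xs = G \<phi> xs"
  shows "prog V k G"
  using assms unfolding prog_def by metis

lemma prog_proj: "i < k \<Longrightarrow> prog V k (\<lambda>\<phi> xs. xs ! i)"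
  unfolding prog_def by (intro exI[of _ "Proj i"]) (auto intro: computes.Proj)

lemma prog_comp:
  assumes "prog V (length Gs) F" "\<And>G. G \<in> set Gs \<Longrightarrow> prog V k G"
  shows "prog V k (\<lambda>\<phi> xs. F \<phi> (map (\<lambda>G. G \<phi> xs) Gs))"
proof -
  obtain P where P: "\<And>\<phi> xs. \<phi> \<in> V \<Longrightarrow> length xs = length Gs \<Longrightarrow> computes \<phi> P xs (F \<phi> xs)"
    using assms(1) unfolding prog_def by blast
  have "\<forall>G\<in>set Gs. \<exists>P. \<forall>\<phi>\<in>V. \<forall>xs. length xs = k \<longrightarrow> computes \<phi> P xs (G \<phi> xs)"
    using assms(2) unfolding prog_def by blast
  then obtain Q where Q: "\<And>G \<phi> xs. G \<in> set Gs \<Longrightarrow> \<phi> \<in> V \<Longrightarrow> length xs = k \<Longrightarrow> computes \<phi> (Q G) xs (G \<phi> xs)"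
    by metis
  show ?thesis unfolding prog_def
  proof (intro exI[of _ "Comp P (map Q Gs)"] ballI allI impI)
    fix \<phi> and xs :: "nat list" assume \<phi>: "\<phi> \<in> V" "length xs = k"
    show "computes \<phi> (Comp P (map Q Gs)) xs (F \<phi> (map (\<lambda>G. G \<phi> xs) Gs))"
      by (rule computes.Comp[where ys = "map (\<lambda>G. G \<phi> xs) Gs"])
        (use P Q \<phi> in \<open>auto simp: list_all2_conv_all_nth\<close>)
  qed
qed

lemma prog_app1:
  assumes "prog V 1 (\<lambda>\<phi> xs. f \<phi> (xs ! 0))" "prog V k a"
  shows "prog V k (\<lambda>\<phi> xs. f \<phi> (a \<phi> xs))"
  using prog_comp[of V "[a]" "\<lambda>\<phi> xs. f \<phi> (xs ! 0)" k] assms by simp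

lemma prog_app2:
  assumes "prog V 2 (\<lambda>\<phi> xs. f \<phi> (xs ! 0) (xs ! 1))" "prog V k a" "prog V k b"
  shows "prog V k (\<lambda>\<phi> xs. f \<phi> (a \<phi> xs) (b \<phi> xs))"
  using prog_comp[of V "[a, b]" "\<lambda>\<phi> xs. f \<phi> (xs ! 0) (xs ! 1)" k] assms by (auto simp: numeral_2_eq_2)

lemma prog_tl:
  assumes "prog V k F" shows "prog V (Suc k) (\<lambda>\<phi> xs. F \<phi> (tl xs))"
proof -
  let ?Gs = "map (\<lambda>i (\<phi> :: nat \<Rightarrow> nat) (xs :: nat list). xs ! i) [1..<Suc k]"
  have "prog V (Suc k) (\<lambda>\<phi> xs. F \<phi> (map (\<lambda>G. G \<phi> xs) ?Gs))"
  proof (rule prog_comp)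
    show "prog V (length ?Gs) F" using assms by (simp del: upt_Suc)
  qed (auto intro: prog_proj)
  moreover have "map (\<lambda>G. G \<phi> xs) ?Gs = tl xs" if "length xs = Suc k" for \<phi> and xs :: "nat list"
    using that by (auto simp: length_Suc_conv simp del: upt_Suc intro!: nth_equalityI)
  ultimately show ?thesis by (auto elim!: prog_cong)
qed

text \<open>Lets a program be called at another precision, which by convention is the first
  argument.\<close>

lemma prog_subst:
  assumes "prog V (Suc k) F" "prog V (Suc k) a"
  shows "prog V (Suc k) (\<lambda>\<phi> xs. F \<phi> (a \<phi> xs # tl xs))"
proof -
  let ?Gs = "a # map (\<lambda>i (\<phi> :: nat \<Rightarrow> nat) (xs :: nat list). xs ! i) [1..<Suc k]"
  have "prog V (Suc k) (\<lambda>\<phi> xs. F \<phi> (map (\<lambda>G. G \<phi> xs) ?Gs))"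
  proof (rule prog_comp)
    show "prog V (length ?Gs) F" using assms(1) by (simp del: upt_Suc)
    show "prog V (Suc k) G" if "G \<in> set ?Gs" for G
      using that assms(2) prog_proj by (auto simp del: upt_Suc)
  qed
  moreover have "map (\<lambda>G. G \<phi> xs) ?Gs = a \<phi> xs # tl xs" if "length xs = Suc k" for \<phi> and xs :: "nat list"
    using that by (auto simp: length_Suc_conv simp del: upt_Suc intro!: nth_equalityI)
  ultimately show ?thesis by (auto elim!: prog_cong)
qed

lemma prog_app3:
  assumes "prog V 3 F" "prog V k a" "prog V k b" "prog V k c"
  shows "prog V k (\<lambda>\<phi> xs. F \<phi> [a \<phi> xs, b \<phi> xs, c \<phi> xs])"
  using prog_comp[of V "[a, b, c]" F k] assms by (auto simp: numeral_3_eq_3)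

lemma prog_hd: "prog V (Suc k) (\<lambda>\<phi> xs. hd xs)"
  by (rule prog_cong[OF prog_proj[of 0]]) (auto simp: length_Suc_conv)

lemma prog_oracle:
  assumes "prog V k a" shows "prog V k (\<lambda>\<phi> xs. \<phi> (a \<phi> xs))"
proof (rule prog_app1[where f = "\<lambda>\<phi> x. \<phi> x", OF _ assms])
  show "prog V 1 (\<lambda>\<phi> xs. \<phi> (xs ! 0))"
    unfolding prog_def by (intro exI[of _ Oracle]) (auto simp: length_Suc_conv intro: computes.Oracle)
qed

lemma prog_Suc:
  assumes "prog V k a" shows "prog V k (\<lambda>\<phi> xs. Suc (a \<phi> xs))"
proof (rule prog_app1[where f = "\<lambda>\<phi> x. Suc x", OF _ assms])
  show "prog V 1 (\<lambda>\<phi> xs. Suc (xs ! 0))"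
    unfolding prog_def by (intro exI[of _ Succ]) (auto simp: length_Suc_conv intro: computes.Succ)
qed

lemma prog_const: "prog V k (\<lambda>\<phi> xs. c)"
proof (induction c)
  case 0
  show ?case unfolding prog_def by (intro exI[of _ Zero]) (auto intro: computes.Zero)
qed (rule prog_Suc)

lemma prog_primrec:
  assumes "prog V k F" "prog V (Suc (Suc k)) G"
  shows "prog V (Suc k) (\<lambda>\<phi> xs. rec_nat (F \<phi> (tl xs)) (\<lambda>m y. G \<phi> (m # y # tl xs)) (hd xs))"
proof -
  obtain P where P: "\<And>\<phi> xs. \<phi> \<in> V \<Longrightarrow> length xs = k \<Longrightarrow> computes \<phi> P xs (F \<phi> xs)"
    using assms(1) unfolding prog_def by blast
  obtain Q where Q: "\<And>\<phi> xs. \<phi> \<in> V \<Longrightarrow> length xs = Suc (Suc k) \<Longrightarrow> computes \<phi> Q xs (G \<phi> xs)"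
    using assms(2) unfolding prog_def by blast
  have "computes \<phi> (PrimRec P Q) (n # xs) (rec_nat (F \<phi> xs) (\<lambda>m y. G \<phi> (m # y # xs)) n)"
    if "\<phi> \<in> V" "length xs = k" for \<phi> n xs
  proof (induction n)
    case (Suc n)
    then show ?case using Q[OF that(1)] that(2) by (auto intro: computes.PrimRec_Suc)
  qed (use P that in \<open>auto intro: computes.PrimRec_0\<close>)
  then show ?thesis unfolding prog_def
    by (intro exI[of _ "PrimRec P Q"]) (auto simp: length_Suc_conv)
qed

text \<open>The search has to succeed only for oracles in V. This is why programs are considered
  relative to a set of oracles: searches that depend on positivity of the named real may fail for
  others.\<close>

lemma prog_Least:
  assumes "prog V (Suc k) F" "\<And>\<phi> xs. \<phi> \<in> V \<Longrightarrow> length xs = k \<Longrightarrow> \<exists>m. F \<phi> (m # xs) = 0"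
  shows "prog V k (\<lambda>\<phi> xs. LEAST m. F \<phi> (m # xs) = 0)"
proof -
  obtain P where P: "\<And>\<phi> xs. \<phi> \<in> V \<Longrightarrow> length xs = Suc k \<Longrightarrow> computes \<phi> P xs (F \<phi> xs)"
    using assms(1) unfolding prog_def by blast
  have "computes \<phi> (Minimize P) xs (LEAST m. F \<phi> (m # xs) = 0)" if "\<phi> \<in> V" "length xs = k" for \<phi> xs
  proof (rule computes.Minimize)
    have "F \<phi> ((LEAST m. F \<phi> (m # xs) = 0) # xs) = 0"
      using assms(2)[OF that] by (rule LeastI_ex)
    then show "computes \<phi> P ((LEAST m. F \<phi> (m # xs) = 0) # xs) 0"
      using P[OF that(1), of "(LEAST m. F \<phi> (m # xs) = 0) # xs"] that(2) by simp
    show "\<forall>i<LEAST m. F \<phi> (m # xs) = 0. \<exists>y. computes \<phi> P (i # xs) (Suc y)"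
    proof (intro allI impI)
      fix i assume "i < (LEAST m. F \<phi> (m # xs) = 0)"
      then have "F \<phi> (i # xs) \<noteq> 0" by (rule not_less_Least)
      then obtain y where "F \<phi> (i # xs) = Suc y" using not0_implies_Suc by blast
      then show "\<exists>y. computes \<phi> P (i # xs) (Suc y)" using P[OF that(1), of "i # xs"] that(2) by auto
    qed
  qed
  then show ?thesis unfolding prog_def by blast
qed

section \<open>Arithmetic of natural numbers\<close>

lemma length2_conv: "length xs = 2 \<longleftrightarrow> (\<exists>a b. xs = [a, b])"
  by (auto simp: numeral_2_eq_2 length_Suc_conv)

lemma prog_primrec1:
  assumes "prog V 2 (\<lambda>\<phi> xs. g (xs ! 0) (xs ! 1))"
  shows "prog V 1 (\<lambda>\<phi> xs. rec_nat c g (xs ! 0))"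
proof -
  have "prog V (Suc (Suc 0)) (\<lambda>\<phi> xs. g (xs ! 0) (xs ! 1))" using assms by (simp add: numeral_2_eq_2)
  from prog_primrec[OF prog_const[of V 0 c] this]
  have "prog V 1 (\<lambda>\<phi> xs. rec_nat c g (hd xs))" by simp
  then show ?thesis by (rule prog_cong) (auto simp: length_Suc_conv)
qed

lemma prog_primrec2:
  assumes "prog V 1 (\<lambda>\<phi> xs. f (xs ! 0))" "prog V 3 (\<lambda>\<phi> xs. g (xs ! 2) (xs ! 0) (xs ! 1))"
  shows "prog V 2 (\<lambda>\<phi> xs. rec_nat (f (xs ! 1)) (g (xs ! 1)) (xs ! 0))"
proof -
  have "prog V (Suc (Suc 1)) (\<lambda>\<phi> xs. g (xs ! 2) (xs ! 0) (xs ! 1))" using assms by (simp add: numeral_3_eq_3)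
  from prog_primrec[OF assms(1) this]
  have "prog V 2 (\<lambda>\<phi> xs. rec_nat (f (tl xs ! 0)) (g (tl xs ! 0)) (hd xs))"
    by (simp add: numeral_2_eq_2)
  then show ?thesis by (rule prog_cong) (auto simp: length2_conv)
qed

lemma prog_add:
  assumes "prog V k a" "prog V k b" shows "prog V k (\<lambda>\<phi> xs. a \<phi> xs + b \<phi> xs)"
proof (rule prog_app2[where f = "\<lambda>\<phi> a b. a + b", OF _ assms])
  have "prog V 2 (\<lambda>\<phi> xs. rec_nat (xs ! 1) (\<lambda>m y. Suc y) (xs ! 0))"
    by (rule prog_primrec2[where f = "\<lambda>x. x" and g = "\<lambda>b m y. Suc y"]) (auto intro!: prog_Suc prog_proj)
  moreover have "rec_nat b (\<lambda>m y. Suc y) a = a + b" for a b by (induction a) auto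
  ultimately show "prog V 2 (\<lambda>\<phi> xs. xs ! 0 + xs ! 1)" by simp
qed

lemma prog_mult:
  assumes "prog V k a" "prog V k b" shows "prog V k (\<lambda>\<phi> xs. a \<phi> xs * b \<phi> xs)"
proof (rule prog_app2[where f = "\<lambda>\<phi> a b. a * b", OF _ assms])
  have "prog V 2 (\<lambda>\<phi> xs. rec_nat 0 (\<lambda>m y. xs ! 1 + y) (xs ! 0))"
    by (rule prog_primrec2[where f = "\<lambda>x. 0" and g = "\<lambda>b m y. b + y"]) (auto intro!: prog_add prog_const prog_proj)
  moreover have "rec_nat 0 (\<lambda>m y. b + y) a = a * b" for a b :: nat by (induction a) auto
  ultimately show "prog V 2 (\<lambda>\<phi> xs. xs ! 0 * xs ! 1)" by simp
qed

lemma prog_power: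
  assumes "prog V k a" "prog V k b" shows "prog V k (\<lambda>\<phi> xs. a \<phi> xs ^ b \<phi> xs)"
proof -
  have "prog V 2 (\<lambda>\<phi> xs. rec_nat 1 (\<lambda>m y. xs ! 1 * y) (xs ! 0))"
    by (rule prog_primrec2[where f = "\<lambda>x. 1" and g = "\<lambda>b m y. b * y"]) (auto intro!: prog_mult prog_const prog_proj)
  moreover have "rec_nat 1 (\<lambda>m y. b * y) a = b ^ a" for a b :: nat by (induction a) auto
  ultimately have "prog V 2 (\<lambda>\<phi> xs. (xs ! 1) ^ (xs ! 0))" by simp
  from prog_app2[where f = "\<lambda>\<phi> a b. b ^ a", OF this assms(2,1)] show ?thesis .
qed

lemma prog_diff:
  assumes "prog V k a" "prog V k b" shows "prog V k (\<lambda>\<phi> xs. a \<phi> xs - b \<phi> xs)"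
proof -
  have "prog V 1 (\<lambda>\<phi> xs. rec_nat 0 (\<lambda>m y. m) (xs ! 0))"
    by (rule prog_primrec1) (auto intro!: prog_proj)
  moreover have "rec_nat 0 (\<lambda>m y. m) a = a - 1" for a :: nat by (cases a) auto
  ultimately have pred: "prog V 1 (\<lambda>\<phi> xs. (xs ! 0) - 1)" by simp
  have "prog V 3 (\<lambda>\<phi> xs. (xs ! 1) - 1)"
    by (rule prog_app1[where f = "\<lambda>\<phi> x. x - 1", OF pred]) (simp add: prog_proj)
  then have "prog V 2 (\<lambda>\<phi> xs. rec_nat (xs ! 1) (\<lambda>m y. y - 1) (xs ! 0))"
    by (intro prog_primrec2[where f = "\<lambda>x. x" and g = "\<lambda>b m y. y - 1"]) (auto intro!: prog_proj)
  moreover have "rec_nat b (\<lambda>m y. y - 1) a = b - a" for a b :: nat by (induction a) auto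
  ultimately have "prog V 2 (\<lambda>\<phi> xs. (xs ! 1) - (xs ! 0))" by simp
  from prog_app2[where f = "\<lambda>\<phi> a b. b - a", OF this assms(2,1)] show ?thesis .
qed

lemmas prog_intros = prog_const prog_hd prog_tl prog_Suc prog_add prog_mult prog_diff prog_power

text \<open>The quotient is the least m with x < (m + 1) y. Replacing y by
  \<open>Suc (y - 1)\<close> lets the search halt for y = 0 too, and the factor
  \<open>1 - (1 - y)\<close> then restores the value 0 of a division by 0.\<close>

lemma prog_div:
  assumes "prog V k a" "prog V k b" shows "prog V k (\<lambda>\<phi> xs. a \<phi> xs div b \<phi> xs)"
proof -
  let ?F = "\<lambda>\<phi> xs. Suc (a \<phi> (tl xs)) - Suc (hd xs) * Suc (b \<phi> (tl xs) - 1)"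
  have "prog V k (\<lambda>\<phi> xs. LEAST m. ?F \<phi> (m # xs) = 0)"
  proof (rule prog_Least)
    show "prog V (Suc k) ?F" by (intro prog_intros assms)
    fix \<phi> xs
    show "\<exists>m. ?F \<phi> (m # xs) = 0" by (intro exI[of _ "a \<phi> xs"]) simp
  qed
  moreover have "(LEAST m. Suc x - Suc m * Suc (y - 1) = 0) = x div Suc (y - 1)" for x y :: nat
  proof (rule Least_equality)
    show "Suc x - Suc (x div Suc (y - 1)) * Suc (y - 1) = 0"
      using dividend_less_div_times[of "Suc (y - 1)" x] by (simp add: algebra_simps)
    fix m assume "Suc x - Suc m * Suc (y - 1) = 0"
    then have "x < Suc m * Suc (y - 1)" by simp
    then have "x div Suc (y - 1) < Suc m" by (simp add: less_mult_imp_div_less)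
    then show "x div Suc (y - 1) \<le> m" by simp
  qed
  ultimately have "prog V k (\<lambda>\<phi> xs. (a \<phi> xs div Suc (b \<phi> xs - 1)) * (1 - (1 - b \<phi> xs)))"
    by (intro prog_mult prog_diff prog_const assms) simp
  then show ?thesis
    by (rule prog_cong) (auto simp: gr0_conv_Suc split: nat_diff_split)
qed

subsection \<open>Computable nonnegative real numbers\<close>

text \<open>Nonnegative reals can be approximated by natural numerators, which avoids signs. The first
  argument of an approximating program is the precision, the others are parameters of the real.\<close>

definition approximates :: "(nat \<Rightarrow> nat) set \<Rightarrow> nat \<Rightarrow> ((nat \<Rightarrow> nat) \<Rightarrow> nat list \<Rightarrow> nat) \<Rightarrow>
    ((nat \<Rightarrow> nat) \<Rightarrow> nat list \<Rightarrow> real) \<Rightarrow> bool" where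
  "approximates V k F f \<longleftrightarrow> prog V (Suc k) F \<and>
     (\<forall>\<phi>\<in>V. \<forall>xs. length xs = k \<longrightarrow> (\<forall>m. \<bar>real (F \<phi> (m # xs)) / 2 ^ m - f \<phi> xs\<bar> \<le> 1 / 2 ^ m))"

definition approximable :: "(nat \<Rightarrow> nat) set \<Rightarrow> nat \<Rightarrow> ((nat \<Rightarrow> nat) \<Rightarrow> nat list \<Rightarrow> real) \<Rightarrow> bool" where
  "approximable V k f \<longleftrightarrow> (\<exists>F. approximates V k F f)"

lemma approximatesD:
  assumes "approximates V k F f"
  shows "prog V (Suc k) F"
    "\<And>\<phi> xs m. \<phi> \<in> V \<Longrightarrow> length xs = k \<Longrightarrow> \<bar>real (F \<phi> (m # xs)) / 2 ^ m - f \<phi> xs\<bar> \<le> 1 / 2 ^ m"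
  using assms by (auto simp: approximates_def)

lemma approximates_scaled:
  assumes "\<bar>real n / 2 ^ m - x\<bar> \<le> 1 / 2 ^ m"
  shows "2 ^ m * x - 1 \<le> real n" "real n \<le> 2 ^ m * x + 1"
proof -
  have "real n / 2 ^ m \<le> x + 1 / 2 ^ m" "x - 1 / 2 ^ m \<le> real n / 2 ^ m" using assms by linarith+
  then have "real n \<le> (x + 1 / 2 ^ m) * 2 ^ m" "(x - 1 / 2 ^ m) * 2 ^ m \<le> real n"
    by (simp_all only: pos_divide_le_eq pos_le_divide_eq zero_less_power zero_less_numeral)
  then show "2 ^ m * x - 1 \<le> real n" "real n \<le> 2 ^ m * x + 1" by (simp_all add: algebra_simps)
qed

lemma approximable_cong:
  assumes "approximable V k f" "\<And>\<phi> xs. \<phi> \<in> V \<Longrightarrow> length xs = k \<Longrightarrow> f \<phi> xs = g \<phi> xs"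
  shows "approximable V k g"
  using assms unfolding approximable_def approximates_def by metis

text \<open>Fractions with arbitrary denominators are enough. The one for precision m + 1 is rounded
  to the nearest multiple of 1 / 2^m by (2^(m+1) a + b) div (2 b), and each of the two errors is at
  most 1 / 2^(m+1).\<close>

lemma approximableI:
  assumes "prog V (Suc k) A" "prog V (Suc k) B"
    and "\<And>\<phi> xs m. \<phi> \<in> V \<Longrightarrow> length xs = k \<Longrightarrow> 0 < B \<phi> (m # xs)"
    and "\<And>\<phi> xs m. \<phi> \<in> V \<Longrightarrow> length xs = k \<Longrightarrow>
      \<bar>real (A \<phi> (m # xs)) / real (B \<phi> (m # xs)) - f \<phi> xs\<bar> \<le> 1 / 2 ^ m"
  shows "approximable V k f"
proof -
  let ?A = "\<lambda>\<phi> ys. A \<phi> (Suc (hd ys) # tl ys)" and ?B = "\<lambda>\<phi> ys. B \<phi> (Suc (hd ys) # tl ys)"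
  let ?F = "\<lambda>\<phi> ys. (2 ^ Suc (hd ys) * ?A \<phi> ys + ?B \<phi> ys) div (2 * ?B \<phi> ys)"
  show ?thesis unfolding approximable_def approximates_def
  proof (intro exI[of _ ?F] conjI ballI allI impI)
    show "prog V (Suc k) ?F"
      by (intro prog_div prog_intros prog_subst[OF assms(1)] prog_subst[OF assms(2)])
    fix \<phi> m and xs :: "nat list" assume \<phi>: "\<phi> \<in> V" "length xs = k"
    define a b where "a = A \<phi> (Suc m # xs)" and "b = B \<phi> (Suc m # xs)"
    have b: "0 < b" using assms(3)[OF \<phi>] by (simp add: b_def)
    have ab: "\<bar>real a / real b - f \<phi> xs\<bar> \<le> 1 / 2 ^ Suc m" using assms(4)[OF \<phi>, of "Suc m"] by (simp only: a_def b_def)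
    define q where "q = (2 ^ Suc m * a + b) div (2 * b)"
    have "q * (2 * b) \<le> 2 ^ Suc m * a + b" unfolding q_def by (rule div_times_less_eq_dividend)
    then have "real (q * (2 * b)) \<le> real (2 ^ Suc m * a + b)" by (simp only: of_nat_le_iff)
    then have "real q \<le> 2 ^ m * (real a / real b) + 1 / 2" using b by (simp add: field_simps)
    moreover have "2 ^ Suc m * a + b < 2 * b + q * (2 * b)"
      unfolding q_def using b by (intro dividend_less_div_times) simp
    then have "real (2 ^ Suc m * a + b) < real (2 * b + q * (2 * b))" by (simp only: of_nat_less_iff)
    then have "2 ^ m * (real a / real b) < real q + 1 / 2" using b by (simp add: field_simps)
    ultimately have "\<bar>real q - 2 ^ m * (real a / real b)\<bar> \<le> 1 / 2" by linarith
    then have "\<bar>real q / 2 ^ m - real a / real b\<bar> \<le> 1 / 2 ^ Suc m"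
    proof -
      assume *: "\<bar>real q - 2 ^ m * (real a / real b)\<bar> \<le> 1 / 2"
      have "real q / 2 ^ m - real a / real b = (real q - 2 ^ m * (real a / real b)) / 2 ^ m"
        by (simp add: diff_divide_distrib)
      then have "\<bar>real q / 2 ^ m - real a / real b\<bar> = \<bar>real q - 2 ^ m * (real a / real b)\<bar> / 2 ^ m"
        by (simp add: abs_divide)
      also have "\<dots> \<le> (1 / 2) / 2 ^ m" by (rule divide_right_mono[OF *]) simp
      finally show ?thesis by simp
    qed
    with ab have "\<bar>real q / 2 ^ m - f \<phi> xs\<bar> \<le> 1 / 2 ^ Suc m + 1 / 2 ^ Suc m" by linarith
    also have "\<dots> = 1 / 2 ^ m" by (simp add: field_simps)
    finally show "\<bar>real (?F \<phi> (m # xs)) / 2 ^ m - f \<phi> xs\<bar> \<le> 1 / 2 ^ m"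
      by (simp only: list.sel a_def[symmetric] b_def[symmetric] q_def[symmetric])
  qed
qed

lemma approximable_nat: "prog V k a \<Longrightarrow> approximable V k (\<lambda>\<phi> xs. real (a \<phi> xs))"
  by (rule approximableI[where A = "\<lambda>\<phi> ys. a \<phi> (tl ys)" and B = "\<lambda>\<phi> ys. 1"]) (auto intro!: prog_intros)

lemma approximable_add:
  assumes "approximable V k f" "approximable V k g" shows "approximable V k (\<lambda>\<phi> xs. f \<phi> xs + g \<phi> xs)"
proof -
  obtain F G where "approximates V k F f" "approximates V k G g" using assms(1,2) unfolding approximable_def by blast
  note F = approximatesD[OF this(1)] and G = approximatesD[OF this(2)]
  show ?thesis
  proof (rule approximableI[where A = "\<lambda>\<phi> ys. F \<phi> (Suc (hd ys) # tl ys) + G \<phi> (Suc (hd ys) # tl ys)"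
        and B = "\<lambda>\<phi> ys. 2 ^ Suc (hd ys)"])
    fix \<phi> m and xs :: "nat list" assume "\<phi> \<in> V" "length xs = k"
    from F(2)[OF this, of "Suc m"] G(2)[OF this, of "Suc m"]
    have "\<bar>(real (F \<phi> (Suc m # xs)) / 2 ^ Suc m + real (G \<phi> (Suc m # xs)) / 2 ^ Suc m) - (f \<phi> xs + g \<phi> xs)\<bar>
        \<le> 1 / 2 ^ Suc m + 1 / 2 ^ Suc m" by linarith
    also have "\<dots> = 1 / 2 ^ m" by (simp add: field_simps)
    finally show "\<bar>real (F \<phi> (Suc (hd (m # xs)) # tl (m # xs)) + G \<phi> (Suc (hd (m # xs)) # tl (m # xs))) /
        real (2 ^ Suc (hd (m # xs))) - (f \<phi> xs + g \<phi> xs)\<bar> \<le> 1 / 2 ^ m"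
      by (simp add: add_divide_distrib)
  qed (auto intro!: prog_intros prog_subst[OF F(1)] prog_subst[OF G(1)])
qed

text \<open>Truncated subtraction of the numerators cuts the difference off at 0, which does not
  increase the error because the true difference is nonnegative.\<close>

lemma approximable_diff:
  assumes "approximable V k f" "approximable V k g" "\<And>\<phi> xs. \<phi> \<in> V \<Longrightarrow> length xs = k \<Longrightarrow> g \<phi> xs \<le> f \<phi> xs"
  shows "approximable V k (\<lambda>\<phi> xs. f \<phi> xs - g \<phi> xs)"
proof -
  obtain F G where "approximates V k F f" "approximates V k G g" using assms(1,2) unfolding approximable_def by blast
  note F = approximatesD[OF this(1)] and G = approximatesD[OF this(2)]
  show ?thesis
  proof (rule approximableI[where A = "\<lambda>\<phi> ys. F \<phi> (Suc (hd ys) # tl ys) - G \<phi> (Suc (hd ys) # tl ys)"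
        and B = "\<lambda>\<phi> ys. 2 ^ Suc (hd ys)"])
    fix \<phi> m and xs :: "nat list" assume \<phi>: "\<phi> \<in> V" "length xs = k"
    define x y where "x = F \<phi> (Suc m # xs)" and "y = G \<phi> (Suc m # xs)"
    have "\<bar>(real x / 2 ^ Suc m - real y / 2 ^ Suc m) - (f \<phi> xs - g \<phi> xs)\<bar> \<le> 1 / 2 ^ Suc m + 1 / 2 ^ Suc m"
      using F(2)[OF \<phi>, of "Suc m"] G(2)[OF \<phi>, of "Suc m"] unfolding x_def y_def by linarith
    moreover have "real (x - y) / 2 ^ Suc m = max 0 (real x / 2 ^ Suc m - real y / 2 ^ Suc m)"
    proof (cases "y \<le> x")
      case True
      then have "real y / 2 ^ Suc m \<le> real x / 2 ^ Suc m" by (intro divide_right_mono) auto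
      with True show ?thesis by (simp add: of_nat_diff diff_divide_distrib max_def)
    next
      case False
      then have "real x / 2 ^ Suc m \<le> real y / 2 ^ Suc m" by (intro divide_right_mono) auto
      with False show ?thesis by (simp add: max_def)
    qed
    ultimately have "\<bar>real (x - y) / 2 ^ Suc m - (f \<phi> xs - g \<phi> xs)\<bar> \<le> 1 / 2 ^ Suc m + 1 / 2 ^ Suc m"
      using assms(3)[OF \<phi>] by linarith
    also have "\<dots> = 1 / 2 ^ m" by (simp add: field_simps)
    finally show "\<bar>real (F \<phi> (Suc (hd (m # xs)) # tl (m # xs)) - G \<phi> (Suc (hd (m # xs)) # tl (m # xs))) /
        real (2 ^ Suc (hd (m # xs))) - (f \<phi> xs - g \<phi> xs)\<bar> \<le> 1 / 2 ^ m"
      by (simp add: x_def y_def)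
  qed (auto intro!: prog_intros prog_subst[OF F(1)] prog_subst[OF G(1)])
qed

lemma approximable_bound:
  assumes "\<bar>real n / 2 ^ 0 - x\<bar> \<le> 1 / 2 ^ 0" shows "x \<le> real n + 1"
  using assms by simp

lemma approximable_nonneg:
  assumes "\<And>m. \<bar>real (F m) / 2 ^ m - x\<bar> \<le> 1 / 2 ^ m" shows "0 \<le> x"
proof (rule ccontr)
  assume "\<not> 0 \<le> x"
  then have "0 < - x" by simp
  then obtain m where "(1 / 2) ^ m < - x" using real_arch_pow_inv[of "- x" "1 / 2"] by auto
  then have "1 / 2 ^ m < - x" by (simp add: power_one_over)
  with assms[of m] show False by (smt (verit) divide_nonneg_nonneg of_nat_0_le_iff zero_le_power)
qed

text \<open>The numerators at precision 0 bound both factors. With S their sum, the error of the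
  product at precision r is at most (S + 3) / 2^r, and r = m + S + 2 suffices as S + 3 \<le> 2^(S +
  2).\<close>

lemma approximable_mult:
  assumes "approximable V k f" "approximable V k g" shows "approximable V k (\<lambda>\<phi> xs. f \<phi> xs * g \<phi> xs)"
proof -
  obtain F G where "approximates V k F f" "approximates V k G g" using assms(1,2) unfolding approximable_def by blast
  note F = approximatesD[OF this(1)] and G = approximatesD[OF this(2)]
  define M where "M \<phi> ys = hd ys + F \<phi> (0 # tl ys) + G \<phi> (0 # tl ys) + 2" for \<phi> and ys :: "nat list"
  have M: "prog V (Suc k) M" unfolding M_def
    by (intro prog_intros prog_subst[OF F(1)] prog_subst[OF G(1)])
  show ?thesis
  proof (rule approximableI[where A = "\<lambda>\<phi> ys. F \<phi> (M \<phi> ys # tl ys) * G \<phi> (M \<phi> ys # tl ys)"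
        and B = "\<lambda>\<phi> ys. 2 ^ M \<phi> ys * 2 ^ M \<phi> ys"])
    fix \<phi> m and xs :: "nat list" assume \<phi>: "\<phi> \<in> V" "length xs = k"
    define r where "r = M \<phi> (m # xs)"
    define S where "S = F \<phi> (0 # xs) + G \<phi> (0 # xs)"
    have r: "r = m + (S + 2)" by (simp add: r_def M_def S_def)
    define x y where "x = real (F \<phi> (r # xs)) / 2 ^ r" and "y = real (G \<phi> (r # xs)) / 2 ^ r"
    have xy: "\<bar>x - f \<phi> xs\<bar> \<le> 1 / 2 ^ r" "\<bar>y - g \<phi> xs\<bar> \<le> 1 / 2 ^ r"
      using F(2)[OF \<phi>] G(2)[OF \<phi>] by (auto simp: x_def y_def)
    have pos: "0 \<le> f \<phi> xs" "0 \<le> y" using approximable_nonneg[OF F(2)[OF \<phi>]] by (auto simp: y_def)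
    have fb: "f \<phi> xs \<le> real (F \<phi> (0 # xs)) + 1" "g \<phi> xs \<le> real (G \<phi> (0 # xs)) + 1"
      using approximable_bound F(2)[OF \<phi>] G(2)[OF \<phi>] by blast+
    have "(1::real) / 2 ^ r \<le> 1" by simp
    then have yb: "y \<le> real (G \<phi> (0 # xs)) + 2" using xy(2) fb(2) by linarith
    have "x * y - f \<phi> xs * g \<phi> xs = (x - f \<phi> xs) * y + f \<phi> xs * (y - g \<phi> xs)" by (simp add: algebra_simps)
    also have "\<bar>\<dots>\<bar> \<le> \<bar>x - f \<phi> xs\<bar> * y + f \<phi> xs * \<bar>y - g \<phi> xs\<bar>"
      using abs_triangle_ineq[of "(x - f \<phi> xs) * y" "f \<phi> xs * (y - g \<phi> xs)"] pos by (simp add: abs_mult)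
    also have "\<dots> \<le> 1 / 2 ^ r * (real (G \<phi> (0 # xs)) + 2) + (real (F \<phi> (0 # xs)) + 1) * (1 / 2 ^ r)"
      by (intro add_mono mult_mono xy yb fb pos) auto
    also have "\<dots> = real (S + 2 + 1) / 2 ^ r" by (simp add: S_def field_simps)
    also have "\<dots> \<le> 2 ^ (S + 2) / 2 ^ r"
    proof (rule divide_right_mono)
      have "S + 2 < 2 ^ (S + 2)" by (rule less_exp)
      then have "S + 2 + 1 \<le> 2 ^ (S + 2)" by simp
      then have "real (S + 2 + 1) \<le> real (2 ^ (S + 2))" by (simp only: of_nat_le_iff)
      then show "real (S + 2 + 1) \<le> 2 ^ (S + 2)" by simp
    qed simp
    also have "\<dots> = 1 / 2 ^ m" unfolding r power_add[of 2 m] by simp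
    finally show "\<bar>real (F \<phi> (M \<phi> (m # xs) # tl (m # xs)) * G \<phi> (M \<phi> (m # xs) # tl (m # xs))) /
        real (2 ^ M \<phi> (m # xs) * 2 ^ M \<phi> (m # xs)) - f \<phi> xs * g \<phi> xs\<bar> \<le> 1 / 2 ^ m"
      unfolding list.sel r_def[symmetric] x_def y_def by simp
  qed (auto intro!: prog_intros prog_subst[OF F(1)] prog_subst[OF G(1)] M)
qed

text \<open>Here a approximates x at the scale 2 g e^2, with 1 / e a lower bound for x and 1 / g the
  error aimed at. The square of e is due to the two small factors in the denominator of (d x - a) /
  (a x).\<close>

lemma inverse_error:
  fixes a x e g :: real
  assumes "2 * g * e\<^sup>2 * x - 1 \<le> a" "a \<le> 2 * g * e\<^sup>2 * x + 1" "1 \<le> e * x" "1 \<le> g" "1 \<le> e"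
  shows "0 < a" "\<bar>2 * g * e\<^sup>2 / a - inverse x\<bar> \<le> 1 / g"
proof -
  define d where "d = 2 * g * e\<^sup>2"
  have x: "0 < x" using assms(3,5) by (smt (verit) mult_nonneg_nonpos)
  have "1 * (1 * 1) \<le> g * (e * (e * x))" by (intro mult_mono assms) (use assms in auto)
  then have dx: "2 \<le> d * x" by (simp add: d_def power2_eq_square mult_ac)
  have d0: "0 < d" using assms by (simp add: d_def)
  have ad: "d * x - 1 \<le> a" "a \<le> d * x + 1" using assms(1,2) by (simp_all only: d_def)
  then have a: "d * x / 2 \<le> a" using dx by linarith
  then show a0: "0 < a" using dx by linarith
  have "d / a - inverse x = (d * x - a) / (a * x)" using a0 x by (simp add: divide_simps)
  then have "\<bar>d / a - inverse x\<bar> = \<bar>d * x - a\<bar> / (a * x)" using a0 x by (simp add: abs_mult)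
  also have "\<dots> \<le> 1 / (d * x / 2 * x)"
    by (intro frac_le mult_right_mono a mult_pos_pos) (use ad d0 x in auto)
  also have "\<dots> = 1 / (g * (e * x)\<^sup>2)" by (simp add: d_def power2_eq_square mult_ac)
  also have "\<dots> \<le> 1 / (g * 1)"
  proof (rule divide_left_mono)
    have "1 \<le> (e * x)\<^sup>2" using assms(3) by (rule one_le_power)
    then show "g * 1 \<le> g * (e * x)\<^sup>2" using assms(4) by (intro mult_left_mono) auto
  qed (use assms(4,5) x in auto)
  finally show "\<bar>2 * g * e\<^sup>2 / a - inverse x\<bar> \<le> 1 / g" by (simp add: d_def)
qed

text \<open>The search for the first precision M with numerator at least 2 halts because f > 0, and
  it certifies f \<ge> 1 / 2^M. Precision m + 2 M + 1 is then the scale of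
  \<open>inverse_error\<close>.\<close>

lemma approximable_inverse:
  assumes "approximable V k f" "\<And>\<phi> xs. \<phi> \<in> V \<Longrightarrow> length xs = k \<Longrightarrow> 0 < f \<phi> xs"
  shows "approximable V k (\<lambda>\<phi> xs. inverse (f \<phi> xs))"
proof -
  obtain F where "approximates V k F f" using assms(1) unfolding approximable_def by blast
  note F = approximatesD[OF this]
  have ge: "2 ^ m * f \<phi> xs - 1 \<le> real (F \<phi> (m # xs))" "real (F \<phi> (m # xs)) \<le> 2 ^ m * f \<phi> xs + 1"
    if \<phi>: "\<phi> \<in> V" "length xs = k" for \<phi> xs m
    using approximates_scaled[OF F(2)[OF \<phi>]] by auto
  define M where "M \<phi> xs = (LEAST j. 2 - F \<phi> (j # xs) = 0)" for \<phi> xs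
  have ex: "\<exists>j. 2 - F \<phi> (j # xs) = 0" if \<phi>: "\<phi> \<in> V" "length xs = k" for \<phi> xs
  proof -
    obtain j where "3 / f \<phi> xs < 2 ^ j" using real_arch_pow[of 2 "3 / f \<phi> xs"] by auto
    then have "3 < 2 ^ j * f \<phi> xs" using assms(2)[OF \<phi>] by (simp add: divide_less_eq)
    with ge(1)[OF \<phi>, of j] have "2 \<le> F \<phi> (j # xs)" by linarith
    then show ?thesis by auto
  qed
  have M: "prog V k M" unfolding M_def
    by (rule prog_Least) (use ex in \<open>auto intro!: prog_intros F(1)\<close>)
  define P where "P \<phi> ys = hd ys + 2 * M \<phi> (tl ys) + 1" for \<phi> and ys :: "nat list"
  have P: "prog V (Suc k) P" unfolding P_def by (intro prog_intros M)
  have low: "1 \<le> 2 ^ M \<phi> xs * f \<phi> xs" if \<phi>: "\<phi> \<in> V" "length xs = k" for \<phi> xs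
  proof -
    have "2 - F \<phi> (M \<phi> xs # xs) = 0" unfolding M_def by (rule LeastI_ex[OF ex[OF \<phi>]])
    with ge(2)[OF \<phi>, of "M \<phi> xs"] show ?thesis by linarith
  qed
  show ?thesis
  proof (rule approximableI[where A = "\<lambda>\<phi> ys. 2 ^ P \<phi> ys" and B = "\<lambda>\<phi> ys. F \<phi> (P \<phi> ys # tl ys)"])
    fix \<phi> m and xs :: "nat list" assume \<phi>: "\<phi> \<in> V" "length xs = k"
    define p where "p = P \<phi> (m # xs)"
    have p: "2 ^ p = 2 * 2 ^ m * (2 ^ M \<phi> xs :: real)\<^sup>2"
      by (simp add: p_def P_def power_add power_even_eq)
    note e = inverse_error[of "2 ^ m" "2 ^ M \<phi> xs" "f \<phi> xs" "real (F \<phi> (p # xs))",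
        folded p, OF ge[OF \<phi>] low[OF \<phi>]]
    show "0 < F \<phi> (P \<phi> (m # xs) # tl (m # xs))"
      using e(1) by (simp add: p_def)
    show "\<bar>real (2 ^ P \<phi> (m # xs)) / real (F \<phi> (P \<phi> (m # xs) # tl (m # xs))) - inverse (f \<phi> xs)\<bar> \<le> 1 / 2 ^ m"
      using e(2) by (simp add: p_def)
  qed (auto intro!: prog_intros prog_subst[OF F(1)] P)
qed

subsection \<open>Exponential, logarithm, powers and pi\<close>

lemma exp_le_4_power: "exp (real b) \<le> 4 ^ b"
proof -
  have "exp (real b) = exp 1 ^ b" using exp_of_nat_mult[of b "1::real"] by simp
  also have "\<dots> \<le> 4 ^ b" using exp_le by (intro power_mono) auto
  finally show ?thesis .
qed

text \<open>N ln (1 + y / N) lies between y - y^2 / (2 N) and y; the second bound then follows from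
  1 + u \<le> exp u.\<close>

lemma exp_minus_power_le:
  fixes y :: real and N :: nat
  assumes "0 \<le> y" "0 < N"
  shows "(1 + y / N) ^ N \<le> exp y" "exp y - (1 + y / N) ^ N \<le> exp y * (y\<^sup>2 / N)"
proof -
  define L where "L = real N * ln (1 + y / N)"
  have pos: "0 < 1 + y / N" using assms by (smt (verit) divide_nonneg_nonneg of_nat_0_le_iff)
  have L: "(1 + y / N) ^ N = exp L"
    unfolding L_def exp_of_nat_mult using pos by simp
  have "ln (1 + y / N) \<le> y / N" using pos by (intro ln_add_one_self_le_self) (use assms in auto)
  then have "L \<le> real N * (y / N)" unfolding L_def by (intro mult_left_mono) auto
  then show "(1 + y / N) ^ N \<le> exp y" using assms unfolding L by simp
  have "real N * (y / N - (y / N)\<^sup>2 / 2) \<le> L"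
    unfolding L_def by (intro mult_left_mono ln_one_plus_lower) (use assms in auto)
  moreover have "real N * (y / N - (y / N)\<^sup>2 / 2) = y - y\<^sup>2 / N / 2"
    using assms by (simp add: right_diff_distrib power2_eq_square)
  ultimately have "y - y\<^sup>2 / N / 2 \<le> L" by simp
  moreover have "0 \<le> y\<^sup>2 / N" by simp
  moreover have "- q \<le> L - y" if "y - q / 2 \<le> L" "0 \<le> q" for q using that by linarith
  ultimately have "- (y\<^sup>2 / N) \<le> L - y" by blast
  moreover have "1 + (L - y) \<le> exp (L - y)" by (rule exp_ge_add_one_self)
  ultimately have "1 - y\<^sup>2 / N \<le> exp (L - y)" by linarith
  then have "exp y * (1 - y\<^sup>2 / N) \<le> exp y * exp (L - y)" by (intro mult_left_mono) auto
  also have "\<dots> = exp L" by (simp flip: exp_add)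
  finally show "exp y - (1 + y / N) ^ N \<le> exp y * (y\<^sup>2 / N)" unfolding L by (simp add: right_diff_distrib)
qed

lemma exp_diff_le:
  fixes x y c :: real
  assumes "x \<le> c" "y \<le> c" shows "\<bar>exp x - exp y\<bar> \<le> exp c * \<bar>x - y\<bar>"
proof -
  have *: "exp v - exp u \<le> exp c * (v - u)" if "u \<le> v" "v \<le> c" for u v :: real
  proof -
    have "1 - exp (u - v) \<le> v - u" using exp_ge_add_one_self[of "u - v"] by linarith
    then have "exp v * (1 - exp (u - v)) \<le> exp v * (v - u)" by (intro mult_left_mono) auto
    also have "\<dots> \<le> exp c * (v - u)" using that by (intro mult_right_mono) auto
    finally show ?thesis by (simp add: right_diff_distrib flip: exp_add)
  qed
  show ?thesis
  proof (cases "x \<le> y")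
    case True
    with *[of x y] assms show ?thesis by (simp add: abs_real_def)
  next
    case False
    with *[of y x] assms show ?thesis by (simp add: abs_real_def)
  qed
qed

lemma exp_error:
  fixes x y \<delta> :: real and b N :: nat
  assumes "x \<le> b" "0 \<le> y" "y \<le> b" "\<bar>y - x\<bar> \<le> \<delta>" "0 < N"
  shows "\<bar>(1 + y / N) ^ N - exp x\<bar> \<le> 4 ^ b * ((real b)\<^sup>2 / N) + 4 ^ b * \<delta>"
proof -
  have "\<bar>(1 + y / N) ^ N - exp y\<bar> \<le> exp y * (y\<^sup>2 / N)"
    using exp_minus_power_le[OF assms(2,5)] by linarith
  also have "\<dots> \<le> 4 ^ b * ((real b)\<^sup>2 / N)"
  proof (rule mult_mono)
    show "exp y \<le> 4 ^ b" using exp_le_4_power[of b] assms(3) by (meson exp_le_cancel_iff order_trans)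
    show "y\<^sup>2 / N \<le> (real b)\<^sup>2 / N" using assms by (intro divide_right_mono power_mono) auto
  qed auto
  finally have "\<bar>(1 + y / N) ^ N - exp y\<bar> \<le> 4 ^ b * ((real b)\<^sup>2 / N)" .
  moreover have "\<bar>exp y - exp x\<bar> \<le> exp (real b) * \<bar>y - x\<bar>" by (rule exp_diff_le[OF assms(3,1)])
  moreover have "exp (real b) * \<bar>y - x\<bar> \<le> 4 ^ b * \<delta>"
    by (rule mult_mono[OF exp_le_4_power assms(4)]) auto
  ultimately show ?thesis by linarith
qed

text \<open>The powers (1 + y / N)^N are fractions of integers. As b bounds f and its approximation
  y, the choice of N limits the error of the power to 1 / 2^(m+1), and precision m + 1 + 2 b does
  the same for the error of y magnified by 4^b.\<close>

lemma approximable_exp: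
  assumes "approximable V k f" shows "approximable V k (\<lambda>\<phi> xs. exp (f \<phi> xs))"
proof -
  obtain F where "approximates V k F f" using assms unfolding approximable_def by blast
  note F = approximatesD[OF this]
  define b where "b \<phi> ys = F \<phi> (0 # tl ys) + 2" for \<phi> and ys :: "nat list"
  define N where "N \<phi> ys = 2 ^ (hd ys + 1) * 4 ^ b \<phi> ys * b \<phi> ys ^ 2" for \<phi> and ys :: "nat list"
  define P where "P \<phi> ys = hd ys + 1 + 2 * b \<phi> ys" for \<phi> and ys :: "nat list"
  define A where "A \<phi> ys = (N \<phi> ys * 2 ^ P \<phi> ys + F \<phi> (P \<phi> ys # tl ys)) ^ N \<phi> ys" for \<phi> and ys :: "nat list"
  define B where "B \<phi> ys = (N \<phi> ys * 2 ^ P \<phi> ys) ^ N \<phi> ys" for \<phi> and ys :: "nat list"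
  have b: "prog V (Suc k) b" unfolding b_def by (intro prog_intros prog_subst[OF F(1)])
  have N: "prog V (Suc k) N" unfolding N_def by (intro prog_intros b)
  have P: "prog V (Suc k) P" unfolding P_def by (intro prog_intros b)
  show ?thesis
  proof (rule approximableI[where A = A and B = B])
    show "prog V (Suc k) A" unfolding A_def by (intro prog_intros prog_subst[OF F(1)] N P)
    show "prog V (Suc k) B" unfolding B_def by (intro prog_intros N P)
    fix \<phi> m and xs :: "nat list" assume \<phi>: "\<phi> \<in> V" "length xs = k"
    define c n p where "c = b \<phi> (m # xs)" and "n = N \<phi> (m # xs)" and "p = P \<phi> (m # xs)"
    have n: "n = 2 ^ (m + 1) * 4 ^ c * c ^ 2" and p: "p = m + 1 + 2 * c" and c: "c = F \<phi> (0 # xs) + 2"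
      by (simp_all add: n_def N_def p_def P_def c_def b_def)
    have n0: "0 < n" by (simp add: n c)
    show "0 < B \<phi> (m # xs)" using n0 by (simp add: B_def flip: n_def)
    define y where "y = real (F \<phi> (p # xs)) / 2 ^ p"
    have y: "\<bar>y - f \<phi> xs\<bar> \<le> 1 / 2 ^ p" unfolding y_def by (rule F(2)[OF \<phi>])
    have fb: "f \<phi> xs \<le> real (F \<phi> (0 # xs)) + 1" by (rule approximable_bound[OF F(2)[OF \<phi>]])
    have rc: "real c = real (F \<phi> (0 # xs)) + 2" by (simp add: c)
    have "(1::real) / 2 ^ p \<le> 1" by simp
    then have yb: "y \<le> real c" using y fb unfolding rc by linarith
    have y0: "0 \<le> y" by (simp add: y_def)
    have "f \<phi> xs \<le> real c" using fb unfolding rc by linarith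
    from exp_error[OF this y0 yb y n0]
    have "\<bar>(1 + y / real n) ^ n - exp (f \<phi> xs)\<bar> \<le> 4 ^ c * ((real c)\<^sup>2 / real n) + 4 ^ c * (1 / 2 ^ p)" .
    also have "4 ^ c * ((real c)\<^sup>2 / real n) = 1 / 2 ^ (m + 1)" unfolding n by (simp add: c)
    also have "4 ^ c * (1 / 2 ^ p) = (1::real) / 2 ^ (m + 1)"
    proof -
      have "(2::real) ^ p = 2 ^ (m + 1) * 4 ^ c" unfolding p power_add[of _ "m + 1"] power_mult by simp
      then show ?thesis by simp
    qed
    also have "1 / 2 ^ (m + 1) + 1 / 2 ^ (m + 1) = (1::real) / 2 ^ m" by simp
    also have "(1 + y / real n) ^ n = real (A \<phi> (m # xs)) / real (B \<phi> (m # xs))"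
    proof -
      have "1 + y / real n = real (n * 2 ^ p + F \<phi> (p # xs)) / real (n * 2 ^ p)"
        using n0 by (simp add: y_def add_divide_distrib mult.commute)
      then show ?thesis by (simp only: A_def B_def n_def p_def list.sel of_nat_power power_divide)
    qed
    finally show "\<bar>real (A \<phi> (m # xs)) / real (B \<phi> (m # xs)) - exp (f \<phi> xs)\<bar> \<le> 1 / 2 ^ m" .
  qed
qed

lemma ln_diff_abs_le:
  fixes x y :: real assumes "0 \<le> x" "0 \<le> y" shows "\<bar>ln (1 + y) - ln (1 + x)\<bar> \<le> \<bar>y - x\<bar>"
proof -
  have *: "ln (1 + v) - ln (1 + u) \<le> v - u" if "0 \<le> u" "u \<le> v" for u v :: real
  proof -
    have "ln ((1 + v) / (1 + u)) \<le> (1 + v) / (1 + u) - 1" using that by (intro ln_le_minus_one) auto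
    also have "\<dots> = (v - u) / (1 + u)" using that by (simp add: field_simps)
    also have "\<dots> \<le> (v - u) / 1" using that by (intro frac_le) auto
    finally show ?thesis using that by (simp add: ln_div)
  qed
  show ?thesis
  proof (cases "x \<le> y")
    case True
    then have "ln (1 + x) \<le> ln (1 + y)" using assms by simp
    with True *[OF assms(1) True] show ?thesis by linarith
  next
    case False
    then have "ln (1 + y) \<le> ln (1 + x)" using assms by simp
    with False *[of y x] assms(2) show ?thesis by linarith
  qed
qed

text \<open>The logarithm is read off from the least power of 1 + 1 / N that reaches 1 + y. One step
  costs at most 1 / N; replacing ln (1 + 1 / N) by 1 / N costs at most 1 / (2 N^2) per step, and J
  \<le> 2 (y + 1) limits the accumulated cost to (y + 1) / N.\<close>

lemma ln_error:
  fixes y :: real and N :: nat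
  assumes y: "0 \<le> y" and N: "0 < N"
    and up: "1 + y \<le> (1 + 1 / real N) ^ j" and low: "\<And>i. i < j \<Longrightarrow> (1 + 1 / real N) ^ i < 1 + y"
  shows "\<bar>real j / N - ln (1 + y)\<bar> \<le> (y + 2) / N"
proof -
  define q where "q = ln (1 + 1 / real N)"
  define t where "t = 1 / real N"
  have t: "0 < t" "t \<le> 1" using N by (auto simp: t_def)
  have q: "q \<le> t" "t - t\<^sup>2 / 2 \<le> q"
    using ln_add_one_self_le_self[of t] ln_one_plus_lower[of t] t by (auto simp: q_def t_def)
  have pw: "ln ((1 + 1 / real N) ^ i) = real i * q" for i
    unfolding q_def by (rule ln_realpow)
  have "ln (1 + y) \<le> ln ((1 + 1 / real N) ^ j)" using up y by (intro ln_mono) auto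
  then have 1: "ln (1 + y) \<le> real j * q" unfolding pw .
  have 2: "real j * q \<le> ln (1 + y) + q"
  proof (cases j)
    case 0
    have "0 \<le> q" unfolding q_def by simp
    with 0 y show ?thesis by simp
  next
    case (Suc i)
    have "(1 + 1 / real N) ^ i < 1 + y" using low Suc by simp
    moreover have "0 < (1 + 1 / real N) ^ i" using t unfolding t_def by (intro zero_less_power) linarith
    ultimately have "ln ((1 + 1 / real N) ^ i) < ln (1 + y)" by (simp only: ln_less_cancel_iff y)
    then show ?thesis unfolding pw Suc by (simp add: distrib_right)
  qed
  define J where "J = real j * t"
  have "real j * q \<le> J" unfolding J_def by (intro mult_left_mono q) simp
  with 1 have lo: "ln (1 + y) \<le> J" by linarith
  define X where "X = J * (t / 2)"
  have "real j * (t - t\<^sup>2 / 2) \<le> real j * q" by (intro mult_left_mono q) simp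
  then have JX: "J - X \<le> ln (1 + y) + t"
    using 2 q(1) by (simp add: J_def X_def power2_eq_square algebra_simps)
  have ly: "ln (1 + y) \<le> y" using y by (rule ln_add_one_self_le_self)
  have "X \<le> J / 2"
    using mult_left_mono[of "t / 2" "1 / 2" J] t by (simp add: X_def J_def)
  moreover have "J - X \<le> y + 1" using JX add_mono[OF ly t(2)] by (rule order_trans)
  ultimately have "J \<le> 2 * (y + 1)" by simp
  then have "X \<le> 2 * (y + 1) * (t / 2)" unfolding X_def using t by (intro mult_right_mono) auto
  also have "2 * (y + 1) * (t / 2) = (y + 1) * t" by (simp add: algebra_simps)
  finally have "X \<le> (y + 1) * t" .
  with JX have "J - ln (1 + y) \<le> (y + 1) * t + t" by linarith
  also have "\<dots> = (y + 2) / N" by (simp add: t_def add_divide_distrib)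
  finally show ?thesis using lo by (simp add: J_def t_def)
qed

text \<open>D clears the denominators of 1 + a / 2^(m+1) \<le> (1 + 1 / N)^j, so the search compares
  integers. The factor a + 2 of N turns the bound of \<open>ln_error\<close> into 1 / 2^(m+1), as y
  \<le> a. The argument 1 + f keeps the logarithm nonnegative.\<close>

lemma approximable_ln:
  assumes "approximable V k f" shows "approximable V k (\<lambda>\<phi> xs. ln (1 + f \<phi> xs))"
proof -
  obtain F where "approximates V k F f" using assms unfolding approximable_def by blast
  note F = approximatesD[OF this]
  define a where "a \<phi> ys = F \<phi> (Suc (hd ys) # tl ys)" for \<phi> and ys :: "nat list"
  define N where "N \<phi> ys = 2 ^ Suc (hd ys) * (a \<phi> ys + 2)" for \<phi> and ys :: "nat list"
  define D where "D \<phi> zs = (2 ^ Suc (hd (tl zs)) + a \<phi> (tl zs)) * N \<phi> (tl zs) ^ hd zs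
      - (N \<phi> (tl zs) + 1) ^ hd zs * 2 ^ Suc (hd (tl zs))" for \<phi> and zs :: "nat list"
  define A where "A \<phi> ys = (LEAST j. D \<phi> (j # ys) = 0)" for \<phi> ys
  have a: "prog V (Suc k) a" unfolding a_def by (intro prog_intros prog_subst[OF F(1)])
  have N: "prog V (Suc k) N" unfolding N_def by (intro prog_intros a)
  have D: "prog V (Suc (Suc k)) D" unfolding D_def by (intro prog_intros a N)
  have N0: "0 < N \<phi> ys" for \<phi> ys by (simp add: N_def)
  have D0: "D \<phi> (j # m # xs) = 0 \<longleftrightarrow>
      1 + real (a \<phi> (m # xs)) / 2 ^ Suc m \<le> (1 + 1 / real (N \<phi> (m # xs))) ^ j" for \<phi> j m xs
  proof -
    define u v :: real where "u = 2 ^ Suc m" and "v = real (N \<phi> (m # xs))"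
    have uv: "0 < u" "0 < v" using N0 by (auto simp: u_def v_def)
    have "D \<phi> (j # m # xs) = 0 \<longleftrightarrow> (2 ^ Suc m + a \<phi> (m # xs)) * N \<phi> (m # xs) ^ j
      \<le> (N \<phi> (m # xs) + 1) ^ j * 2 ^ Suc m" by (simp only: D_def list.sel diff_is_0_eq)
    also have "\<dots> \<longleftrightarrow> real ((2 ^ Suc m + a \<phi> (m # xs)) * N \<phi> (m # xs) ^ j)
      \<le> real ((N \<phi> (m # xs) + 1) ^ j * 2 ^ Suc m)" by (simp only: of_nat_le_iff)
    also have "\<dots> \<longleftrightarrow> (u + real (a \<phi> (m # xs))) * v ^ j \<le> (v + 1) ^ j * u"
      by (simp add: u_def v_def add.commute)
    also have "\<dots> \<longleftrightarrow> (u + real (a \<phi> (m # xs))) / u \<le> (v + 1) ^ j / v ^ j"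
      using uv by (simp add: divide_simps)
    also have "(u + real (a \<phi> (m # xs))) / u = 1 + real (a \<phi> (m # xs)) / u"
      using uv by (simp add: add_divide_distrib)
    also have "(v + 1) ^ j / v ^ j = (1 + 1 / v) ^ j"
      using uv by (simp add: add_divide_distrib flip: power_divide)
    finally show ?thesis by (simp only: u_def v_def)
  qed
  have ex: "\<exists>j. D \<phi> (j # m # xs) = 0" for \<phi> m xs
  proof -
    have "1 < 1 + 1 / real (N \<phi> (m # xs))" using N0[of \<phi> "m # xs"] by simp
    then obtain j where "1 + real (a \<phi> (m # xs)) / 2 ^ Suc m < (1 + 1 / real (N \<phi> (m # xs))) ^ j"
      using real_arch_pow by blast
    then show ?thesis unfolding D0 by (intro exI[of _ j]) linarith
  qed
  have A: "prog V (Suc k) A" unfolding A_def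
  proof (rule prog_Least[OF D])
    fix \<phi> and ys :: "nat list" assume "length ys = Suc k"
    then show "\<exists>j. D \<phi> (j # ys) = 0" using ex by (auto simp: length_Suc_conv)
  qed
  show ?thesis
  proof (rule approximableI[OF A N])
    fix \<phi> m and xs :: "nat list" assume \<phi>: "\<phi> \<in> V" "length xs = k"
    show "0 < N \<phi> (m # xs)" by (rule N0)
    define y where "y = real (a \<phi> (m # xs)) / 2 ^ Suc m"
    have y0: "0 \<le> y" by (simp add: y_def)
    have yf: "\<bar>y - f \<phi> xs\<bar> \<le> 1 / 2 ^ Suc m"
      unfolding y_def a_def list.sel by (rule F(2)[OF \<phi>])
    have f0: "0 \<le> f \<phi> xs" by (rule approximable_nonneg[OF F(2)[OF \<phi>]])
    have *: "D \<phi> (j # m # xs) = 0 \<longleftrightarrow> 1 + y \<le> (1 + 1 / real (N \<phi> (m # xs))) ^ j" for j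
      unfolding D0 y_def ..
    have "\<bar>real (A \<phi> (m # xs)) / real (N \<phi> (m # xs)) - ln (1 + y)\<bar> \<le> (y + 2) / real (N \<phi> (m # xs))"
    proof (rule ln_error[OF y0 N0])
      have "D \<phi> (A \<phi> (m # xs) # m # xs) = 0" unfolding A_def by (rule LeastI_ex[OF ex])
      then show "1 + y \<le> (1 + 1 / real (N \<phi> (m # xs))) ^ A \<phi> (m # xs)" by (simp only: *)
      fix i assume "i < A \<phi> (m # xs)"
      then have "D \<phi> (i # m # xs) \<noteq> 0" unfolding A_def by (rule not_less_Least)
      then show "(1 + 1 / real (N \<phi> (m # xs))) ^ i < 1 + y" unfolding * by linarith
    qed
    also have "(y + 2) / real (N \<phi> (m # xs)) \<le> (real (a \<phi> (m # xs)) + 2) / real (N \<phi> (m # xs))"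
    proof (intro divide_right_mono add_right_mono)
      have "real (a \<phi> (m # xs)) / 2 ^ Suc m \<le> real (a \<phi> (m # xs)) / 1"
        by (intro divide_left_mono one_le_power) auto
      then show "y \<le> real (a \<phi> (m # xs))" by (simp add: y_def)
    qed simp
    also have "\<dots> = 1 / 2 ^ Suc m"
    proof -
      have "real (N \<phi> (m # xs)) = 2 ^ Suc m * (real (a \<phi> (m # xs)) + 2)" by (simp add: N_def algebra_simps)
      moreover have "real (a \<phi> (m # xs)) + 2 \<noteq> 0" by linarith
      ultimately show ?thesis by simp
    qed
    finally have "\<bar>real (A \<phi> (m # xs)) / real (N \<phi> (m # xs)) - ln (1 + y)\<bar> \<le> 1 / 2 ^ Suc m" .
    moreover have "\<bar>ln (1 + y) - ln (1 + f \<phi> xs)\<bar> \<le> 1 / 2 ^ Suc m"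
      using ln_diff_abs_le[OF f0 y0] yf by linarith
    moreover have "1 / 2 ^ Suc m + 1 / 2 ^ Suc m = (1::real) / 2 ^ m" by simp
    ultimately show "\<bar>real (A \<phi> (m # xs)) / real (N \<phi> (m # xs)) - ln (1 + f \<phi> xs)\<bar> \<le> 1 / 2 ^ m"
      by linarith
  qed
qed

text \<open>ln f may be negative, but approximable numbers are not. So it is split as ln (1 + f) -
  ln (1 + 1 / f), and the two exponentials are divided.\<close>

lemma approximable_powr:
  assumes "approximable V k f" "approximable V k g" "\<And>\<phi> xs. \<phi> \<in> V \<Longrightarrow> length xs = k \<Longrightarrow> 0 < f \<phi> xs"
  shows "approximable V k (\<lambda>\<phi> xs. f \<phi> xs powr g \<phi> xs)"
proof (rule approximable_cong)
  show "approximable V k (\<lambda>\<phi> xs. exp (g \<phi> xs * ln (1 + f \<phi> xs)) * inverse (exp (g \<phi> xs * ln (1 + inverse (f \<phi> xs)))))"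
    by (intro approximable_mult approximable_inverse approximable_exp approximable_ln assms) auto
  fix \<phi> and xs :: "nat list" assume "\<phi> \<in> V" "length xs = k"
  then have f: "0 < f \<phi> xs" by (rule assms(3))
  then have "ln (1 + inverse (f \<phi> xs)) = ln ((1 + f \<phi> xs) / f \<phi> xs)" by (simp add: field_simps)
  also have "\<dots> = ln (1 + f \<phi> xs) - ln (f \<phi> xs)" using f by (simp add: ln_div)
  finally show "exp (g \<phi> xs * ln (1 + f \<phi> xs)) * inverse (exp (g \<phi> xs * ln (1 + inverse (f \<phi> xs)))) =
      f \<phi> xs powr g \<phi> xs"
    using f by (simp add: powr_def right_diff_distrib flip: exp_minus exp_add)
qed

lemma approximable_sqrt:
  assumes "approximable V k f" "\<And>\<phi> xs. \<phi> \<in> V \<Longrightarrow> length xs = k \<Longrightarrow> 0 < f \<phi> xs"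
  shows "approximable V k (\<lambda>\<phi> xs. sqrt (f \<phi> xs))"
proof (rule approximable_cong)
  have "approximable V k (\<lambda>\<phi> xs. inverse (real 2))" by (intro approximable_inverse approximable_nat prog_const) auto
  then show "approximable V k (\<lambda>\<phi> xs. f \<phi> xs powr inverse (real 2))" by (rule approximable_powr[OF assms(1) _ assms(2)])
  fix \<phi> and xs :: "nat list" assume "\<phi> \<in> V" "length xs = k"
  then have "0 < f \<phi> xs" by (rule assms(2))
  then show "f \<phi> xs powr inverse (real 2) = sqrt (f \<phi> xs)" by (simp add: powr_half_sqrt inverse_eq_divide)
qed

text \<open>The Wallis products W n increase to pi / 2, while W n (2 n + 1) / (2 n) decreases to it.
  These bounds differ by W n / (2 n), which is at most 1 / n because pi < 4.\<close>

lemma wallis_error: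
  assumes "0 < n"
  shows "\<bar>2 * (\<Prod>k=1..n. (4 * real k ^ 2) / (4 * real k ^ 2 - 1)) - pi\<bar> \<le> 2 / real n"
proof -
  define W where "W n = (\<Prod>k=1..n. (4 * real k ^ 2) / (4 * real k ^ 2 - 1))" for n
  have W_Suc: "W (Suc n) = W n * (4 * real (Suc n) ^ 2 / (4 * real (Suc n) ^ 2 - 1))" for n
    by (simp add: W_def)
  have fac: "1 \<le> 4 * real (Suc n) ^ 2 / (4 * real (Suc n) ^ 2 - 1)" for n
  proof -
    have "1 \<le> 4 * s / (4 * s - 1)" if "1 \<le> s" for s :: real using that by (simp add: divide_simps)
    moreover have "1 \<le> real (Suc n) ^ 2" by simp
    ultimately show ?thesis .
  qed
  have W1: "1 \<le> W n" for n
  proof (induction n)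
    case (Suc n)
    then show ?case using mult_mono[OF Suc fac[of n]] by (simp add: W_Suc)
  qed (simp add: W_def)
  have lim: "W \<longlonglongrightarrow> pi / 2" unfolding W_def by (rule wallis)
  have "incseq W"
  proof (rule incseq_SucI)
    fix n show "W n \<le> W (Suc n)"
      using mult_left_mono[OF fac[of n], of "W n"] W1[of n] by (simp add: W_Suc)
  qed
  then have 1: "W n \<le> pi / 2" using lim by (rule incseq_le)
  define U where "U n = W (Suc n) * ((2 * real (Suc n) + 1) / (2 * real (Suc n)))" for n
  have "decseq U"
  proof (rule decseq_SucI)
    fix n
    define x where "x = real (Suc n)"
    have x: "1 \<le> x" by (simp add: x_def)
    have x': "real (Suc (Suc n)) = x + 1" by (simp add: x_def)
    have "4 * (x + 1) ^ 2 / (4 * (x + 1) ^ 2 - 1) * ((2 * (x + 1) + 1) / (2 * (x + 1))) \<le> (2 * x + 1) / (2 * x)"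
    proof -
      have e: "4 * (x + 1) ^ 2 - 1 = (2 * x + 1) * (2 * x + 3)" by (simp add: power2_eq_square algebra_simps)
      have "4 * (x + 1) ^ 2 / (4 * (x + 1) ^ 2 - 1) * ((2 * (x + 1) + 1) / (2 * (x + 1))) = 2 * (x + 1) / (2 * x + 1)"
        unfolding e using x by (simp add: divide_simps power2_eq_square) (simp add: algebra_simps)
      also have "\<dots> \<le> (2 * x + 1) / (2 * x)"
        using x by (simp add: divide_simps) (simp add: algebra_simps)
      finally show ?thesis .
    qed
    then have "W (Suc n) * (4 * (x + 1) ^ 2 / (4 * (x + 1) ^ 2 - 1) * ((2 * (x + 1) + 1) / (2 * (x + 1))))
        \<le> W (Suc n) * ((2 * x + 1) / (2 * x))" using W1[of "Suc n"] by (intro mult_left_mono) auto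
    then show "U (Suc n) \<le> U n" unfolding U_def W_Suc[of "Suc n"] x' x_def[symmetric] by (simp only: mult.assoc)
  qed
  moreover have "U \<longlonglongrightarrow> pi / 2"
  proof -
    have "(\<lambda>n. W (Suc n) * ((2 * real (Suc n) + 1) / (2 * real (Suc n)))) \<longlonglongrightarrow> pi / 2 * 1"
      by (intro tendsto_mult LIMSEQ_Suc[OF lim]) real_asymp
    then show ?thesis unfolding U_def by (simp only: mult_1_right)
  qed
  ultimately have "pi / 2 \<le> U (n - 1)" by (rule decseq_ge)
  also have "\<dots> = W n + W n / (2 * real n)" using assms by (simp add: U_def add_divide_distrib distrib_left)
  also have "\<dots> \<le> W n + 2 / (2 * real n)"
    using 1 pi_less_4 by (intro add_left_mono divide_right_mono) auto
  finally have "pi / 2 \<le> W n + 1 / real n" by simp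
  with 1 have "\<bar>2 * W n - pi\<bar> \<le> 2 / real n" by (simp add: abs_real_def)
  then show ?thesis by (simp only: W_def)
qed

lemma approximable_pi: "approximable V k (\<lambda>\<phi> xs. pi)"
proof -
  define a b :: "nat \<Rightarrow> nat" where "a n = rec_nat 1 (\<lambda>m y. y * (4 * Suc m ^ 2)) n"
    and "b n = rec_nat 1 (\<lambda>m y. y * (4 * Suc m ^ 2 - 1)) n" for n
  have "prog V 1 (\<lambda>\<phi> xs. a (xs ! 0))" unfolding a_def
    by (rule prog_primrec1) (intro prog_intros prog_proj; simp)
  moreover have "prog V 1 (\<lambda>\<phi> xs. b (xs ! 0))" unfolding b_def
    by (rule prog_primrec1) (intro prog_intros prog_proj; simp)
  moreover have "prog V (Suc k) (\<lambda>\<phi> ys. 2 ^ Suc (hd ys))" by (intro prog_intros)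
  ultimately have ab: "prog V (Suc k) (\<lambda>\<phi> ys. 2 * a (2 ^ Suc (hd ys)))" "prog V (Suc k) (\<lambda>\<phi> ys. b (2 ^ Suc (hd ys)))"
    using prog_app1[where f = "\<lambda>\<phi>. a"] prog_app1[where f = "\<lambda>\<phi>. b"] by (auto intro!: prog_mult prog_const)
  have b0: "0 < b n" for n
  proof (induction n)
    case (Suc n)
    have "1 < 4 * (Suc n)\<^sup>2" by (simp add: power2_eq_square)
    with Suc show ?case by (simp add: b_def)
  qed (simp add: b_def)
  have W: "real (a n) / real (b n) = (\<Prod>k=1..n. (4 * real k ^ 2) / (4 * real k ^ 2 - 1))" for n
  proof (induction n)
    case (Suc n)
    have "1 \<le> 4 * Suc n ^ 2" by simp
    then have "real (4 * Suc n ^ 2 - 1) = 4 * real (Suc n) ^ 2 - 1" by (subst of_nat_diff) auto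
    moreover have "a (Suc n) = a n * (4 * Suc n ^ 2)" "b (Suc n) = b n * (4 * Suc n ^ 2 - 1)"
      by (simp_all only: a_def b_def nat.rec)
    ultimately have "real (a (Suc n)) / real (b (Suc n)) = real (a n) / real (b n) * (4 * real (Suc n) ^ 2 / (4 * real (Suc n) ^ 2 - 1))"
      by (simp only: of_nat_mult of_nat_power of_nat_numeral times_divide_times_eq)
    then show ?case unfolding Suc by simp
  qed (simp add: a_def b_def)
  show ?thesis
  proof (rule approximableI[OF ab])
    fix \<phi> :: "nat \<Rightarrow> nat" and m and xs :: "nat list"
    show "0 < b (2 ^ Suc (hd (m # xs)))" by (rule b0)
    have "\<bar>2 * (real (a (2 ^ Suc m)) / real (b (2 ^ Suc m))) - pi\<bar> \<le> 2 / real (2 ^ Suc m)"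
      unfolding W by (rule wallis_error) simp
    then show "\<bar>real (2 * a (2 ^ Suc (hd (m # xs)))) / real (b (2 ^ Suc (hd (m # xs)))) - pi\<bar> \<le> 1 / 2 ^ m"
      by simp
  qed
qed

subsection \<open>Root finding\<close>

text \<open>Scaled numerators are off by at most 1, so a lead of 3 certifies a strict inequality;
  conversely, a scaled difference above 5 guarantees this lead.\<close>

lemma approximable_less_iff:
  assumes "approximates V k F f" "approximates V k G g" "\<phi> \<in> V" "length xs = k"
  shows "F \<phi> (t # xs) + 3 \<le> G \<phi> (t # xs) \<Longrightarrow> f \<phi> xs < g \<phi> xs"
    "f \<phi> xs < g \<phi> xs \<Longrightarrow> \<exists>t0. \<forall>t\<ge>t0. F \<phi> (t # xs) + 3 \<le> G \<phi> (t # xs)"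
proof -
  note F = approximates_scaled[OF approximatesD(2)[OF assms(1,3,4)]] and G = approximates_scaled[OF approximatesD(2)[OF assms(2,3,4)]]
  show "f \<phi> xs < g \<phi> xs" if "F \<phi> (t # xs) + 3 \<le> G \<phi> (t # xs)"
  proof -
    have "real (F \<phi> (t # xs)) + 3 \<le> real (G \<phi> (t # xs))" using that by linarith
    with F(1)[of t] G(2)[of t] have "2 ^ t * f \<phi> xs < 2 ^ t * g \<phi> xs" by linarith
    then show ?thesis by simp
  qed
  show "\<exists>t0. \<forall>t\<ge>t0. F \<phi> (t # xs) + 3 \<le> G \<phi> (t # xs)" if less: "f \<phi> xs < g \<phi> xs"
  proof -
    obtain t0 where t0: "5 / (g \<phi> xs - f \<phi> xs) < 2 ^ t0"
      using real_arch_pow[of 2 "5 / (g \<phi> xs - f \<phi> xs)"] by auto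
    have "F \<phi> (t # xs) + 3 \<le> G \<phi> (t # xs)" if "t0 \<le> t" for t
    proof -
      have "(2::real) ^ t0 \<le> 2 ^ t" using that by (intro power_increasing) auto
      with t0 have "5 / (g \<phi> xs - f \<phi> xs) < 2 ^ t" by linarith
      then have "5 < 2 ^ t * (g \<phi> xs - f \<phi> xs)" using less by (simp add: pos_divide_less_eq)
      then have "5 < 2 ^ t * g \<phi> xs - 2 ^ t * f \<phi> xs" by (simp add: right_diff_distrib)
      with F(2)[of t] G(1)[of t] have "real (F \<phi> (t # xs)) + 3 \<le> real (G \<phi> (t # xs))" by linarith
      then show ?thesis by linarith
    qed
    then show ?thesis by blast
  qed
qed

text \<open>The search runs over pairs of a grid index \<open>i\<close> and a precision \<open>t\<close>, until it can be certified at
  precision \<open>t\<close> that the root lies between \<open>i / D\<close> and \<open>(i + 2) / D\<close>. The overlap of these intervals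
  avoids having to decide whether the root is a grid point. The parameters \<open>[i, r]\<close> of \<open>f\<close> and \<open>g\<close>
  stand for the point \<open>(i + 1) / (i + r + 2)\<close>.\<close>

lemma approximable_root:
  assumes f: "approximable V 2 f" and g: "approximable V 2 g"
    and s: "\<And>\<phi>. \<phi> \<in> V \<Longrightarrow> 0 < s \<phi> \<and> s \<phi> < 1"
    and less: "\<And>\<phi> i r. \<phi> \<in> V \<Longrightarrow> real (i + 1) / real (i + r + 2) < s \<phi> \<longleftrightarrow> f \<phi> [i, r] < g \<phi> [i, r]"
    and greater: "\<And>\<phi> i r. \<phi> \<in> V \<Longrightarrow> s \<phi> < real (i + 1) / real (i + r + 2) \<longleftrightarrow> g \<phi> [i, r] < f \<phi> [i, r]"
  shows "approximable V 0 (\<lambda>\<phi> xs. s \<phi>)"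
proof -
  obtain F where "approximates V 2 F f" using f unfolding approximable_def by blast
  note F = this approximatesD(1)[OF this]
  obtain G where "approximates V 2 G g" using g unfolding approximable_def by blast
  note G = this approximatesD(1)[OF this]
  \<comment> \<open>A sum of naturals, zero exactly when both tests pass. The factors
    \<open>i\<close> and \<open>D - (i + 2)\<close> switch a test off at the ends of the unit
    interval, where the bounds 0 and 1 hold anyway.\<close>
  define T where "T D \<phi> i t = i * (F \<phi> [t, i - 1, D - 1 - i] + 3 - G \<phi> [t, i - 1, D - 1 - i])
      + (D - (i + 2)) * (G \<phi> [t, i + 1, D - 3 - i] + 3 - F \<phi> [t, i + 1, D - 3 - i])" for D \<phi> i t
  have sound: "\<bar>real (i + 1) / real D - s \<phi>\<bar> \<le> 1 / real D"
    if \<phi>: "\<phi> \<in> V" and T: "T D \<phi> i t = 0" and i: "i < D" for D \<phi> i t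
  proof -
    have D: "0 < D" using i by simp
    have "real i / real D \<le> s \<phi>"
    proof (cases "i = 0")
      case False
      then have "F \<phi> (t # [i - 1, D - 1 - i]) + 3 \<le> G \<phi> (t # [i - 1, D - 1 - i])" using T by (simp add: T_def)
      from approximable_less_iff(1)[OF F(1) G(1) \<phi>, OF _ this]
      have "f \<phi> [i - 1, D - 1 - i] < g \<phi> [i - 1, D - 1 - i]" by simp
      then have "real (i - 1 + 1) / real (i - 1 + (D - 1 - i) + 2) < s \<phi>" unfolding less[OF \<phi>] .
      moreover have "i - 1 + 1 = i" "i - 1 + (D - 1 - i) + 2 = D" using False i by auto
      ultimately show ?thesis by simp
    qed (use s[OF \<phi>] in simp)
    moreover have "s \<phi> \<le> real (i + 2) / real D"
    proof (cases "D \<le> i + 2")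
      case True
      then have "1 \<le> real (i + 2) / real D" using D by (simp add: le_divide_eq)
      then show ?thesis using s[OF \<phi>] by linarith
    next
      case False
      then have "G \<phi> (t # [i + 1, D - 3 - i]) + 3 \<le> F \<phi> (t # [i + 1, D - 3 - i])" using T by (simp add: T_def)
      from approximable_less_iff(1)[OF G(1) F(1) \<phi>, OF _ this]
      have "g \<phi> [i + 1, D - 3 - i] < f \<phi> [i + 1, D - 3 - i]" by simp
      then have "s \<phi> < real (i + 1 + 1) / real (i + 1 + (D - 3 - i) + 2)" unfolding greater[OF \<phi>] .
      moreover have "i + 1 + 1 = i + 2" "i + 1 + (D - 3 - i) + 2 = D" using False by auto
      ultimately show ?thesis by simp
    qed
    moreover have "\<bar>a + e - u\<bar> \<le> e" if "a \<le> u" "u \<le> a + 2 * e" for a e u :: real using that by linarith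
    moreover have "real (i + 1) / real D = real i / real D + 1 / real D"
      "real (i + 2) / real D = real i / real D + 2 * (1 / real D)" by (simp_all add: add_divide_distrib)
    ultimately show ?thesis by (simp only:)
  qed
  have complete: "\<exists>i t. i < D \<and> T D \<phi> i t = 0" if \<phi>: "\<phi> \<in> V" and D: "0 < D" for D \<phi>
  proof -
    \<comment> \<open>The cell with i / D < s \<le> (i + 1) / D. Then s < (i + 2) / D is strict as
      well, so both tests pass at sufficient precision.\<close>
    define i where "i = nat (\<lceil>s \<phi> * real D\<rceil> - 1)"
    have "0 < s \<phi> * real D" using s[OF \<phi>] D by simp
    then have i: "real i = real_of_int \<lceil>s \<phi> * real D\<rceil> - 1" by (simp add: i_def)
    have "real i < s \<phi> * real D" "s \<phi> * real D \<le> real i + 1" unfolding i by linarith+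
    then have lo: "real i / real D < s \<phi>" and hi: "s \<phi> < real (i + 2) / real D"
      using D by (simp_all add: pos_divide_less_eq pos_less_divide_eq)
    have "s \<phi> * real D < 1 * real D" using s[OF \<phi>] D by (intro mult_strict_right_mono) auto
    with \<open>real i < s \<phi> * real D\<close> have iD: "i < D" by simp
    have zero: "\<exists>t0. \<forall>t\<ge>t0. c * (a t - b t) = 0" if "\<exists>t0. \<forall>t\<ge>t0. a t \<le> b t"
      for a b :: "nat \<Rightarrow> nat" and c :: nat using that by auto
    have "\<exists>t0. \<forall>t\<ge>t0. i * (F \<phi> [t, i - 1, D - 1 - i] + 3 - G \<phi> [t, i - 1, D - 1 - i]) = 0"
    proof (cases "i = 0")
      case False
      then have "i - 1 + 1 = i" "i - 1 + (D - 1 - i) + 2 = D" using iD by auto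
      with lo have "real (i - 1 + 1) / real (i - 1 + (D - 1 - i) + 2) < s \<phi>" by simp
      then have "f \<phi> [i - 1, D - 1 - i] < g \<phi> [i - 1, D - 1 - i]" unfolding less[OF \<phi>] .
      from approximable_less_iff(2)[OF F(1) G(1) \<phi>, OF _ this] show ?thesis by (intro zero) simp
    qed simp
    then obtain t0 where t0: "\<forall>t\<ge>t0. i * (F \<phi> [t, i - 1, D - 1 - i] + 3 - G \<phi> [t, i - 1, D - 1 - i]) = 0" ..
    have "\<exists>t0. \<forall>t\<ge>t0. (D - (i + 2)) * (G \<phi> [t, i + 1, D - 3 - i] + 3 - F \<phi> [t, i + 1, D - 3 - i]) = 0"
    proof (cases "D \<le> i + 2")
      case False
      then have "i + 1 + 1 = i + 2" "i + 1 + (D - 3 - i) + 2 = D" by auto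
      with hi have "s \<phi> < real (i + 1 + 1) / real (i + 1 + (D - 3 - i) + 2)" by simp
      then have "g \<phi> [i + 1, D - 3 - i] < f \<phi> [i + 1, D - 3 - i]" unfolding greater[OF \<phi>] .
      from approximable_less_iff(2)[OF G(1) F(1) \<phi>, OF _ this] show ?thesis by (intro zero) simp
    qed simp
    then obtain t1 where t1: "\<forall>t\<ge>t1. (D - (i + 2)) * (G \<phi> [t, i + 1, D - 3 - i] + 3 - F \<phi> [t, i + 1, D - 3 - i]) = 0" ..
    have "T D \<phi> i (max t0 t1) = 0" unfolding T_def using t0 t1 by simp
    with iD show ?thesis by blast
  qed
  \<comment> \<open>A single search variable j carries the pair of i = j mod D and t = j div D; the
    remainder is expressed by operations already known to be programs.\<close>
  define I :: "nat \<Rightarrow> nat \<Rightarrow> nat" where "I D j = j - D * (j div D)" for D j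
  have I: "I D j = j mod D" for D j by (simp add: I_def minus_mult_div_eq_mod)
  define J where "J \<phi> ys = (LEAST j. T (2 ^ hd ys) \<phi> (I (2 ^ hd ys) j) (j div 2 ^ hd ys) = 0)" for \<phi> and ys :: "nat list"
  have ex: "\<exists>j. T (2 ^ m) \<phi> (I (2 ^ m) j) (j div 2 ^ m) = 0" if \<phi>: "\<phi> \<in> V" for \<phi> m
  proof -
    obtain i t where "i < 2 ^ m" "T (2 ^ m) \<phi> i t = 0" using complete[OF \<phi>, of "2 ^ m"] by auto
    then show ?thesis by (intro exI[of _ "i + 2 ^ m * t"]) (simp add: I)
  qed
  have J: "prog V (Suc 0) J" unfolding J_def
  proof (rule prog_cong)
    have *: "prog V (Suc 2) F" "prog V (Suc 2) G" by (fact F(2) G(2))+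
    have 3: "prog V 3 F" "prog V 3 G" using * by (simp_all add: numeral_3_eq_3)
    have d: "prog V (Suc (Suc 0)) (\<lambda>\<phi> zs. hd zs div 2 ^ hd (tl zs))" by (intro prog_div prog_intros)
    show "prog V (Suc 0) (\<lambda>\<phi> ys. LEAST j.
      T (2 ^ hd (tl (j # ys))) \<phi> (I (2 ^ hd (tl (j # ys))) (hd (j # ys))) (hd (j # ys) div 2 ^ hd (tl (j # ys))) = 0)"
    proof (rule prog_Least)
      show "prog V (Suc (Suc 0)) (\<lambda>\<phi> zs.
        T (2 ^ hd (tl zs)) \<phi> (I (2 ^ hd (tl zs)) (hd zs)) (hd zs div 2 ^ hd (tl zs)))"
        unfolding T_def I_def by (intro prog_app3[OF 3(1)] prog_app3[OF 3(2)] prog_intros d)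
    qed (use ex in \<open>auto simp: length_Suc_conv\<close>)
  qed simp
  show ?thesis
  proof (rule approximableI)
    show "prog V (Suc 0) (\<lambda>\<phi> ys. I (2 ^ hd ys) (J \<phi> ys) + 1)" unfolding I_def
      by (intro prog_intros prog_div J)
    show "prog V (Suc 0) (\<lambda>\<phi> ys. 2 ^ hd ys)" by (intro prog_intros)
    fix \<phi> m and xs :: "nat list" assume \<phi>: "\<phi> \<in> V" "length xs = 0"
    show "0 < (2::nat) ^ hd (m # xs)" by simp
    have "T (2 ^ m) \<phi> (I (2 ^ m) (J \<phi> (m # xs))) (J \<phi> (m # xs) div 2 ^ m) = 0"
      unfolding J_def list.sel by (rule LeastI_ex[OF ex[OF \<phi>(1)]])
    from sound[OF \<phi>(1) this]
    show "\<bar>real (I (2 ^ hd (m # xs)) (J \<phi> (m # xs)) + 1) / real (2 ^ hd (m # xs)) - s \<phi>\<bar> \<le> 1 / 2 ^ m"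
      by (simp add: I)
  qed
qed

subsection \<open>Names of real numbers\<close>

definition unit_names :: "(nat \<Rightarrow> nat) set" where
  "unit_names = {\<phi>. \<exists>x\<in>{0<..<1}. \<forall>m. dyadic_approx x m (\<phi> m)}"

text \<open>Programs see only the name, so the real has to be a function of it; by
  \<open>dyadic_approx_unique\<close> the choice is forced.\<close>

definition name_val :: "(nat \<Rightarrow> nat) \<Rightarrow> real" where
  "name_val \<phi> = (SOME x. x \<in> {0<..<1} \<and> (\<forall>m. dyadic_approx x m (\<phi> m)))"

lemma name_val:
  assumes "\<phi> \<in> unit_names"
  shows "0 < name_val \<phi>" "name_val \<phi> < 1" "dyadic_approx (name_val \<phi>) m (\<phi> m)"
proof -
  have "\<exists>x. x \<in> {0<..<1} \<and> (\<forall>m. dyadic_approx x m (\<phi> m))" using assms by (auto simp: unit_names_def)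
  from someI_ex[OF this, folded name_val_def]
  show "0 < name_val \<phi>" "name_val \<phi> < 1" "dyadic_approx (name_val \<phi>) m (\<phi> m)" by auto
qed

lemma dyadic_approx_unique:
  assumes "\<And>m. dyadic_approx x m (\<phi> m)" "\<And>m. dyadic_approx y m (\<phi> m)"
  shows "x = y"
proof (rule ccontr)
  assume "x \<noteq> y"
  then obtain m where m: "2 / \<bar>x - y\<bar> < 2 ^ m" using real_arch_pow[of 2 "2 / \<bar>x - y\<bar>"] by auto
  have "\<bar>x - y\<bar> \<le> 2 * (1 / 2 ^ m)"
    using assms(1)[of m] assms(2)[of m] unfolding dyadic_approx_def by linarith
  then have "2 ^ m * \<bar>x - y\<bar> \<le> 2" by (simp add: field_simps)
  moreover have "2 < 2 ^ m * \<bar>x - y\<bar>" using m \<open>x \<noteq> y\<close> by (simp add: pos_divide_less_eq)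
  ultimately show False by simp
qed

text \<open>Even codes decode to nonnegative integers and odd ones to negative integers. The parity
  factor replaces negative numerators by 0, which does not increase the error since the value is
  positive.\<close>

lemma approximable_name_val: "approximable unit_names k (\<lambda>\<phi> xs. name_val \<phi>)"
  unfolding approximable_def approximates_def
proof (intro exI conjI ballI allI impI)
  let ?c = "\<lambda>(\<phi> :: nat \<Rightarrow> nat) (ys :: nat list). \<phi> (hd ys)"
  let ?F = "\<lambda>\<phi> ys. (?c \<phi> ys div 2) * (1 - (?c \<phi> ys - 2 * (?c \<phi> ys div 2)))"
  show "prog unit_names (Suc k) ?F"
    by (intro prog_intros prog_div prog_oracle)
  fix \<phi> m and xs :: "nat list" assume "\<phi> \<in> unit_names"
  note v = name_val[OF this]
  define z where "z = int_decode (\<phi> m)"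
  have "real (?F \<phi> (m # xs)) = max 0 (real_of_int z)"
  proof (cases "even (\<phi> m)")
    case True
    then show ?thesis by (simp add: z_def int_decode_def sum_decode_def)
  next
    case False
    then have "\<phi> m - 2 * (\<phi> m div 2) = 1" by (simp add: minus_mult_div_eq_mod odd_iff_mod_2_eq_one)
    with False show ?thesis by (simp add: z_def int_decode_def sum_decode_def)
  qed
  moreover have "max 0 (real_of_int z) / 2 ^ m = max 0 (real_of_int z / 2 ^ m)"
    by (simp add: max_def divide_le_0_iff zero_le_divide_iff not_le)
  moreover have "\<bar>real_of_int z / 2 ^ m - name_val \<phi>\<bar> \<le> 1 / 2 ^ m"
    using v(3)[of m] by (simp add: dyadic_approx_def z_def)
  ultimately show "\<bar>real (?F \<phi> (m # xs)) / 2 ^ m - name_val \<phi>\<bar> \<le> 1 / 2 ^ m"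
    using v(1) by simp
qed

lemma computable_on_cr:
  assumes "approximable unit_names 0 (\<lambda>\<phi> xs. f (name_val \<phi>))" shows "computable_on {0<..<1} f"
proof -
  obtain F where "approximates unit_names 0 F (\<lambda>\<phi> xs. f (name_val \<phi>))" using assms unfolding approximable_def by blast
  note F = approximatesD[OF this]
  have "prog unit_names (Suc 0) (\<lambda>\<phi> xs. 2 * F \<phi> xs)" by (intro prog_intros F(1))
  then obtain P where P: "\<And>\<phi> xs. \<phi> \<in> unit_names \<Longrightarrow> length xs = Suc 0 \<Longrightarrow> computes \<phi> P xs (2 * F \<phi> xs)"
    unfolding prog_def by blast
  show ?thesis unfolding computable_on_def
  proof (intro exI[of _ P] ballI allI impI)
    fix x :: real and \<phi> m assume x: "x \<in> {0<..<1}" and a: "\<forall>m. dyadic_approx x m (\<phi> m)"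
    then have \<phi>: "\<phi> \<in> unit_names" by (auto simp: unit_names_def)
    have "name_val \<phi> = x"
      by (rule dyadic_approx_unique[of _ \<phi>]) (use a name_val(3)[OF \<phi>] in auto)
    then have "dyadic_approx (f x) m (2 * F \<phi> [m])"
      using F(2)[OF \<phi>, of "[]" m] by (simp add: dyadic_approx_def int_decode_def sum_decode_def)
    then show "\<exists>c. computes \<phi> P [m] c \<and> dyadic_approx (f x) m c" using P[OF \<phi>, of "[m]"] by auto
  qed
qed

subsection \<open>Growth rate and growth factor\<close>

text \<open>All intermediate results must be nonnegative: - ln w is written as ln (1 + (1 / w - 1)),
  and the differences are justified by w < 1 and by the positivity of z, s and the
  determinant.\<close>

lemma approximable_sp:
  assumes w: "approximable V k w" "\<And>\<phi> xs. \<phi> \<in> V \<Longrightarrow> length xs = k \<Longrightarrow> 0 < w \<phi> xs \<and> w \<phi> xs < 1"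
  shows "approximable V k (\<lambda>\<phi> xs. sp_z (w \<phi> xs))" "approximable V k (\<lambda>\<phi> xs. sp_s (w \<phi> xs))" "approximable V k (\<lambda>\<phi> xs. sp_det (w \<phi> xs))"
proof -
  have one: "approximable V k (\<lambda>\<phi> xs. 1)" using approximable_nat[OF prog_const[of V k 1]] by simp
  have two: "approximable V k (\<lambda>\<phi> xs. 2)" using approximable_nat[OF prog_const[of V k 2]] by simp
  have z: "approximable V k (\<lambda>\<phi> xs. 2 * ln (1 + w \<phi> xs) - w \<phi> xs)"
  proof (intro approximable_diff approximable_mult approximable_ln two w(1))
    fix \<phi> and xs :: "nat list" assume "\<phi> \<in> V" "length xs = k"
    with w(2) have "0 < sp_z (w \<phi> xs)" by (intro sp_bounds) auto
    then show "w \<phi> xs \<le> 2 * ln (1 + w \<phi> xs)" by (simp add: sp_z_def)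
  qed
  then show z': "approximable V k (\<lambda>\<phi> xs. sp_z (w \<phi> xs))" by (simp only: sp_z_def)
  have s_eq: "w + ln (1 + (inverse w - 1)) - 1 = sp_s w" if "0 < w" for w :: real
    using that by (simp add: sp_s_def ln_inverse)
  have "approximable V k (\<lambda>\<phi> xs. w \<phi> xs + ln (1 + (inverse (w \<phi> xs) - 1)) - 1)"
  proof (intro approximable_diff[of V k "\<lambda>\<phi> xs. w \<phi> xs + ln (1 + (inverse (w \<phi> xs) - 1))" "\<lambda>\<phi> xs. 1"]
      approximable_add approximable_ln approximable_diff[of V k "\<lambda>\<phi> xs. inverse (w \<phi> xs)" "\<lambda>\<phi> xs. 1"] approximable_inverse one w(1))
    fix \<phi> and xs :: "nat list" assume "\<phi> \<in> V" "length xs = k"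
    with w(2) have w': "0 < w \<phi> xs" "w \<phi> xs < 1" by auto
    then show "0 < w \<phi> xs" by simp
    show "1 \<le> inverse (w \<phi> xs)" using w' by (intro one_le_inverse) auto
    show "1 \<le> w \<phi> xs + ln (1 + (inverse (w \<phi> xs) - 1))"
      using s_eq[OF w'(1)] sp_bounds(6)[OF w'] by linarith
  qed
  then show s': "approximable V k (\<lambda>\<phi> xs. sp_s (w \<phi> xs))"
    by (rule approximable_cong) (use s_eq w(2) in auto)
  have det_eq: "(1 - w) * w * inverse (sp_z w) + (1 - w * w) * inverse (sp_s w) - 1 = sp_det w" for w
    by (simp add: sp_det_def divide_inverse power2_eq_square)
  have "approximable V k (\<lambda>\<phi> xs. (1 - w \<phi> xs) * w \<phi> xs * inverse (sp_z (w \<phi> xs)) +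
      (1 - w \<phi> xs * w \<phi> xs) * inverse (sp_s (w \<phi> xs)) - 1)"
  proof (intro approximable_diff[of V k "\<lambda>\<phi> xs. (1 - w \<phi> xs) * w \<phi> xs * inverse (sp_z (w \<phi> xs)) +
      (1 - w \<phi> xs * w \<phi> xs) * inverse (sp_s (w \<phi> xs))" "\<lambda>\<phi> xs. 1"] approximable_add approximable_mult approximable_inverse
      approximable_diff[of V k "\<lambda>\<phi> xs. 1"] one w(1) z' s')
    fix \<phi> and xs :: "nat list" assume "\<phi> \<in> V" "length xs = k"
    with w(2) have w': "0 < w \<phi> xs" "w \<phi> xs < 1" by auto
    show "w \<phi> xs \<le> 1" using w' by simp
    show "w \<phi> xs * w \<phi> xs \<le> 1" using w' by (intro mult_le_one) auto
    show "0 < sp_z (w \<phi> xs)" "0 < sp_s (w \<phi> xs)" using sp_bounds[OF w'] by auto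
    show "1 \<le> (1 - w \<phi> xs) * w \<phi> xs * inverse (sp_z (w \<phi> xs)) +
      (1 - w \<phi> xs * w \<phi> xs) * inverse (sp_s (w \<phi> xs))"
      using det_eq[of "w \<phi> xs"] sp_det_pos[OF w'] by linarith
  qed
  then show "approximable V k (\<lambda>\<phi> xs. sp_det (w \<phi> xs))" by (simp only: det_eq)
qed

text \<open>The saddle equation is tested with cleared denominators: as \<open>sp_h\<close>
  decreases, \<beta> (1 + w) z is smaller than w s (1 - \<beta>) exactly to the left of the saddle
  point. The test points w are rational, so both sides are approximable.\<close>

lemma approximable_saddle: "approximable unit_names 0 (\<lambda>\<phi> xs. saddle (name_val \<phi>))"
proof (rule approximable_root)
  let ?w = "\<lambda>(\<phi> :: nat \<Rightarrow> nat) xs. real (xs ! 0 + 1) * inverse (real (xs ! 0 + xs ! 1 + 2))"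
  have w: "approximable unit_names 2 ?w"
    by (intro approximable_mult approximable_inverse approximable_nat prog_add prog_proj prog_const) auto
  have w01: "0 < ?w \<phi> xs \<and> ?w \<phi> xs < 1" for \<phi> and xs :: "nat list" by (simp add: field_simps)
  have one: "approximable unit_names 2 (\<lambda>\<phi> xs. 1)" using approximable_nat[OF prog_const[of unit_names 2 1]] by simp
  note sp = approximable_sp[OF w w01]
  show "approximable unit_names 2 (\<lambda>\<phi> xs. name_val \<phi> * ((1 + ?w \<phi> xs) * sp_z (?w \<phi> xs)))"
    by (intro approximable_mult approximable_add one w sp approximable_name_val)
  show "approximable unit_names 2 (\<lambda>\<phi> xs. ?w \<phi> xs * sp_s (?w \<phi> xs) * (1 - name_val \<phi>))"
    by (intro approximable_mult approximable_diff one w sp approximable_name_val) (simp add: name_val less_imp_le)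
  fix \<phi> assume "\<phi> \<in> unit_names"
  note v = name_val[OF this]
  show "0 < saddle (name_val \<phi>) \<and> saddle (name_val \<phi>) < 1" using saddle[OF v(1,2)] by simp
  fix i r
  have w': "0 < ?w \<phi> [i, r]" "?w \<phi> [i, r] < 1" using w01[of "[i, r]"] by auto
  have e: "real (i + 1) / real (i + r + 2) = ?w \<phi> [i, r]" by (simp add: divide_inverse)
  have pos: "0 < (1 + w) * sp_z w" if "0 < w" "w < 1" for w using sp_bounds(2)[OF that] that by simp
  have "sp_h w < \<beta> / (1 - \<beta>) \<longleftrightarrow> w * sp_s w * (1 - \<beta>) < \<beta> * ((1 + w) * sp_z w)"
    "\<beta> / (1 - \<beta>) < sp_h w \<longleftrightarrow> \<beta> * ((1 + w) * sp_z w) < w * sp_s w * (1 - \<beta>)"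
    if "0 < w" "w < 1" "0 < \<beta>" "\<beta> < 1" for w \<beta> :: real
    unfolding sp_h_def using pos[OF that(1,2)] that(3,4)
    by (simp_all add: pos_less_divide_eq pos_divide_less_eq times_divide_eq_left)
  note h = this[OF w' v(1,2)]
  show "real (i + 1) / real (i + r + 2) < saddle (name_val \<phi>) \<longleftrightarrow>
      name_val \<phi> * ((1 + ?w \<phi> [i, r]) * sp_z (?w \<phi> [i, r])) < ?w \<phi> [i, r] * sp_s (?w \<phi> [i, r]) * (1 - name_val \<phi>)"
    unfolding e saddle_less_iff(2)[OF v(1,2) w'] h(2) ..
  show "saddle (name_val \<phi>) < real (i + 1) / real (i + r + 2) \<longleftrightarrow>
      ?w \<phi> [i, r] * sp_s (?w \<phi> [i, r]) * (1 - name_val \<phi>) < name_val \<phi> * ((1 + ?w \<phi> [i, r]) * sp_z (?w \<phi> [i, r]))"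
    unfolding e saddle_less_iff(1)[OF v(1,2) w'] h(1) ..
qed

text \<open>The negative exponents of \<open>growth_rate\<close> are realised as inverses of powers
  with the exponents \<beta> and 1 - \<beta>, which are positive on the unit interval.\<close>

theorem computable_growth: "computable_on {0<..<1} growth_factor" "computable_on {0<..<1} growth_rate"
proof -
  let ?V = unit_names
  let ?w = "\<lambda>\<phi> (xs :: nat list). saddle (name_val \<phi>)"
  have one: "approximable ?V 0 (\<lambda>\<phi> xs. 1)" using approximable_nat[OF prog_const[of ?V 0 1]] by simp
  have two: "approximable ?V 0 (\<lambda>\<phi> xs. 2)" using approximable_nat[OF prog_const[of ?V 0 2]] by simp
  have w: "0 < saddle (name_val \<phi>) \<and> saddle (name_val \<phi>) < 1" if "\<phi> \<in> ?V" for \<phi>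
    using saddle name_val[OF that] by auto
  have sp: "approximable ?V 0 (\<lambda>\<phi> xs. sp_z (?w \<phi> xs))" "approximable ?V 0 (\<lambda>\<phi> xs. sp_s (?w \<phi> xs))"
    "approximable ?V 0 (\<lambda>\<phi> xs. sp_det (?w \<phi> xs))"
    using approximable_sp[OF approximable_saddle] w by blast+
  have pos: "0 < sp_z (?w \<phi> xs)" "0 < sp_s (?w \<phi> xs)" "0 < sp_det (?w \<phi> xs)" "?w \<phi> xs * ?w \<phi> xs < 1"
    if "\<phi> \<in> ?V" for \<phi> and xs :: "nat list"
    using sp_bounds(2,6)[of "?w \<phi> xs"] sp_det_pos[of "?w \<phi> xs"] w[OF that]
      mult_strict_mono[of "?w \<phi> xs" 1 "?w \<phi> xs" 1] by auto
  have "approximable ?V 0 (\<lambda>\<phi> xs. 2 * ln (1 + 1) - 1)"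
    by (intro approximable_diff approximable_mult approximable_ln one two) (use rho_bounds(1) in \<open>simp add: rho_def\<close>)
  then have rho: "approximable ?V 0 (\<lambda>\<phi> xs. rho)" by (simp add: rho_def)
  have "approximable ?V 0 (\<lambda>\<phi> xs. rho * inverse (sp_z (?w \<phi> xs) powr (1 - name_val \<phi>)) *
      inverse (sp_s (?w \<phi> xs) powr name_val \<phi>))"
  proof (intro approximable_mult approximable_inverse approximable_powr approximable_diff approximable_name_val rho sp one)
    fix \<phi> and xs :: "nat list" assume \<phi>: "\<phi> \<in> ?V"
    note p = pos[OF \<phi>]
    show "0 < sp_z (?w \<phi> xs)" "0 < sp_s (?w \<phi> xs)" by (fact p)+
    show "0 < sp_z (?w \<phi> xs) powr (1 - name_val \<phi>)" "0 < sp_s (?w \<phi> xs) powr name_val \<phi>"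
      using p by simp_all
    show "name_val \<phi> \<le> 1" using name_val(2)[OF \<phi>] by simp
  qed
  then show "computable_on {0<..<1} growth_rate"
    by (intro computable_on_cr) (simp only: growth_rate_def powr_minus)
  have "approximable ?V 0 (\<lambda>\<phi> xs. sp_s (?w \<phi> xs) * sqrt (1 - ?w \<phi> xs * ?w \<phi> xs) * inverse
      (2 * (name_val \<phi> * name_val \<phi>) * sp_z (?w \<phi> xs) * sqrt (pi * rho * sp_det (?w \<phi> xs))))"
  proof (intro approximable_mult approximable_inverse approximable_sqrt approximable_diff approximable_name_val rho sp one two approximable_pi approximable_saddle)
    fix \<phi> and xs :: "nat list" assume \<phi>: "\<phi> \<in> ?V"
    note p = pos[OF \<phi>]
    show "0 < 1 - ?w \<phi> xs * ?w \<phi> xs" "?w \<phi> xs * ?w \<phi> xs \<le> 1" using p(4) by simp_all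
    show "0 < pi * rho * sp_det (?w \<phi> xs)" using p(3) rho_bounds(1) by simp
    then show "0 < 2 * (name_val \<phi> * name_val \<phi>) * sp_z (?w \<phi> xs) * sqrt (pi * rho * sp_det (?w \<phi> xs))"
      using p(1) name_val(1)[OF \<phi>] by (intro mult_pos_pos) auto
  qed
  then show "computable_on {0<..<1} growth_factor"
    by (intro computable_on_cr) (simp only: growth_factor_def divide_inverse power2_eq_square)
qed

theorem theorem1p3:
  shows "\<exists>B C :: real \<Rightarrow> real.
    computable_on {0<..<1} B \<and> computable_on {0<..<1} C \<and>
    (\<forall>\<beta>\<in>{0<..<1}. B \<beta> > 0 \<and> C \<beta> > 0) \<and>
    (\<forall>a b :: real. 0 < a \<and> a \<le> b \<and> b < 1 \<longrightarrow>
      (\<forall>\<epsilon>>0. \<forall>\<^sub>F n :: nat in sequentially. \<forall>k :: nat. a * real n \<le> real k \<and> real k \<le> b * real n \<longrightarrow>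
        \<bar>expected_indep_sets n k /
          (B (real k / real n) * real n powr (- 1 / 2) * C (real k / real n) ^ n) - 1\<bar> < \<epsilon>)) \<and>
    (\<lambda>\<beta>. C \<beta> - (1 + \<beta> * \<bar>ln \<beta>\<bar>)) \<in> o[at_right 0](\<lambda>\<beta>. \<beta> * ln \<beta>) \<and>
    (\<exists>\<beta>0>0. \<beta>0 \<le> 1 \<and> (\<forall>\<beta>\<in>{0<..<\<beta>0}. C \<beta> > 1))"
proof (rule exI[of _ growth_factor], rule exI[of _ growth_rate], intro conjI)
  show "\<forall>\<beta>\<in>{0<..<1}. growth_factor \<beta> > 0 \<and> growth_rate \<beta> > 0"
    using growth_factor_pos growth_rate_pos by auto
  show "\<forall>a b :: real. 0 < a \<and> a \<le> b \<and> b < 1 \<longrightarrow>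
      (\<forall>\<epsilon>>0. \<forall>\<^sub>F n :: nat in sequentially. \<forall>k :: nat. a * real n \<le> real k \<and> real k \<le> b * real n \<longrightarrow>
        \<bar>expected_indep_sets n k /
          (growth_factor (real k / real n) * real n powr (- 1 / 2) * growth_rate (real k / real n) ^ n) - 1\<bar> < \<epsilon>)"
    by (intro allI impI expected_indep_sets_uniform) auto
qed (fact computable_growth growth_rate_asymp growth_rate_gt_1)+

end
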